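(* Let $n\in\mathbb{N}$ and let $\varphi\in RO$. Let $a\in ES^{1}(\mathbb{Z}^n\times\mathbb{T}^n)$ and assume that the operator $A:=\operatorname{Op}[a]$ satisfies $(Au,u)\geq\|u\|^2$ for all $u\in\mathcal{S}(\mathbb{Z}^n)$. Then, up to norm equivalence, $$H^{\varphi}_{A}(\mathbb{Z}^n)=H^{\varphi}(\mathbb{Z}^n).$$
   Context: Notation on $\mathbb{Z}^n$: $|k|=\sqrt{k_1^2+\dots+k_n^2}$ and $\langle k\rangle=(1+|k|^2)^{1/2}$; $\mathbb{T}^n=\mathbb{R}^n/\mathbb{Z}^n$. $\ell^2(\mathbb{Z}^n)$ is the Hilbert space of square summable functions $u\colon\mathbb{Z}^n\to\mathbb{C}$ with inner product $(u,v)=\sum_{k\in\mathbb{Z}^n}u(k)\overline{v(k)}$ and norm $\|\cdot\|$. $\Delta_{k_j}u(k)=u(k+e_j)-u(k)$ and $\Delta_k^\alpha=\Delta_{k_1}^{\alpha_1}\cdots\Delta_{k_n}^{\alpha_n}$ for $\alpha\in\mathbb{N}_0^n$, where $e_j$ is the $j$-th standard unit vector; $|\alpha|=\alpha_1+\dots+\alpha_n$. $\mathcal{S}(\mathbb{Z}^n)$ is the Schwartz space of functions $u\colon\mathbb{Z}^n\to\mathbb{C}$ with $\sup_{k}|k^{\alpha}(\Delta_k^{\beta}u)(k)|<\infty$ for all $\alpha,\beta\in\mathbb{N}_0^n$. $\mathcal{S}'(\mathbb{Z}^n)$ is the space of continuous linear functionals on $\mathcal{S}(\mathbb{Z}^n)$,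 identified with functions $u\colon\mathbb{Z}^n\to\mathbb{C}$ of at most polynomial growth acting by $v\mapsto\sum_k u(k)v(k)$. Function spaces: $\varphi\in RO$ means that $\varphi\colon[1,\infty)\to(0,\infty)$ is Borel measurable and there exist $a>1$, $c\geq1$ with $c^{-1}\leq\varphi(\lambda t)/\varphi(t)\leq c$ for all $t\geq1$, $\lambda\in[1,a]$. For $\varphi\in RO$, $H^{\varphi}(\mathbb{Z}^n)=\{u\in\mathcal{S}'(\mathbb{Z}^n):\varphi(\langle k\rangle)u\in\ell^2(\mathbb{Z}^n)\}$ with inner product $(u,v)_{H^{\varphi}(\mathbb{Z}^n)}=\sum_{k\in\mathbb{Z}^n}[\varphi(\langle k\rangle)]^2u(k)\overline{v(k)}$. For $s\in\mathbb{R}$, $H^{(s)}(\mathbb{Z}^n)=\{u\in\mathcal{S}'(\mathbb{Z}^n):\langle k\rangle^su\in\ell^2(\mathbb{Z}^n)\}$ with norm $\|\langle k\rangle^su\|$. Symbols: for $l\in\mathbb{N}_0$, $D_{x_j}^{(l)}=\prod_{r=0}^{l-1}\left(\frac{1}{2\pi i}\frac{\partial}{\partial x_j}-r\right)$, $D_{x_j}^{(0)}=1$ (identity), and $D_x^{(\beta)}=D_{x_1}^{(\beta_1)}\cdots D_{x_n}^{(\beta_n)}$. For $m\in\mathbb{R}$, $S^m(\mathbb{Z}^n\times\mathbb{T}^n)$ is the set of functions $a\colon\mathbb{Z}^n\times\mathbb{T}^n\to\mathbb{C}$ such that $a(k,\cdot)\in C^\infty(\mathbb{T}^n)$ for all $k\in\mathbb{Z}^n$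 and for all $\alpha,\beta\in\mathbb{N}_0^n$ there is $C_{\alpha,\beta}>0$ with $|D_x^{(\beta)}\Delta_k^\alpha a(k,x)|\leq C_{\alpha,\beta}(1+|k|)^{m-|\alpha|}$ for all $(k,x)$. The elliptic class $ES^m(\mathbb{Z}^n\times\mathbb{T}^n)$ consists of those $a\in S^m(\mathbb{Z}^n\times\mathbb{T}^n)$ for which there exist $C>0$, $R>0$ with $|a(k,x)|\geq C(1+|k|)^m$ for all $x\in\mathbb{T}^n$ and all $k\in\mathbb{Z}^n$ with $|k|>R$. Pseudo-differential operators: $\widehat{u}(x)=\sum_{k\in\mathbb{Z}^n}e^{-2\pi ik\cdot x}u(k)$, $x\in\mathbb{T}^n$, and $(\operatorname{Op}[a]u)(k)=\int_{\mathbb{T}^n}e^{2\pi ik\cdot x}a(k,x)\widehat{u}(x)\,dx$ for $u\in\mathcal{S}(\mathbb{Z}^n)$. The space $H_A^\varphi(\mathbb{Z}^n)$: under the hypotheses of the claim, $A|_{\mathcal{S}(\mathbb{Z}^n)}$ is essentially self-adjoint in $\ell^2(\mathbb{Z}^n)$, and its self-adjoint closure, again denoted $A$, has domain $H^{(1)}(\mathbb{Z}^n)$; it satisfies $(Au,u)\geq\|u\|^2$ for $u\in\operatorname{Dom}(A)$. For a Borel measurable function $\varphi\colon[1,\infty)\to(0,\infty)$, the operator $\varphi(A)$ is defined by spectral calculus in $\ell^2(\mathbb{Z}^n)$, and $H_A^\varphi(\mathbb{Z}^n)$ is the completion of $\operatorname{Dom}(\varphi(A))$ with respect to the inner product $(u,v)_\varphi=(\varphi(A)u,\varphi(A)v)$.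 "Up to norm equivalence" means the two spaces coincide as vector spaces and their norms are equivalent. *)

theory Defs
  imports "HOL-Analysis.Analysis"
begin

text \<open>
  Points of \<open>\<int>\<^sup>n\<close> have type \<open>int ^ 'n\<close>, with \<open>n = CARD('n)\<close>, and functions on the torus
  \<open>\<real>\<^sup>n/\<int>\<^sup>n\<close> are \<open>\<int>\<^sup>n\<close>-periodic functions on \<open>real ^ 'n\<close>. The class \<open>linorder\<close> on the finite
  index type only fixes the order of the coordinates \<open>1, ..., n\<close>.
\<close>

section \<open>The lattice\<close>

definition lat_norm :: "int ^ 'n::finite \<Rightarrow> real" where
  "lat_norm k = sqrt (\<Sum>j\<in>UNIV. (real_of_int (k $ j))\<^sup>2)"

definition bracket :: "int ^ 'n::finite \<Rightarrow> real" where
  "bracket k = sqrt (1 + (lat_norm k)\<^sup>2)"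

definition lat_dot :: "int ^ 'n::finite \<Rightarrow> real ^ 'n \<Rightarrow> real" where
  "lat_dot k x = (\<Sum>j\<in>UNIV. real_of_int (k $ j) * x $ j)"

definition mi_order :: "nat ^ 'n::finite \<Rightarrow> nat" where
  "mi_order \<alpha> = (\<Sum>j\<in>UNIV. \<alpha> $ j)"

definition coords :: "'n::{finite,linorder} list" where
  "coords = sorted_list_of_set UNIV"

definition diff1 :: "'n::finite \<Rightarrow> (int ^ 'n \<Rightarrow> complex) \<Rightarrow> int ^ 'n \<Rightarrow> complex" where
  "diff1 j u k = u (k + axis j 1) - u k"

definition diff_op ::
  "nat ^ 'n::{finite,linorder} \<Rightarrow> (int ^ 'n::{finite,linorder} \<Rightarrow> complex) \<Rightarrow> int ^ 'n::{finite,linorder} \<Rightarrow> complex" where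
  "diff_op \<alpha> u = foldr (\<lambda>j v. (diff1 j ^^ (\<alpha> $ j)) v) coords u"

definition schwartz :: "(int ^ 'n::{finite,linorder} \<Rightarrow> complex) set" where
  "schwartz = {u. \<forall>\<alpha> \<beta>. bdd_above
     (range (\<lambda>k. cmod ((\<Prod>j\<in>UNIV. of_int (k $ j) ^ (\<alpha> $ j)) * diff_op \<beta> u k)))}"

text \<open>\<open>\<S>'(\<int>\<^sup>n)\<close>, under its identification with the functions of at most polynomial growth.\<close>

definition tempered :: "(int ^ 'n::finite \<Rightarrow> complex) set" where
  "tempered = {u. \<exists>C. \<exists>N::nat. \<forall>k. cmod (u k) \<le> C * (1 + lat_norm k) ^ N}"


section \<open>Square summable functions\<close>

definition l2 :: "('i \<Rightarrow> complex) set" where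
  "l2 = {u. (\<lambda>k. (cmod (u k))\<^sup>2) summable_on UNIV}"

definition l2_inner :: "('i \<Rightarrow> complex) \<Rightarrow> ('i \<Rightarrow> complex) \<Rightarrow> complex" where
  "l2_inner u v = (\<Sum>\<^sub>\<infinity>k. u k * cnj (v k))"

definition l2_norm :: "('i \<Rightarrow> complex) \<Rightarrow> real" where
  "l2_norm u = sqrt (\<Sum>\<^sub>\<infinity>k. (cmod (u k))\<^sup>2)"

definition l2_tendsto :: "(nat \<Rightarrow> 'i \<Rightarrow> complex) \<Rightarrow> ('i \<Rightarrow> complex) \<Rightarrow> bool" where
  "l2_tendsto U u \<longleftrightarrow> (\<forall>m. U m \<in> l2) \<and> u \<in> l2 \<and> (\<lambda>m. l2_norm (\<lambda>k. U m k - u k)) \<longlonglongrightarrow> 0"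


section \<open>The weighted spaces \<open>H\<^sup>\<phi>\<close>\<close>

definition RO :: "(real \<Rightarrow> real) set" where
  "RO = {\<phi>. \<phi> \<in> borel_measurable (restrict_space borel {1..}) \<and> (\<forall>t\<ge>1. \<phi> t > 0) \<and>
     (\<exists>a>1. \<exists>c\<ge>1. \<forall>t\<ge>1. \<forall>l\<in>{1..a}. inverse c \<le> \<phi> (l * t) / \<phi> t \<and> \<phi> (l * t) / \<phi> t \<le> c)}"

definition H_space :: "(real \<Rightarrow> real) \<Rightarrow> (int ^ 'n::finite \<Rightarrow> complex) set" where
  "H_space \<phi> = {u \<in> tempered. (\<lambda>k. of_real (\<phi> (bracket k)) * u k) \<in> l2}"

definition H_inner ::
  "(real \<Rightarrow> real) \<Rightarrow> (int ^ 'n::finite \<Rightarrow> complex) \<Rightarrow> (int ^ 'n \<Rightarrow> complex) \<Rightarrow> complex" where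
  "H_inner \<phi> u v = (\<Sum>\<^sub>\<infinity>k. of_real ((\<phi> (bracket k))\<^sup>2) * u k * cnj (v k))"


section \<open>Symbols and pseudo-differential operators\<close>

definition partial_deriv :: "'n::finite \<Rightarrow> (real ^ 'n \<Rightarrow> complex) \<Rightarrow> real ^ 'n \<Rightarrow> complex" where
  "partial_deriv j f x = vector_derivative (\<lambda>t. f (x + t *\<^sub>R axis j 1)) (at 0)"

primrec C_k :: "nat \<Rightarrow> (real ^ 'n::finite \<Rightarrow> complex) \<Rightarrow> bool" where
  "C_k 0 f \<longleftrightarrow> continuous_on UNIV f"
| "C_k (Suc r) f \<longleftrightarrow> continuous_on UNIV f \<and>
     (\<forall>j. (\<forall>x. (\<lambda>t. f (x + t *\<^sub>R axis j 1)) differentiable (at 0)) \<and> C_k r (partial_deriv j f))"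

definition smooth_torus :: "(real ^ 'n::finite \<Rightarrow> complex) set" where
  "smooth_torus = {f. (\<forall>r. C_k r f) \<and> (\<forall>x j. f (x + axis j 1) = f x)}"

primrec D1 :: "'n::finite \<Rightarrow> nat \<Rightarrow> (real ^ 'n \<Rightarrow> complex) \<Rightarrow> real ^ 'n \<Rightarrow> complex" where
  "D1 j 0 f = f"
| "D1 j (Suc l) f =
     (\<lambda>x. 1 / (2 * of_real pi * \<i>) * partial_deriv j (D1 j l f) x - of_nat l * D1 j l f x)"

definition D_op ::
  "nat ^ 'n::{finite,linorder} \<Rightarrow> (real ^ 'n::{finite,linorder} \<Rightarrow> complex) \<Rightarrow> real ^ 'n::{finite,linorder} \<Rightarrow> complex" where
  "D_op \<beta> f = foldr (\<lambda>j g. D1 j (\<beta> $ j) g) coords f"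

definition symbols :: "real \<Rightarrow> (int ^ 'n::{finite,linorder} \<Rightarrow> real ^ 'n::{finite,linorder} \<Rightarrow> complex) set" where
  "symbols m = {a. (\<forall>k. a k \<in> smooth_torus) \<and>
     (\<forall>\<alpha> \<beta>. \<exists>C>0. \<forall>k x. cmod (D_op \<beta> (\<lambda>y. diff_op \<alpha> (\<lambda>l. a l y) k) x)
        \<le> C * (1 + lat_norm k) powr (m - real (mi_order \<alpha>)))}"

definition elliptic_symbols ::
  "real \<Rightarrow> (int ^ 'n::{finite,linorder} \<Rightarrow> real ^ 'n::{finite,linorder} \<Rightarrow> complex) set" where
  "elliptic_symbols m = {a \<in> symbols m. \<exists>C>0. \<exists>R>0. \<forall>k x.
     lat_norm k > R \<longrightarrow> cmod (a k x) \<ge> C * (1 + lat_norm k) powr m}"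

definition fourier :: "(int ^ 'n::finite \<Rightarrow> complex) \<Rightarrow> real ^ 'n \<Rightarrow> complex" where
  "fourier u x = (\<Sum>\<^sub>\<infinity>k. exp (- 2 * of_real pi * \<i> * of_real (lat_dot k x)) * u k)"

definition Op ::
  "(int ^ 'n::finite \<Rightarrow> real ^ 'n \<Rightarrow> complex) \<Rightarrow> (int ^ 'n \<Rightarrow> complex) \<Rightarrow> int ^ 'n \<Rightarrow> complex" where
  "Op a u k = (LINT x : cbox 0 1 | lborel.
     exp (2 * of_real pi * \<i> * of_real (lat_dot k x)) * a k x * fourier u x)"


section \<open>Unbounded operators and spectral calculus\<close>

text \<open>An unbounded operator in \<open>\<ell>\<^sup>2\<close> is represented by its graph.\<close>

type_synonym 'i op_graph = "(('i \<Rightarrow> complex) \<times> ('i \<Rightarrow> complex)) set"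

definition op_closure :: "'i op_graph \<Rightarrow> 'i op_graph" where
  "op_closure G = {(u, v). \<exists>U V. (\<forall>m::nat. (U m, V m) \<in> G) \<and> l2_tendsto U u \<and> l2_tendsto V v}"

definition op_apply :: "'i op_graph \<Rightarrow> ('i \<Rightarrow> complex) \<Rightarrow> 'i \<Rightarrow> complex" where
  "op_apply G u = (THE v. (u, v) \<in> G)"

definition Op_closure ::
  "(int ^ 'n::{finite,linorder} \<Rightarrow> real ^ 'n::{finite,linorder} \<Rightarrow> complex) \<Rightarrow> (int ^ 'n::{finite,linorder}) op_graph" where
  "Op_closure a = op_closure {(u, Op a u) |u. u \<in> schwartz}"

definition orth_projection :: "(('i \<Rightarrow> complex) \<Rightarrow> 'i \<Rightarrow> complex) \<Rightarrow> bool" where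
  "orth_projection P \<longleftrightarrow>
     (\<forall>u\<in>l2. P u \<in> l2 \<and> P (P u) = P u) \<and>
     (\<forall>u\<in>l2. \<forall>v\<in>l2. P (\<lambda>k. u k + v k) = (\<lambda>k. P u k + P v k)) \<and>
     (\<forall>c. \<forall>u\<in>l2. P (\<lambda>k. c * u k) = (\<lambda>k. c * P u k)) \<and>
     (\<forall>u\<in>l2. \<forall>v\<in>l2. l2_inner (P u) v = l2_inner u (P v))"

text \<open>
  Projection-valued measures on the Borel sets of the real line; countable additivity is in the
  strong operator topology.
\<close>

definition pvm :: "(real set \<Rightarrow> ('i \<Rightarrow> complex) \<Rightarrow> 'i \<Rightarrow> complex) \<Rightarrow> bool" where
  "pvm E \<longleftrightarrow>
     (\<forall>B\<in>sets borel. orth_projection (E B)) \<and>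
     (\<forall>u\<in>l2. E UNIV u = u) \<and>
     (\<forall>B::nat \<Rightarrow> real set. range B \<subseteq> sets borel \<longrightarrow> disjoint_family B \<longrightarrow>
        (\<forall>u\<in>l2. l2_tendsto (\<lambda>m k. \<Sum>i<m. E (B i) u k) (E (\<Union>i. B i) u)))"

text \<open>The finite scalar measure \<open>B \<mapsto> (E(B)u, u) = \<parallel>E(B)u\<parallel>\<^sup>2\<close>.\<close>

definition pvm_scalar ::
  "(real set \<Rightarrow> ('i \<Rightarrow> complex) \<Rightarrow> 'i \<Rightarrow> complex) \<Rightarrow> ('i \<Rightarrow> complex) \<Rightarrow> real measure" where
  "pvm_scalar E u = measure_of UNIV (sets borel) (\<lambda>B. ennreal ((l2_norm (E B u))\<^sup>2))"

definition simple_pvm_integral ::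
  "(real set \<Rightarrow> ('i \<Rightarrow> complex) \<Rightarrow> 'i \<Rightarrow> complex) \<Rightarrow> (real \<Rightarrow> real) \<Rightarrow> ('i \<Rightarrow> complex)
     \<Rightarrow> 'i \<Rightarrow> complex" where
  "simple_pvm_integral E s u = (\<lambda>k. \<Sum>y\<in>range s. of_real y * E (s -` {y}) u k)"

text \<open>
  The graph of \<open>\<integral> f dE\<close> for real Borel \<open>f\<close>: the domain consists of the \<open>u\<close> for which \<open>f\<close> is square
  integrable with respect to the scalar measure of \<open>u\<close>, and the value at \<open>u\<close> is the limit of the
  integrals of simple functions that approximate \<open>f\<close> in the \<open>L\<^sup>2\<close> space of that measure.
\<close>

definition pvm_integral ::
  "(real set \<Rightarrow> ('i \<Rightarrow> complex) \<Rightarrow> 'i \<Rightarrow> complex) \<Rightarrow> (real \<Rightarrow> real) \<Rightarrow> 'i op_graph" where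
  "pvm_integral E f = {(u, v). u \<in> l2 \<and> integrable (pvm_scalar E u) (\<lambda>t. (f t)\<^sup>2) \<and>
     (\<exists>s::nat \<Rightarrow> real \<Rightarrow> real. (\<forall>m. simple_function borel (s m)) \<and>
        (\<lambda>m. LINT t | pvm_scalar E u. (s m t - f t)\<^sup>2) \<longlonglongrightarrow> 0 \<and>
        l2_tendsto (\<lambda>m. simple_pvm_integral E (s m) u) v)}"

text \<open>
  For self-adjoint \<open>A\<close> the spectral measure exists and is unique on Borel sets and \<open>\<ell>\<^sup>2\<close>; the
  description operator is \<open>SOME\<close> because the values of \<open>E\<close> elsewhere are irrelevant.
\<close>

definition spectral_measure ::
  "'i op_graph \<Rightarrow> real set \<Rightarrow> ('i \<Rightarrow> complex) \<Rightarrow> 'i \<Rightarrow> complex" where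
  "spectral_measure A = (SOME E. pvm E \<and> pvm_integral E (\<lambda>t. t) = A)"

text \<open>
  The operator \<open>\<phi>(A)\<close> for \<open>\<phi>\<close> defined on \<open>[1, \<infinity>)\<close> and \<open>A \<ge> 1\<close>. The spectrum of \<open>A\<close> lies in
  \<open>[1, \<infinity>)\<close>, so the value \<open>0\<close> assigned outside of it plays no role.
\<close>

definition fun_calc :: "(real \<Rightarrow> real) \<Rightarrow> 'i op_graph \<Rightarrow> 'i op_graph" where
  "fun_calc \<phi> A = pvm_integral (spectral_measure A) (\<lambda>t. if 1 \<le> t then \<phi> t else 0)"

definition fun_calc_inner ::
  "(real \<Rightarrow> real) \<Rightarrow> 'i op_graph \<Rightarrow> ('i \<Rightarrow> complex) \<Rightarrow> ('i \<Rightarrow> complex) \<Rightarrow> complex" where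
  "fun_calc_inner \<phi> A u v = l2_inner (op_apply (fun_calc \<phi> A) u) (op_apply (fun_calc \<phi> A) v)"


section \<open>Completion of an inner product space\<close>

text \<open>
  The completion of a space \<open>V\<close> of functions with inner product \<open>ip\<close>: Cauchy sequences modulo
  sequences that tend to zero.
\<close>

definition ip_norm ::
  "(('i \<Rightarrow> complex) \<Rightarrow> ('i \<Rightarrow> complex) \<Rightarrow> complex) \<Rightarrow> ('i \<Rightarrow> complex) \<Rightarrow> real" where
  "ip_norm ip u = sqrt (Re (ip u u))"

definition cauchy_seqs ::
  "('i \<Rightarrow> complex) set \<Rightarrow> (('i \<Rightarrow> complex) \<Rightarrow> ('i \<Rightarrow> complex) \<Rightarrow> complex)
     \<Rightarrow> (nat \<Rightarrow> 'i \<Rightarrow> complex) set" where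
  "cauchy_seqs V ip = {X. range X \<subseteq> V \<and>
     (\<forall>e>0. \<exists>M. \<forall>m\<ge>M. \<forall>l\<ge>M. ip_norm ip (\<lambda>k. X m k - X l k) < e)}"

definition cauchy_rel ::
  "('i \<Rightarrow> complex) set \<Rightarrow> (('i \<Rightarrow> complex) \<Rightarrow> ('i \<Rightarrow> complex) \<Rightarrow> complex)
     \<Rightarrow> (nat \<Rightarrow> 'i \<Rightarrow> complex) rel" where
  "cauchy_rel V ip = {(X, Y). X \<in> cauchy_seqs V ip \<and> Y \<in> cauchy_seqs V ip \<and>
     (\<lambda>m. ip_norm ip (\<lambda>k. X m k - Y m k)) \<longlonglongrightarrow> 0}"

definition completion ::
  "('i \<Rightarrow> complex) set \<Rightarrow> (('i \<Rightarrow> complex) \<Rightarrow> ('i \<Rightarrow> complex) \<Rightarrow> complex)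
     \<Rightarrow> (nat \<Rightarrow> 'i \<Rightarrow> complex) set set" where
  "completion V ip = cauchy_seqs V ip // cauchy_rel V ip"

definition completion_class ::
  "('i \<Rightarrow> complex) set \<Rightarrow> (('i \<Rightarrow> complex) \<Rightarrow> ('i \<Rightarrow> complex) \<Rightarrow> complex)
     \<Rightarrow> (nat \<Rightarrow> 'i \<Rightarrow> complex) \<Rightarrow> (nat \<Rightarrow> 'i \<Rightarrow> complex) set" where
  "completion_class V ip X = cauchy_rel V ip `` {X}"

definition completion_add ::
  "('i \<Rightarrow> complex) set \<Rightarrow> (('i \<Rightarrow> complex) \<Rightarrow> ('i \<Rightarrow> complex) \<Rightarrow> complex)
     \<Rightarrow> (nat \<Rightarrow> 'i \<Rightarrow> complex) set \<Rightarrow> (nat \<Rightarrow> 'i \<Rightarrow> complex) set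
     \<Rightarrow> (nat \<Rightarrow> 'i \<Rightarrow> complex) set" where
  "completion_add V ip \<xi> \<eta> = (\<Union>X\<in>\<xi>. \<Union>Y\<in>\<eta>. completion_class V ip (\<lambda>m k. X m k + Y m k))"

definition completion_scale ::
  "('i \<Rightarrow> complex) set \<Rightarrow> (('i \<Rightarrow> complex) \<Rightarrow> ('i \<Rightarrow> complex) \<Rightarrow> complex)
     \<Rightarrow> complex \<Rightarrow> (nat \<Rightarrow> 'i \<Rightarrow> complex) set \<Rightarrow> (nat \<Rightarrow> 'i \<Rightarrow> complex) set" where
  "completion_scale V ip c \<xi> = (\<Union>X\<in>\<xi>. completion_class V ip (\<lambda>m k. c * X m k))"

definition completion_norm ::
  "(('i \<Rightarrow> complex) \<Rightarrow> ('i \<Rightarrow> complex) \<Rightarrow> complex) \<Rightarrow> (nat \<Rightarrow> 'i \<Rightarrow> complex) set \<Rightarrow> real" where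
  "completion_norm ip \<xi> = (THE r. \<forall>X\<in>\<xi>. (\<lambda>m. ip_norm ip (X m)) \<longlonglongrightarrow> r)"

text \<open>
  The completion of \<open>(V, ip)\<close> equals the function space \<open>W\<close> with inner product \<open>iq\<close>, up to norm
  equivalence. An element of \<open>V\<close> and its image in the completion are identified, so the
  identification \<open>J\<close> of the two vector spaces is the identity on \<open>V\<close>.
\<close>

definition completion_eq_upto_norm_equiv ::
  "('i \<Rightarrow> complex) set \<Rightarrow> (('i \<Rightarrow> complex) \<Rightarrow> ('i \<Rightarrow> complex) \<Rightarrow> complex)
     \<Rightarrow> ('i \<Rightarrow> complex) set \<Rightarrow> (('i \<Rightarrow> complex) \<Rightarrow> ('i \<Rightarrow> complex) \<Rightarrow> complex) \<Rightarrow> bool" where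
  "completion_eq_upto_norm_equiv V ip W iq \<longleftrightarrow>
     (\<exists>J. bij_betw J (completion V ip) W \<and>
        (\<forall>u\<in>V. J (completion_class V ip (\<lambda>m. u)) = u) \<and>
        (\<forall>\<xi>\<in>completion V ip. \<forall>\<eta>\<in>completion V ip.
           J (completion_add V ip \<xi> \<eta>) = (\<lambda>k. J \<xi> k + J \<eta> k)) \<and>
        (\<forall>c. \<forall>\<xi>\<in>completion V ip. J (completion_scale V ip c \<xi>) = (\<lambda>k. c * J \<xi> k)) \<and>
        (\<exists>c>0. \<exists>C>0. \<forall>\<xi>\<in>completion V ip.
           c * completion_norm ip \<xi> \<le> ip_norm iq (J \<xi>) \<and>
           ip_norm iq (J \<xi>) \<le> C * completion_norm ip \<xi>))"

end

theory Submission
  imports Defs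
begin

text \<open>
  The operator with symbol \<open>a\<close> is an infinite matrix: its entry at \<open>(k, l)\<close> is the Fourier coefficient
  of \<open>a(k, \<cdot>)\<close> at \<open>k - l\<close>. The symbol estimates bound the entries by \<open>1 + |k|\<close> with rapid decay in
  \<open>k - l\<close>, so the matrix maps the Sobolev space of order \<open>t + 1\<close> to the one of order \<open>t\<close>. The matrix
  of \<open>1/a\<close> inverts it up to a remainder of order \<open>-1\<close> (\<open>parametrix\<close>), because the difference
  \<open>a(l, \<cdot>) - a(k, \<cdot>)\<close> is of order \<open>0\<close> and its growth in \<open>k - l\<close> is absorbed by the decay away from
  the diagonal. This gives \<open>elliptic_regularity\<close>: from \<open>u\<close> and \<open>A u\<close> of order \<open>t\<close> one concludes that
  \<open>u\<close> is of order \<open>t + 1\<close>.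

  Regularity identifies the closure of the operator on the Schwartz space with the matrix on the
  Sobolev space of order \<open>1\<close> (\<open>op_closure_matvec\<close>). On this domain it is symmetric, bounded below by
  \<open>1\<close> and onto, and by Rellich's theorem its inverse is compact. Hence there is a complete orthonormal
  family of eigenvectors with eigenvalues at least \<open>1\<close> (\<open>ex_eigenbasis\<close>), and the coefficient map
  of this family is unitary and turns the operator into multiplication by the eigenvalues.

  For natural \<open>N\<close> the norms of \<open>\<langle>k\<rangle>\<^sup>N u\<close> and of \<open>A\<^sup>N u\<close> are equivalent, by \<open>N\<close>-fold use of the mapping
  property and of regularity. The passage from powers to a function \<open>\<phi>\<close> of \<open>RO\<close>-variation is
  \<open>interpolation\<close>. Such a \<open>\<phi>\<close> has polynomial growth bounds in both directions (\<open>RO_growth\<close>), so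
  \<open>\<phi>(s)\<^sup>2\<close> is comparable with the sum over the dyadic points \<open>t = 2\<^sup>j\<close> of the terms
  \<open>\<phi>(t)\<^sup>2 min(s/t, t/s)\<^sup>2\<^sup>N\<close>. For a single term the two sides are compared by splitting \<open>u\<close> spectrally at \<open>t\<close>:
  one part is estimated by the weights to the power \<open>N\<close>, the other one by duality with the power
  \<open>-N\<close>. The result is that \<open>\<phi>(\<langle>k\<rangle>) u\<close> is square summable exactly if \<open>u\<close> is in the domain of \<open>\<phi>(A)\<close>, with
  equivalent norms, for every \<open>u\<close> in \<open>\<ell>\<^sup>2\<close> (\<open>RO_weights\<close>).

  The operator \<open>\<phi>(A)\<close> is defined by an arbitrary spectral measure of \<open>A\<close>. Its eigenvectors are
  eigenvectors of every such measure (\<open>pvm_eigenvector\<close>), which is therefore diagonal in the eigenbasis,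
  and \<open>\<phi>(A)\<close> multiplies the coefficient at an eigenvalue \<open>\<lambda>\<close> by \<open>\<phi>(\<lambda>)\<close> (\<open>fun_calc_diag\<close>).

  The domain of \<open>\<phi>(A)\<close> is thus \<open>\<ell>\<^sup>2 \<inter> H\<^sup>\<phi>\<close>. It contains the finitely supported functions, which are
  dense in \<open>H\<^sup>\<phi>\<close>, and \<open>H\<^sup>\<phi>\<close> is complete, so sending a Cauchy sequence to its limit in \<open>H\<^sup>\<phi>\<close> identifies the
  completion with \<open>H\<^sup>\<phi>\<close> (\<open>completion_eq_weighted\<close>).
\<close>

section \<open>Square summable functions\<close>

text \<open>
  Square summability and the norm are controlled by finite partial sums, so the inequalities for the
  Euclidean norm of finite families carry over.
\<close>

lemma l2_norm_nonneg [simp]: "l2_norm u \<ge> 0"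
  by (simp add: l2_norm_def infsum_nonneg)

lemma l2_norm_sq: "(l2_norm u)\<^sup>2 = (\<Sum>\<^sub>\<infinity>k. (cmod (u k))\<^sup>2)"
  by (simp add: l2_norm_def infsum_nonneg)

lemma l2_finite_le:
  assumes "u \<in> l2" "finite F" shows "(\<Sum>k\<in>F. (cmod (u k))\<^sup>2) \<le> (l2_norm u)\<^sup>2"
  unfolding l2_norm_sq using assms by (intro finite_sum_le_infsum) (auto simp: l2_def)

lemma l2_boundI:
  assumes "\<And>F. finite F \<Longrightarrow> (\<Sum>k\<in>F. (cmod (u k))\<^sup>2) \<le> B\<^sup>2" "B \<ge> 0"
  shows "u \<in> l2" "l2_norm u \<le> B"
proof -
  have s: "(\<lambda>k. (cmod (u k))\<^sup>2) summable_on UNIV"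
    by (rule nonneg_bdd_above_summable_on) (auto intro!: bdd_aboveI[of _ "B\<^sup>2"] assms)
  then show "u \<in> l2" by (simp add: l2_def)
  have "(l2_norm u)\<^sup>2 \<le> B\<^sup>2"
    unfolding l2_norm_sq by (rule infsum_le_finite_sums[OF s]) (auto intro: assms)
  then show "l2_norm u \<le> B" using assms(2) power2_le_imp_le by blast
qed

lemma L2_set_le_l2_norm:
  assumes "u \<in> l2" "finite F" shows "L2_set (\<lambda>k. cmod (u k)) F \<le> l2_norm u"
  unfolding L2_set_def by (rule real_le_lsqrt) (auto simp: sum_nonneg l2_finite_le assms)

lemma l2_mono:
  assumes "v \<in> l2" "\<And>k. cmod (u k) \<le> C * cmod (v k)" "C \<ge> 0"
  shows "u \<in> l2" "l2_norm u \<le> C * l2_norm v"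
proof -
  have *: "(\<Sum>k\<in>F. (cmod (u k))\<^sup>2) \<le> (C * l2_norm v)\<^sup>2" if "finite F" for F
  proof -
    have "(\<Sum>k\<in>F. (cmod (u k))\<^sup>2) \<le> (\<Sum>k\<in>F. (C * cmod (v k))\<^sup>2)"
      by (intro sum_mono power_mono assms) auto
    also have "\<dots> = C\<^sup>2 * (\<Sum>k\<in>F. (cmod (v k))\<^sup>2)" by (simp add: sum_distrib_left power_mult_distrib)
    also have "\<dots> \<le> C\<^sup>2 * (l2_norm v)\<^sup>2" by (intro mult_left_mono l2_finite_le assms that) auto
    finally show ?thesis by (simp add: power_mult_distrib)
  qed
  show "u \<in> l2" "l2_norm u \<le> C * l2_norm v"
    using l2_boundI[of u "C * l2_norm v"] * assms(3) by auto
qed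

lemma l2_add:
  assumes "u \<in> l2" "v \<in> l2"
  shows "(\<lambda>k. u k + v k) \<in> l2" "l2_norm (\<lambda>k. u k + v k) \<le> l2_norm u + l2_norm v"
proof -
  have *: "(\<Sum>k\<in>F. (cmod (u k + v k))\<^sup>2) \<le> (l2_norm u + l2_norm v)\<^sup>2" if "finite F" for F
  proof -
    have "L2_set (\<lambda>k. cmod (u k + v k)) F \<le> L2_set (\<lambda>k. cmod (u k) + cmod (v k)) F"
      by (rule L2_set_mono) (auto intro: norm_triangle_ineq)
    also have "\<dots> \<le> L2_set (\<lambda>k. cmod (u k)) F + L2_set (\<lambda>k. cmod (v k)) F"
      by (rule L2_set_triangle_ineq)
    also have "\<dots> \<le> l2_norm u + l2_norm v" by (intro add_mono L2_set_le_l2_norm assms that)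
    finally have "(L2_set (\<lambda>k. cmod (u k + v k)) F)\<^sup>2 \<le> (l2_norm u + l2_norm v)\<^sup>2"
      by (intro power_mono) auto
    then show ?thesis by (simp add: L2_set_def sum_nonneg)
  qed
  show "(\<lambda>k. u k + v k) \<in> l2" "l2_norm (\<lambda>k. u k + v k) \<le> l2_norm u + l2_norm v"
    using l2_boundI[of "\<lambda>k. u k + v k" "l2_norm u + l2_norm v"] * by auto
qed

lemma l2_norm_scale: "l2_norm (\<lambda>k. c * u k) = cmod c * l2_norm u"
  by (simp add: l2_norm_def norm_mult power_mult_distrib infsum_cmult_right' real_sqrt_mult)

lemma l2_scale [simp]: "u \<in> l2 \<Longrightarrow> (\<lambda>k. c * u k) \<in> l2"
  by (rule l2_mono(1)[of u _ "cmod c"]) (auto simp: norm_mult)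

lemma l2_norm_minus_commute: "l2_norm (\<lambda>k. u k - v k) = l2_norm (\<lambda>k. v k - u k)"
  by (simp add: l2_norm_def norm_minus_commute)

lemma l2_diff:
  assumes "u \<in> l2" "v \<in> l2"
  shows "(\<lambda>k. u k - v k) \<in> l2" "l2_norm (\<lambda>k. u k - v k) \<le> l2_norm u + l2_norm v"
  using l2_add[OF assms(1) l2_scale[OF assms(2), of "-1"]] l2_norm_scale[of "-1" v] by auto

lemma l2_norm_triangle_sub:
  assumes "u \<in> l2" "v \<in> l2" shows "\<bar>l2_norm u - l2_norm v\<bar> \<le> l2_norm (\<lambda>k. u k - v k)"
proof -
  have "l2_norm (\<lambda>k. (u k - v k) + v k) \<le> l2_norm (\<lambda>k. u k - v k) + l2_norm v"
    by (intro l2_add l2_diff assms)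
  moreover have "l2_norm (\<lambda>k. (v k - u k) + u k) \<le> l2_norm (\<lambda>k. v k - u k) + l2_norm u"
    by (intro l2_add l2_diff assms)
  ultimately show ?thesis using l2_norm_minus_commute[of u v] by simp
qed

lemma l2_zero [simp]: "(\<lambda>k. 0) \<in> l2" "l2_norm (\<lambda>k. 0) = 0"
  by (auto simp: l2_def l2_norm_def)

lemma l2_sum: "(\<And>i. i \<in> A \<Longrightarrow> f i \<in> l2) \<Longrightarrow> (\<lambda>k. \<Sum>i\<in>A. f i k) \<in> l2"
  by (induction A rule: infinite_finite_induct) (auto intro: l2_add)

lemma cmod_le_l2_norm: "u \<in> l2 \<Longrightarrow> cmod (u k) \<le> l2_norm u"
  using l2_finite_le[of u "{k}"] power2_le_imp_le[of "cmod (u k)" "l2_norm u"] by auto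

lemma l2_norm_eq_0:
  assumes "u \<in> l2" shows "l2_norm u = 0 \<longleftrightarrow> u = (\<lambda>k. 0)"
proof
  assume "l2_norm u = 0" with assms show "u = (\<lambda>k. 0)" using cmod_le_l2_norm[of u] by auto
qed simp

lemma l2_finite_support: "finite {k. u k \<noteq> 0} \<Longrightarrow> u \<in> l2"
  unfolding l2_def mem_Collect_eq
  by (rule summable_on_cong_neutral[THEN iffD1, of UNIV "{k. u k \<noteq> 0}" "\<lambda>k. (cmod (u k))\<^sup>2"]) auto

lemma l2_restrict:
  assumes "u \<in> l2"
  shows "(\<lambda>k. if P k then u k else 0) \<in> l2" "l2_norm (\<lambda>k. if P k then u k else 0) \<le> l2_norm u"
  using l2_mono[OF assms, of "\<lambda>k. if P k then u k else 0" 1] by auto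

lemma l2_tail:
  assumes "u \<in> l2" "e > 0"
  shows "\<exists>F. finite F \<and> (\<forall>G. F \<subseteq> G \<longrightarrow> l2_norm (\<lambda>k. if k \<in> G then 0 else u k) < e)"
proof -
  have s: "(\<lambda>k. (cmod (u k))\<^sup>2) summable_on UNIV" using assms by (simp add: l2_def)
  have "(e/2)\<^sup>2 > 0" using assms by simp
  from infsum_finite_approximation[OF s this] obtain F where F: "finite F"
    "dist (\<Sum>k\<in>F. (cmod (u k))\<^sup>2) (\<Sum>\<^sub>\<infinity>k. (cmod (u k))\<^sup>2) \<le> (e/2)\<^sup>2" by auto
  have "l2_norm (\<lambda>k. if k \<in> G then 0 else u k) < e" if "F \<subseteq> G" for G
  proof -
    have "(\<Sum>k\<in>H. (cmod (if k \<in> G then 0 else u k))\<^sup>2) \<le> (e/2)\<^sup>2" if H: "finite H" for H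
    proof -
      have "(\<Sum>k\<in>H. (cmod (if k \<in> G then 0 else u k))\<^sup>2) = (\<Sum>k\<in>H-G. (cmod (u k))\<^sup>2)"
        using H by (intro sum.mono_neutral_cong_right) auto
      also have "\<dots> = (\<Sum>k\<in>(H-G) \<union> F. (cmod (u k))\<^sup>2) - (\<Sum>k\<in>F. (cmod (u k))\<^sup>2)"
        using H F \<open>F \<subseteq> G\<close> by (subst sum.union_disjoint) auto
      also have "\<dots> \<le> (\<Sum>\<^sub>\<infinity>k. (cmod (u k))\<^sup>2) - (\<Sum>k\<in>F. (cmod (u k))\<^sup>2)"
        using H F by (intro diff_right_mono finite_sum_le_infsum s) auto
      also have "\<dots> \<le> (e/2)\<^sup>2" using F(2) by (simp add: dist_real_def)
      finally show ?thesis .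
    qed
    then have "l2_norm (\<lambda>k. if k \<in> G then 0 else u k) \<le> e/2" using assms by (intro l2_boundI) auto
    then show ?thesis using assms by simp
  qed
  then show ?thesis using F by blast
qed

subsection \<open>Inner product\<close>

lemma l2_inner_abs_summable:
  assumes "u \<in> l2" "v \<in> l2"
  shows "(\<lambda>k. norm (u k * cnj (v k))) summable_on UNIV"
proof (rule summable_on_comparison_test)
  show "(\<lambda>k. (cmod (u k))\<^sup>2 + (cmod (v k))\<^sup>2) summable_on UNIV"
    using assms by (intro summable_on_add) (auto simp: l2_def)
  show "norm (u k * cnj (v k)) \<le> (cmod (u k))\<^sup>2 + (cmod (v k))\<^sup>2" for k
  proof -
    have "2 * (cmod (u k) * cmod (v k)) \<le> (cmod (u k))\<^sup>2 + (cmod (v k))\<^sup>2"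
      using sum_squares_bound[of "cmod (u k)" "cmod (v k)"] by (simp add: mult.assoc)
    moreover have "0 \<le> cmod (u k) * cmod (v k)" by simp
    ultimately show ?thesis unfolding norm_mult complex_mod_cnj by linarith
  qed
qed simp

lemma l2_inner_summable:
  assumes "u \<in> l2" "v \<in> l2" shows "(\<lambda>k. u k * cnj (v k)) summable_on UNIV"
  using l2_inner_abs_summable[OF assms] by (rule abs_summable_summable)

lemma l2_inner_add_left:
  "u \<in> l2 \<Longrightarrow> v \<in> l2 \<Longrightarrow> w \<in> l2 \<Longrightarrow> l2_inner (\<lambda>k. u k + v k) w = l2_inner u w + l2_inner v w"
  unfolding l2_inner_def by (subst infsum_add[symmetric]) (auto simp: l2_inner_summable distrib_right)

lemma l2_inner_scale_left: "l2_inner (\<lambda>k. c * u k) w = c * l2_inner u w"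
  unfolding l2_inner_def by (simp add: mult.assoc infsum_cmult_right')

lemma l2_inner_cnj: "cnj (l2_inner u v) = l2_inner v u"
  unfolding l2_inner_def by (subst infsum_cnj[symmetric]) (simp add: mult.commute)

lemma l2_inner_diff_left:
  "u \<in> l2 \<Longrightarrow> v \<in> l2 \<Longrightarrow> w \<in> l2 \<Longrightarrow> l2_inner (\<lambda>k. u k - v k) w = l2_inner u w - l2_inner v w"
  using l2_inner_add_left[of u "\<lambda>k. (-1) * v k" w] l2_scale[of v "-1"] l2_inner_scale_left[of "-1" v w]
  by simp

lemma l2_inner_add_right:
  "u \<in> l2 \<Longrightarrow> v \<in> l2 \<Longrightarrow> w \<in> l2 \<Longrightarrow> l2_inner w (\<lambda>k. u k + v k) = l2_inner w u + l2_inner w v"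
  using l2_inner_add_left[of u v w] l2_inner_cnj[of _ w] by (metis complex_cnj_add)

lemma l2_inner_diff_right:
  "u \<in> l2 \<Longrightarrow> v \<in> l2 \<Longrightarrow> w \<in> l2 \<Longrightarrow> l2_inner w (\<lambda>k. u k - v k) = l2_inner w u - l2_inner w v"
  using l2_inner_diff_left[of u v w] l2_inner_cnj[of _ w] by (metis complex_cnj_diff)

lemma l2_inner_scale_right: "l2_inner w (\<lambda>k. c * u k) = cnj c * l2_inner w u"
  using l2_inner_scale_left[of c u w] l2_inner_cnj[of _ w] by (metis complex_cnj_mult)

lemma infsum_of_real_complex: "(\<Sum>\<^sub>\<infinity>k\<in>A. complex_of_real (f k)) = of_real (\<Sum>\<^sub>\<infinity>k\<in>A. f k)"
proof (cases "f summable_on A")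
  case True then show ?thesis by (intro infsumI has_sum_of_real) simp
next
  case False
  then have "\<not> (\<lambda>k. complex_of_real (f k)) summable_on A" using summable_on_Re by fastforce
  then show ?thesis using False by (simp add: infsum_not_exists)
qed

lemma l2_inner_self: "l2_inner u u = of_real ((l2_norm u)\<^sup>2)"
proof -
  have "u k * cnj (u k) = of_real ((cmod (u k))\<^sup>2)" for k
    using complex_norm_square[of "u k"] by simp
  then show ?thesis unfolding l2_inner_def l2_norm_sq by (simp only: infsum_of_real_complex)
qed

lemma l2_inner_zero [simp]: "l2_inner (\<lambda>k. 0) u = 0" "l2_inner u (\<lambda>k. 0) = 0"
  by (auto simp: l2_inner_def)

lemma l2_inner_sum_left:
  "finite A \<Longrightarrow> (\<And>i. i \<in> A \<Longrightarrow> f i \<in> l2) \<Longrightarrow> w \<in> l2 \<Longrightarrow>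
    l2_inner (\<lambda>k. \<Sum>i\<in>A. f i k) w = (\<Sum>i\<in>A. l2_inner (f i) w)"
  by (induction A rule: finite_induct) (auto simp: l2_inner_add_left l2_sum)

lemma cauchy_schwarz:
  assumes "u \<in> l2" "v \<in> l2"
  shows "(\<Sum>\<^sub>\<infinity>k. cmod (u k * cnj (v k))) \<le> l2_norm u * l2_norm v"
    and "cmod (l2_inner u v) \<le> l2_norm u * l2_norm v"
proof -
  show 1: "(\<Sum>\<^sub>\<infinity>k. cmod (u k * cnj (v k))) \<le> l2_norm u * l2_norm v"
  proof (rule infsum_le_finite_sums[OF l2_inner_abs_summable[OF assms]])
    fix F :: "'a set" assume F: "finite F"
    have "(\<Sum>k\<in>F. cmod (u k * cnj (v k))) = (\<Sum>k\<in>F. \<bar>cmod (u k)\<bar> * \<bar>cmod (v k)\<bar>)"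
      by (simp add: norm_mult)
    also have "\<dots> \<le> L2_set (\<lambda>k. cmod (u k)) F * L2_set (\<lambda>k. cmod (v k)) F"
      by (rule L2_set_mult_ineq)
    also have "\<dots> \<le> l2_norm u * l2_norm v"
      by (intro mult_mono L2_set_le_l2_norm assms F) auto
    finally show "(\<Sum>k\<in>F. cmod (u k * cnj (v k))) \<le> l2_norm u * l2_norm v" .
  qed
  then show "cmod (l2_inner u v) \<le> l2_norm u * l2_norm v"
    unfolding l2_inner_def using norm_infsum_bound[OF l2_inner_abs_summable[OF assms]] by linarith
qed

lemma l2_norm_add_sq:
  assumes "u \<in> l2" "v \<in> l2"
  shows "(l2_norm (\<lambda>k. u k + v k))\<^sup>2 = (l2_norm u)\<^sup>2 + 2 * Re (l2_inner u v) + (l2_norm v)\<^sup>2"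
proof -
  have "l2_inner (\<lambda>k. u k + v k) (\<lambda>k. u k + v k)
      = l2_inner u u + l2_inner u v + (l2_inner v u + l2_inner v v)"
    using assms by (simp add: l2_inner_add_left l2_inner_add_right l2_add)
  then have "Re (l2_inner (\<lambda>k. u k + v k) (\<lambda>k. u k + v k))
      = (l2_norm u)\<^sup>2 + Re (l2_inner u v) + Re (l2_inner v u) + (l2_norm v)\<^sup>2"
    by (simp add: l2_inner_self)
  moreover have "Re (l2_inner v u) = Re (l2_inner u v)" by (metis complex_cnj l2_inner_cnj complex.sel(1) Re_complex_of_real cnj.sel(1))
  ultimately show ?thesis by (simp add: l2_inner_self)
qed

lemma l2_norm_diff_sq:
  assumes "u \<in> l2" "v \<in> l2"
  shows "(l2_norm (\<lambda>k. u k - v k))\<^sup>2 = (l2_norm u)\<^sup>2 - 2 * Re (l2_inner u v) + (l2_norm v)\<^sup>2"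
  using l2_norm_add_sq[OF assms(1) l2_scale[OF assms(2), of "-1"]]
    l2_inner_scale_right[of u "-1" v] l2_norm_scale[of "-1" v] by simp

subsection \<open>Convergence\<close>

text \<open>
  A bound for the norms is a bound for all finite partial sums, and these pass to pointwise limits.
\<close>

lemma l2_fatou:
  assumes "\<And>m. U m \<in> l2" "\<And>m. l2_norm (U m) \<le> B" "\<And>k. (\<lambda>m. U m k) \<longlonglongrightarrow> u k"
  shows "u \<in> l2" "l2_norm u \<le> B"
proof -
  have B: "B \<ge> 0" using assms(2)[of 0] l2_norm_nonneg[of "U 0"] by linarith
  have *: "(\<Sum>k\<in>F. (cmod (u k))\<^sup>2) \<le> B\<^sup>2" if "finite F" for F
  proof (rule LIMSEQ_le_const2)
    show "(\<lambda>m. \<Sum>k\<in>F. (cmod (U m k))\<^sup>2) \<longlonglongrightarrow> (\<Sum>k\<in>F. (cmod (u k))\<^sup>2)"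
      by (intro tendsto_intros assms)
    show "\<exists>N. \<forall>n\<ge>N. (\<Sum>k\<in>F. (cmod (U n k))\<^sup>2) \<le> B\<^sup>2"
      using l2_finite_le[OF assms(1) that] power_mono[OF assms(2) l2_norm_nonneg, of _ 2]
      by (meson order_trans)
  qed
  show "u \<in> l2" "l2_norm u \<le> B" using l2_boundI[of u B, OF * B] by auto
qed

lemma tendsto_dominated:
  fixes X :: "nat \<Rightarrow> 'a::real_normed_vector"
  assumes "\<And>m. norm (X m - x) \<le> Y m" "Y \<longlonglongrightarrow> 0" shows "X \<longlonglongrightarrow> x"
  by (rule LIM_zero_cancel, rule Lim_null_comparison[OF _ assms(2)]) (simp add: assms(1))

lemma l2_tendsto_pointwise:
  assumes "l2_tendsto U u" shows "(\<lambda>m. U m k) \<longlonglongrightarrow> u k"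
proof (rule tendsto_dominated)
  show "norm (U m k - u k) \<le> l2_norm (\<lambda>k. U m k - u k)" for m
    using assms cmod_le_l2_norm[OF l2_diff(1)[of "U m" u]] by (auto simp: l2_tendsto_def)
qed (use assms in \<open>simp add: l2_tendsto_def\<close>)

lemma l2_tendsto_unique: "l2_tendsto U u \<Longrightarrow> l2_tendsto U v \<Longrightarrow> u = v"
  by (rule ext) (rule LIMSEQ_unique[OF l2_tendsto_pointwise l2_tendsto_pointwise])

lemma l2_tendsto_norm:
  assumes "l2_tendsto U u" shows "(\<lambda>m. l2_norm (U m)) \<longlonglongrightarrow> l2_norm u"
proof (rule tendsto_dominated)
  show "norm (l2_norm (U m) - l2_norm u) \<le> l2_norm (\<lambda>k. U m k - u k)" for m
    using assms l2_norm_triangle_sub[of "U m" u] by (auto simp: l2_tendsto_def)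
qed (use assms in \<open>simp add: l2_tendsto_def\<close>)

lemma l2_tendsto_inner:
  assumes "l2_tendsto U u" "w \<in> l2" shows "(\<lambda>m. l2_inner (U m) w) \<longlonglongrightarrow> l2_inner u w"
proof (rule tendsto_dominated)
  show "norm (l2_inner (U m) w - l2_inner u w) \<le> l2_norm (\<lambda>k. U m k - u k) * l2_norm w" for m
    using assms cauchy_schwarz(2)[OF l2_diff(1)[of "U m" u] assms(2)]
    by (auto simp: l2_tendsto_def l2_inner_diff_left)
  show "(\<lambda>m. l2_norm (\<lambda>k. U m k - u k) * l2_norm w) \<longlonglongrightarrow> 0"
    using assms unfolding l2_tendsto_def by (auto intro: tendsto_mult_left_zero)
qed

text \<open>
  The limit is found pointwise, and Fatou's lemma applied to the differences gives the convergence in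
  norm.
\<close>

lemma l2_complete:
  assumes U: "\<And>m. U m \<in> l2"
    and C: "\<And>e. e > 0 \<Longrightarrow> \<exists>M. \<forall>m\<ge>M. \<forall>l\<ge>M. l2_norm (\<lambda>k. U m k - U l k) < e"
  shows "\<exists>u. l2_tendsto U u"
proof -
  have "Cauchy (\<lambda>m. U m k)" for k
  proof (rule metric_CauchyI)
    fix e :: real assume "e > 0"
    then obtain M where M: "\<forall>m\<ge>M. \<forall>l\<ge>M. l2_norm (\<lambda>k. U m k - U l k) < e" using C by blast
    have "dist (U m k) (U l k) < e" if "m \<ge> M" "l \<ge> M" for m l
      using M that cmod_le_l2_norm[OF l2_diff(1)[OF U[of m] U[of l]], of k] by (fastforce simp: dist_norm)
    then show "\<exists>M. \<forall>m\<ge>M. \<forall>n\<ge>M. dist (U m k) (U n k) < e" by blast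
  qed
  then obtain u where u: "\<And>k. (\<lambda>m. U m k) \<longlonglongrightarrow> u k"
    unfolding Cauchy_convergent_iff convergent_def by (metis (no_types))
  have *: "\<exists>M. \<forall>m\<ge>M. (\<lambda>k. U m k - u k) \<in> l2 \<and> l2_norm (\<lambda>k. U m k - u k) \<le> e" if "e > 0" for e
  proof -
    obtain M where M: "\<forall>m\<ge>M. \<forall>l\<ge>M. l2_norm (\<lambda>k. U m k - U l k) < e" using C \<open>e > 0\<close> by blast
    have "(\<lambda>k. U m k - u k) \<in> l2 \<and> l2_norm (\<lambda>k. U m k - u k) \<le> e" if "m \<ge> M" for m
    proof -
      have a: "(\<lambda>l. U m k - U (l + M) k) \<longlonglongrightarrow> U m k - u k" for k
        by (intro tendsto_intros LIMSEQ_ignore_initial_segment u)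
      have "l2_norm (\<lambda>k. U m k - U (l + M) k) \<le> e" for l using M that by (simp add: less_imp_le)
      then show ?thesis using l2_fatou[of "\<lambda>l k. U m k - U (l + M) k" e "\<lambda>k. U m k - u k"] a l2_diff(1)[OF U U] by blast
    qed
    then show ?thesis by blast
  qed
  obtain M where "(\<lambda>k. U M k - u k) \<in> l2" using *[of 1] by auto
  from l2_diff(1)[OF U[of M] this] have "u \<in> l2" by simp
  moreover have "(\<lambda>m. l2_norm (\<lambda>k. U m k - u k)) \<longlonglongrightarrow> 0"
  proof (rule LIMSEQ_I)
    fix r :: real assume "r > 0"
    then obtain M where "\<forall>m\<ge>M. l2_norm (\<lambda>k. U m k - u k) \<le> r / 2" using *[of "r/2"] by auto
    then show "\<exists>no. \<forall>n\<ge>no. norm (l2_norm (\<lambda>k. U n k - u k) - 0) < r"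
      using \<open>r > 0\<close> by (intro exI[of _ M]) (auto intro: le_less_trans)
  qed
  ultimately show ?thesis using U by (auto simp: l2_tendsto_def)
qed

text \<open>
  Bounded pointwise convergence implies weak convergence: a square summable \<open>w\<close> is the sum of a
  finitely supported function, for which pointwise convergence suffices, and a small remainder, whose
  contribution is small because the norms are bounded.
\<close>

lemma l2_weak_inner:
  assumes U: "\<And>m. U m \<in> l2" "\<And>m. l2_norm (U m) \<le> B" "\<And>k. (\<lambda>m. U m k) \<longlonglongrightarrow> u k" and w: "w \<in> l2"
  shows "(\<lambda>m. l2_inner (U m) w) \<longlonglongrightarrow> l2_inner u w"
proof (rule LIMSEQ_I)
  fix r :: real assume r: "r > 0"
  have u: "u \<in> l2" "l2_norm u \<le> B" using l2_fatou[OF U] by auto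
  have B: "B \<ge> 0" using u l2_norm_nonneg order_trans by blast
  obtain F where F: "finite F" "l2_norm (\<lambda>k. if k \<in> F then 0 else w k) < r / (4 * (B + 1))"
    using l2_tail[OF w, of "r / (4 * (B + 1))"] r B by auto
  define w1 where "w1 = (\<lambda>k. if k \<in> F then 0 else w k)"
  define w2 where "w2 = (\<lambda>k. if k \<in> F then w k else 0)"
  have w12: "w1 \<in> l2" "w2 \<in> l2"
    unfolding w1_def w2_def by (rule l2_mono(1)[OF w, of _ 1]; simp)+
  have split: "l2_inner v w = l2_inner v w1 + l2_inner v w2" if "v \<in> l2" for v
  proof -
    have "w = (\<lambda>k. w1 k + w2 k)" by (auto simp: w1_def w2_def)
    then show ?thesis using l2_inner_add_right[OF w12 that] by simp
  qed
  have fin: "l2_inner v w2 = (\<Sum>k\<in>F. v k * cnj (w k))" for v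
    unfolding l2_inner_def w2_def
    using F by (subst infsum_cong_neutral[where T = F and g = "\<lambda>k. v k * cnj (w k)"]) auto
  have "(\<lambda>m. l2_inner (U m) w2) \<longlonglongrightarrow> l2_inner u w2"
    unfolding fin by (intro tendsto_intros U)
  then obtain M where M: "\<forall>m\<ge>M. norm (l2_inner (U m) w2 - l2_inner u w2) < r/2"
    using LIMSEQ_D[of _ _ "r/2"] r half_gt_zero by blast
  have small: "cmod (l2_inner v w1) \<le> r / 4" if "v \<in> l2" "l2_norm v \<le> B" for v
  proof -
    have "cmod (l2_inner v w1) \<le> B * (r / (4 * (B + 1)))"
      using cauchy_schwarz(2)[OF that(1) w12(1)] F(2) that(2) B
      by (intro order_trans[OF cauchy_schwarz(2)[OF that(1) w12(1)]] mult_mono) (auto simp: w1_def)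
    also have "\<dots> \<le> r / 4" using B r by (simp add: field_simps)
    finally show ?thesis .
  qed
  have "norm (l2_inner (U m) w - l2_inner u w) < r" if "m \<ge> M" for m
  proof -
    have "l2_inner (U m) w - l2_inner u w
       = (l2_inner (U m) w2 - l2_inner u w2) + (l2_inner (U m) w1 - l2_inner u w1)"
      using split U u by simp
    then have "norm (l2_inner (U m) w - l2_inner u w)
       \<le> norm (l2_inner (U m) w2 - l2_inner u w2) + (norm (l2_inner (U m) w1) + norm (l2_inner u w1))"
      by (metis norm_triangle_ineq norm_triangle_ineq4 add_left_mono order_trans)
    moreover have "norm (l2_inner (U m) w2 - l2_inner u w2) < r / 2" using M that by blast
    moreover have "norm (l2_inner (U m) w1) \<le> r/4" "norm (l2_inner u w1) \<le> r/4" using small U u by auto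
    ultimately show ?thesis by linarith
  qed
  then show "\<exists>no. \<forall>n\<ge>no. norm (l2_inner (U n) w - l2_inner u w) < r" by blast
qed

lemma tendsto_fun_apply:
  fixes u :: "'i::countable \<Rightarrow> complex"
  assumes "(U \<longlongrightarrow> u) F" shows "((\<lambda>m. U m k) \<longlongrightarrow> u k) F"
proof -
  have "isCont (\<lambda>x :: 'i \<Rightarrow> complex. x k) u"
    using continuous_on_product_coordinates[of k] continuous_on_eq_continuous_at[OF open_UNIV] by blast
  then show ?thesis using assms by (rule isCont_tendsto_compose)
qed

text \<open>
  Bounded sets are relatively compact for pointwise convergence: their values lie in a product of
  discs, which is compact by Tychonoff's theorem, and sequentially compact because the index set is
  countable.
\<close>

lemma l2_weak_compact:
  fixes U :: "nat \<Rightarrow> 'i::countable \<Rightarrow> complex"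
  assumes "\<And>m. U m \<in> l2" "\<And>m. l2_norm (U m) \<le> B"
  shows "\<exists>r u. strict_mono r \<and> (\<forall>k. (\<lambda>m. U (r m) k) \<longlonglongrightarrow> u k)"
proof -
  have "compactin (product_topology (\<lambda>i::'i. euclidean) UNIV) (PiE UNIV (\<lambda>i. cball (0::complex) B))"
    by (subst compactin_PiE) auto
  then have "compact (PiE UNIV (\<lambda>i::'i. cball (0::complex) B))"
    by (simp add: euclidean_product_topology flip: compactin_euclidean_iff)
  then have "seq_compact (PiE UNIV (\<lambda>i::'i. cball (0::complex) B))"
    by (rule compact_imp_seq_compact)
  moreover have "U m \<in> PiE UNIV (\<lambda>i. cball 0 B)" for m
    using order_trans[OF cmod_le_l2_norm[OF assms(1)] assms(2)] by auto
  ultimately obtain u r where "strict_mono r" "(U \<circ> r) \<longlonglongrightarrow> u"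
    unfolding seq_compact_def by metis
  then show ?thesis
    using tendsto_fun_apply[of "U \<circ> r" u sequentially] by (intro exI[of _ r] exI[of _ u]) (auto simp: o_def)
qed

text \<open>
  The distance of \<open>f\<close> from a subspace is approximated along a sequence that the parallelogram law
  makes Cauchy; its limit is the orthogonal projection of \<open>f\<close> onto the closure of the subspace.
\<close>

lemma l2_projection:
  assumes L: "L \<subseteq> l2" "(\<lambda>k. 0) \<in> L" "\<And>x y. x \<in> L \<Longrightarrow> y \<in> L \<Longrightarrow> (\<lambda>k. x k + y k) \<in> L"
     "\<And>c x. x \<in> L \<Longrightarrow> (\<lambda>k. c * x k) \<in> L"
    and f: "f \<in> l2"
  shows "\<exists>V v. (\<forall>m. V m \<in> L) \<and> l2_tendsto V v \<and> (\<forall>x\<in>L. l2_inner (\<lambda>k. f k - v k) x = 0)"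
proof -
  define D where "D = (\<lambda>x. (l2_norm (\<lambda>k. f k - x k))\<^sup>2) ` L"
  define d where "d = Inf D"
  define h where "h = (\<lambda>m. inverse (real (Suc m)))"
  have h: "h m > 0" "m \<le> l \<Longrightarrow> h l \<le> h m" for m l by (auto simp: h_def field_simps)
  have hlim: "h \<longlonglongrightarrow> 0" unfolding h_def by (rule LIMSEQ_inverse_real_of_nat)
  have bdd: "bdd_below D" unfolding D_def by (rule bdd_belowI[of _ 0]) auto
  have ne: "D \<noteq> {}" using L by (auto simp: D_def)
  have d_le: "d \<le> (l2_norm (\<lambda>k. f k - x k))\<^sup>2" if "x \<in> L" for x
    unfolding d_def using bdd that by (intro cInf_lower) (auto simp: D_def)
  have "\<exists>x\<in>L. (l2_norm (\<lambda>k. f k - x k))\<^sup>2 < d + h m" for m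
  proof -
    have "Inf D < d + h m" using h(1)[of m] by (simp add: d_def)
    then show ?thesis using cInf_less_iff[OF ne bdd] by (auto simp: D_def)
  qed
  then obtain V where V: "\<And>m. V m \<in> L" "\<And>m. (l2_norm (\<lambda>k. f k - V m k))\<^sup>2 < d + h m"
    by metis
  have Vl2: "V m \<in> l2" for m using V L by auto
  have par: "(l2_norm (\<lambda>k. V m k - V l k))\<^sup>2 \<le> 2 * (h m + h l)" for m l
  proof -
    define p where "p = (\<lambda>k. f k - V m k)"
    define q where "q = (\<lambda>k. f k - V l k)"
    have pq: "p \<in> l2" "q \<in> l2" using f Vl2 by (auto simp: p_def q_def l2_diff)
    have "(l2_norm (\<lambda>k. p k + q k))\<^sup>2 + (l2_norm (\<lambda>k. p k - q k))\<^sup>2 = 2 * (l2_norm p)\<^sup>2 + 2 * (l2_norm q)\<^sup>2"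
      using l2_norm_add_sq[OF pq] l2_norm_diff_sq[OF pq] by simp
    \<comment> \<open>The midpoint lies in the subspace, so it is no closer to \<open>f\<close> than the infimum.\<close>
    moreover have "(\<lambda>k. (1/2) * (V m k + V l k)) \<in> L" using L(4)[OF L(3)[OF V(1)[of m] V(1)[of l]], of "1/2"] by simp
    then have "4 * d \<le> (l2_norm (\<lambda>k. p k + q k))\<^sup>2"
    proof -
      have "(\<lambda>k. p k + q k) = (\<lambda>k. 2 * (f k - (1/2) * (V m k + V l k)))" by (auto simp: p_def q_def algebra_simps)
      then have "(l2_norm (\<lambda>k. p k + q k))\<^sup>2 = 4 * (l2_norm (\<lambda>k. f k - (1/2) * (V m k + V l k)))\<^sup>2"
        by (simp only: l2_norm_scale) (simp add: power_mult_distrib)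
      then show ?thesis using d_le[OF \<open>(\<lambda>k. (1/2) * (V m k + V l k)) \<in> L\<close>] by linarith
    qed
    moreover have "(l2_norm p)\<^sup>2 < d + h m" "(l2_norm q)\<^sup>2 < d + h l"
      using V by (auto simp: p_def q_def)
    moreover have "l2_norm (\<lambda>k. V m k - V l k) = l2_norm (\<lambda>k. p k - q k)"
      unfolding p_def q_def by (subst l2_norm_minus_commute) simp
    ultimately show ?thesis by simp
  qed
  have "\<exists>M. \<forall>m\<ge>M. \<forall>l\<ge>M. l2_norm (\<lambda>k. V m k - V l k) < e" if e: "e > 0" for e
  proof -
    obtain M where M: "h M < e\<^sup>2 / 4" using reals_Archimedean[of "e\<^sup>2/4"] e by (auto simp: h_def)
    have "l2_norm (\<lambda>k. V m k - V l k) < e" if "m \<ge> M" "l \<ge> M" for m l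
    proof -
      have hh: "h m \<le> h M" "h l \<le> h M"
        using that h by auto
      have "2 * (h m + h l) \<le> 4 * h M" using add_mono[OF hh] by simp
      also have "\<dots> < e\<^sup>2" using M by simp
      finally have "(l2_norm (\<lambda>k. V m k - V l k))\<^sup>2 < e\<^sup>2" using par[of m l] by linarith
      then show ?thesis using e by (simp add: power2_less_imp_less)
    qed
    then show ?thesis by blast
  qed
  then obtain v where v: "l2_tendsto V v" using l2_complete[of V] Vl2 by blast
  have vl: "v \<in> l2" using v by (simp add: l2_tendsto_def)
  define r where "r = (\<lambda>k. f k - v k)"
  have r: "r \<in> l2" unfolding r_def by (intro l2_diff f vl)
  have lim: "(l2_norm r)\<^sup>2 \<le> (l2_norm (\<lambda>k. r k - x k))\<^sup>2" if x: "x \<in> L" for x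
  proof -
    have xl: "x \<in> l2" using x L by auto
    have e: "(\<lambda>k. f k - V m k - (f k - v k)) = (\<lambda>k. v k - V m k)" for m by auto
    have "l2_tendsto (\<lambda>m k. f k - V m k) r" unfolding l2_tendsto_def r_def e
      using v f Vl2 vl l2_norm_minus_commute[of v] by (auto simp: l2_tendsto_def l2_diff)
    then have "(\<lambda>m. (l2_norm (\<lambda>k. f k - V m k))\<^sup>2) \<longlonglongrightarrow> (l2_norm r)\<^sup>2"
      by (intro tendsto_intros l2_tendsto_norm)
    moreover have "(\<lambda>m. d + h m) \<longlonglongrightarrow> d + 0"
      by (intro tendsto_intros hlim)
    ultimately have "(l2_norm r)\<^sup>2 \<le> d + 0"
      by (rule LIMSEQ_le) (use V(2) less_imp_le in blast)
    moreover have "d \<le> (l2_norm (\<lambda>k. r k - x k))\<^sup>2"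
    proof (rule LIMSEQ_le_const)
      have e: "(\<lambda>k. f k - (V m k + x k) - (f k - v k - x k)) = (\<lambda>k. v k - V m k)" for m by auto
      have "l2_tendsto (\<lambda>m k. f k - (V m k + x k)) (\<lambda>k. r k - x k)"
        unfolding l2_tendsto_def r_def
        using v f Vl2 vl xl l2_norm_minus_commute[of v]
        by (auto simp: e l2_tendsto_def l2_diff l2_add)
      then show "(\<lambda>m. (l2_norm (\<lambda>k. f k - (V m k + x k)))\<^sup>2) \<longlonglongrightarrow> (l2_norm (\<lambda>k. r k - x k))\<^sup>2"
        by (intro tendsto_intros l2_tendsto_norm)
      show "\<exists>N. \<forall>n\<ge>N. d \<le> (l2_norm (\<lambda>k. f k - (V n k + x k)))\<^sup>2"
        using d_le[OF L(3)[OF V(1) x]] by blast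
    qed
    ultimately show ?thesis by linarith
  qed
  have "l2_inner r x = 0" if x: "x \<in> L" for x
  proof (rule ccontr)
    assume nz: "l2_inner r x \<noteq> 0"
    have xl: "x \<in> l2" using x L by auto
    have nx: "l2_norm x > 0" using nz l2_norm_eq_0[OF xl] by (metis l2_inner_zero(2) l2_norm_nonneg less_eq_real_def)
    \<comment> \<open>Subtracting the component of \<open>r\<close> along \<open>x\<close> would decrease the norm of \<open>r\<close>.\<close>
    define c where "c = l2_inner r x / of_real ((l2_norm x)\<^sup>2)"
    have "(l2_norm (\<lambda>k. r k - c * x k))\<^sup>2 = (l2_norm r)\<^sup>2 - 2 * Re (cnj c * l2_inner r x) + (cmod c * l2_norm x)\<^sup>2"
      using l2_norm_diff_sq[OF r l2_scale[OF xl, of c]] by (simp add: l2_inner_scale_right l2_norm_scale)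
    moreover have "cnj c * l2_inner r x = of_real ((cmod (l2_inner r x))\<^sup>2 / (l2_norm x)\<^sup>2)"
      unfolding c_def using complex_norm_square[of "l2_inner r x"] by (simp add: mult.commute)
    moreover have "(cmod c * l2_norm x)\<^sup>2 = (cmod (l2_inner r x))\<^sup>2 / (l2_norm x)\<^sup>2"
    proof -
      have "cmod c = cmod (l2_inner r x) / (l2_norm x)\<^sup>2"
        unfolding c_def norm_divide norm_of_real by simp
      then show ?thesis using nx by (simp add: field_simps power2_eq_square)
    qed
    ultimately have "(l2_norm (\<lambda>k. r k - c * x k))\<^sup>2 = (l2_norm r)\<^sup>2 - (cmod (l2_inner r x))\<^sup>2 / (l2_norm x)\<^sup>2"
      by simp
    moreover have "(cmod (l2_inner r x))\<^sup>2 / (l2_norm x)\<^sup>2 > 0" using nz nx by simp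
    ultimately show False using lim[OF L(4)[OF x, of c]] by linarith
  qed
  then show ?thesis using V v unfolding r_def by blast
qed

section \<open>Fourier coefficients on the torus\<close>

text \<open>
  The symbol is integrated against \<open>ee k\<close>, so the coefficients are taken with this sign: the entry
  \<open>(k, l)\<close> of the matrix of an operator is then the coefficient of \<open>a k\<close> at \<open>k - l\<close>, and a
  function is the sum of \<open>fcoef f q * ee (- q)\<close>.
\<close>

definition ee :: "int ^ 'n::finite \<Rightarrow> real ^ 'n \<Rightarrow> complex" where
  "ee q x = exp (2 * of_real pi * \<i> * of_real (lat_dot q x))"

definition fcoef :: "(real ^ 'n::finite \<Rightarrow> complex) \<Rightarrow> int ^ 'n \<Rightarrow> complex" where
  "fcoef f q = integral (cbox 0 1) (\<lambda>x. ee q x * f x)"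

definition periodic :: "(real ^ 'n::finite \<Rightarrow> complex) \<Rightarrow> bool" where
  "periodic f \<longleftrightarrow> (\<forall>x j. f (x + axis j 1) = f x)"

lemma lat_dot_add: "lat_dot (p + q) x = lat_dot p x + lat_dot q x"
  by (simp add: lat_dot_def distrib_right sum.distrib)

lemma lat_dot_minus: "lat_dot (- p) x = - lat_dot p x"
  by (simp add: lat_dot_def sum_negf)

lemma lat_dot_shift: "lat_dot q (x + t *\<^sub>R axis j 1) = lat_dot q x + real_of_int (q $ j) * t"
proof -
  have "lat_dot q (x + t *\<^sub>R axis j 1)
      = (\<Sum>i\<in>UNIV. real_of_int (q $ i) * x $ i + (if i = j then real_of_int (q $ i) * t else 0))"
    unfolding lat_dot_def by (rule sum.cong) (auto simp: axis_def distrib_left)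
  then show ?thesis by (simp add: sum.distrib lat_dot_def)
qed

lemma ee_add: "ee (p + q) x = ee p x * ee q x"
  by (simp add: ee_def lat_dot_add distrib_left exp_add)

lemma ee_0 [simp]: "ee 0 x = 1"
  by (simp add: ee_def lat_dot_def)

lemma ee_minus: "exp (- 2 * of_real pi * \<i> * of_real (lat_dot q x)) = ee (- q) x"
  by (simp add: ee_def lat_dot_minus)

lemma ee_cis: "ee q x = cis (2 * pi * lat_dot q x)"
  by (simp add: ee_def cis_conv_exp algebra_simps)

lemma norm_ee [simp]: "norm (ee q x) = 1"
  by (simp add: ee_cis)

lemma continuous_on_lat_dot [continuous_intros]: "continuous_on S (lat_dot q)"
  unfolding lat_dot_def by (intro continuous_intros)

lemma continuous_on_ee [continuous_intros]: "continuous_on S (ee q)"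
  unfolding ee_def by (intro continuous_intros)

lemma ee_shift: "ee q (x + t *\<^sub>R axis j 1) = exp (2 * of_real pi * \<i> * of_int (q $ j) * of_real t) * ee q x"
  by (simp add: ee_def lat_dot_shift distrib_left exp_add mult.commute mult.left_commute)

lemma periodic_ee: "periodic (ee q)"
proof -
  have "exp (2 * of_real pi * \<i> * of_int m) = 1" for m :: int
    using exp_integer_2pi[of "of_int m"] by (simp add: mult_ac)
  then show ?thesis unfolding periodic_def using ee_shift[of q _ 1] by simp
qed

lemma periodic_mult: "periodic f \<Longrightarrow> periodic g \<Longrightarrow> periodic (\<lambda>x. f x * g x)"
  by (simp add: periodic_def)

lemma integrable_torus: "continuous_on UNIV f \<Longrightarrow> f integrable_on cbox 0 (1 :: real ^ 'n::finite)"
  for f :: "real ^ 'n \<Rightarrow> complex"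
  by (rule integrable_continuous) (rule continuous_on_subset, auto)

lemma measure_unit_cbox [simp]: "measure lborel (cbox 0 (1 :: real ^ 'n::finite)) = 1"
proof -
  have "cbox 0 (1 :: real ^ 'n) \<noteq> {}" by (auto simp: interval_ne_empty_cart)
  then show ?thesis by (simp add: content_cbox_cart)
qed

lemma norm_fcoef_le:
  assumes "continuous_on UNIV f" "\<And>x. cmod (f x) \<le> C" shows "cmod (fcoef f q) \<le> C"
proof -
  have "C \<ge> 0" using assms(2) norm_ge_zero order_trans by blast
  then have "cmod (fcoef f q) \<le> C * measure lborel (cbox 0 (1 :: real ^ 'a))"
    unfolding fcoef_def
    by (intro has_integral_bound[OF _ integrable_integral] integrable_torus continuous_intros assms)
      (simp_all add: norm_mult assms)
  then show ?thesis by simp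
qed

text \<open>
  Shifting the period cell in the direction of the \<open>j\<close>-th axis moves one slab of it by a period.
\<close>

lemma integral_shift_pos:
  fixes g :: "real ^ 'n::finite \<Rightarrow> complex"
  assumes g: "continuous_on UNIV g" "periodic g" and t: "t \<ge> 0"
  shows "integral (cbox 0 1) (\<lambda>x. g (x + t *\<^sub>R axis j 1)) = integral (cbox 0 1) g"
proof -
  define e where "e = (axis j 1 :: real ^ 'n)"
  have e: "e \<in> Basis" "x \<bullet> e = x $ j" for x by (auto simp: e_def axis_in_Basis_iff inner_axis)
  define b where "b = (\<chi> i. if i = j then t else (1 :: real))"
  have int: "g integrable_on cbox c d" for c d
    by (rule integrable_continuous) (rule continuous_on_subset[OF g(1)], auto)
  have "integral (cbox 0 1) (\<lambda>x. g (x + t *\<^sub>R e)) = integral (cbox (t *\<^sub>R e) (1 + t *\<^sub>R e)) g"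
    using integral_shift_cbox[where a = "t *\<^sub>R e" and b = "1 + t *\<^sub>R e" and c = "t *\<^sub>R e" and f = g] by simp
  moreover have "integral (cbox 0 (1 + t *\<^sub>R e)) g
      = integral (cbox 0 b) g + integral (cbox (t *\<^sub>R e) (1 + t *\<^sub>R e)) g"
  proof -
    have "cbox 0 (1 + t *\<^sub>R e) \<inter> {x. x \<bullet> e \<le> t} = cbox 0 b"
         "cbox 0 (1 + t *\<^sub>R e) \<inter> {x. x \<bullet> e \<ge> t} = cbox (t *\<^sub>R e) (1 + t *\<^sub>R e)"
      unfolding e(2) using t
      by (auto simp: mem_box_cart b_def e_def axis_def one_vec_def split: if_splits) (smt (verit))+
    then show ?thesis using integral_split[OF int e(1), of 0 "1 + t *\<^sub>R e" t] by simp
  qed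
  moreover have "integral (cbox 0 (1 + t *\<^sub>R e)) g
      = integral (cbox 0 1) g + integral (cbox e (1 + t *\<^sub>R e)) g"
  proof -
    have "cbox 0 (1 + t *\<^sub>R e) \<inter> {x. x \<bullet> e \<le> 1} = cbox 0 1"
         "cbox 0 (1 + t *\<^sub>R e) \<inter> {x. x \<bullet> e \<ge> 1} = cbox e (1 + t *\<^sub>R e)"
      unfolding e(2) using t
      by (auto simp: mem_box_cart e_def axis_def one_vec_def split: if_splits) (smt (verit))+
    then show ?thesis using integral_split[OF int e(1), of 0 "1 + t *\<^sub>R e" 1] by simp
  qed
  moreover have "integral (cbox e (1 + t *\<^sub>R e)) g = integral (cbox 0 b) g"
  proof -
    have "1 + t *\<^sub>R e - e = b" by (auto simp: vec_eq_iff b_def e_def axis_def one_vec_def)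
    then have "integral (cbox e (1 + t *\<^sub>R e)) g = integral (cbox 0 b) (\<lambda>x. g (x + e))"
      using integral_shift_cbox[where a = e and b = "1 + t *\<^sub>R e" and c = e and f = g] by simp
    then show ?thesis using g(2) by (simp add: periodic_def e_def)
  qed
  ultimately show ?thesis by (simp add: e_def)
qed

lemma integral_shift_torus:
  fixes g :: "real ^ 'n::finite \<Rightarrow> complex"
  assumes g: "continuous_on UNIV g" "periodic g"
  shows "integral (cbox 0 1) (\<lambda>x. g (x + t *\<^sub>R axis j 1)) = integral (cbox 0 1) g"
proof (cases "t \<ge> 0")
  case False
  define h where "h = (\<lambda>x. g (x + t *\<^sub>R axis j 1))"
  have "continuous_on UNIV h" unfolding h_def
    by (intro continuous_on_compose2[OF g(1)] continuous_intros) auto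
  moreover have "periodic h" using g(2) unfolding h_def periodic_def
    by (metis add.commute add.left_commute)
  ultimately have "integral (cbox 0 1) (\<lambda>x. h (x + (- t) *\<^sub>R axis j 1)) = integral (cbox 0 1) h"
    using False by (intro integral_shift_pos) auto
  then show ?thesis by (simp add: h_def)
qed (rule integral_shift_pos[OF assms])

subsection \<open>Derivatives in a coordinate direction\<close>

definition dir_diff :: "'n::finite \<Rightarrow> (real ^ 'n \<Rightarrow> complex) \<Rightarrow> bool" where
  "dir_diff j f \<longleftrightarrow> (\<forall>x. (\<lambda>t. f (x + t *\<^sub>R axis j 1)) differentiable (at 0))"

lemma dir_diff_deriv:
  assumes "dir_diff j f"
  shows "((\<lambda>t. f (x + t *\<^sub>R axis j 1)) has_vector_derivative partial_deriv j f (x + s *\<^sub>R axis j 1)) (at s)"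
proof -
  define y where "y = x + s *\<^sub>R axis j 1"
  have "((\<lambda>t. f (y + t *\<^sub>R axis j 1)) has_vector_derivative partial_deriv j f y) (at (s - s))"
    using assms unfolding dir_diff_def partial_deriv_def by (simp add: vector_derivative_works)
  moreover have "((\<lambda>t. t - s) has_vector_derivative 1) (at s)"
    by (auto intro!: derivative_eq_intros)
  ultimately have "((\<lambda>t. f (y + t *\<^sub>R axis j 1)) \<circ> (\<lambda>t. t - s) has_vector_derivative 1 *\<^sub>R partial_deriv j f y) (at s)"
    by (intro vector_diff_chain_at)
  moreover have "((\<lambda>t. f (y + t *\<^sub>R axis j 1)) \<circ> (\<lambda>t. t - s)) = (\<lambda>t. f (x + t *\<^sub>R axis j 1))"
    by (auto simp: y_def algebra_simps)
  ultimately show ?thesis by (simp add: y_def)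
qed

lemma dir_diff_deriv0:
  "dir_diff j f \<Longrightarrow> ((\<lambda>t. f (x + t *\<^sub>R axis j 1)) has_vector_derivative partial_deriv j f x) (at 0)"
  using dir_diff_deriv[of j f x 0] by simp

lemma partial_derivI:
  assumes "\<And>x. ((\<lambda>t. f (x + t *\<^sub>R axis j 1)) has_vector_derivative f' x) (at 0)"
  shows "dir_diff j f" "partial_deriv j f = f'"
proof -
  show "dir_diff j f" unfolding dir_diff_def using assms differentiableI_vector by blast
  show "partial_deriv j f = f'" unfolding partial_deriv_def using assms by (auto intro: vector_derivative_at)
qed

lemma has_vector_derivative_mult_complex:
  fixes f g :: "real \<Rightarrow> complex"
  assumes "(f has_vector_derivative f') (at t)" "(g has_vector_derivative g') (at t)"
  shows "((\<lambda>t. f t * g t) has_vector_derivative (f' * g t + f t * g')) (at t)"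
  using has_vector_derivative_mult[OF assms] by (simp add: add.commute)

lemma partial_deriv_mult:
  assumes "dir_diff j f" "dir_diff j g"
  shows "dir_diff j (\<lambda>x. f x * g x)"
    "partial_deriv j (\<lambda>x. f x * g x) = (\<lambda>x. partial_deriv j f x * g x + f x * partial_deriv j g x)"
proof -
  have "((\<lambda>t. f (x + t *\<^sub>R axis j 1) * g (x + t *\<^sub>R axis j 1)) has_vector_derivative
     (partial_deriv j f x * g x + f x * partial_deriv j g x)) (at 0)" for x
    using has_vector_derivative_mult_complex[OF dir_diff_deriv0[OF assms(1)] dir_diff_deriv0[OF assms(2)], of x x] by simp
  then show "dir_diff j (\<lambda>x. f x * g x)"
    "partial_deriv j (\<lambda>x. f x * g x) = (\<lambda>x. partial_deriv j f x * g x + f x * partial_deriv j g x)"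
    by (rule partial_derivI)+
qed

lemma partial_deriv_lin:
  assumes "dir_diff j f" "dir_diff j g"
  shows "dir_diff j (\<lambda>x. c * f x + d * g x)"
    "partial_deriv j (\<lambda>x. c * f x + d * g x) = (\<lambda>x. c * partial_deriv j f x + d * partial_deriv j g x)"
proof -
  have "((\<lambda>t. c * f (x + t *\<^sub>R axis j 1) + d * g (x + t *\<^sub>R axis j 1)) has_vector_derivative
     (c * partial_deriv j f x + d * partial_deriv j g x)) (at 0)" for x
    by (intro has_vector_derivative_add has_vector_derivative_mult_right dir_diff_deriv0 assms)
  then show "dir_diff j (\<lambda>x. c * f x + d * g x)"
    "partial_deriv j (\<lambda>x. c * f x + d * g x) = (\<lambda>x. c * partial_deriv j f x + d * partial_deriv j g x)"
    by (rule partial_derivI)+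
qed

lemma partial_deriv_inverse:
  assumes "dir_diff j f" "\<And>x. f x \<noteq> 0"
  shows "dir_diff j (\<lambda>x. inverse (f x))"
    "partial_deriv j (\<lambda>x. inverse (f x)) = (\<lambda>x. (-1) * (partial_deriv j f x * (inverse (f x) * inverse (f x))) + 0 * f x)"
proof -
  have "((\<lambda>t. inverse (f (x + t *\<^sub>R axis j 1))) has_vector_derivative
     ((-1) * (partial_deriv j f x * (inverse (f x) * inverse (f x))) + 0 * f x)) (at 0)" for x
  proof -
    have "(inverse has_field_derivative - (inverse (f x) * inverse (f x))) (at (f (x + 0 *\<^sub>R axis j 1)))"
      using DERIV_inverse[of "f x"] assms(2) by (simp add: power2_eq_square)
    from field_vector_diff_chain_at[OF dir_diff_deriv0[OF assms(1)] this]
    show ?thesis by (simp add: o_def)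
  qed
  then show "dir_diff j (\<lambda>x. inverse (f x))"
    "partial_deriv j (\<lambda>x. inverse (f x)) = (\<lambda>x. (-1) * (partial_deriv j f x * (inverse (f x) * inverse (f x))) + 0 * f x)"
    by (rule partial_derivI)+
qed

lemma partial_deriv_ee:
  "dir_diff j (ee q)" "partial_deriv j (ee q) = (\<lambda>x. 2 * of_real pi * \<i> * of_int (q $ j) * ee q x)"
proof -
  have "((\<lambda>t. ee q (x + t *\<^sub>R axis j 1)) has_vector_derivative 2 * of_real pi * \<i> * of_int (q $ j) * ee q x) (at 0)" for x
    unfolding ee_shift by (auto intro!: derivative_eq_intros has_vector_derivative_real_field)
  then show "dir_diff j (ee q)" "partial_deriv j (ee q) = (\<lambda>x. 2 * of_real pi * \<i> * of_int (q $ j) * ee q x)"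
    by (rule partial_derivI)+
qed

lemma periodic_partial_deriv: "periodic f \<Longrightarrow> periodic (partial_deriv j f)"
  unfolding periodic_def partial_deriv_def
proof (intro allI)
  fix x i assume f: "\<forall>x j. f (x + axis j 1) = f x"
  have "f (x + axis i 1 + t *\<^sub>R axis j 1) = f (x + t *\<^sub>R axis j 1)" for t
    using f by (metis add.assoc add.commute)
  then show "vector_derivative (\<lambda>t. f (x + axis i 1 + t *\<^sub>R axis j 1)) (at 0)
     = vector_derivative (\<lambda>t. f (x + t *\<^sub>R axis j 1)) (at 0)" by simp
qed

text \<open>
  The integral over a period cell is invariant under translations; differentiate under the integral
  sign at translation \<open>0\<close>.
\<close>

lemma integral_partial_deriv_0:
  fixes g :: "real ^ 'n::finite \<Rightarrow> complex"
  assumes g: "continuous_on UNIV g" "periodic g" "dir_diff j g" "continuous_on UNIV (partial_deriv j g)"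
  shows "integral (cbox 0 1) (partial_deriv j g) = 0"
proof -
  have "((\<lambda>t. integral (cbox 0 1) (\<lambda>x. g (x + t *\<^sub>R axis j 1))) has_vector_derivative
      integral (cbox 0 1) (\<lambda>x. partial_deriv j g (x + 0 *\<^sub>R axis j 1))) (at 0 within UNIV)"
  proof (rule leibniz_rule_vector_derivative)
    show "((\<lambda>t. g (x + t *\<^sub>R axis j 1)) has_vector_derivative partial_deriv j g (x + s *\<^sub>R axis j 1)) (at s within UNIV)" for x s
      using dir_diff_deriv[OF g(3)] by simp
    show "(\<lambda>x. g (x + t *\<^sub>R axis j 1)) integrable_on cbox 0 1" for t
      by (intro integrable_torus continuous_on_compose2[OF g(1)] continuous_intros) auto
    show "continuous_on (UNIV \<times> cbox 0 1) (\<lambda>(t, x). partial_deriv j g (x + t *\<^sub>R axis j 1))"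
      unfolding split_def by (intro continuous_on_compose2[OF g(4)] continuous_intros) auto
  qed auto
  then have "((\<lambda>t::real. integral (cbox 0 1) g) has_vector_derivative integral (cbox 0 1) (partial_deriv j g)) (at 0)"
    by (simp add: integral_shift_torus[OF g(1,2)])
  moreover have "((\<lambda>t::real. integral (cbox 0 1) g) has_vector_derivative 0) (at 0)" by simp
  ultimately show ?thesis using vector_derivative_unique_at by blast
qed

text \<open>
  Integration by parts, in the form that the derivative of \<open>ee q x * f x\<close> has integral \<open>0\<close>.
\<close>

lemma fcoef_partial_deriv:
  assumes f: "continuous_on UNIV f" "periodic f" "dir_diff j f" "continuous_on UNIV (partial_deriv j f)"
  shows "fcoef (partial_deriv j f) q = - (2 * of_real pi * \<i> * of_int (q $ j)) * fcoef f q"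
proof -
  let ?c = "2 * of_real pi * \<i> * of_int (q $ j) :: complex"
  have d: "partial_deriv j (\<lambda>x. ee q x * f x) = (\<lambda>x. ?c * (ee q x * f x) + ee q x * partial_deriv j f x)"
    using partial_deriv_mult(2)[OF partial_deriv_ee(1) f(3), of q] by (simp add: partial_deriv_ee(2) mult_ac)
  have "integral (cbox 0 1) (partial_deriv j (\<lambda>x. ee q x * f x)) = 0"
    by (intro integral_partial_deriv_0 periodic_mult periodic_ee f partial_deriv_mult partial_deriv_ee)
      (auto simp: d intro!: continuous_intros f)
  moreover have "integral (cbox 0 1) (partial_deriv j (\<lambda>x. ee q x * f x)) = ?c * fcoef f q + fcoef (partial_deriv j f) q"
    unfolding d fcoef_def
    by (subst Henstock_Kurzweil_Integration.integral_add) (auto intro!: integrable_torus continuous_intros f)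
  ultimately show ?thesis by (simp add: eq_neg_iff_add_eq_0 add.commute)
qed

lemma integral_ee:
  fixes q :: "int ^ 'n::finite"
  shows "integral (cbox 0 1) (ee q) = (if q = 0 then 1 else 0)"
proof (cases "q = 0")
  case True
  have "integral (cbox 0 (1 :: real ^ 'n)) (ee q) = integral (cbox 0 (1 :: real ^ 'n)) (\<lambda>x. 1)"
    by (intro integral_cong) (simp add: True)
  also have "\<dots> = measure lborel (cbox 0 (1 :: real ^ 'n)) *\<^sub>R 1" by (rule integral_const)
  also have "\<dots> = 1" unfolding measure_unit_cbox by simp
  finally show ?thesis by (simp add: True)
next
  case False
  then obtain j where j: "q $ j \<noteq> 0" by (auto simp: vec_eq_iff)
  have 0: "partial_deriv j (\<lambda>x. 1 :: complex) = (\<lambda>x. 0)" "dir_diff j (\<lambda>x. 1 :: complex)"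
    using partial_derivI[of "\<lambda>x. 1" j "\<lambda>x. 0", OF has_vector_derivative_const] by auto
  have "fcoef (\<lambda>x. 0) q = - (2 * of_real pi * \<i> * of_int (q $ j)) * fcoef (\<lambda>x. 1) q"
    using fcoef_partial_deriv[of "\<lambda>x. 1" j q] 0 by (simp add: periodic_def)
  then have "fcoef (\<lambda>x. 1) q = 0" using j by (simp add: fcoef_def)
  then show ?thesis using False by (simp add: fcoef_def)
qed

subsection \<open>Families with bounded derivatives in one direction\<close>

text \<open>
  Decay of \<open>fcoef f q\<close> in the coordinate \<open>q $ j\<close> comes from derivatives in the \<open>j\<close>-th direction
  alone. Regularity is therefore measured one direction at a time, uniformly over a family indexed by
  \<open>i\<close>; by the product rule the resulting classes are closed under products and under inverses of
  functions bounded away from \<open>0\<close>.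
\<close>

definition torus_bounded :: "('i \<Rightarrow> real ^ 'n::finite \<Rightarrow> complex) \<Rightarrow> bool" where
  [simp]: "torus_bounded F \<longleftrightarrow> (\<forall>i. continuous_on UNIV (F i) \<and> periodic (F i)) \<and> (\<exists>C. \<forall>i x. cmod (F i x) \<le> C)"

primrec dir_bounded :: "'n::finite \<Rightarrow> nat \<Rightarrow> ('i \<Rightarrow> real ^ 'n \<Rightarrow> complex) \<Rightarrow> bool" where
  "dir_bounded j 0 F \<longleftrightarrow> torus_bounded F"
| "dir_bounded j (Suc r) F \<longleftrightarrow> torus_bounded F \<and> (\<forall>i. dir_diff j (F i)) \<and> dir_bounded j r (\<lambda>i. partial_deriv j (F i))"

lemma dir_bounded_0: "dir_bounded j r F \<Longrightarrow> dir_bounded j 0 F"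
  by (cases r) auto

lemma dir_bounded_Suc: "dir_bounded j (Suc r) F \<Longrightarrow> dir_bounded j r F"
  by (induction r arbitrary: F) auto

lemma torus_bounded_lin:
  assumes "torus_bounded F" "torus_bounded G" "\<And>i. cmod (c i) \<le> K" "\<And>i. cmod (d i) \<le> K"
  shows "torus_bounded (\<lambda>i x. c i * F i x + d i * G i x)"
proof -
  obtain C D where CD: "\<And>i x. cmod (F i x) \<le> C" "\<And>i x. cmod (G i x) \<le> D" using assms by auto
  have "cmod (c i * F i x + d i * G i x) \<le> K * C + K * D" for i x
    using assms(3,4)[of i] CD[of i x]
    by (intro order_trans[OF norm_triangle_ineq] add_mono)
      (simp_all add: norm_mult mult_mono' order_trans[OF norm_ge_zero])
  then show ?thesis using assms(1,2) by (auto intro!: continuous_intros simp: periodic_def)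
qed

lemma dir_bounded_lin:
  assumes "dir_bounded j r F" "dir_bounded j r G" "\<And>i. cmod (c i) \<le> K" "\<And>i. cmod (d i) \<le> K"
  shows "dir_bounded j r (\<lambda>i x. c i * F i x + d i * G i x)"
  using assms(1,2)
proof (induction r arbitrary: F G)
  case 0
  show ?case using torus_bounded_lin[of F G c K d] 0 assms(3,4) by (simp only: dir_bounded.simps)
next
  case (Suc r)
  have "torus_bounded (\<lambda>i x. c i * F i x + d i * G i x)"
    using Suc.prems assms(3,4) by (intro torus_bounded_lin) (simp_all only: dir_bounded.simps)
  then show ?case using Suc by (simp add: partial_deriv_lin)
qed

lemma dir_bounded_const: "dir_bounded j r (\<lambda>i x. c)"
proof (induction r arbitrary: c)
  case (Suc r)
  have "dir_diff j (\<lambda>x. c)" "partial_deriv j (\<lambda>x. c) = (\<lambda>x. 0)"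
    using partial_derivI[of "\<lambda>x. c" j "\<lambda>x. 0", OF has_vector_derivative_const] by auto
  then show ?case using Suc[of 0] by (auto simp: periodic_def)
qed (auto simp: periodic_def)

lemma torus_bounded_mult:
  assumes "torus_bounded F" "torus_bounded G"
  shows "torus_bounded (\<lambda>i x. F i x * G i x)"
proof -
  obtain C D where CD: "\<And>i x. cmod (F i x) \<le> C" "\<And>i x. cmod (G i x) \<le> D" using assms by auto
  have "cmod (F i x * G i x) \<le> C * D" for i x
    using CD[of i x] by (simp add: norm_mult mult_mono' order_trans[OF norm_ge_zero])
  then show ?thesis using assms by (auto intro!: continuous_intros simp: periodic_def)
qed

lemma dir_bounded_mult:
  assumes "dir_bounded j r F" "dir_bounded j r G"
  shows "dir_bounded j r (\<lambda>i x. F i x * G i x)"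
  using assms
proof (induction r arbitrary: F G)
  case (Suc r)
  have "dir_bounded j r (\<lambda>i x. 1 * (partial_deriv j (F i) x * G i x) + 1 * (F i x * partial_deriv j (G i) x))"
    using Suc.prems dir_bounded_Suc by (intro dir_bounded_lin[where K = 1] Suc.IH) auto
  moreover have "torus_bounded (\<lambda>i x. F i x * G i x)"
    using Suc.prems by (intro torus_bounded_mult) auto
  ultimately show ?case using Suc.prems by (simp add: partial_deriv_mult)
qed (simp only: dir_bounded.simps torus_bounded_mult)

text \<open>
  Since \<open>\<partial>(1/f) = - \<partial>f (1/f)\<^sup>2\<close>, each further derivative of \<open>1/f\<close> is a product of functions that are
  already known to have bounded derivatives.
\<close>

lemma dir_bounded_inverse:
  assumes "dir_bounded j r F" "c > 0" "\<And>i x. cmod (F i x) \<ge> c"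
  shows "dir_bounded j r (\<lambda>i x. inverse (F i x))"
  using assms(1)
proof (induction r)
  case 0
  have "F i x \<noteq> 0" for i x using assms(2) assms(3)[of i x] by auto
  moreover have "cmod (inverse (F i x)) \<le> inverse c" for i x
    using assms(2) assms(3)[of i x] by (simp add: norm_inverse le_imp_inverse_le)
  ultimately show ?case using 0 by (auto intro!: continuous_intros simp: periodic_def)
next
  case (Suc r)
  have nz: "F i x \<noteq> 0" for i x using assms(2) assms(3)[of i x] by auto
  have IH: "dir_bounded j r (\<lambda>i x. inverse (F i x))" using Suc dir_bounded_Suc by blast
  have "dir_bounded j r (\<lambda>i x. (-1) * (partial_deriv j (F i) x * (inverse (F i x) * inverse (F i x))) + 0 * F i x)"
    using Suc.prems IH dir_bounded_Suc by (intro dir_bounded_lin[where K = 1] dir_bounded_mult) auto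
  then show ?case using Suc.prems dir_bounded_0[OF IH] nz by (auto simp: partial_deriv_inverse)
qed

text \<open>
  Each derivative contributes a factor \<open>2 \<pi> q $ j\<close> to the coefficient.
\<close>

lemma dir_bounded_fcoef:
  assumes "dir_bounded j r F"
  shows "\<exists>C. \<forall>i q. \<bar>real_of_int (q $ j)\<bar> ^ r * cmod (fcoef (F i) q) \<le> C"
  using assms
proof (induction r arbitrary: F)
  case 0
  then obtain C where "\<And>i x. cmod (F i x) \<le> C" by auto
  then have "cmod (fcoef (F i) q) \<le> C" for i q using 0 by (intro norm_fcoef_le) auto
  then show ?case by auto
next
  case (Suc r)
  then obtain C where C: "\<And>i q. \<bar>real_of_int (q $ j)\<bar> ^ r * cmod (fcoef (partial_deriv j (F i)) q) \<le> C"
    by (metis dir_bounded.simps(2))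
  have "\<bar>real_of_int (q $ j)\<bar> ^ Suc r * cmod (fcoef (F i) q) \<le> C" for i q
  proof -
    have "continuous_on UNIV (partial_deriv j (F i))" "continuous_on UNIV (F i)" "periodic (F i)" "dir_diff j (F i)"
      using Suc.prems dir_bounded_0[of j r "\<lambda>i. partial_deriv j (F i)"] by auto
    then have "cmod (fcoef (partial_deriv j (F i)) q) = 2 * pi * (\<bar>real_of_int (q $ j)\<bar> * cmod (fcoef (F i) q))"
      by (simp add: fcoef_partial_deriv norm_mult)
    then have "\<bar>real_of_int (q $ j)\<bar> * cmod (fcoef (F i) q) \<le> cmod (fcoef (partial_deriv j (F i)) q)"
      using pi_gt3 by (simp add: mult_le_cancel_right1 mult_less_0_iff)
    then have "\<bar>real_of_int (q $ j)\<bar> ^ r * (\<bar>real_of_int (q $ j)\<bar> * cmod (fcoef (F i) q)) \<le> C"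
      using C[of q i] by (meson mult_left_mono order_trans zero_le_power abs_ge_zero)
    then show ?thesis by (simp add: mult_ac)
  qed
  then show ?case by blast
qed

subsection \<open>Uniqueness and inversion\<close>

text \<open>
  The powers of a function with values in \<open>[0,1]\<close> that attains \<open>1\<close> only at \<open>x\<^sub>0\<close> concentrate their mass
  near \<open>x\<^sub>0\<close>, so a continuous function that is orthogonal to all of them cannot be positive
  there.
\<close>

lemma concentration_real:
  fixes p h :: "'a::euclidean_space \<Rightarrow> real"
  assumes p: "continuous_on (cbox a b) p" "\<And>x. x \<in> cbox a b \<Longrightarrow> 0 \<le> p x"
    "\<And>x. x \<in> cbox a b \<Longrightarrow> x \<noteq> x0 \<Longrightarrow> p x < 1" "p x0 = 1"
    and x0: "x0 \<in> box a b" and h: "continuous_on (cbox a b) h"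
    and int: "\<And>N. integral (cbox a b) (\<lambda>x. p x ^ N * h x) = 0"
  shows "h x0 \<le> 0"
proof (rule ccontr)
  assume "\<not> h x0 \<le> 0"
  define \<eta> where "\<eta> = h x0 / 2"
  have \<eta>: "\<eta> > 0" "\<eta> < h x0" using \<open>\<not> h x0 \<le> 0\<close> by (auto simp: \<eta>_def)
  have cont: "isCont p x0" "isCont h x0"
    using p(1) h x0 continuous_on_subset[OF _ box_subset_cbox] continuous_on_eq_continuous_at[OF open_box] by blast+
  have "\<forall>\<^sub>F x in nhds x0. h x > \<eta>" using cont(2) \<eta>(2)
    unfolding isCont_def tendsto_at_iff_tendsto_nhds by (rule order_tendstoD)
  moreover have "\<forall>\<^sub>F x in nhds x0. x \<in> box a b" using x0 open_box eventually_nhds_in_open by blast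
  ultimately have "\<forall>\<^sub>F x in nhds x0. h x > \<eta> \<and> x \<in> box a b" by (rule eventually_conj)
  then obtain \<delta> where \<delta>: "\<delta> > 0" "\<And>x. dist x x0 < \<delta> \<Longrightarrow> h x > \<eta> \<and> x \<in> box a b"
    unfolding eventually_nhds_metric by blast
  have comp: "compact (cbox a b - ball x0 \<delta>)" by (intro compact_diff compact_cbox open_ball)
  obtain \<theta> where \<theta>: "0 \<le> \<theta>" "\<theta> < 1" "\<And>x. x \<in> cbox a b \<Longrightarrow> dist x x0 \<ge> \<delta> \<Longrightarrow> p x \<le> \<theta>"
  proof (cases "cbox a b - ball x0 \<delta> = {}")
    case True
    then show ?thesis by (intro that[of 0]) (auto simp: dist_commute not_less)
  next
    case False
    then obtain z where z: "z \<in> cbox a b - ball x0 \<delta>" "\<And>x. x \<in> cbox a b - ball x0 \<delta> \<Longrightarrow> p x \<le> p z"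
      using continuous_attains_sup[OF comp False continuous_on_subset[OF p(1)]] by blast
    have "z \<noteq> x0" using z(1) \<delta>(1) by auto
    then show ?thesis using z p(2,3) by (intro that[of "p z"]) (auto simp: dist_commute not_less)
  qed
  \<comment> \<open>Away from \<open>x0\<close> the function \<open>p\<close> is at most \<open>\<theta>\<close>; near \<open>x0\<close> it is at least \<open>\<theta>' > \<theta>\<close>.\<close>
  define \<theta>' where "\<theta>' = (1 + \<theta>) / 2"
  have \<theta>': "\<theta> < \<theta>'" "\<theta>' < 1" "0 < \<theta>'" using \<theta> by (auto simp: \<theta>'_def)
  have "\<forall>\<^sub>F x in nhds x0. p x > \<theta>'" using cont(1) \<theta>'(2) p(4)
    unfolding isCont_def tendsto_at_iff_tendsto_nhds by (intro order_tendstoD) auto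
  then obtain \<delta>1 where \<delta>1: "\<delta>1 > 0" "\<And>x. dist x x0 < \<delta>1 \<Longrightarrow> p x > \<theta>'"
    unfolding eventually_nhds_metric by blast
  obtain c d where cd: "x0 \<in> box c d" "cbox c d \<subseteq> ball x0 (min \<delta> \<delta>1)"
    using open_contains_cbox[of "ball x0 (min \<delta> \<delta>1)" x0] \<delta>(1) \<delta>1(1)
    by (metis centre_in_ball min_less_iff_conj open_ball)
  obtain H where H: "\<And>x. x \<in> cbox a b \<Longrightarrow> \<bar>h x\<bar> \<le> H"
    using compact_imp_bounded[OF compact_continuous_image[OF h compact_cbox]] unfolding bounded_iff by auto
  have x0c: "x0 \<in> cbox a b" using x0 box_subset_cbox by blast
  have H0: "H \<ge> 0" using H[OF x0c] by linarith
  define V where "V = measure lborel (cbox c d)"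
  define W where "W = measure lborel (cbox a b)"
  have V: "V > 0" using cd(1) unfolding V_def by (simp add: content_pos_lt_eq box_ne_empty mem_box) (metis order_less_trans)
  have sub: "cbox c d \<subseteq> cbox a b" using cd(2) \<delta>(2) box_subset_cbox by (fastforce simp: dist_commute)
  have key: "\<eta> * \<theta>' ^ N * V \<le> H * \<theta> ^ N * W" for N
  proof -
    have i1: "((\<lambda>x. if x \<in> cbox c d then \<eta> * \<theta>' ^ N else 0) has_integral (V * (\<eta> * \<theta>' ^ N))) (cbox a b)"
      using has_integral_const[of "\<eta> * \<theta>' ^ N" c d] sub by (subst has_integral_restrict) (auto simp: V_def)
    have i2: "((\<lambda>x. H * \<theta> ^ N) has_integral (W * (H * \<theta> ^ N))) (cbox a b)"
      using has_integral_const[of "H * \<theta> ^ N" a b] by (simp add: W_def)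
    have "(\<lambda>x. p x ^ N * h x) integrable_on cbox a b"
      by (intro integrable_continuous continuous_intros p h)
    then have i3: "((\<lambda>x. p x ^ N * h x) has_integral 0) (cbox a b)" using int[of N] by (simp add: has_integral_integral)
    have "V * (\<eta> * \<theta>' ^ N) - W * (H * \<theta> ^ N) \<le> 0"
    proof (rule has_integral_le[OF has_integral_diff[OF i1 i2] i3])
      fix x assume x: "x \<in> cbox a b"
      show "(if x \<in> cbox c d then \<eta> * \<theta>' ^ N else 0) - H * \<theta> ^ N \<le> p x ^ N * h x"
      proof (cases "dist x x0 < \<delta>")
        case True
        have t: "0 \<le> H * \<theta> ^ N" using H0 \<theta> by simp
        have "0 \<le> p x ^ N * h x" using \<delta>(2)[OF True] p(2)[OF x] \<eta>(1) by simp
        moreover have "\<eta> * \<theta>' ^ N \<le> p x ^ N * h x" if "x \<in> cbox c d"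
        proof -
          have "\<theta>' < p x" using cd(2) that \<delta>1(2)[of x] by (auto simp: dist_commute)
          then have "\<theta>' ^ N \<le> p x ^ N" using \<theta>'(3) by (intro power_mono) auto
          then show ?thesis using \<delta>(2)[OF True] \<eta>(1) \<theta>'(3) p(2)[OF x] by (subst mult.commute) (intro mult_mono, auto)
        qed
        ultimately show ?thesis using t by auto
      next
        case False
        then have "x \<notin> cbox c d" using cd(2) by (auto simp: dist_commute)
        moreover have "\<bar>p x ^ N * h x\<bar> \<le> \<theta> ^ N * H"
          unfolding abs_mult using p(2)[OF x] \<theta>(3)[OF x] False H[OF x] by (intro mult_mono) (auto intro: power_mono \<theta>)
        ultimately show ?thesis by (simp add: mult.commute)
      qed
    qed
    then show ?thesis by (simp add: mult_ac)
  qed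
  have "(\<lambda>N. H * W * (\<theta> / \<theta>') ^ N) \<longlonglongrightarrow> H * W * 0"
    using \<theta> \<theta>' by (intro tendsto_intros LIMSEQ_power_zero) auto
  moreover have "\<eta> * V \<le> H * W * (\<theta> / \<theta>') ^ N" for N
    using key[of N] \<theta>'(3) by (simp add: power_divide field_simps)
  ultimately have "\<eta> * V \<le> H * W * 0" by (intro LIMSEQ_le_const) auto
  then show False using \<eta> V by (simp add: mult_le_0_iff)
qed

text \<open>
  Multiplication by the trigonometric polynomial \<open>(1 + cos (2 \<pi> (x\<^sub>j - x\<^sub>0\<^sub>j))) / 2\<close> keeps the property
  that all Fourier coefficients vanish. The product of these over \<open>j\<close> takes the value \<open>1\<close> at
  \<open>x\<^sub>0\<close> and smaller values at all other points of the period cell, so its powers concentrate at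
  \<open>x\<^sub>0\<close>. This needs \<open>x\<^sub>0\<close> in the interior of the cell; continuity and periodicity extend the
  conclusion to all points.
\<close>

lemma fcoef_eq_0_imp:
  fixes g :: "real ^ 'n::finite \<Rightarrow> complex"
  assumes g: "continuous_on UNIV g" "periodic g" and z: "\<And>q. fcoef g q = 0"
  shows "g x = 0"
proof -
  have box: "g x0 = 0" if x0: "x0 \<in> box 0 1" for x0
  proof -
    \<comment> \<open>The factors \<open>T\<close> for which all Fourier coefficients of \<open>T g\<close> vanish.\<close>
    define Z where "Z = (\<lambda>T. continuous_on UNIV T \<and> (\<forall>q. integral (cbox 0 1) (\<lambda>x. ee q x * (T x * g x)) = 0))"
    define f where "f = (\<lambda>j x. complex_of_real ((1 + cos (2 * pi * (x $ j - x0 $ j))) / 2))"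
    have Z1: "Z (\<lambda>x. 1)" using z by (simp add: Z_def fcoef_def)
    have Zf: "Z (\<lambda>x. f j x * T x)" if T: "Z T" for T j
      unfolding Z_def
    proof (intro conjI allI)
      show "continuous_on UNIV (\<lambda>x. f j x * T x)" using T unfolding f_def Z_def by (intro continuous_intros) auto
      fix q
      define w where "w = cis (2 * pi * x0 $ j)"
      have f_eq: "f j x = 1/2 + cnj w / 4 * ee (axis j 1) x + w / 4 * ee (- axis j 1) x" for x
      proof -
        have "lat_dot (axis j 1) x = x $ j" unfolding lat_dot_def
          by (simp add: axis_def if_distrib[of real_of_int] if_distrib[of "\<lambda>y. y * _"] cong: if_cong)
        then have e: "ee (axis j 1) x = cis (2 * pi * x $ j)" "ee (- axis j 1) x = cis (- (2 * pi * x $ j))"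
          by (auto simp: ee_cis lat_dot_minus)
        have cc: "cis t + cis (- t) = of_real (2 * cos t)" for t by (simp add: complex_eq_iff)
        from e have "cnj w * ee (axis j 1) x + w * ee (- axis j 1) x
            = cis (2 * pi * x $ j - 2 * pi * x0 $ j) + cis (- (2 * pi * x $ j - 2 * pi * x0 $ j))"
          by (simp add: w_def cis_cnj cis_mult algebra_simps)
        also have "\<dots> = of_real (2 * cos (2 * pi * (x $ j - x0 $ j)))"
          unfolding cc by (simp add: right_diff_distrib)
        finally have "cnj w * ee (axis j 1) x + w * ee (- axis j 1) x = of_real (2 * cos (2 * pi * (x $ j - x0 $ j)))" .
        then show ?thesis by (simp add: f_def field_simps)
      qed
      have i: "(\<lambda>x. ee q x * (T x * g x)) integrable_on cbox 0 1" for q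
        using T g unfolding Z_def by (intro integrable_torus continuous_intros) auto
      have "integral (cbox 0 1) (\<lambda>x. ee q x * ((f j x * T x) * g x))
         = integral (cbox 0 1) (\<lambda>x. 1/2 * (ee q x * (T x * g x)) + cnj w / 4 * (ee (q + axis j 1) x * (T x * g x))
              + w / 4 * (ee (q + - axis j 1) x * (T x * g x)))"
        by (intro integral_cong)
          (simp add: f_eq ee_add[of q "axis j 1"] ee_add[of q "- axis j 1"] ring_distribs mult_ac del: add_uminus_conv_diff)
      also have "\<dots> = 1/2 * integral (cbox 0 1) (\<lambda>x. ee q x * (T x * g x))
         + cnj w / 4 * integral (cbox 0 1) (\<lambda>x. ee (q + axis j 1) x * (T x * g x))
         + w / 4 * integral (cbox 0 1) (\<lambda>x. ee (q + - axis j 1) x * (T x * g x))"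
        using i by (simp add: Henstock_Kurzweil_Integration.integral_add integrable_add integrable_on_mult_right
            Henstock_Kurzweil_Integration.integral_mult_right del: add_uminus_conv_diff)
      also have "\<dots> = 0" using T by (simp add: Z_def del: add_uminus_conv_diff)
      finally show "integral (cbox 0 1) (\<lambda>x. ee q x * ((f j x * T x) * g x)) = 0" .
    qed
    have Zprod: "Z (\<lambda>x. (\<Prod>j\<in>A. f j x) * T x)" if "finite A" "Z T" for A T
      using that by (induction A arbitrary: T rule: finite_induct) (auto simp: mult.assoc Zf)
    define p where "p = (\<lambda>x. \<Prod>j\<in>UNIV. (1 + cos (2 * pi * (x $ j - x0 $ j))) / 2)"
    have pf: "complex_of_real (p x) = (\<Prod>j\<in>UNIV. f j x)" for x unfolding p_def f_def by simp
    have Zp: "Z (\<lambda>x. of_real (p x) ^ N)" for N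
    proof (induction N)
      case (Suc N)
      then show ?case using Zprod[of UNIV "\<lambda>x. of_real (p x) ^ N"] by (simp add: pf)
    qed (simp add: Z1)
    \<comment> \<open>A real function whose value at \<open>x0\<close> is \<open>|g x0|\<^sup>2\<close>.\<close>
    define h where "h = (\<lambda>x. Re (cnj (g x0) * g x))"
    have pc: "continuous_on UNIV p" unfolding p_def by (intro continuous_intros) auto
    have ci: "(\<lambda>x. complex_of_real (p x) ^ N * g x) integrable_on cbox 0 1" for N
      by (intro integrable_torus continuous_intros g pc)
    have "integral (cbox 0 1) (\<lambda>x. p x ^ N * h x) = 0" for N
    proof -
      have "integral (cbox 0 1) (\<lambda>x. complex_of_real (p x) ^ N * g x) = 0"
        using Zp[of N] unfolding Z_def by (metis (no_types, lifting) ee_0 integral_cong mult_1)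
      then have "((\<lambda>x. complex_of_real (p x) ^ N * g x) has_integral 0) (cbox 0 1)"
        using ci[of N] by (simp add: has_integral_integral)
      then have "((\<lambda>x. cnj (g x0) * (complex_of_real (p x) ^ N * g x)) has_integral cnj (g x0) * 0) (cbox 0 1)"
        by (rule has_integral_mult_right)
      from has_integral_linear[OF this bounded_linear_Re]
      have "((\<lambda>x. Re (cnj (g x0) * (complex_of_real (p x) ^ N * g x))) has_integral 0) (cbox 0 1)"
        by (simp add: o_def)
      moreover have "Re (cnj (g x0) * (complex_of_real (p x) ^ N * g x)) = p x ^ N * h x" for x
        by (simp add: h_def algebra_simps flip: of_real_power)
      ultimately show ?thesis by (simp add: integral_unique)
    qed
    moreover have "continuous_on (cbox 0 1) p" unfolding p_def by (intro continuous_intros) auto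
    moreover have "continuous_on (cbox 0 1) h" unfolding h_def
      by (intro continuous_intros continuous_on_subset[OF g(1)]) auto
    moreover have f01: "0 \<le> (1 + cos t) / 2 \<and> (1 + cos t) / 2 \<le> (1::real)" for t
      using cos_ge_minus_one[of t] cos_le_one[of t] by argo
    moreover have "p x < 1" if x: "x \<in> cbox 0 1" "x \<noteq> x0" for x
    proof -
      obtain j where j: "x $ j \<noteq> x0 $ j" using x(2) by (auto simp: vec_eq_iff)
      have b: "0 \<le> x $ j" "x $ j \<le> 1" "0 < x0 $ j" "x0 $ j < 1" using x(1) x0 by (auto simp: mem_box_cart)
      have "cos (2 * pi * (x $ j - x0 $ j)) \<noteq> 1"
      proof
        assume "cos (2 * pi * (x $ j - x0 $ j)) = 1"
        then obtain m :: int where "2 * pi * (x $ j - x0 $ j) = of_int m * 2 * pi" using cos_one_2pi_int by blast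
        then have m: "x $ j - x0 $ j = of_int m" by simp
        then have "\<bar>of_int m\<bar> < (1::real)" using b by linarith
        then have "m = 0" by linarith
        then show False using m j by simp
      qed
      then have lt: "(1 + cos (2 * pi * (x $ j - x0 $ j))) / 2 < 1" using cos_le_one[of "2 * pi * (x $ j - x0 $ j)"] by (simp add: order_less_le)
      have "p x = (1 + cos (2 * pi * (x $ j - x0 $ j))) / 2 * (\<Prod>i\<in>UNIV - {j}. (1 + cos (2 * pi * (x $ i - x0 $ i))) / 2)"
        unfolding p_def by (rule prod.remove) auto
      also have "\<dots> \<le> (1 + cos (2 * pi * (x $ j - x0 $ j))) / 2 * 1"
        using f01 by (intro mult_left_mono prod_le_1) auto
      finally show ?thesis using lt by simp
    qed
    moreover have "0 \<le> p x" for x unfolding p_def using f01 by (intro prod_nonneg) auto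
    moreover have "p x0 = 1" by (simp add: p_def)
    ultimately have "h x0 \<le> 0" using x0 by (intro concentration_real[of 0 1 p x0 h]) auto
    moreover have "h x0 = (cmod (g x0))\<^sup>2"
      unfolding h_def using complex_norm_square[of "g x0"] by (metis Re_complex_of_real mult.commute)
    ultimately show ?thesis by simp
  qed
  have "closure (box 0 (1 :: real ^ 'n)) = cbox 0 1"
    by (rule closure_box) (auto simp: interval_ne_empty_cart)
  then have cbox: "g y = 0" if "y \<in> cbox 0 1" for y
    using continuous_constant_on_closure[of "box 0 1" g 0] continuous_on_subset[OF g(1)] box that by auto
  have per_nat: "g (y + of_nat m *\<^sub>R axis j 1) = g y" for m y j
  proof (induction m)
    case (Suc m)
    have "y + of_nat (Suc m) *\<^sub>R axis j 1 = (y + of_nat m *\<^sub>R axis j 1) + axis j (1::real)"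
      by (simp add: algebra_simps)
    then show ?case using Suc g(2) unfolding periodic_def by metis
  qed simp
  have per_int: "g (y + of_int m *\<^sub>R axis j 1) = g y" for m y j
  proof (cases "m \<ge> 0")
    case True then show ?thesis using per_nat[of y "nat m" j] by simp
  next
    case False then show ?thesis using per_nat[of "y + of_int m *\<^sub>R axis j 1" "nat (- m)" j] by simp
  qed
  have per: "g (y + (\<Sum>j\<in>A. of_int (m j) *\<^sub>R axis j 1)) = g y" if "finite A" for A m y
    using that
  proof (induction A arbitrary: y rule: finite_induct)
    case (insert j A)
    have "y + (\<Sum>j\<in>insert j A. of_int (m j) *\<^sub>R axis j 1) = (y + of_int (m j) *\<^sub>R axis j 1) + (\<Sum>j\<in>A. of_int (m j) *\<^sub>R axis j 1)"
      using insert by (simp add: add.assoc)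
    then show ?case by (simp only: insert.IH per_int)
  qed simp
  define y where "y = (\<chi> j. frac (x $ j))"
  have "x = y + (\<Sum>j\<in>UNIV. of_int \<lfloor>x $ j\<rfloor> *\<^sub>R axis j 1)"
    by (auto simp: vec_eq_iff y_def frac_def axis_def if_distrib[of "\<lambda>z. _ * z"] cong: if_cong)
  then have "g x = g y" using per[where A = UNIV and m = "\<lambda>j. \<lfloor>x $ j\<rfloor>" and y = y] by simp
  moreover have "y \<in> cbox 0 1" by (auto simp: mem_box_cart y_def frac_lt_1 less_imp_le)
  ultimately show ?thesis by (simp only: cbox)
qed

lemma trig_uniform_limit:
  fixes c :: "int ^ 'n::finite \<Rightarrow> complex"
  assumes "(\<lambda>q. cmod (c q)) summable_on UNIV"
  shows "uniform_limit UNIV (\<lambda>X x. \<Sum>q\<in>X. c q * ee (- q) x) (\<lambda>x. \<Sum>\<^sub>\<infinity>q. c q * ee (- q) x)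
     (finite_subsets_at_top UNIV)"
  by (rule Weierstrass_m_test_general[OF _ assms]) (simp add: norm_mult)

lemma trig_continuous:
  fixes c :: "int ^ 'n::finite \<Rightarrow> complex"
  assumes "(\<lambda>q. cmod (c q)) summable_on UNIV"
  shows "continuous_on S (\<lambda>x. \<Sum>\<^sub>\<infinity>q. c q * ee (- q) x)"
proof -
  have "continuous_on UNIV (\<lambda>x. \<Sum>\<^sub>\<infinity>q. c q * ee (- q) x)"
    by (rule uniform_limit_theorem[OF _ trig_uniform_limit[OF assms]])
      (auto intro!: always_eventually continuous_intros)
  then show ?thesis by (rule continuous_on_subset) simp
qed

text \<open>
  The series converges uniformly, so it may be integrated term by term.
\<close>

lemma integral_trig_series:
  fixes c :: "int ^ 'n::finite \<Rightarrow> complex"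
  assumes c: "(\<lambda>q. cmod (c q)) summable_on UNIV" and h: "continuous_on UNIV h"
  shows "((\<lambda>q. c q * integral (cbox 0 1) (\<lambda>x. h x * ee (- q) x)) has_sum
     integral (cbox 0 1) (\<lambda>x. h x * (\<Sum>\<^sub>\<infinity>q. c q * ee (- q) x))) UNIV"
proof -
  have "bounded (h ` cbox 0 1)"
    by (intro compact_imp_bounded compact_continuous_image continuous_on_subset[OF h]) auto
  moreover have "bounded ((\<lambda>x. \<Sum>\<^sub>\<infinity>q. c q * ee (- q) x) ` cbox 0 1)"
    by (intro compact_imp_bounded compact_continuous_image trig_continuous c) auto
  ultimately have "uniform_limit (cbox 0 1) (\<lambda>X x. h x * (\<Sum>q\<in>X. c q * ee (- q) x))
      (\<lambda>x. h x * (\<Sum>\<^sub>\<infinity>q. c q * ee (- q) x)) (finite_subsets_at_top UNIV)"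
    by (intro uniform_lim_mult uniform_limit_const uniform_limit_on_subset[OF trig_uniform_limit[OF c]]) auto
  then obtain I J where IJ:
    "\<And>X. ((\<lambda>x. h x * (\<Sum>q\<in>X. c q * ee (- q) x)) has_integral I X) (cbox 0 1)"
    "((\<lambda>x. h x * (\<Sum>\<^sub>\<infinity>q. c q * ee (- q) x)) has_integral J) (cbox 0 1)"
    "(I \<longlongrightarrow> J) (finite_subsets_at_top UNIV)"
    by (rule uniform_limit_integral_cbox)
      (auto intro!: continuous_intros continuous_on_subset[OF h])
  have "I X = (\<Sum>q\<in>X. c q * integral (cbox 0 1) (\<lambda>x. h x * ee (- q) x))" if "finite X" for X
  proof -
    have "((\<lambda>x. \<Sum>q\<in>X. c q * (h x * ee (- q) x)) has_integral
        (\<Sum>q\<in>X. c q * integral (cbox 0 1) (\<lambda>x. h x * ee (- q) x))) (cbox 0 1)"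
      by (intro has_integral_sum that has_integral_mult_right integrable_integral integrable_torus continuous_intros h)
    moreover have "(\<lambda>x. \<Sum>q\<in>X. c q * (h x * ee (- q) x)) = (\<lambda>x. h x * (\<Sum>q\<in>X. c q * ee (- q) x))"
      by (auto simp: sum_distrib_left mult_ac)
    ultimately show ?thesis by (intro has_integral_unique[OF IJ(1)]) simp
  qed
  then have "\<forall>\<^sub>F X in finite_subsets_at_top UNIV. I X = (\<Sum>q\<in>X. c q * integral (cbox 0 1) (\<lambda>x. h x * ee (- q) x))"
    by (auto intro: eventually_finite_subsets_at_top_weakI)
  then have "((\<lambda>X. \<Sum>q\<in>X. c q * integral (cbox 0 1) (\<lambda>x. h x * ee (- q) x)) \<longlongrightarrow> J) (finite_subsets_at_top UNIV)"
    by (rule Lim_transform_eventually[OF IJ(3)])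
  then show ?thesis using IJ(2) by (simp add: has_sum_def integral_unique)
qed

text \<open>
  The sum of the series is continuous and has the same coefficients as \<open>f\<close>, so uniqueness applies
  to the difference.
\<close>

theorem fourier_inversion:
  fixes f :: "real ^ 'n::finite \<Rightarrow> complex"
  assumes f: "continuous_on UNIV f" "periodic f" and s: "(\<lambda>q. cmod (fcoef f q)) summable_on UNIV"
  shows "f x = (\<Sum>\<^sub>\<infinity>q. fcoef f q * ee (- q) x)"
proof -
  define S where "S = (\<lambda>x. \<Sum>\<^sub>\<infinity>q. fcoef f q * ee (- q) x)"
  have S: "continuous_on UNIV S" unfolding S_def by (rule trig_continuous[OF s])
  have "periodic S" unfolding S_def periodic_def by (simp add: periodic_ee[unfolded periodic_def, rule_format])
  have "fcoef S p = fcoef f p" for p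
  proof -
    have "((\<lambda>q. fcoef f q * integral (cbox 0 1) (\<lambda>x. ee p x * ee (- q) x)) has_sum fcoef S p) UNIV"
      unfolding fcoef_def[of S] unfolding S_def by (rule integral_trig_series[OF s]) (intro continuous_intros)
    moreover have "integral (cbox 0 1) (\<lambda>x. ee p x * ee (- q) x) = (if q = p then 1 else 0)" for q
    proof -
      have "(\<lambda>x. ee p x * ee (- q) x) = ee (p - q)" using ee_add[of p "- q"] by (intro ext) simp
      then show ?thesis using integral_ee[of "p - q"] by auto
    qed
    moreover have "((\<lambda>q. fcoef f q * (if q = p then 1 else 0)) has_sum fcoef f p) UNIV"
      by (rule has_sum_finite_neutralI[of "{p}"]) auto
    ultimately show ?thesis using has_sum_unique by auto
  qed
  then have "fcoef (\<lambda>x. f x - S x) p = 0" for p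
    unfolding fcoef_def
    by (simp add: right_diff_distrib, subst Henstock_Kurzweil_Integration.integral_diff)
      (auto intro!: integrable_torus continuous_intros f S)
  moreover have "continuous_on UNIV (\<lambda>x. f x - S x)" by (intro continuous_intros f S)
  moreover have "periodic (\<lambda>x. f x - S x)" using f(2) \<open>periodic S\<close> by (simp add: periodic_def)
  ultimately have "f x - S x = 0" using fcoef_eq_0_imp by blast
  then show ?thesis by (simp add: S_def)
qed

text \<open>
  Fourier coefficients turn products into convolutions: expand \<open>f\<close> and integrate term by term.
\<close>

theorem fcoef_mult:
  fixes f g :: "real ^ 'n::finite \<Rightarrow> complex"
  assumes f: "continuous_on UNIV f" "periodic f" and s: "(\<lambda>q. cmod (fcoef f q)) summable_on UNIV"
    and g: "continuous_on UNIV g"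
  shows "((\<lambda>p. fcoef f p * fcoef g (q - p)) has_sum fcoef (\<lambda>x. f x * g x) q) UNIV"
proof -
  have h: "continuous_on UNIV (\<lambda>x. ee q x * g x)" by (intro continuous_intros g)
  have 1: "(\<lambda>x. ee q x * g x * (\<Sum>\<^sub>\<infinity>p. fcoef f p * ee (- p) x)) = (\<lambda>x. ee q x * (f x * g x))"
    using fourier_inversion[OF f s] by (intro ext) (simp add: mult_ac)
  have 2: "(\<lambda>x. ee q x * g x * ee (- p) x) = (\<lambda>x. ee (q - p) x * g x)" for p
    using ee_add[of q "- p"] by (intro ext) simp
  show ?thesis using integral_trig_series[OF s h]
    unfolding 1 2 fcoef_def[of g, symmetric] fcoef_def[of "\<lambda>x. f x * g x", symmetric] .
qed

text \<open>
  Inserting the series that defines \<open>fourier u\<close> and integrating term by term exhibits the operator as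
  an infinite matrix, which also makes sense for functions outside the Schwartz space.
\<close>

lemma Op_matrix:
  assumes u: "(\<lambda>l. cmod (u l)) summable_on UNIV" and a: "continuous_on UNIV (a k)"
  shows "Op a u k = (\<Sum>\<^sub>\<infinity>l. fcoef (a k) (k - l) * u l)"
proof -
  have h: "continuous_on UNIV (\<lambda>x. ee k x * a k x)" by (intro continuous_intros a)
  have 1: "(\<lambda>x. ee k x * a k x * ee (- p) x) = (\<lambda>x. ee (k - p) x * a k x)" for p
    using ee_add[of k "- p"] by (intro ext) simp
  have f: "fourier u x = (\<Sum>\<^sub>\<infinity>l. u l * ee (- l) x)" for x
    unfolding fourier_def ee_minus by (simp add: mult.commute)
  have c: "continuous_on (cbox 0 1) (\<lambda>x. ee k x * a k x * (\<Sum>\<^sub>\<infinity>l. u l * ee (- l) x))"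
    by (intro continuous_intros trig_continuous[OF u] continuous_on_subset[OF a]) auto
  have "Op a u k = integral (cbox 0 1) (\<lambda>x. ee k x * a k x * (\<Sum>\<^sub>\<infinity>l. u l * ee (- l) x))"
    unfolding Op_def f ee_def[symmetric]
    using borel_integrable_compact[OF compact_cbox c]
    by (intro set_borel_integral_eq_integral) (simp add: set_integrable_def)
  also have "\<dots> = (\<Sum>\<^sub>\<infinity>l. u l * fcoef (a k) (k - l))"
    using infsumI[OF integral_trig_series[OF u h]] unfolding 1 fcoef_def[of "a k", symmetric] by (rule sym)
  also have "\<dots> = (\<Sum>\<^sub>\<infinity>l. fcoef (a k) (k - l) * u l)" by (intro infsum_cong mult.commute)
  finally show ?thesis .
qed

section \<open>Infinite matrices with decay away from the diagonal\<close>

definition rho :: "int ^ 'n::finite \<Rightarrow> real" where "rho k = 1 + lat_norm k"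

lemma lat_norm_L2: "lat_norm k = L2_set (\<lambda>j. real_of_int (k $ j)) UNIV"
  by (simp add: lat_norm_def L2_set_def)

lemma lat_norm_nonneg [simp]: "lat_norm k \<ge> 0"
  by (simp add: lat_norm_L2)

lemma lat_norm_minus: "lat_norm (- k) = lat_norm k"
  by (simp add: lat_norm_def)

lemma lat_norm_triangle: "lat_norm (k + l) \<le> lat_norm k + lat_norm l"
  using L2_set_triangle_ineq[of "\<lambda>j. real_of_int (k $ j)" "\<lambda>j. real_of_int (l $ j)" UNIV]
  by (simp add: lat_norm_L2)

lemma coord_le_lat_norm: "\<bar>real_of_int (k $ j)\<bar> \<le> lat_norm k"
proof -
  have "(real_of_int (k $ j))\<^sup>2 \<le> (\<Sum>j\<in>UNIV. (real_of_int (k $ j))\<^sup>2)"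
    by (rule member_le_sum) auto
  then show ?thesis unfolding lat_norm_def by (simp add: real_le_rsqrt)
qed

lemma lat_norm_le_sum: "lat_norm k \<le> (\<Sum>j\<in>UNIV. \<bar>real_of_int (k $ j)\<bar>)"
  unfolding lat_norm_L2 by (rule L2_set_le_sum_abs)

lemma rho_ge_1 [simp]: "rho k \<ge> 1" and rho_pos [simp]: "rho k > 0" and rho_nonneg [simp]: "rho k \<ge> 0"
  and rho_nz [simp]: "rho k \<noteq> 0"
  using lat_norm_nonneg[of k] by (auto simp: rho_def simp del: lat_norm_nonneg)

lemma rho_0 [simp]: "rho 0 = 1"
  by (simp add: rho_def lat_norm_def)

lemma rho_minus_commute: "rho (k - l) = rho (l - k)"
  using lat_norm_minus[of "k - l"] by (simp add: rho_def)

lemma rho_add_le: "rho (k + l) \<le> rho k * rho l"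
proof -
  have "0 \<le> lat_norm k * lat_norm l" by simp
  then have "1 + (lat_norm k + lat_norm l) \<le> rho k * rho l" by (simp add: rho_def algebra_simps)
  then show ?thesis using lat_norm_triangle[of k l] by (simp add: rho_def)
qed

text \<open>
  Peetre's inequality: changing the argument of the weight costs a power of the weight of the
  difference, which is absorbed by the decay of a matrix away from the diagonal.
\<close>

lemma rho_le: "rho k \<le> rho l * rho (k - l)"
  using rho_add_le[of l "k - l"] by simp

text \<open>
  The monomials \<open>k\<^sub>j\<^sup>N\<close> control the \<open>N\<close>-th power of the weight, because one coordinate is maximal.
\<close>

lemma rho_power_le_sum:
  "rho (k :: int ^ 'n::finite) ^ N \<le> (1 + real CARD('n)) ^ N * (1 + (\<Sum>j\<in>UNIV. \<bar>real_of_int (k $ j)\<bar> ^ N))"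
proof -
  let ?S = "insert 1 (range (\<lambda>j. \<bar>real_of_int (k $ j)\<bar>))"
  define M where "M = Max ?S"
  have fin: "finite ?S" by simp
  have M1: "M \<ge> 1" and Mj: "\<bar>real_of_int (k $ j)\<bar> \<le> M" for j unfolding M_def by (rule Max_ge[OF fin], simp)+
  have "rho k \<le> 1 + (\<Sum>j\<in>UNIV. \<bar>real_of_int (k $ j)\<bar>)" using lat_norm_le_sum[of k] by (simp add: rho_def)
  also have "\<dots> \<le> M + (\<Sum>j\<in>(UNIV::'n set). M)" by (intro add_mono sum_mono M1 Mj)
  also have "\<dots> = (1 + real CARD('n)) * M" by (simp add: algebra_simps)
  finally have "rho k ^ N \<le> ((1 + real CARD('n)) * M) ^ N" by (intro power_mono) auto
  also have "\<dots> = (1 + real CARD('n)) ^ N * M ^ N" by (simp add: power_mult_distrib)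
  also have "M ^ N \<le> 1 + (\<Sum>j\<in>UNIV. \<bar>real_of_int (k $ j)\<bar> ^ N)"
  proof -
    have "M \<in> ?S" unfolding M_def by (rule Max_in) auto
    then consider "M = 1" | j where "M = \<bar>real_of_int (k $ j)\<bar>" by auto
    then show ?thesis
    proof cases
      case 2
      have "M ^ N \<le> (\<Sum>j\<in>UNIV. \<bar>real_of_int (k $ j)\<bar> ^ N)"
        unfolding 2 by (rule member_le_sum) auto
      then show ?thesis by simp
    qed (simp add: sum_nonneg)
  qed
  finally show ?thesis by (simp add: mult_left_mono)
qed

lemma rho_power_mult_le:
  fixes k :: "int ^ 'n::finite" and x :: complex
  assumes "cmod x \<le> B0" "\<And>j. \<bar>real_of_int (k $ j)\<bar> ^ N * cmod x \<le> B j"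
  shows "rho k ^ N * cmod x \<le> (1 + real CARD('n)) ^ N * (B0 + (\<Sum>j\<in>UNIV. B j))"
proof -
  have "rho k ^ N * cmod x \<le> (1 + real CARD('n)) ^ N * (1 + (\<Sum>j\<in>UNIV. \<bar>real_of_int (k $ j)\<bar> ^ N)) * cmod x"
    by (intro mult_right_mono rho_power_le_sum) simp
  also have "\<dots> = (1 + real CARD('n)) ^ N * (cmod x + (\<Sum>j\<in>UNIV. \<bar>real_of_int (k $ j)\<bar> ^ N * cmod x))"
    by (simp add: sum_distrib_left algebra_simps)
  also have "\<dots> \<le> (1 + real CARD('n)) ^ N * (B0 + (\<Sum>j\<in>UNIV. B j))"
    by (intro mult_left_mono add_mono sum_mono assms) simp
  finally show ?thesis .
qed

lemma summable_int_inverse_square: "(\<lambda>s::int. 1 / (1 + (real_of_int s)\<^sup>2)) summable_on UNIV"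
proof -
  let ?f = "\<lambda>s::int. 1 / (1 + (real_of_int s)\<^sup>2)"
  have "summable (\<lambda>n. 1 / (1 + (real n)\<^sup>2))"
  proof (rule summable_comparison_test_ev)
    show "\<forall>\<^sub>F n in sequentially. norm (1 / (1 + (real n)\<^sup>2)) \<le> inverse ((real n)\<^sup>2)"
      using eventually_gt_at_top[of 0] by eventually_elim (auto simp: field_simps add_pos_pos)
    show "summable (\<lambda>n. inverse ((real n)\<^sup>2))" by (rule inverse_power_summable) simp
  qed
  then have n: "(\<lambda>n. 1 / (1 + (real n)\<^sup>2)) summable_on UNIV"
    by (subst summable_on_UNIV_nonneg_real_iff) auto
  have "?f summable_on range int"
    by (subst summable_on_reindex) (auto simp: o_def n inj_on_def)
  moreover have "?f summable_on range (\<lambda>n. - int n)"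
    by (subst summable_on_reindex) (auto simp: o_def n inj_on_def)
  ultimately have "?f summable_on (range int \<union> range (\<lambda>n. - int n))" by (rule summable_on_union)
  moreover have "range int \<union> range (\<lambda>n. - int n) = UNIV" by (auto simp: image_iff) (metis int_cases2)
  ultimately show ?thesis by simp
qed

text \<open>
  Compare with the product over the coordinates of \<open>1 / (1 + q\<^sub>j\<^sup>2)\<close>, which is summable in each
  coordinate.
\<close>

lemma summable_rho:
  "(\<lambda>q :: int ^ 'n::finite. 1 / rho q ^ (2 * CARD('n))) summable_on UNIV"
proof -
  let ?h = "\<lambda>s::int. 1 / (1 + (real_of_int s)\<^sup>2)"
  have le: "1 / rho q ^ (2 * CARD('n)) \<le> (\<Prod>j\<in>UNIV. ?h (q $ j))" for q :: "int ^ 'n"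
  proof -
    have "(\<Prod>j\<in>(UNIV::'n set). 1 + (real_of_int (q $ j))\<^sup>2) \<le> (\<Prod>j\<in>(UNIV::'n set). (rho q)\<^sup>2)"
    proof (intro prod_mono conjI)
      fix j
      have "(real_of_int (q $ j))\<^sup>2 \<le> (lat_norm q)\<^sup>2"
        using coord_le_lat_norm[of q j] by (simp add: abs_le_square_iff[symmetric])
      then show "1 + (real_of_int (q $ j))\<^sup>2 \<le> (rho q)\<^sup>2"
        using lat_norm_nonneg[of q] unfolding rho_def power2_sum by (simp del: lat_norm_nonneg)
    qed (simp add: add_nonneg_nonneg)
    also have "\<dots> = rho q ^ (2 * CARD('n))" by (simp add: power_mult)
    finally have "1 / rho q ^ (2 * CARD('n)) \<le> 1 / (\<Prod>j\<in>(UNIV::'n set). 1 + (real_of_int (q $ j))\<^sup>2)"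
      by (intro divide_left_mono mult_pos_pos prod_pos) (auto simp: add_pos_nonneg)
    then show ?thesis by (simp add: prod_dividef)
  qed
  define Z where "Z = (\<Sum>\<^sub>\<infinity>s. ?h s)"
  have "(\<lambda>q :: int ^ 'n. \<Prod>j\<in>UNIV. ?h (q $ j)) summable_on UNIV"
  proof (rule nonneg_bdd_above_summable_on)
    show "bdd_above (sum (\<lambda>q :: int ^ 'n. \<Prod>j\<in>UNIV. ?h (q $ j)) ` {F. F \<subseteq> UNIV \<and> finite F})"
    proof (rule bdd_aboveI2)
      fix F :: "(int ^ 'n) set" assume "F \<in> {F. F \<subseteq> UNIV \<and> finite F}"
      then have F: "finite F" by simp
      define S where "S = (\<Union>j. (\<lambda>q. q $ j) ` F)"
      have S: "finite S" using F by (auto simp: S_def)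
      have "(\<Sum>q\<in>F. \<Prod>j\<in>UNIV. ?h (q $ j)) = (\<Sum>g\<in>vec_nth ` F. \<Prod>j\<in>UNIV. ?h (g j))"
        by (subst sum.reindex) (auto simp: inj_on_def vec_eq_iff)
      also have "\<dots> \<le> (\<Sum>g\<in>PiE (UNIV :: 'n set) (\<lambda>_. S). \<Prod>j\<in>UNIV. ?h (g j))"
      proof (rule sum_mono2)
        show "finite (PiE UNIV (\<lambda>_ :: 'n. S))" using S by (intro finite_PiE) auto
      qed (auto simp: S_def intro!: prod_nonneg)
      also have "\<dots> = (\<Prod>j\<in>(UNIV::'n set). \<Sum>s\<in>S. ?h s)"
        by (rule prod_sum_PiE[symmetric]) (auto simp: S)
      also have "\<dots> \<le> (\<Prod>j\<in>(UNIV::'n set). Z)"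
        unfolding Z_def
        by (intro prod_mono conjI sum_nonneg finite_sum_le_infsum summable_int_inverse_square S) auto
      finally show "(\<Sum>q\<in>F. \<Prod>j\<in>UNIV. ?h (q $ j)) \<le> Z ^ CARD('n)" by simp
    qed
  qed (auto intro: prod_nonneg)
  then show ?thesis
    by (rule summable_on_comparison_test) (auto simp: le)
qed

definition rho_sum :: "'n::finite itself \<Rightarrow> real" where
  "rho_sum _ = (\<Sum>\<^sub>\<infinity>q :: int ^ 'n. 1 / rho q ^ (2 * CARD('n)))"

lemma rho_sum_nonneg: "rho_sum TYPE('n::finite) \<ge> 0"
  by (simp add: rho_sum_def infsum_nonneg)

lemma bij_minus: "bij_betw (\<lambda>q. k - q) UNIV (UNIV :: 'a::ab_group_add set)"
  by (rule bij_betwI[where g = "\<lambda>q. k - q"]) auto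

lemma summable_reflect: "(\<lambda>l. f (k - l)) summable_on UNIV \<longleftrightarrow> f summable_on (UNIV :: 'a::ab_group_add set)"
  using summable_on_reindex_bij_betw[OF bij_minus[of k], of f] by simp

lemma infsum_reflect: "(\<Sum>\<^sub>\<infinity>l. f (k - l)) = (\<Sum>\<^sub>\<infinity>l\<in>(UNIV :: 'a::ab_group_add set). f l)"
  using infsum_reindex_bij_betw[OF bij_minus[of k], of f] by simp

lemma l2_translate:
  fixes u :: "'a::ab_group_add \<Rightarrow> complex"
  assumes "u \<in> l2" shows "(\<lambda>k. u (k - q)) \<in> l2" "l2_norm (\<lambda>k. u (k - q)) = l2_norm u"
proof -
  have b: "bij_betw (\<lambda>k. k - q) UNIV (UNIV :: 'a set)" by (rule bij_betwI[where g = "\<lambda>k. k + q"]) auto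
  show "(\<lambda>k. u (k - q)) \<in> l2"
    using assms summable_on_reindex_bij_betw[OF b, of "\<lambda>k. (cmod (u k))\<^sup>2"] by (simp add: l2_def)
  show "l2_norm (\<lambda>k. u (k - q)) = l2_norm u"
    using infsum_reindex_bij_betw[OF b, of "\<lambda>k. (cmod (u k))\<^sup>2"] by (simp add: l2_norm_def)
qed

lemma l2_sum_norm:
  assumes "finite A" "\<And>i. i \<in> A \<Longrightarrow> f i \<in> l2"
  shows "l2_norm (\<lambda>k. \<Sum>i\<in>A. f i k) \<le> (\<Sum>i\<in>A. l2_norm (f i))"
  using assms
proof (induction A rule: finite_induct)
  case (insert x F)
  then have "l2_norm (\<lambda>k. f x k + (\<Sum>i\<in>F. f i k)) \<le> l2_norm (f x) + l2_norm (\<lambda>k. \<Sum>i\<in>F. f i k)"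
    by (intro l2_add l2_sum) auto
  then show ?case using insert by simp
qed simp

definition matvec :: "('i \<Rightarrow> 'j \<Rightarrow> complex) \<Rightarrow> ('j \<Rightarrow> complex) \<Rightarrow> 'i \<Rightarrow> complex" where
  "matvec M u = (\<lambda>k. \<Sum>\<^sub>\<infinity>l. M k l * u l)"

text \<open>
  A matrix whose entries are dominated by a summable function of \<open>k - l\<close> acts like a sum of
  weighted translations, so Minkowski's inequality bounds it on square summable functions.
\<close>

lemma schur_bound:
  fixes u :: "'a::ab_group_add \<Rightarrow> complex" and M :: "'a \<Rightarrow> 'a \<Rightarrow> complex"
  assumes M: "\<And>k l. cmod (M k l) \<le> \<kappa> (k - l)" and \<kappa>: "\<kappa> summable_on UNIV" and u: "u \<in> l2"
  shows "(\<lambda>l. cmod (M k l * u l)) summable_on UNIV"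
    and "matvec M u \<in> l2" and "l2_norm (matvec M u) \<le> (\<Sum>\<^sub>\<infinity>q. \<kappa> q) * l2_norm u"
proof -
  have \<kappa>0: "\<kappa> q \<ge> 0" for q using order_trans[OF norm_ge_zero M[of q 0]] by simp
  define S where "S = (\<Sum>\<^sub>\<infinity>q. \<kappa> q)"
  have S0: "S \<ge> 0" unfolding S_def using \<kappa>0 by (intro infsum_nonneg) auto
  define w where "w = (\<lambda>k. \<Sum>\<^sub>\<infinity>q. \<kappa> q * cmod (u (k - q)))"
  have sw: "(\<lambda>q. \<kappa> q * cmod (u (k - q))) summable_on UNIV" for k
  proof (rule summable_on_comparison_test)
    show "(\<lambda>q. \<kappa> q * l2_norm u) summable_on UNIV" by (intro summable_on_cmult_left \<kappa>)
  qed (use \<kappa>0 cmod_le_l2_norm[OF u] in \<open>auto intro: mult_left_mono\<close>)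
  have sk: "(\<lambda>l. \<kappa> (k - l) * cmod (u l)) summable_on UNIV" for k
    using sw[of k] summable_reflect[of "\<lambda>q. \<kappa> q * cmod (u (k - q))" k] by simp
  have b: "cmod (M k l * u l) \<le> \<kappa> (k - l) * cmod (u l)" for k l
    by (simp add: norm_mult mult_right_mono M)
  show s: "(\<lambda>l. cmod (M k l * u l)) summable_on UNIV" for k
    by (rule summable_on_comparison_test[OF sk[of k]]) (auto simp: b)
  have le_w: "cmod (matvec M u k) \<le> w k" for k
  proof -
    have "cmod (matvec M u k) \<le> (\<Sum>\<^sub>\<infinity>l. cmod (M k l * u l))"
      unfolding matvec_def by (rule norm_infsum_bound[OF s])
    also have "\<dots> \<le> (\<Sum>\<^sub>\<infinity>l. \<kappa> (k - l) * cmod (u l))" by (intro infsum_mono s sk b)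
    also have "\<dots> = w k" unfolding w_def using infsum_reflect[of "\<lambda>q. \<kappa> q * cmod (u (k - q))" k] by simp
    finally show ?thesis .
  qed
  have fin: "(\<Sum>k\<in>F. (cmod (matvec M u k))\<^sup>2) \<le> (S * l2_norm u)\<^sup>2" if F: "finite F" for F
  proof -
    have "(\<Sum>k\<in>F. (cmod (matvec M u k))\<^sup>2) \<le> (\<Sum>k\<in>F. (w k)\<^sup>2)"
      by (intro sum_mono power_mono le_w) auto
    also have "\<dots> \<le> (S * l2_norm u)\<^sup>2"
    proof (rule tendsto_upperbound)
      show "((\<lambda>G. \<Sum>k\<in>F. (\<Sum>q\<in>G. \<kappa> q * cmod (u (k - q)))\<^sup>2) \<longlongrightarrow> (\<Sum>k\<in>F. (w k)\<^sup>2)) (finite_subsets_at_top UNIV)"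
        unfolding w_def by (intro tendsto_intros infsum_tendsto sw)
      show "\<forall>\<^sub>F G in finite_subsets_at_top UNIV. (\<Sum>k\<in>F. (\<Sum>q\<in>G. \<kappa> q * cmod (u (k - q)))\<^sup>2) \<le> (S * l2_norm u)\<^sup>2"
      proof (rule eventually_finite_subsets_at_top_weakI)
        fix G :: "'a set" assume G: "finite G"
        define f where "f = (\<lambda>q k. complex_of_real (\<kappa> q) * of_real (cmod (u (k - q))))"
        have au: "(\<lambda>k. complex_of_real (cmod (u k))) \<in> l2" "l2_norm (\<lambda>k. complex_of_real (cmod (u k))) = l2_norm u"
          using u by (auto simp: l2_def l2_norm_def)
        have f: "f q \<in> l2" "l2_norm (f q) = \<kappa> q * l2_norm u" for q
          using l2_translate[OF au(1), of q] au(2) \<kappa>0[of q] by (auto simp: f_def l2_norm_scale)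
        have "l2_norm (\<lambda>k. \<Sum>q\<in>G. f q k) \<le> (\<Sum>q\<in>G. \<kappa> q * l2_norm u)"
          using l2_sum_norm[OF G, of f] f by simp
        also have "\<dots> = (\<Sum>q\<in>G. \<kappa> q) * l2_norm u" by (simp add: sum_distrib_right)
        also have "\<dots> \<le> S * l2_norm u" unfolding S_def
          by (intro mult_right_mono finite_sum_le_infsum \<kappa> G) (auto simp: \<kappa>0)
        finally have n: "l2_norm (\<lambda>k. \<Sum>q\<in>G. f q k) \<le> S * l2_norm u" .
        have "(\<Sum>k\<in>F. (\<Sum>q\<in>G. \<kappa> q * cmod (u (k - q)))\<^sup>2) = (\<Sum>k\<in>F. (cmod (\<Sum>q\<in>G. f q k))\<^sup>2)"
        proof (rule sum.cong[OF refl])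
          fix k
          have "(\<Sum>q\<in>G. f q k) = complex_of_real (\<Sum>q\<in>G. \<kappa> q * cmod (u (k - q)))" by (simp add: f_def)
          then show "(\<Sum>q\<in>G. \<kappa> q * cmod (u (k - q)))\<^sup>2 = (cmod (\<Sum>q\<in>G. f q k))\<^sup>2"
            by (simp only: norm_of_real power2_abs)
        qed
        also have "\<dots> \<le> (l2_norm (\<lambda>k. \<Sum>q\<in>G. f q k))\<^sup>2"
          by (intro l2_finite_le l2_sum f F)
        also have "\<dots> \<le> (S * l2_norm u)\<^sup>2" by (intro power_mono n) auto
        finally show "(\<Sum>k\<in>F. (\<Sum>q\<in>G. \<kappa> q * cmod (u (k - q)))\<^sup>2) \<le> (S * l2_norm u)\<^sup>2" .
      qed
    qed auto
    finally show ?thesis .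
  qed
  show "matvec M u \<in> l2" "l2_norm (matvec M u) \<le> (\<Sum>\<^sub>\<infinity>q. \<kappa> q) * l2_norm u"
    using l2_boundI[of "matvec M u" "S * l2_norm u"] fin S0 by (auto simp: S_def)
qed

text \<open>
  The Sobolev space of order \<open>p\<close> consists of the \<open>u\<close> with \<open>wt p u \<in> l2\<close>.
\<close>

definition wt :: "nat \<Rightarrow> (int ^ 'n::finite \<Rightarrow> complex) \<Rightarrow> int ^ 'n \<Rightarrow> complex" where
  "wt p u = (\<lambda>k. of_real (rho k ^ p) * u k)"

lemma wt_0 [simp]: "wt 0 u = u" by (simp add: wt_def)

lemma cmod_wt: "cmod (wt p u k) = rho k ^ p * cmod (u k)"
  by (simp add: wt_def norm_mult norm_power)

lemma wt_mono:
  assumes "p \<le> q" "wt q u \<in> l2" shows "wt p u \<in> l2" "l2_norm (wt p u) \<le> l2_norm (wt q u)"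
proof -
  have "cmod (wt p u k) \<le> 1 * cmod (wt q u k)" for k
    unfolding cmod_wt using assms(1) by (auto intro!: mult_right_mono power_increasing)
  from l2_mono[OF assms(2) this] show "wt p u \<in> l2" "l2_norm (wt p u) \<le> l2_norm (wt q u)" by auto
qed

text \<open>
  Conjugation with the weights reduces an estimate between Sobolev spaces to the unweighted case.
\<close>

lemma weighted_bound:
  fixes M :: "int ^ 'n::finite \<Rightarrow> int ^ 'n \<Rightarrow> complex"
  assumes M: "\<And>k l. rho k ^ p * cmod (M k l) \<le> C * rho l ^ q / rho (k - l) ^ (2 * CARD('n))"
    and u: "wt q u \<in> l2"
  shows "(\<lambda>l. cmod (M k l * u l)) summable_on UNIV"
    and "wt p (matvec M u) \<in> l2" "l2_norm (wt p (matvec M u)) \<le> C * rho_sum TYPE('n) * l2_norm (wt q u)"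
proof -
  define N where "N = (\<lambda>k l. of_real (rho k ^ p / rho l ^ q) * M k l)"
  define \<kappa> where "\<kappa> = (\<lambda>q :: int ^ 'n. C * (1 / rho q ^ (2 * CARD('n))))"
  have N: "cmod (N k l) \<le> \<kappa> (k - l)" for k l
  proof -
    have "cmod (N k l) = rho k ^ p * cmod (M k l) / rho l ^ q"
      by (simp add: N_def norm_mult norm_divide norm_power)
    also have "\<dots> \<le> (C * rho l ^ q / rho (k - l) ^ (2 * CARD('n))) / rho l ^ q"
      by (intro divide_right_mono M) auto
    finally show ?thesis by (simp add: \<kappa>_def)
  qed
  have \<kappa>: "\<kappa> summable_on UNIV" unfolding \<kappa>_def by (intro summable_on_cmult_right summable_rho)
  have \<kappa>s: "(\<Sum>\<^sub>\<infinity>q. \<kappa> q) = C * rho_sum TYPE('n)" unfolding \<kappa>_def rho_sum_def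
    by (rule infsum_cmult_right')
  have e: "N k l * wt q u l = of_real (rho k ^ p) * (M k l * u l)" for k l
    by (simp add: N_def wt_def)
  note s = schur_bound[of N \<kappa>, OF N \<kappa> u]
  have "(\<lambda>l. inverse (rho k ^ p) * cmod (N k l * wt q u l)) summable_on UNIV"
    by (intro summable_on_cmult_right s)
  moreover have "inverse (rho k ^ p) * cmod (N k l * wt q u l) = cmod (M k l * u l)" for l
    unfolding e by (simp add: norm_mult norm_power)
  ultimately show "(\<lambda>l. cmod (M k l * u l)) summable_on UNIV" by simp
  have "matvec N (wt q u) = wt p (matvec M u)"
    unfolding matvec_def e by (simp add: wt_def infsum_cmult_right')
  then show "wt p (matvec M u) \<in> l2" "l2_norm (wt p (matvec M u)) \<le> C * rho_sum TYPE('n) * l2_norm (wt q u)"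
    using s(2,3) \<kappa>s by auto
qed

section \<open>The matrix of an elliptic operator\<close>

subsection \<open>What the symbol estimates say about derivatives and differences\<close>

lemma coords_props: "distinct (coords :: 'n::{finite,linorder} list)" "set (coords :: 'n list) = UNIV"
  by (auto simp: coords_def)

text \<open>
  In the iterated operators of a multi-index concentrated in one coordinate all other factors are the
  identity.
\<close>

lemma foldr_single:
  assumes "\<And>i g. i \<noteq> j \<Longrightarrow> F i g = g" "distinct xs" "j \<in> set xs"
  shows "foldr F xs f = F j f"
proof -
  have id: "foldr F ys f = f" if "j \<notin> set ys" for ys
    using that by (induction ys) (use assms(1) in auto)
  show ?thesis using assms(2,3)
  proof (induction xs)
    case (Cons i xs)
    then show ?case using id[of xs] assms(1)[of i] by (cases "i = j") auto
  qed simp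
qed

lemma D_op_axis: "D_op (axis j l) f = D1 j l f"
  unfolding D_op_def using coords_props
  by (subst foldr_single[of j]) (auto simp: axis_def)

lemma diff_op_axis: "diff_op (axis j 1) u = diff1 j u"
  unfolding diff_op_def using coords_props
  by (subst foldr_single[of j]) (auto simp: axis_def)

lemma diff_op_0: "diff_op 0 u = u"
proof -
  have "foldr (\<lambda>i v. (diff1 i ^^ (0 $ i)) v) xs u = u" for xs :: "'a list"
    by (induction xs) auto
  then show ?thesis by (simp add: diff_op_def)
qed

lemma mi_order_axis: "mi_order (axis j l) = l" and mi_order_0: "mi_order 0 = 0"
  by (auto simp: mi_order_def axis_def)

lemma C_k_lin: "C_k r f \<Longrightarrow> C_k r g \<Longrightarrow> C_k r (\<lambda>x. c * f x + d * g x)"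
proof (induction r arbitrary: f g)
  case (Suc r)
  then have "dir_diff j f" "dir_diff j g" for j by (auto simp: dir_diff_def)
  then show ?case using Suc partial_deriv_lin(1)[of _ f g c d, unfolded dir_diff_def]
    by (auto simp: partial_deriv_lin intro!: continuous_intros)
qed (auto intro!: continuous_intros)

lemma smooth_torus_lin:
  assumes "f \<in> smooth_torus" "g \<in> smooth_torus" shows "(\<lambda>x. c * f x + d * g x) \<in> smooth_torus"
  using assms by (auto simp: smooth_torus_def C_k_lin)

lemma smooth_torusD:
  assumes "f \<in> smooth_torus"
  shows "continuous_on UNIV f" "periodic f" "dir_diff j f" "partial_deriv j f \<in> smooth_torus"
proof -
  have C: "C_k r f" for r using assms by (simp add: smooth_torus_def)
  show "continuous_on UNIV f" using C[of 0] by simp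
  show p: "periodic f" using assms by (simp add: smooth_torus_def periodic_def)
  show "dir_diff j f" using C[of "Suc 0"] by (simp add: dir_diff_def)
  show "partial_deriv j f \<in> smooth_torus"
    using C[of "Suc _"] periodic_partial_deriv[OF p, of j] by (simp add: smooth_torus_def periodic_def)
qed

lemma D1_smooth: "f \<in> smooth_torus \<Longrightarrow> D1 j l f \<in> smooth_torus"
proof (induction l)
  case (Suc l)
  have "(\<lambda>x. (1 / (2 * of_real pi * \<i>)) * partial_deriv j (D1 j l f) x + (- of_nat l) * D1 j l f x) \<in> smooth_torus"
    by (intro smooth_torus_lin smooth_torusD Suc)
  then show ?case by simp
qed simp

lemma partial_deriv_D1:
  "partial_deriv j (D1 j l f) x = 2 * of_real pi * \<i> * D1 j (Suc l) f x + 2 * of_real pi * \<i> * of_nat l * D1 j l f x"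
  by (simp add: field_simps)

text \<open>
  The operators \<open>D\<^sup>(\<^sup>l\<^sup>)\<close> in one direction span the same space as the pure derivatives of order up to
  \<open>l\<close>, so bounds for the former give bounds for the latter.
\<close>

lemma dir_bounded_of_D1:
  assumes f: "\<And>i. f i \<in> smooth_torus"
    and b: "\<And>l. \<exists>C. \<forall>i x. cmod (s i * D1 j l (f i) x) \<le> C"
  shows "dir_bounded j r (\<lambda>i x. s i * f i x)"
proof -
  have tb: "torus_bounded (\<lambda>i x. s i * D1 j l (f i) x)" for l
    using b[of l] smooth_torusD[OF D1_smooth[OF f]] by (auto intro!: continuous_intros simp: periodic_def)
  have dd: "dir_diff j (\<lambda>x. s i * D1 j l (f i) x)"
    "partial_deriv j (\<lambda>x. s i * D1 j l (f i) x) = (\<lambda>x. s i * partial_deriv j (D1 j l (f i)) x)" for i l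
    using partial_deriv_lin[of j "D1 j l (f i)" "D1 j l (f i)" "s i" 0] smooth_torusD[OF D1_smooth[OF f]] by auto
  have "dir_bounded j r (\<lambda>i x. s i * D1 j l (f i) x)" for l
  proof (induction r arbitrary: l)
    case 0
    then show ?case using tb by (simp only: dir_bounded.simps)
  next
    case (Suc r)
    have "dir_bounded j r (\<lambda>i x. (2 * of_real pi * \<i>) * (s i * D1 j (Suc l) (f i) x)
        + (2 * of_real pi * \<i> * of_nat l) * (s i * D1 j l (f i) x))"
      by (rule dir_bounded_lin[where K = "2 * pi * (1 + l)", OF Suc Suc]) (auto simp: norm_mult)
    moreover have "(\<lambda>i. partial_deriv j (\<lambda>x. s i * D1 j l (f i) x)) = (\<lambda>i x. (2 * of_real pi * \<i>) * (s i * D1 j (Suc l) (f i) x)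
        + (2 * of_real pi * \<i> * of_nat l) * (s i * D1 j l (f i) x))"
      unfolding dd by (intro ext) (simp only: partial_deriv_D1 ring_distribs mult_ac)
    ultimately show ?case using tb dd by (simp only: dir_bounded.simps) simp
  qed
  from this[of 0] show ?thesis by simp
qed

lemma torus_bounded_If:
  assumes "torus_bounded F" "torus_bounded G" shows "torus_bounded (\<lambda>i. if P i then F i else G i)"
proof -
  obtain C D where CD: "\<And>i x. cmod (F i x) \<le> C" "\<And>i x. cmod (G i x) \<le> D" using assms by auto
  then have "cmod ((if P i then F i else G i) x) \<le> max C D" for i x by (simp add: le_max_iff_disj)
  then have "\<exists>C. \<forall>i x. cmod ((if P i then F i else G i) x) \<le> C" by blast
  then show ?thesis using assms by simp
qed

lemma dir_bounded_If:
  "dir_bounded j r F \<Longrightarrow> dir_bounded j r G \<Longrightarrow> dir_bounded j r (\<lambda>i. if P i then F i else G i)"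
proof (induction r arbitrary: F G)
  case 0
  then show ?case by (simp only: dir_bounded.simps torus_bounded_If)
next
  case (Suc r)
  have "torus_bounded (\<lambda>i. if P i then F i else G i)" using Suc.prems by (intro torus_bounded_If) auto
  moreover have "(\<lambda>i. partial_deriv j (if P i then F i else G i)) = (\<lambda>i. if P i then partial_deriv j (F i) else partial_deriv j (G i))"
    by auto
  ultimately show ?case using Suc by (simp del: torus_bounded_def)
qed

text \<open>
  The bounds in the separate directions combine to decay in \<open>|q|\<close>.
\<close>

lemma fcoef_decay:
  fixes F :: "'i \<Rightarrow> real ^ 'n::finite \<Rightarrow> complex"
  assumes "\<And>j r. dir_bounded j r F"
  shows "\<exists>C\<ge>0. \<forall>i q. cmod (fcoef (F i) q) \<le> C / rho q ^ N"
proof -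
  have "\<forall>j. \<exists>C. \<forall>i q. \<bar>real_of_int (q $ j)\<bar> ^ N * cmod (fcoef (F i) q) \<le> C"
    using dir_bounded_fcoef assms by blast
  then obtain C where C: "\<And>j i q. \<bar>real_of_int (q $ j)\<bar> ^ N * cmod (fcoef (F i) q) \<le> C j" by metis
  obtain C0 where C0: "\<And>i q. cmod (fcoef (F i) q) \<le> C0"
    using dir_bounded_fcoef[OF assms[of undefined 0]] by auto
  define K where "K = (1 + real CARD('n)) ^ N * (C0 + (\<Sum>j\<in>UNIV. C j))"
  have le: "rho q ^ N * cmod (fcoef (F i) q) \<le> K" for i q
    unfolding K_def by (rule rho_power_mult_le[OF C0 C])
  then have "cmod (fcoef (F i) q) \<le> K / rho q ^ N" for i q by (simp add: field_simps)
  moreover have "K \<ge> 0" using order_trans[OF _ le[of 0 undefined]] by simp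
  ultimately show ?thesis by blast
qed

text \<open>
  The symbol divided by \<open>\<rho>(k)\<close> and the first differences of the symbol in \<open>k\<close> have derivatives in
  \<open>x\<close> that are bounded uniformly in \<open>k\<close>, so their Fourier coefficients decay rapidly,
  uniformly in \<open>k\<close>.
\<close>

lemma symbol_fcoef:
  fixes a :: "int ^ 'n::{finite,linorder} \<Rightarrow> real ^ 'n::{finite,linorder} \<Rightarrow> complex"
  assumes a: "a \<in> symbols 1"
  shows "a k \<in> smooth_torus"
    and "dir_bounded j r (\<lambda>k x. of_real (1 / rho k) * a k x)"
    and "\<exists>C\<ge>0. \<forall>k q. cmod (fcoef (a k) q) \<le> C * rho k / rho q ^ N"
    and "\<exists>C\<ge>0. \<forall>k q. cmod (fcoef (a (k + axis i 1)) q - fcoef (a k) q) \<le> C / rho q ^ N"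
proof -
  show s: "a k \<in> smooth_torus" for k using a by (simp add: symbols_def)
  have est: "\<exists>C>0. \<forall>k x. cmod (D_op \<beta> (\<lambda>y. diff_op \<alpha> (\<lambda>l. a l y) k) x) \<le> C * rho k powr (1 - real (mi_order \<alpha>))" for \<alpha> \<beta>
    using a by (simp add: symbols_def rho_def)
  show db: "dir_bounded j r (\<lambda>k x. of_real (1 / rho k) * a k x)" for j r
  proof (rule dir_bounded_of_D1[OF s])
    fix l
    obtain C where C: "\<And>k x. cmod (D1 j l (a k) x) \<le> C * rho k"
      using est[of "axis j l" 0] by (auto simp: D_op_axis diff_op_0 mi_order_0)
    have "cmod (of_real (1 / rho k) * D1 j l (a k) x) \<le> C" for k x
      using C[of k x] by (simp add: norm_mult norm_divide field_simps)
    then show "\<exists>C. \<forall>k x. cmod (of_real (1 / rho k) * D1 j l (a k) x) \<le> C" by blast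
  qed
  obtain C where C: "C \<ge> 0" "\<And>k q. cmod (fcoef (\<lambda>x. of_real (1 / rho k) * a k x) q) \<le> C / rho q ^ N"
    using fcoef_decay[OF db] by blast
  have "cmod (fcoef (a k) q) \<le> C * rho k / rho q ^ N" for k q
  proof -
    have "(\<lambda>x. ee q x * (of_real (1 / rho k) * a k x)) = (\<lambda>x. of_real (1 / rho k) * (ee q x * a k x))"
      by (simp add: mult_ac)
    then have "fcoef (\<lambda>x. of_real (1 / rho k) * a k x) q = of_real (1 / rho k) * fcoef (a k) q"
      unfolding fcoef_def by (simp only: Henstock_Kurzweil_Integration.integral_mult_right)
    then have "cmod (fcoef (a k) q) / rho k \<le> C / rho q ^ N" using C(2)[of k q] by (simp add: norm_mult norm_divide)
    then show ?thesis by (simp add: field_simps)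
  qed
  then show "\<exists>C\<ge>0. \<forall>k q. cmod (fcoef (a k) q) \<le> C * rho k / rho q ^ N" using C(1) by blast
  define d where "d = (\<lambda>k x. a (k + axis i 1) x - a k x)"
  have ds: "d k \<in> smooth_torus" for k
    unfolding d_def using smooth_torus_lin[OF s[of "k + axis i 1"] s[of k], of 1 "-1"] by simp
  have "dir_bounded j r (\<lambda>k x. 1 * d k x)" for j r
  proof (rule dir_bounded_of_D1[OF ds])
    fix l
    obtain C where C: "\<And>k x. cmod (D1 j l (d k) x) \<le> C"
      using est[of "axis j l" "axis i 1"] by (auto simp: D_op_axis diff_op_axis mi_order_axis diff1_def d_def simp del: One_nat_def)
    then show "\<exists>C. \<forall>k x. cmod (1 * D1 j l (d k) x) \<le> C" by auto
  qed
  then obtain C where C: "C \<ge> 0" "\<And>k q. cmod (fcoef (d k) q) \<le> C / rho q ^ N"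
    using fcoef_decay[of d N] by auto
  have "fcoef (d k) q = fcoef (a (k + axis i 1)) q - fcoef (a k) q" for k q
    unfolding fcoef_def d_def right_diff_distrib
    by (intro Henstock_Kurzweil_Integration.integral_diff integrable_torus continuous_intros smooth_torusD s)
  then show "\<exists>C\<ge>0. \<forall>k q. cmod (fcoef (a (k + axis i 1)) q - fcoef (a k) q) \<le> C / rho q ^ N" using C by metis
qed

text \<open>Summing first differences along a lattice path gives a Lipschitz estimate.\<close>

lemma lattice_lipschitz:
  fixes g :: "int ^ 'n::finite \<Rightarrow> complex"
  assumes g: "\<And>k j. cmod (g (k + axis j 1) - g k) \<le> C"
  shows "cmod (g l - g k) \<le> C * (\<Sum>j\<in>UNIV. \<bar>real_of_int (l $ j - k $ j)\<bar>)"
proof -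
  have nat: "cmod (g (k + of_nat m * axis j 1) - g k) \<le> C * real m" for m k j
  proof (induction m)
    case (Suc m)
    have "k + of_nat (Suc m) * axis j 1 = (k + of_nat m * axis j 1) + axis j (1::int)"
      by (simp add: algebra_simps)
    then have "g (k + of_nat (Suc m) * axis j 1) - g k
       = (g ((k + of_nat m * axis j 1) + axis j 1) - g (k + of_nat m * axis j 1)) + (g (k + of_nat m * axis j 1) - g k)"
      by (simp only:) simp
    then have "cmod (g (k + of_nat (Suc m) * axis j 1) - g k) \<le> C + C * real m"
      using norm_triangle_mono[OF g[of "k + of_nat m * axis j 1" j] Suc] by simp
    then show ?case by (simp add: algebra_simps)
  qed simp
  have int: "cmod (g (k + of_int m * axis j 1) - g k) \<le> C * \<bar>real_of_int m\<bar>" for m k j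
  proof (cases "m \<ge> 0")
    case True then show ?thesis using nat[of k "nat m" j] by simp
  next
    case False
    then show ?thesis using nat[of "k + of_int m * axis j 1" "nat (- m)" j]
      by (simp add: norm_minus_commute algebra_simps)
  qed
  have *: "cmod (g (k + (\<Sum>j\<in>A. of_int (m j) * axis j 1)) - g k) \<le> C * (\<Sum>j\<in>A. \<bar>real_of_int (m j)\<bar>)" if "finite A" for A m k
    using that
  proof (induction A arbitrary: k rule: finite_induct)
    case (insert j A)
    define k' where "k' = k + of_int (m j) * axis j 1"
    have e: "k + (\<Sum>j\<in>insert j A. of_int (m j) * axis j 1) = k' + (\<Sum>j\<in>A. of_int (m j) * axis j 1)"
      using insert by (simp add: k'_def add.assoc)
    have "cmod ((g (k' + (\<Sum>j\<in>A. of_int (m j) * axis j 1)) - g k') + (g k' - g k))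
       \<le> C * (\<Sum>j\<in>A. \<bar>real_of_int (m j)\<bar>) + C * \<bar>real_of_int (m j)\<bar>"
      by (intro norm_triangle_mono insert.IH) (simp add: k'_def int)
    then show ?case unfolding e using insert by (simp add: distrib_left)
  qed simp
  have "l = k + (\<Sum>j\<in>UNIV. of_int (l $ j - k $ j) * axis j 1)"
  proof -
    have i: "(of_int z :: int ^ 'n) $ i = z" for z i
      by (cases z rule: int_cases2) (auto simp: of_nat_index)
    show ?thesis
      by (auto simp: vec_eq_iff axis_def i if_distrib[of "\<lambda>z. _ * z"] simp del: of_int_diff cong: if_cong)
  qed
  then show ?thesis using *[of UNIV k "\<lambda>j. l $ j - k $ j"] by simp
qed

lemma symbol_fcoef_lipschitz:
  fixes a :: "int ^ 'n::{finite,linorder} \<Rightarrow> real ^ 'n::{finite,linorder} \<Rightarrow> complex"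
  assumes a: "a \<in> symbols 1"
  shows "\<exists>C\<ge>0. \<forall>k l q. cmod (fcoef (a l) q - fcoef (a k) q) \<le> C * rho (k - l) / rho q ^ N"
proof -
  obtain C where C: "\<And>i. C i \<ge> 0" "\<And>i k q. cmod (fcoef (a (k + axis i 1)) q - fcoef (a k) q) \<le> C i / rho q ^ N"
    using symbol_fcoef(4)[OF a, where N = N] by metis
  define S where "S = (\<Sum>i\<in>UNIV. C i)"
  have S: "S \<ge> 0" "C i \<le> S" for i unfolding S_def by (auto intro!: sum_nonneg member_le_sum simp: C)
  have "cmod (fcoef (a l) q - fcoef (a k) q) \<le> (S * real CARD('n)) * rho (k - l) / rho q ^ N" for k l q
  proof -
    have "cmod (fcoef (a l) q - fcoef (a k) q) \<le> (S / rho q ^ N) * (\<Sum>j\<in>UNIV. \<bar>real_of_int (l $ j - k $ j)\<bar>)"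
      by (intro lattice_lipschitz order_trans[OF C(2)] divide_right_mono S) auto
    also have "\<dots> \<le> (S / rho q ^ N) * (\<Sum>j\<in>(UNIV::'n set). rho (k - l))"
    proof (intro mult_left_mono sum_mono)
      fix j
      have "\<bar>real_of_int ((l - k) $ j)\<bar> \<le> rho (l - k)"
        using coord_le_lat_norm[of "l - k" j] unfolding rho_def by linarith
      then show "\<bar>real_of_int (l $ j - k $ j)\<bar> \<le> rho (k - l)" using rho_minus_commute[of k l] by simp
    qed (use S in simp)
    finally show ?thesis by (simp add: mult_ac)
  qed
  moreover have "S * real CARD('n) \<ge> 0" using S by simp
  ultimately show ?thesis by blast
qed

subsection \<open>Parametrix and elliptic regularity\<close>

definition symbol_matrix ::
  "(int ^ 'n::finite \<Rightarrow> real ^ 'n \<Rightarrow> complex) \<Rightarrow> int ^ 'n \<Rightarrow> int ^ 'n \<Rightarrow> complex" where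
  "symbol_matrix a k l = fcoef (a k) (k - l)"

lemma rho_power_le: "rho k ^ t \<le> rho l ^ t * rho (k - l) ^ t"
  using power_mono[OF rho_le[of k l], of t] by (simp add: power_mult_distrib)

lemma summable_decay:
  assumes "\<And>q :: int ^ 'n::finite. cmod (f q) \<le> C / rho q ^ (2 * CARD('n))"
  shows "(\<lambda>q. cmod (f q)) summable_on UNIV"
proof (rule summable_on_comparison_test)
  show "(\<lambda>q :: int ^ 'n. C * (1 / rho q ^ (2 * CARD('n)))) summable_on UNIV"
    by (intro summable_on_cmult_right summable_rho)
qed (use assms in auto)

text \<open>
  Matrices dominated by \<open>\<rho>(k)\<close> resp. \<open>1/\<rho>(k)\<close> with rapid decay in \<open>k - l\<close> change the weight by
  one order, because \<open>\<rho>\<close> is submultiplicative.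
\<close>

lemma order_plus_bound:
  fixes M :: "int ^ 'n::finite \<Rightarrow> int ^ 'n \<Rightarrow> complex"
  assumes "\<And>N. \<exists>C\<ge>0. \<forall>k l. cmod (M k l) \<le> C * rho k / rho (k - l) ^ N"
  shows "\<exists>C\<ge>0. \<forall>u. wt (Suc t) u \<in> l2 \<longrightarrow>
    (\<forall>k. (\<lambda>l. cmod (M k l * u l)) summable_on UNIV) \<and>
    wt t (matvec M u) \<in> l2 \<and> l2_norm (wt t (matvec M u)) \<le> C * l2_norm (wt (Suc t) u)"
proof -
  obtain C where C: "C \<ge> 0" "\<And>k l. cmod (M k l) \<le> C * rho k / rho (k - l) ^ (2 * CARD('n) + Suc t)"
    using assms by metis
  have "rho k ^ t * cmod (M k l) \<le> C * rho l ^ Suc t / rho (k - l) ^ (2 * CARD('n))" for k l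
  proof -
    have "rho k ^ t * cmod (M k l) \<le> rho k ^ t * (C * rho k / rho (k - l) ^ (2 * CARD('n) + Suc t))"
      by (intro mult_left_mono C) auto
    also have "\<dots> = C * rho k ^ Suc t / rho (k - l) ^ (2 * CARD('n) + Suc t)" by (simp add: mult_ac)
    also have "\<dots> \<le> C * (rho l ^ Suc t * rho (k - l) ^ Suc t) / rho (k - l) ^ (2 * CARD('n) + Suc t)"
      by (intro divide_right_mono mult_left_mono rho_power_le C(1)) auto
    also have "\<dots> = C * rho l ^ Suc t / rho (k - l) ^ (2 * CARD('n))" by (simp add: power_add field_simps)
    finally show ?thesis .
  qed
  note * = weighted_bound[OF this]
  show ?thesis
    by (rule exI[of _ "C * rho_sum TYPE('n)"]) (auto simp: * C(1) rho_sum_nonneg)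
qed

lemma order_minus_bound:
  fixes M :: "int ^ 'n::finite \<Rightarrow> int ^ 'n \<Rightarrow> complex"
  assumes "\<And>N. \<exists>C\<ge>0. \<forall>k l. cmod (M k l) \<le> C / rho k / rho (k - l) ^ N"
  shows "\<exists>C\<ge>0. \<forall>u. wt t u \<in> l2 \<longrightarrow>
    (\<forall>k. (\<lambda>l. cmod (M k l * u l)) summable_on UNIV) \<and>
    wt (Suc t) (matvec M u) \<in> l2 \<and> l2_norm (wt (Suc t) (matvec M u)) \<le> C * l2_norm (wt t u)"
proof -
  obtain C where C: "C \<ge> 0" "\<And>k l. cmod (M k l) \<le> C / rho k / rho (k - l) ^ (2 * CARD('n) + t)"
    using assms by metis
  have "rho k ^ Suc t * cmod (M k l) \<le> C * rho l ^ t / rho (k - l) ^ (2 * CARD('n))" for k l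
  proof -
    have "rho k ^ Suc t * cmod (M k l) \<le> rho k ^ Suc t * (C / rho k / rho (k - l) ^ (2 * CARD('n) + t))"
      by (intro mult_left_mono C) auto
    also have "\<dots> = C * rho k ^ t / rho (k - l) ^ (2 * CARD('n) + t)" by (simp add: field_simps)
    also have "\<dots> \<le> C * (rho l ^ t * rho (k - l) ^ t) / rho (k - l) ^ (2 * CARD('n) + t)"
      by (intro divide_right_mono mult_left_mono rho_power_le C(1)) auto
    also have "\<dots> = C * rho l ^ t / rho (k - l) ^ (2 * CARD('n))" by (simp add: power_add field_simps)
    finally show ?thesis .
  qed
  note * = weighted_bound[OF this]
  show ?thesis
    by (rule exI[of _ "C * rho_sum TYPE('n)"]) (auto simp: * C(1) rho_sum_nonneg)
qed

text \<open>
  Products of matrices with decay away from the diagonal have such decay: by submultiplicativity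
  the powers of \<open>\<rho>(k - l)\<close> and \<open>\<rho>(l - m)\<close> together pay for \<open>\<rho>(k - m)\<close>, and a summable factor is
  left.
\<close>

lemma convolution_decay:
  fixes k m :: "int ^ 'n::finite"
  assumes f: "\<And>l. 0 \<le> f l \<and> f l \<le> C / rho (k - l) ^ (2 * CARD('n) + N) / rho (l - m) ^ N" and C: "C \<ge> 0"
  shows "f summable_on UNIV" "(\<Sum>\<^sub>\<infinity>l. f l) \<le> C * rho_sum TYPE('n) / rho (k - m) ^ N"
proof -
  define g where "g = (\<lambda>q :: int ^ 'n. C / rho (k - m) ^ N * (1 / rho q ^ (2 * CARD('n))))"
  have le: "f l \<le> g (k - l)" for l
  proof -
    have "rho (k - m) ^ N \<le> rho (k - l) ^ N * rho (l - m) ^ N"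
      using power_mono[OF rho_add_le[of "k - l" "l - m"], of N] by (simp add: power_mult_distrib)
    then have "C / (rho (k - l) ^ N * rho (l - m) ^ N) \<le> C / rho (k - m) ^ N"
      by (intro divide_left_mono C) auto
    then have "C / (rho (k - l) ^ N * rho (l - m) ^ N) / rho (k - l) ^ (2 * CARD('n)) \<le> C / rho (k - m) ^ N / rho (k - l) ^ (2 * CARD('n))"
      by (rule divide_right_mono) simp
    moreover have "C / rho (k - l) ^ (2 * CARD('n) + N) / rho (l - m) ^ N = C / (rho (k - l) ^ N * rho (l - m) ^ N) / rho (k - l) ^ (2 * CARD('n))"
      by (simp add: power_add mult_ac)
    moreover have "f l \<le> C / rho (k - l) ^ (2 * CARD('n) + N) / rho (l - m) ^ N" using f by blast
    ultimately have "f l \<le> C / rho (k - m) ^ N / rho (k - l) ^ (2 * CARD('n))" by linarith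
    then show ?thesis by (simp add: g_def)
  qed
  have g: "g summable_on UNIV" unfolding g_def by (intro summable_on_cmult_right summable_rho)
  then have gs: "(\<lambda>l. g (k - l)) summable_on UNIV" by (simp add: summable_reflect)
  show s: "f summable_on UNIV" by (rule summable_on_comparison_test[OF gs]) (use f le in auto)
  have "(\<Sum>\<^sub>\<infinity>l. f l) \<le> (\<Sum>\<^sub>\<infinity>l. g (k - l))" by (intro infsum_mono s gs le)
  also have "\<dots> = (\<Sum>\<^sub>\<infinity>l. g l)" by (rule infsum_reflect)
  also have "\<dots> = C * rho_sum TYPE('n) / rho (k - m) ^ N"
    unfolding g_def rho_sum_def infsum_cmult_right' by simp
  finally show "(\<Sum>\<^sub>\<infinity>l. f l) \<le> C * rho_sum TYPE('n) / rho (k - m) ^ N" .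
qed

text \<open>
  The parametrix is the matrix of the symbol \<open>1/a\<close> (cut off where \<open>a\<close> may vanish). Freezing \<open>k\<close> in
  \<open>a(l,x)\<close> would make its product with the matrix of \<open>a\<close> the Fourier series of \<open>1\<close>; the error of
  freezing is controlled by first differences of \<open>a\<close>, which are one order lower.
\<close>

lemma parametrix:
  fixes a :: "int ^ 'n::{finite,linorder} \<Rightarrow> real ^ 'n::{finite,linorder} \<Rightarrow> complex"
  assumes ell: "a \<in> elliptic_symbols 1"
  obtains B R where "\<And>N. \<exists>C\<ge>0. \<forall>k l. cmod (B k l) \<le> C / rho k / rho (k - l) ^ N"
    "\<And>N. \<exists>C\<ge>0. \<forall>k l. cmod (R k l) \<le> C / rho k / rho (k - l) ^ N"
    "\<And>k m. (\<Sum>\<^sub>\<infinity>l. B k l * symbol_matrix a l m) = (if k = m then 1 else 0) + R k m"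
proof -
  have a: "a \<in> symbols 1" using ell by (simp add: elliptic_symbols_def)
  obtain c r where c: "c > 0" "r > 0" "\<And>k x. lat_norm k > r \<Longrightarrow> cmod (a k x) \<ge> c * rho k"
    using ell by (auto simp: elliptic_symbols_def rho_def)
  note sm = symbol_fcoef(1)[OF a]
  \<comment> \<open>The symbol normalized to order \<open>0\<close>, replaced by \<open>1\<close> where it may vanish.\<close>
  define F where "F = (\<lambda>k. if lat_norm k > r then (\<lambda>x. of_real (1 / rho k) * a k x) else (\<lambda>x. 1))"
  have dF: "dir_bounded j s F" for j s
    unfolding F_def by (intro dir_bounded_If symbol_fcoef(2)[OF a] dir_bounded_const)
  have lowF: "cmod (F k x) \<ge> min c 1" for k x
  proof (cases "lat_norm k > r")
    case True
    then have "c \<le> cmod (a k x) / rho k" using c(3)[OF True, of x] by (simp add: field_simps)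
    then show ?thesis using True by (simp add: F_def norm_mult norm_divide)
  qed (simp add: F_def)
  have F0: "F k x \<noteq> 0" for k x using lowF[of k x] c(1) by auto
  define G where "G = (\<lambda>k x. inverse (F k x))"
  have dG: "dir_bounded j s G" for j s
    unfolding G_def using c(1) by (intro dir_bounded_inverse[OF dF _ lowF]) auto
  have G0: "continuous_on UNIV (G k)" "periodic (G k)" for k using dG[of undefined 0] by auto
  note Gd = fcoef_decay[OF dG]
  define B where "B = (\<lambda>k l. of_real (1 / rho k) * fcoef (G k) (k - l))"
  have Bd: "\<exists>C\<ge>0. \<forall>k l. cmod (B k l) \<le> C / rho k / rho (k - l) ^ N" for N
  proof -
    obtain C where "C \<ge> 0" "\<And>k q. cmod (fcoef (G k) q) \<le> C / rho q ^ N" using Gd by blast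
    then have "cmod (B k l) \<le> C / rho k / rho (k - l) ^ N" for k l
      using divide_right_mono[of "cmod (fcoef (G k) (k - l))" "C / rho (k - l) ^ N" "rho k"]
      by (simp add: B_def norm_mult norm_divide mult.commute)
    then show ?thesis using \<open>C \<ge> 0\<close> by blast
  qed
  \<comment> \<open>\<open>H k\<close> is \<open>1\<close> where \<open>|k| > r\<close>; \<open>R\<close> collects its deviation from \<open>1\<close> and the error of freezing \<open>k\<close>.\<close>
  define H where "H = (\<lambda>k x. of_real (1 / rho k) * (G k x * a k x))"
  define R where "R = (\<lambda>k m. (\<Sum>\<^sub>\<infinity>l. B k l * (fcoef (a l) (l - m) - fcoef (a k) (l - m)))
     + (fcoef (H k) (k - m) - (if k = m then 1 else 0)))"
  have frozen: "((\<lambda>l. B k l * fcoef (a k) (l - m)) has_sum fcoef (H k) (k - m)) UNIV" for k m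
  proof -
    have "(\<lambda>q. cmod (fcoef (G k) q)) summable_on UNIV"
      using Gd[of "2 * CARD('n)"] summable_decay by metis
    then have "((\<lambda>p. fcoef (G k) p * fcoef (a k) ((k - m) - p)) has_sum fcoef (\<lambda>x. G k x * a k x) (k - m)) UNIV"
      by (intro fcoef_mult G0 smooth_torusD[OF sm])
    then have "((\<lambda>l. fcoef (G k) (k - l) * fcoef (a k) ((k - m) - (k - l))) has_sum fcoef (\<lambda>x. G k x * a k x) (k - m)) UNIV"
      by (rule iffD2[OF has_sum_reindex_bij_betw[OF bij_minus[of k], of "\<lambda>p. fcoef (G k) p * fcoef (a k) ((k - m) - p)"]])
    from has_sum_cmult_right[OF this, of "of_real (1 / rho k)"]
    have "((\<lambda>l. B k l * fcoef (a k) (l - m)) has_sum of_real (1 / rho k) * fcoef (\<lambda>x. G k x * a k x) (k - m)) UNIV"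
      by (simp add: B_def mult.assoc)
    moreover have "fcoef (H k) q = of_real (1 / rho k) * fcoef (\<lambda>x. G k x * a k x) q" for q
    proof -
      have "(\<lambda>x. ee q x * (of_real (1 / rho k) * (G k x * a k x))) = (\<lambda>x. of_real (1 / rho k) * (ee q x * (G k x * a k x)))"
        by (simp add: mult_ac)
      then show ?thesis
        unfolding fcoef_def H_def by (simp only: Henstock_Kurzweil_Integration.integral_mult_right)
    qed
    ultimately show ?thesis by simp
  qed
  have diff: "(\<lambda>l. B k l * (fcoef (a l) (l - m) - fcoef (a k) (l - m))) summable_on UNIV"
     "\<exists>C\<ge>0. \<forall>k m. cmod (\<Sum>\<^sub>\<infinity>l. B k l * (fcoef (a l) (l - m) - fcoef (a k) (l - m))) \<le> C / rho k / rho (k - m) ^ N" for k m N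
  proof -
    have *: "\<exists>C\<ge>0. \<forall>k m. (\<lambda>l. cmod (B k l * (fcoef (a l) (l - m) - fcoef (a k) (l - m)))) summable_on UNIV \<and>
       (\<Sum>\<^sub>\<infinity>l. cmod (B k l * (fcoef (a l) (l - m) - fcoef (a k) (l - m)))) \<le> C / rho k / rho (k - m) ^ N" for N
    proof -
      obtain C1 where C1: "C1 \<ge> 0" "\<And>k l. cmod (B k l) \<le> C1 / rho k / rho (k - l) ^ (2 * CARD('n) + N + 1)"
        using Bd by metis
      obtain C2 where C2: "C2 \<ge> 0" "\<And>k l q. cmod (fcoef (a l) q - fcoef (a k) q) \<le> C2 * rho (k - l) / rho q ^ N"
        using symbol_fcoef_lipschitz[OF a] by metis
      have le: "cmod (B k l * (fcoef (a l) (l - m) - fcoef (a k) (l - m)))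
          \<le> (C1 * C2 / rho k) / rho (k - l) ^ (2 * CARD('n) + N) / rho (l - m) ^ N" for k l m
      proof -
        have "cmod (B k l * (fcoef (a l) (l - m) - fcoef (a k) (l - m)))
          \<le> (C1 / rho k / rho (k - l) ^ (2 * CARD('n) + N + 1)) * (C2 * rho (k - l) / rho (l - m) ^ N)"
          unfolding norm_mult by (intro mult_mono C1 C2) (auto simp: C1)
        also have "\<dots> = (C1 * C2 / rho k) / rho (k - l) ^ (2 * CARD('n) + N) / rho (l - m) ^ N"
          by (simp add: field_simps)
        finally show ?thesis .
      qed
      have "(\<lambda>l. cmod (B k l * (fcoef (a l) (l - m) - fcoef (a k) (l - m)))) summable_on UNIV \<and>
       (\<Sum>\<^sub>\<infinity>l. cmod (B k l * (fcoef (a l) (l - m) - fcoef (a k) (l - m)))) \<le> (C1 * C2 / rho k) * rho_sum TYPE('n) / rho (k - m) ^ N" for k m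
        using convolution_decay[of "\<lambda>l. cmod (B k l * (fcoef (a l) (l - m) - fcoef (a k) (l - m)))" "C1 * C2 / rho k" k N m] le C1 C2
        by auto
      then show ?thesis using C1 C2 rho_sum_nonneg[where 'n = 'n]
        by (intro exI[of _ "C1 * C2 * rho_sum TYPE('n)"]) auto
    qed
    show "(\<lambda>l. B k l * (fcoef (a l) (l - m) - fcoef (a k) (l - m))) summable_on UNIV"
      by (rule abs_summable_summable) (use *[of 0] in blast)
    obtain C where C: "C \<ge> 0" "\<And>k m. (\<lambda>l. cmod (B k l * (fcoef (a l) (l - m) - fcoef (a k) (l - m)))) summable_on UNIV"
       "\<And>k m. (\<Sum>\<^sub>\<infinity>l. cmod (B k l * (fcoef (a l) (l - m) - fcoef (a k) (l - m)))) \<le> C / rho k / rho (k - m) ^ N"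
      using *[of N] by blast
    then show "\<exists>C\<ge>0. \<forall>k m. cmod (\<Sum>\<^sub>\<infinity>l. B k l * (fcoef (a l) (l - m) - fcoef (a k) (l - m))) \<le> C / rho k / rho (k - m) ^ N"
      using order_trans[OF norm_infsum_bound[OF C(2)] C(3)] C(1) by (intro exI[of _ C]) simp
  qed
  have BA: "(\<Sum>\<^sub>\<infinity>l. B k l * symbol_matrix a l m) = (if k = m then 1 else 0) + R k m" for k m
  proof -
    have "((\<lambda>l. B k l * (fcoef (a l) (l - m) - fcoef (a k) (l - m)) + B k l * fcoef (a k) (l - m))
      has_sum ((\<Sum>\<^sub>\<infinity>l. B k l * (fcoef (a l) (l - m) - fcoef (a k) (l - m))) + fcoef (H k) (k - m))) UNIV"
      by (intro has_sum_add frozen has_sum_infsum diff)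
    then have "((\<lambda>l. B k l * symbol_matrix a l m) has_sum ((if k = m then 1 else 0) + R k m)) UNIV"
      by (simp add: R_def symbol_matrix_def right_diff_distrib)
    then show ?thesis by (rule infsumI)
  qed
  have "\<exists>C\<ge>0. \<forall>k m. cmod (R k m) \<le> C / rho k / rho (k - m) ^ N" for N
  proof -
    obtain C1 where C1: "C1 \<ge> 0"
      "\<And>k m. cmod (\<Sum>\<^sub>\<infinity>l. B k l * (fcoef (a l) (l - m) - fcoef (a k) (l - m))) \<le> C1 / rho k / rho (k - m) ^ N"
      using diff(2)[of N] by blast
    have dH: "dir_bounded j s (\<lambda>k x. G k x * (of_real (1 / rho k) * a k x))" for j s
      by (intro dir_bounded_mult dG symbol_fcoef(2)[OF a])
    have "H = (\<lambda>k x. G k x * (of_real (1 / rho k) * a k x))" by (simp add: H_def mult_ac)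
    then have "dir_bounded j s H" for j s using dH by simp
    then obtain C2 where C2: "C2 \<ge> 0" "\<And>k q. cmod (fcoef (H k) q) \<le> C2 / rho q ^ N"
      using fcoef_decay[of H N] by blast
    have "cmod (fcoef (H k) (k - m) - (if k = m then 1 else 0)) \<le> (C2 + 1) * (1 + r) / rho k / rho (k - m) ^ N" for k m
    proof (cases "lat_norm k > r")
      case True
      have nz: "a k x \<noteq> 0" for x
      proof -
        have "0 < c * rho k" using c(1) by simp
        then show ?thesis using c(3)[OF True, of x] by auto
      qed
      have "H k = (\<lambda>x. 1)" using True nz by (auto simp: H_def G_def F_def)
      moreover have "fcoef (\<lambda>x. 1) (k - m) = (if k = m then 1 else 0)"
        using integral_ee[of "k - m"] by (simp add: fcoef_def)
      ultimately show ?thesis using C2(1) c(2) by simp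
    next
      case False
      have "cmod (fcoef (H k) (k - m) - (if k = m then 1 else 0)) \<le> C2 / rho (k - m) ^ N + 1 / rho (k - m) ^ N"
        by (intro order_trans[OF norm_triangle_ineq4] add_mono C2) auto
      also have "\<dots> = (C2 + 1) / rho (k - m) ^ N * 1" by (simp add: add_divide_distrib)
      also have "\<dots> \<le> (C2 + 1) / rho (k - m) ^ N * ((1 + r) / rho k)"
      proof (rule mult_left_mono)
        have "rho k \<le> 1 + r" using False by (simp add: rho_def)
        then show "1 \<le> (1 + r) / rho k" by (simp add: le_divide_eq_1_pos)
      qed (use C2(1) in simp)
      finally show ?thesis by (simp add: mult_ac)
    qed
    then have "cmod (R k m) \<le> C1 / rho k / rho (k - m) ^ N + (C2 + 1) * (1 + r) / rho k / rho (k - m) ^ N" for k m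
      unfolding R_def by (intro order_trans[OF norm_triangle_ineq] add_mono C1)
    then show ?thesis using C1 C2 c(2)
      by (intro exI[of _ "C1 + (C2 + 1) * (1 + r)"]) (auto simp: add_divide_distrib)
  qed
  from that[OF Bd this BA] show ?thesis .
qed

lemma wt_imp_l2: "wt t u \<in> l2 \<Longrightarrow> u \<in> l2"
  using wt_mono(1)[of 0 t u] by simp

lemma symbol_matrix_bound:
  assumes a: "a \<in> symbols 1"
  shows "\<exists>C\<ge>0. \<forall>k l. cmod (symbol_matrix a k l) \<le> C * rho k / rho (k - l) ^ N"
  using symbol_fcoef(3)[OF a] unfolding symbol_matrix_def by blast

text \<open>Rows of the matrix are summable, so it acts pointwise on all of \<open>\<ell>\<^sup>2\<close>.\<close>

lemma symbol_matrix_row_bound: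
  fixes a :: "int ^ 'n::{finite,linorder} \<Rightarrow> real ^ 'n::{finite,linorder} \<Rightarrow> complex"
  assumes a: "a \<in> symbols 1"
  shows "\<exists>C\<ge>0. \<forall>u k. u \<in> l2 \<longrightarrow> (\<lambda>l. cmod (symbol_matrix a k l * u l)) summable_on UNIV \<and>
     (\<Sum>\<^sub>\<infinity>l. cmod (symbol_matrix a k l * u l)) \<le> C * rho k * l2_norm u"
proof -
  obtain C where C: "C \<ge> 0" "\<And>k l. cmod (symbol_matrix a k l) \<le> C * rho k / rho (k - l) ^ (2 * CARD('n))"
    using symbol_matrix_bound[OF a] by metis
  have "(\<lambda>l. cmod (symbol_matrix a k l * u l)) summable_on UNIV \<and>
     (\<Sum>\<^sub>\<infinity>l. cmod (symbol_matrix a k l * u l)) \<le> (C * rho_sum TYPE('n)) * rho k * l2_norm u" if u: "u \<in> l2" for u k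
  proof -
    define g where "g = (\<lambda>q :: int ^ 'n::{finite,linorder}. (C * rho k * l2_norm u) * (1 / rho q ^ (2 * CARD('n))))"
    have le: "cmod (symbol_matrix a k l * u l) \<le> g (k - l)" for l
    proof -
      have "cmod (symbol_matrix a k l * u l) \<le> (C * rho k / rho (k - l) ^ (2 * CARD('n))) * l2_norm u"
        unfolding norm_mult by (intro mult_mono C cmod_le_l2_norm u) (auto simp: C)
      then show ?thesis by (simp add: g_def mult_ac)
    qed
    have "g summable_on UNIV" unfolding g_def by (intro summable_on_cmult_right summable_rho)
    then have gs: "(\<lambda>l. g (k - l)) summable_on UNIV" by (simp add: summable_reflect)
    have s: "(\<lambda>l. cmod (symbol_matrix a k l * u l)) summable_on UNIV"
      by (rule summable_on_comparison_test[OF gs]) (auto simp: le)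
    have "(\<Sum>\<^sub>\<infinity>l. cmod (symbol_matrix a k l * u l)) \<le> (\<Sum>\<^sub>\<infinity>l. g (k - l))"
      by (intro infsum_mono s gs le)
    also have "\<dots> = (\<Sum>\<^sub>\<infinity>l. g l)" by (rule infsum_reflect)
    also have "\<dots> = (C * rho_sum TYPE('n)) * rho k * l2_norm u"
      unfolding g_def rho_sum_def infsum_cmult_right' by simp
    finally show ?thesis using s by blast
  qed
  then show ?thesis using C(1) rho_sum_nonneg[where 'n = 'n] by (intro exI[of _ "C * rho_sum TYPE('n)"]) auto
qed

text \<open>
  With the parametrix \<open>B\<close> and its remainder \<open>R\<close>, \<open>u = B (A u) - R u\<close>, and both \<open>B\<close> and \<open>R\<close> gain
  one order. The identity \<open>B (A u) = (B A) u\<close> is an interchange of two sums that converge absolutely.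
\<close>

theorem elliptic_regularity:
  fixes a :: "int ^ 'n::{finite,linorder} \<Rightarrow> real ^ 'n::{finite,linorder} \<Rightarrow> complex"
  assumes ell: "a \<in> elliptic_symbols 1"
  shows "\<exists>C\<ge>0. \<forall>u. wt t u \<in> l2 \<longrightarrow> wt t (matvec (symbol_matrix a) u) \<in> l2 \<longrightarrow>
     wt (Suc t) u \<in> l2 \<and>
     l2_norm (wt (Suc t) u) \<le> C * (l2_norm (wt t (matvec (symbol_matrix a) u)) + l2_norm (wt t u))"
proof -
  have a: "a \<in> symbols 1" using ell by (simp add: elliptic_symbols_def)
  let ?A = "symbol_matrix a"
  obtain B R where B: "\<And>N. \<exists>C\<ge>0. \<forall>k l. cmod (B k l) \<le> C / rho k / rho (k - l) ^ N"
    and R: "\<And>N. \<exists>C\<ge>0. \<forall>k l. cmod (R k l) \<le> C / rho k / rho (k - l) ^ N"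
    and BA: "\<And>k m. (\<Sum>\<^sub>\<infinity>l. B k l * ?A l m) = (if k = m then 1 else 0) + R k m"
    by (rule parametrix[OF ell]) blast
  obtain CB where CB: "CB \<ge> 0" "\<And>u. wt t u \<in> l2 \<Longrightarrow> wt (Suc t) (matvec B u) \<in> l2 \<and>
      l2_norm (wt (Suc t) (matvec B u)) \<le> CB * l2_norm (wt t u)"
    using order_minus_bound[OF B, where t = t] by blast
  obtain CR where CR: "CR \<ge> 0" "\<And>u k. wt t u \<in> l2 \<Longrightarrow> (\<lambda>l. cmod (R k l * u l)) summable_on UNIV"
      "\<And>u. wt t u \<in> l2 \<Longrightarrow> wt (Suc t) (matvec R u) \<in> l2 \<and>
      l2_norm (wt (Suc t) (matvec R u)) \<le> CR * l2_norm (wt t u)"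
    using order_minus_bound[OF R, where t = t] by blast
  obtain CA where CA: "CA \<ge> 0" "\<And>u k. u \<in> l2 \<Longrightarrow> (\<lambda>l. cmod (?A k l * u l)) summable_on UNIV"
     "\<And>u k. u \<in> l2 \<Longrightarrow> (\<Sum>\<^sub>\<infinity>l. cmod (?A k l * u l)) \<le> CA * rho k * l2_norm u"
    using symbol_matrix_row_bound[OF a] by blast
  have "wt (Suc t) u \<in> l2 \<and>
     l2_norm (wt (Suc t) u) \<le> (CB + CR) * (l2_norm (wt t (matvec ?A u)) + l2_norm (wt t u))"
    if u: "wt t u \<in> l2" and Au: "wt t (matvec ?A u) \<in> l2" for u
  proof -
    have ul: "u \<in> l2" using u by (rule wt_imp_l2)
    have eq: "matvec B (matvec ?A u) k = u k + matvec R u k" for k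
    proof -
      obtain C where C: "C \<ge> 0" "\<And>k l. cmod (B k l) \<le> C / rho k / rho (k - l) ^ (2 * CARD('n) + 1)"
        using B by blast
      define f where "f = (\<lambda>l m. B k l * (?A l m * u m))"
      have fl: "(\<lambda>m. cmod (f l m)) summable_on UNIV" for l
        unfolding f_def norm_mult[of "B k l"] by (intro summable_on_cmult_right CA(2) ul)
      have bd0: "(\<Sum>\<^sub>\<infinity>m. cmod (f l m)) \<le> C * CA * l2_norm u / rho (k - l) ^ (2 * CARD('n))" for l
      proof -
        have "(\<Sum>\<^sub>\<infinity>m. cmod (f l m)) = cmod (B k l) * (\<Sum>\<^sub>\<infinity>m. cmod (?A l m * u m))"
          unfolding f_def norm_mult[of "B k l"] by (rule infsum_cmult_right')
        also have "\<dots> \<le> (C / rho k / rho (k - l) ^ (2 * CARD('n) + 1)) * (CA * rho l * l2_norm u)"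
          using C(1) by (intro mult_mono C CA(3) ul infsum_nonneg) auto
        also have "\<dots> = (C * CA * l2_norm u / rho k / rho (k - l) ^ (2 * CARD('n) + 1)) * rho l" by (simp add: mult_ac)
        also have "\<dots> \<le> (C * CA * l2_norm u / rho k / rho (k - l) ^ (2 * CARD('n) + 1)) * (rho k * rho (k - l))"
          using C(1) CA(1) rho_le[of l k] rho_minus_commute[of l k] by (intro mult_left_mono) auto
        also have "\<dots> = C * CA * l2_norm u / rho (k - l) ^ (2 * CARD('n))" by (simp add: field_simps)
        finally show ?thesis .
      qed
      have "(\<lambda>l. C * CA * l2_norm u * (1 / rho (k - l) ^ (2 * CARD('n)))) summable_on UNIV"
        using summable_reflect[of "\<lambda>q. C * CA * l2_norm u * (1 / rho q ^ (2 * CARD('n)))" k]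
        by (simp only: summable_on_cmult_right summable_rho)
      then have fs: "(\<lambda>l. \<Sum>\<^sub>\<infinity>m. cmod (f l m)) summable_on UNIV"
        by (rule summable_on_comparison_test) (auto intro: infsum_nonneg bd0)
      have "(\<lambda>p. norm (case p of (l, m) \<Rightarrow> f l m)) summable_on UNIV \<times> UNIV"
        by (subst Infinite_Sum.abs_summable_on_Sigma_iff) (use fl fs in \<open>simp add: infsum_nonneg\<close>)
      then have s2: "(\<lambda>(l, m). f l m) summable_on UNIV \<times> UNIV" by (rule abs_summable_summable)
      have "matvec B (matvec ?A u) k = (\<Sum>\<^sub>\<infinity>l. \<Sum>\<^sub>\<infinity>m. f l m)"
        unfolding matvec_def f_def by (simp add: infsum_cmult_right')
      also have "\<dots> = (\<Sum>\<^sub>\<infinity>m. \<Sum>\<^sub>\<infinity>l. f l m)" by (rule infsum_swap_banach[OF s2])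
      also have "\<dots> = (\<Sum>\<^sub>\<infinity>m. ((if k = m then 1 else 0) + R k m) * u m)"
      proof (rule infsum_cong)
        fix m
        have "(\<Sum>\<^sub>\<infinity>l. f l m) = (\<Sum>\<^sub>\<infinity>l. (B k l * ?A l m) * u m)" by (simp add: f_def mult.assoc)
        also have "\<dots> = (\<Sum>\<^sub>\<infinity>l. B k l * ?A l m) * u m" by (rule infsum_cmult_left')
        finally show "(\<Sum>\<^sub>\<infinity>l. f l m) = ((if k = m then 1 else 0) + R k m) * u m" by (simp add: BA)
      qed
      also have "\<dots> = (\<Sum>\<^sub>\<infinity>m. (if k = m then u m else 0) + R k m * u m)"
        by (intro infsum_cong) (simp add: distrib_right)
      also have "((\<lambda>m. (if k = m then u m else 0) + R k m * u m) has_sum (u k + matvec R u k)) UNIV"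
        unfolding matvec_def
        by (intro has_sum_add has_sum_infsum abs_summable_summable[OF CR(2)[OF u]] has_sum_finite_neutralI[of "{k}"]) auto
      then have "(\<Sum>\<^sub>\<infinity>m. (if k = m then u m else 0) + R k m * u m) = u k + matvec R u k" by (rule infsumI)
      finally show ?thesis .
    qed
    have n1: "wt (Suc t) u = (\<lambda>k. wt (Suc t) (matvec B (matvec ?A u)) k - wt (Suc t) (matvec R u) k)"
      unfolding wt_def by (simp add: eq distrib_left)
    have n2: "(\<lambda>k. wt (Suc t) (matvec B (matvec ?A u)) k - wt (Suc t) (matvec R u) k) \<in> l2"
      "l2_norm (\<lambda>k. wt (Suc t) (matvec B (matvec ?A u)) k - wt (Suc t) (matvec R u) k)
        \<le> l2_norm (wt (Suc t) (matvec B (matvec ?A u))) + l2_norm (wt (Suc t) (matvec R u))"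
      using CB(2)[OF Au] CR(3)[OF u] by (auto intro: l2_diff)
    have n3: "l2_norm (wt (Suc t) (matvec B (matvec ?A u))) + l2_norm (wt (Suc t) (matvec R u))
       \<le> (CB + CR) * (l2_norm (wt t (matvec ?A u)) + l2_norm (wt t u))"
    proof -
      have "0 \<le> CB * l2_norm (wt t u)" "0 \<le> CR * l2_norm (wt t (matvec ?A u))" using CB(1) CR(1) by auto
      then show ?thesis using CB(2)[OF Au] CR(3)[OF u] by (simp add: algebra_simps)
    qed
    show ?thesis unfolding n1 using n2(1) order_trans[OF n2(2) n3] by blast
  qed
  then show ?thesis using CB(1) CR(1) by (intro exI[of _ "CB + CR"]) auto
qed

section \<open>Orthonormal families and compact operators\<close>

definition unit_vec :: "'i \<Rightarrow> 'i \<Rightarrow> complex" where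
  "unit_vec k = (\<lambda>l. if l = k then 1 else 0)"

lemma unit_vec_l2 [simp]: "unit_vec k \<in> l2"
  by (rule l2_finite_support) (simp add: unit_vec_def)

lemma l2_inner_unit_vec: "l2_inner u (unit_vec k) = u k"
proof -
  have "((\<lambda>l. u l * cnj (unit_vec k l)) has_sum u k) UNIV"
    by (rule has_sum_finite_neutralI[of "{k}"]) (auto simp: unit_vec_def)
  then show ?thesis unfolding l2_inner_def by (rule infsumI)
qed

lemma l2_tendsto_inner2:
  assumes "l2_tendsto U u" "l2_tendsto V v"
  shows "(\<lambda>m. l2_inner (U m) (V m)) \<longlonglongrightarrow> l2_inner u v"
proof (rule tendsto_dominated)
  have l: "U m \<in> l2" "V m \<in> l2" "u \<in> l2" "v \<in> l2" for m using assms by (auto simp: l2_tendsto_def)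
  show "norm (l2_inner (U m) (V m) - l2_inner u v)
      \<le> l2_norm (\<lambda>k. U m k - u k) * l2_norm (V m) + l2_norm u * l2_norm (\<lambda>k. V m k - v k)" for m
  proof -
    have "l2_inner (U m) (V m) - l2_inner u v = l2_inner (\<lambda>k. U m k - u k) (V m) + l2_inner u (\<lambda>k. V m k - v k)"
      using l by (simp add: l2_inner_diff_left l2_inner_diff_right)
    then show ?thesis
      by (simp only:) (intro order_trans[OF norm_triangle_ineq] add_mono cauchy_schwarz l l2_diff)
  qed
  have "(\<lambda>m. l2_norm (\<lambda>k. U m k - u k) * l2_norm (V m) + l2_norm u * l2_norm (\<lambda>k. V m k - v k))
      \<longlonglongrightarrow> 0 * l2_norm v + l2_norm u * 0"
    using assms l2_tendsto_norm[OF assms(2)] unfolding l2_tendsto_def by (intro tendsto_intros) auto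
  then show "(\<lambda>m. l2_norm (\<lambda>k. U m k - u k) * l2_norm (V m) + l2_norm u * l2_norm (\<lambda>k. V m k - v k)) \<longlonglongrightarrow> 0"
    by simp
qed

lemma l2_tail_sequence:
  assumes "u \<in> l2"
  shows "\<exists>F :: nat \<Rightarrow> 'i set. (\<forall>m. finite (F m)) \<and> l2_tendsto (\<lambda>m k. if k \<in> F m then u k else 0) u"
proof -
  have "\<forall>m. \<exists>F. finite F \<and> l2_norm (\<lambda>k. if k \<in> F then 0 else u k) < inverse (real (Suc m))"
    using l2_tail[OF assms] by (meson inverse_positive_iff_positive of_nat_0_less_iff order_refl zero_less_Suc)
  then obtain F where F: "\<And>m. finite (F m)" "\<And>m. l2_norm (\<lambda>k. if k \<in> F m then 0 else u k) < inverse (real (Suc m))"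
    by metis
  have e: "l2_norm (\<lambda>k. (if k \<in> F m then u k else 0) - u k) = l2_norm (\<lambda>k. if k \<in> F m then 0 else u k)" for m
    unfolding l2_norm_def by (intro arg_cong[of _ _ sqrt] infsum_cong) auto
  have "(\<lambda>m. l2_norm (\<lambda>k. (if k \<in> F m then u k else 0) - u k)) \<longlonglongrightarrow> 0"
    unfolding e by (rule tendsto_dominated[OF _ LIMSEQ_inverse_real_of_nat]) (use F(2) in \<open>simp add: less_imp_le\<close>)
  then show ?thesis using F(1) assms by (intro exI[of _ F]) (auto simp: l2_tendsto_def l2_restrict)
qed

subsection \<open>Expansion in a complete orthonormal family\<close>

text \<open>
  The coefficients with respect to a set \<open>EE\<close> of functions are indexed by all functions and vanish
  off \<open>EE\<close>, so that they form a square summable function in the sense of \<^const>\<open>l2\<close>.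
\<close>

definition hcoeff :: "('i \<Rightarrow> complex) set \<Rightarrow> ('i \<Rightarrow> complex) \<Rightarrow> ('i \<Rightarrow> complex) \<Rightarrow> complex" where
  "hcoeff EE u = (\<lambda>e. if e \<in> EE then l2_inner u e else 0)"

text \<open>
  The adjoint of the coefficient map, that is, the sum of \<open>c e * e\<close> over \<open>e \<in> EE\<close>; as an inner
  product it is defined pointwise for every square summable \<open>c\<close>.
\<close>

definition synth :: "('i \<Rightarrow> complex) set \<Rightarrow> (('i \<Rightarrow> complex) \<Rightarrow> complex) \<Rightarrow> 'i \<Rightarrow> complex" where
  "synth EE c = (\<lambda>k. l2_inner c (hcoeff EE (unit_vec k)))"

definition orthonormal :: "('i \<Rightarrow> complex) set \<Rightarrow> bool" where
  "orthonormal EE \<longleftrightarrow> EE \<subseteq> l2 \<and> (\<forall>e\<in>EE. \<forall>f\<in>EE. l2_inner e f = (if e = f then 1 else 0))"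

definition complete_orthonormal :: "('i \<Rightarrow> complex) set \<Rightarrow> bool" where
  "complete_orthonormal EE \<longleftrightarrow> orthonormal EE \<and> (\<forall>u\<in>l2. (\<forall>e\<in>EE. l2_inner u e = 0) \<longrightarrow> u = (\<lambda>k. 0))"

lemma pythagoras:
  assumes "orthonormal EE" "finite F" "F \<subseteq> EE"
  shows "(l2_norm (\<lambda>k. \<Sum>e\<in>F. c e * e k))\<^sup>2 = (\<Sum>e\<in>F. (cmod (c e))\<^sup>2)"
    and "e \<in> EE \<Longrightarrow> l2_inner (\<lambda>k. \<Sum>e\<in>F. c e * e k) e = (if e \<in> F then c e else 0)"
proof -
  have l: "e \<in> l2" if "e \<in> F" for e using that assms by (auto simp: orthonormal_def)
  have 2: "l2_inner (\<lambda>k. \<Sum>e\<in>F. c e * e k) e = (if e \<in> F then c e else 0)" if "e \<in> EE" for e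
  proof -
    have "l2_inner (\<lambda>k. \<Sum>e\<in>F. c e * e k) e = (\<Sum>f\<in>F. l2_inner (\<lambda>k. c f * f k) e)"
      using assms that l by (intro l2_inner_sum_left) (auto simp: orthonormal_def)
    also have "\<dots> = (\<Sum>f\<in>F. if f = e then c f else 0)"
      using assms that by (intro sum.cong) (auto simp: orthonormal_def l2_inner_scale_left)
    finally show ?thesis using assms(2) by simp
  qed
  then show "e \<in> EE \<Longrightarrow> l2_inner (\<lambda>k. \<Sum>e\<in>F. c e * e k) e = (if e \<in> F then c e else 0)" .
  define s where "s = (\<lambda>k. \<Sum>e\<in>F. c e * e k)"
  have sl: "s \<in> l2" unfolding s_def by (intro l2_sum l2_scale l)
  have "l2_inner s s = (\<Sum>f\<in>F. l2_inner (\<lambda>k. c f * f k) s)"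
    using assms(2) l sl by (subst s_def, intro l2_inner_sum_left) auto
  also have "\<dots> = (\<Sum>f\<in>F. c f * cnj (l2_inner s f))"
    by (simp add: l2_inner_scale_left l2_inner_cnj)
  also have "\<dots> = (\<Sum>f\<in>F. of_real ((cmod (c f))\<^sup>2))"
    by (intro sum.cong refl) (simp add: s_def 2 subsetD[OF assms(3)] complex_norm_square del: of_real_power)
  finally have "l2_inner s s = of_real (\<Sum>f\<in>F. (cmod (c f))\<^sup>2)" by simp
  then show "(l2_norm (\<lambda>k. \<Sum>e\<in>F. c e * e k))\<^sup>2 = (\<Sum>e\<in>F. (cmod (c e))\<^sup>2)"
    unfolding l2_inner_self s_def[symmetric] using of_real_eq_iff by blast
qed

lemma hcoeff_bessel:
  assumes EE: "orthonormal EE" and u: "u \<in> l2"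
  shows "hcoeff EE u \<in> l2" "l2_norm (hcoeff EE u) \<le> l2_norm u"
proof -
  have fin: "(\<Sum>e\<in>F. (cmod (hcoeff EE u e))\<^sup>2) \<le> (l2_norm u)\<^sup>2" if F: "finite F" for F
  proof -
    define G where "G = F \<inter> EE"
    have G: "finite G" "G \<subseteq> EE" using F by (auto simp: G_def)
    define s where "s = (\<lambda>k. \<Sum>e\<in>G. l2_inner u e * e k)"
    have l: "e \<in> l2" if "e \<in> G" for e using that G EE by (auto simp: orthonormal_def)
    have sl: "s \<in> l2" unfolding s_def by (intro l2_sum l2_scale l)
    have s2: "(l2_norm s)\<^sup>2 = (\<Sum>e\<in>G. (cmod (l2_inner u e))\<^sup>2)"
      unfolding s_def by (rule pythagoras(1)[OF EE G])
    have "l2_inner s u = (\<Sum>e\<in>G. l2_inner (\<lambda>k. l2_inner u e * e k) u)"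
      using G l u by (subst s_def, intro l2_inner_sum_left) auto
    also have "\<dots> = (\<Sum>e\<in>G. of_real ((cmod (l2_inner u e))\<^sup>2))"
      by (intro sum.cong refl) (metis l2_inner_scale_left l2_inner_cnj complex_norm_square)
    finally have "Re (l2_inner s u) = (l2_norm s)\<^sup>2" using s2 by simp
    then have "0 \<le> (l2_norm u)\<^sup>2 - (l2_norm s)\<^sup>2"
      using l2_norm_diff_sq[OF sl u] zero_le_power2[of "l2_norm (\<lambda>k. s k - u k)"] by linarith
    moreover have "(\<Sum>e\<in>F. (cmod (hcoeff EE u e))\<^sup>2) = (\<Sum>e\<in>G. (cmod (l2_inner u e))\<^sup>2)"
      unfolding G_def hcoeff_def using F by (intro sum.mono_neutral_cong_right) auto
    ultimately show ?thesis using s2 by simp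
  qed
  show "hcoeff EE u \<in> l2" "l2_norm (hcoeff EE u) \<le> l2_norm u"
    using l2_boundI[of "hcoeff EE u" "l2_norm u"] fin by auto
qed

lemma synth_finite:
  assumes "finite F" "F \<subseteq> EE" "EE \<subseteq> l2"
  shows "synth EE (\<lambda>e. if e \<in> F then c e else 0) = (\<lambda>k. \<Sum>e\<in>F. c e * e k)"
proof
  fix k
  have "((\<lambda>e. (if e \<in> F then c e else 0) * cnj (hcoeff EE (unit_vec k) e)) has_sum (\<Sum>e\<in>F. c e * cnj (hcoeff EE (unit_vec k) e))) UNIV"
    using assms by (intro has_sum_finite_neutralI[of F]) auto
  moreover have "cnj (hcoeff EE (unit_vec k) e) = e k" if "e \<in> F" for e
    using that assms l2_inner_unit_vec[of e k] by (auto simp: hcoeff_def l2_inner_cnj)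
  ultimately show "synth EE (\<lambda>e. if e \<in> F then c e else 0) k = (\<Sum>e\<in>F. c e * e k)"
    unfolding synth_def l2_inner_def by (simp add: infsumI)
qed

text \<open>
  For finitely many coefficients these are identities between finite sums; the general case follows by
  approximation, since the coefficients converge in norm and the synthesized functions converge
  pointwise with bounded norms.
\<close>

lemma synth_props:
  assumes EE: "orthonormal EE" and c: "c \<in> l2" "\<forall>e. e \<notin> EE \<longrightarrow> c e = 0"
  shows "synth EE c \<in> l2" "l2_norm (synth EE c) \<le> l2_norm c" "hcoeff EE (synth EE c) = c"
    and "v \<in> l2 \<Longrightarrow> l2_inner (synth EE c) v = l2_inner c (hcoeff EE v)"
proof -
  obtain F0 where F0: "\<And>m. finite (F0 m)" "l2_tendsto (\<lambda>m e. if e \<in> F0 m then c e else 0) c"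
    using l2_tail_sequence[OF c(1)] by blast
  define F where "F = (\<lambda>m. F0 m \<inter> EE)"
  define C where "C = (\<lambda>m e. if e \<in> F m then c e else 0)"
  have C_eq: "C = (\<lambda>m e. if e \<in> F0 m then c e else 0)" using c(2) by (auto simp: C_def F_def fun_eq_iff)
  have F: "finite (F m)" "F m \<subseteq> EE" for m using F0 by (auto simp: F_def)
  have Cc: "l2_tendsto C c" unfolding C_eq by (rule F0)
  have EEl: "EE \<subseteq> l2" using EE by (simp add: orthonormal_def)
  have sC: "synth EE (C m) = (\<lambda>k. \<Sum>e\<in>F m. c e * e k)" for m
    unfolding C_def by (rule synth_finite[OF F EEl])
  have sCl: "synth EE (C m) \<in> l2" for m unfolding sC using F EEl by (intro l2_sum l2_scale) auto
  have pt: "(\<lambda>m. synth EE (C m) k) \<longlonglongrightarrow> synth EE c k" for k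
    unfolding synth_def by (intro l2_tendsto_inner Cc hcoeff_bessel EE) simp
  have bd: "l2_norm (synth EE (C m)) \<le> l2_norm c" for m
  proof -
    have "(l2_norm (synth EE (C m)))\<^sup>2 = (\<Sum>e\<in>F m. (cmod (c e))\<^sup>2)"
      unfolding sC by (rule pythagoras(1)[OF EE F])
    also have "\<dots> \<le> (l2_norm c)\<^sup>2" by (rule l2_finite_le[OF c(1) F(1)])
    finally show ?thesis by (rule power2_le_imp_le) simp
  qed
  show "synth EE c \<in> l2" "l2_norm (synth EE c) \<le> l2_norm c"
    using l2_fatou[OF sCl bd pt] by auto
  show inner: "l2_inner (synth EE c) v = l2_inner c (hcoeff EE v)" if v: "v \<in> l2" for v
  proof -
    have "l2_inner (synth EE (C m)) v = l2_inner (C m) (hcoeff EE v)" for m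
    proof -
      have "l2_inner (synth EE (C m)) v = (\<Sum>e\<in>F m. l2_inner (\<lambda>k. c e * e k) v)"
      proof -
        have "e \<in> l2" if "e \<in> F m" for e using that F(2) EEl by blast
        then show ?thesis unfolding sC by (intro l2_inner_sum_left l2_scale F v)
      qed
      also have "\<dots> = (\<Sum>e\<in>F m. c e * cnj (hcoeff EE v e))"
        by (intro sum.cong) (simp_all add: subsetD[OF F(2)] l2_inner_scale_left l2_inner_cnj hcoeff_def)
      also have "\<dots> = l2_inner (C m) (hcoeff EE v)"
      proof -
        have "((\<lambda>e. C m e * cnj (hcoeff EE v e)) has_sum (\<Sum>e\<in>F m. c e * cnj (hcoeff EE v e))) UNIV"
          using F by (intro has_sum_finite_neutralI[of "F m"]) (auto simp: C_def)
        then show ?thesis unfolding l2_inner_def by (rule infsumI[symmetric])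
      qed
      finally show ?thesis .
    qed
    then have "(\<lambda>m. l2_inner (C m) (hcoeff EE v)) \<longlonglongrightarrow> l2_inner (synth EE c) v"
      using l2_weak_inner[OF sCl bd pt v] by simp
    moreover have "(\<lambda>m. l2_inner (C m) (hcoeff EE v)) \<longlonglongrightarrow> l2_inner c (hcoeff EE v)"
      by (intro l2_tendsto_inner Cc hcoeff_bessel EE v)
    ultimately show ?thesis by (rule LIMSEQ_unique)
  qed
  show "hcoeff EE (synth EE c) = c"
  proof
    fix e show "hcoeff EE (synth EE c) e = c e"
    proof (cases "e \<in> EE")
      case True
      then have el: "e \<in> l2" using EEl by blast
      have "hcoeff EE e = unit_vec e"
        by (rule ext) (use EE True in \<open>auto simp: hcoeff_def unit_vec_def orthonormal_def\<close>)
      then show ?thesis using inner[OF el] l2_inner_unit_vec[of c e] True by (simp add: hcoeff_def)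
    qed (simp add: hcoeff_def c)
  qed
qed

text \<open>
  The difference of \<open>u\<close> and the function synthesized from its coefficients is orthogonal to the family,
  hence \<open>0\<close> by completeness.
\<close>

lemma hcoeff_unitary:
  assumes EE: "complete_orthonormal EE" and u: "u \<in> l2"
  shows "synth EE (hcoeff EE u) = u" "l2_norm (hcoeff EE u) = l2_norm u"
    and "v \<in> l2 \<Longrightarrow> l2_inner (hcoeff EE u) (hcoeff EE v) = l2_inner u v"
proof -
  have on: "orthonormal EE" using EE by (simp add: complete_orthonormal_def)
  have c: "hcoeff EE u \<in> l2" "\<forall>e. e \<notin> EE \<longrightarrow> hcoeff EE u e = 0"
    using hcoeff_bessel[OF on u] by (auto simp: hcoeff_def)
  note s = synth_props[OF on c]
  have "l2_inner (\<lambda>k. synth EE (hcoeff EE u) k - u k) e = 0" if "e \<in> EE" for e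
  proof -
    have "e \<in> l2" using on that by (auto simp: orthonormal_def)
    moreover have "l2_inner (synth EE (hcoeff EE u)) e = l2_inner u e"
      using s(3) that by (auto simp: hcoeff_def fun_eq_iff split: if_splits)
    ultimately show ?thesis by (simp add: l2_inner_diff_left s u)
  qed
  then have "(\<lambda>k. synth EE (hcoeff EE u) k - u k) = (\<lambda>k. 0)"
    using EE l2_diff(1)[OF s(1) u] by (simp add: complete_orthonormal_def)
  then show e: "synth EE (hcoeff EE u) = u" by (auto simp: fun_eq_iff)
  show "l2_norm (hcoeff EE u) = l2_norm u"
    using s(2) hcoeff_bessel(2)[OF on u] unfolding e by linarith
  show "l2_inner (hcoeff EE u) (hcoeff EE v) = l2_inner u v" if "v \<in> l2"
    using s(4)[OF that] e by simp
qed

lemma hcoeff_lin: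
  assumes "u \<in> l2" "v \<in> l2" "EE \<subseteq> l2"
  shows "hcoeff EE (\<lambda>k. u k + v k) = (\<lambda>e. hcoeff EE u e + hcoeff EE v e)"
    "hcoeff EE (\<lambda>k. u k - v k) = (\<lambda>e. hcoeff EE u e - hcoeff EE v e)"
    "hcoeff EE (\<lambda>k. z * u k) = (\<lambda>e. z * hcoeff EE u e)"
  by (rule ext; use assms in \<open>auto simp: hcoeff_def l2_inner_add_left l2_inner_diff_left l2_inner_scale_left\<close>)+

subsection \<open>Eigenvectors of compact symmetric operators\<close>

text \<open>
  The quadratic form of a compact symmetric operator attains its supremum on the unit ball, and at a
  maximiser \<open>u\<close> the nonnegative form of \<open>\<mu> - K\<close> vanishes, which forces \<open>K u = \<mu> u\<close>.
\<close>

lemma compact_symmetric_eigenvector: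
  fixes K :: "('i::countable \<Rightarrow> complex) \<Rightarrow> 'i \<Rightarrow> complex"
  assumes V: "V \<subseteq> l2" "\<And>u v. u \<in> V \<Longrightarrow> v \<in> V \<Longrightarrow> (\<lambda>k. u k + v k) \<in> V"
      "\<And>z u. u \<in> V \<Longrightarrow> (\<lambda>k. z * u k) \<in> V"
      "\<And>U B u. (\<And>m. U m \<in> V) \<Longrightarrow> (\<And>m. l2_norm (U m) \<le> B) \<Longrightarrow> (\<And>k. (\<lambda>m. U m k) \<longlonglongrightarrow> u k) \<Longrightarrow> u \<in> V"
    and K: "\<And>u. u \<in> V \<Longrightarrow> K u \<in> V"
      "\<And>u v. u \<in> V \<Longrightarrow> v \<in> V \<Longrightarrow> K (\<lambda>k. u k + v k) = (\<lambda>k. K u k + K v k)"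
      "\<And>z u. u \<in> V \<Longrightarrow> K (\<lambda>k. z * u k) = (\<lambda>k. z * K u k)"
      "\<And>u v. u \<in> V \<Longrightarrow> v \<in> V \<Longrightarrow> l2_inner (K u) v = l2_inner u (K v)"
      "\<And>u. u \<in> V \<Longrightarrow> l2_norm (K u) \<le> l2_norm u"
      "\<And>u. u \<in> V \<Longrightarrow> u \<noteq> (\<lambda>k. 0) \<Longrightarrow> Re (l2_inner (K u) u) > 0"
      "\<And>U B u. (\<And>m. U m \<in> V) \<Longrightarrow> (\<And>m. l2_norm (U m) \<le> B) \<Longrightarrow> (\<And>k. (\<lambda>m. U m k) \<longlonglongrightarrow> u k)
         \<Longrightarrow> l2_tendsto (\<lambda>m. K (U m)) (K u)"
    and ne: "u0 \<in> V" "u0 \<noteq> (\<lambda>k. 0)"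
  shows "\<exists>e\<in>V. \<exists>\<mu>>0. l2_norm e = 1 \<and> K e = (\<lambda>k. of_real \<mu> * e k)"
proof -
  define Q where "Q = (\<lambda>u. Re (l2_inner (K u) u))"
  define D where "D = Q ` {u \<in> V. l2_norm u \<le> 1}"
  define \<mu> where "\<mu> = Sup D"
  have Vl: "u \<in> l2" if "u \<in> V" for u using that V(1) by blast
  have Qle: "Q u \<le> (l2_norm u)\<^sup>2" if "u \<in> V" for u
  proof -
    have "Q u \<le> cmod (l2_inner (K u) u)" unfolding Q_def by (rule complex_Re_le_cmod)
    also have "\<dots> \<le> l2_norm (K u) * l2_norm u" by (intro cauchy_schwarz Vl K(1) that)
    also have "\<dots> \<le> l2_norm u * l2_norm u" by (intro mult_right_mono K(5) that) simp
    finally show ?thesis by (simp add: power2_eq_square)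
  qed
  have bdd: "bdd_above D"
  proof (rule bdd_aboveI)
    fix x assume "x \<in> D"
    then obtain u where u: "u \<in> V" "l2_norm u \<le> 1" "x = Q u" by (auto simp: D_def)
    then show "x \<le> 1" using Qle[OF u(1)] power_le_one[of "l2_norm u" 2] by simp
  qed
  have scale: "Q (\<lambda>k. of_real t * u k) = t\<^sup>2 * Q u" if "u \<in> V" for t u
    unfolding Q_def using that by (simp add: K(3) l2_inner_scale_left l2_inner_scale_right power2_eq_square)
  have Q\<mu>: "Q u \<le> \<mu> * (l2_norm u)\<^sup>2" if u: "u \<in> V" for u
  proof (cases "u = (\<lambda>k. 0)")
    case True
    then show ?thesis by (simp add: Q_def)
  next
    case False
    then have n: "l2_norm u > 0" using l2_norm_eq_0[OF Vl[OF u]] l2_norm_nonneg[of u] by linarith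
    have "(\<lambda>k. of_real (inverse (l2_norm u)) * u k) \<in> {u \<in> V. l2_norm u \<le> 1}"
      using n V(3)[OF u] by (simp add: l2_norm_scale norm_inverse)
    then have "Q (\<lambda>k. of_real (inverse (l2_norm u)) * u k) \<le> \<mu>"
      unfolding \<mu>_def using bdd by (intro cSup_upper) (auto simp: D_def)
    then have "(inverse (l2_norm u))\<^sup>2 * Q u \<le> \<mu>" unfolding scale[OF u] .
    then show ?thesis using n by (simp add: field_simps power2_eq_square)
  qed
  have \<mu>0: "\<mu> > 0"
  proof -
    have "0 < Q u0" using K(6)[OF ne] by (simp add: Q_def)
    then have "0 < \<mu> * (l2_norm u0)\<^sup>2" using Q\<mu>[OF ne(1)] by linarith
    then show ?thesis by (simp add: zero_less_mult_iff)
  qed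
  have "D \<noteq> {}" unfolding D_def using V(3)[OF ne(1), of 0] by auto
  then have "\<exists>u\<in>V. l2_norm u \<le> 1 \<and> Q u > \<mu> - inverse (real (Suc m))" for m
    using less_cSup_iff[of D "\<mu> - inverse (real (Suc m))"] bdd by (auto simp: D_def \<mu>_def)
  then obtain U where U: "\<And>m. U m \<in> V" "\<And>m. l2_norm (U m) \<le> 1" "\<And>m. Q (U m) > \<mu> - inverse (real (Suc m))"
    by metis
  obtain r u where r: "strict_mono (r :: nat \<Rightarrow> nat)" "\<And>k. (\<lambda>m. U (r m) k) \<longlonglongrightarrow> u k"
    using l2_weak_compact[of U 1] U Vl by blast
  have u: "u \<in> V" using V(4)[of "\<lambda>m. U (r m)" 1 u] U r by blast
  have nu: "l2_norm u \<le> 1" using l2_fatou(2)[of "\<lambda>m. U (r m)" 1 u] U Vl r by blast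
  have KU: "l2_tendsto (\<lambda>m. K (U (r m))) (K u)" using K(7)[of "\<lambda>m. U (r m)" 1 u] U r by blast
  have "(\<lambda>m. l2_inner (K (U (r m))) (U (r m)) - l2_inner (K u) (U (r m))) \<longlonglongrightarrow> 0"
  proof (rule tendsto_dominated)
    show "norm (l2_inner (K (U (r m))) (U (r m)) - l2_inner (K u) (U (r m)) - 0) \<le> l2_norm (\<lambda>k. K (U (r m)) k - K u k)" for m
    proof -
      have "norm (l2_inner (\<lambda>k. K (U (r m)) k - K u k) (U (r m))) \<le> l2_norm (\<lambda>k. K (U (r m)) k - K u k) * l2_norm (U (r m))"
        by (intro cauchy_schwarz l2_diff Vl K U u)
      also have "\<dots> \<le> l2_norm (\<lambda>k. K (U (r m)) k - K u k) * 1" by (intro mult_left_mono U) simp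
      finally show ?thesis by (simp add: l2_inner_diff_left Vl K U u)
    qed
  qed (use KU in \<open>simp add: l2_tendsto_def\<close>)
  moreover have "(\<lambda>m. cnj (l2_inner (U (r m)) (K u))) \<longlonglongrightarrow> cnj (l2_inner u (K u))"
    by (intro tendsto_intros l2_weak_inner[where B = 1] Vl U r K u)
  ultimately have "(\<lambda>m. (l2_inner (K (U (r m))) (U (r m)) - l2_inner (K u) (U (r m))) + cnj (l2_inner (U (r m)) (K u)))
     \<longlonglongrightarrow> 0 + cnj (l2_inner u (K u))" by (rule tendsto_add)
  then have "(\<lambda>m. l2_inner (K (U (r m))) (U (r m))) \<longlonglongrightarrow> l2_inner (K u) u"
    by (simp add: l2_inner_cnj)
  then have "(\<lambda>m. Q (U (r m))) \<longlonglongrightarrow> Q u" unfolding Q_def by (rule tendsto_Re)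
  moreover have "(\<lambda>m. \<mu> - inverse (real (Suc (r m)))) \<longlonglongrightarrow> \<mu> - 0"
    using LIMSEQ_subseq_LIMSEQ[OF LIMSEQ_inverse_real_of_nat r(1)] by (intro tendsto_intros) (simp add: o_def)
  ultimately have "\<mu> - 0 \<le> Q u"
    using U(3) by (intro LIMSEQ_le[of "\<lambda>m. \<mu> - inverse (real (Suc (r m)))" _ "\<lambda>m. Q (U (r m))"]) (auto intro: less_imp_le)
  then have Qu: "\<mu> \<le> Q u" by simp
  have nu1: "l2_norm u = 1"
  proof -
    have "\<mu> * 1 \<le> \<mu> * (l2_norm u)\<^sup>2" using Qu Q\<mu>[OF u] by linarith
    then have "1 \<le> (l2_norm u)\<^sup>2" using \<mu>0 by simp
    then show ?thesis using nu power2_le_imp_le[of 1 "l2_norm u"] by simp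
  qed
  \<comment> \<open>Perturb the maximiser in the direction of \<open>w = K u - \<mu> u\<close> and compare terms of first order in \<open>t\<close>.\<close>
  define w where "w = (\<lambda>k. K u k + (- of_real \<mu>) * u k)"
  have w: "w \<in> V" unfolding w_def by (intro V(2) V(3) K(1) u)
  define b where "b = \<mu> * (l2_norm w)\<^sup>2 - Q w"
  have key: "(l2_norm w)\<^sup>2 * (2 * t) \<le> t\<^sup>2 * b" if t: "t > 0" for t
  proof -
    define v where "v = (\<lambda>k. u k + of_real t * w k)"
    have tw: "(\<lambda>k. of_real t * w k) \<in> V" by (intro V(3) w)
    have v: "v \<in> V" unfolding v_def by (intro V(2) u tw)
    have Kv: "K v = (\<lambda>k. K u k + of_real t * K w k)" unfolding v_def using K(2)[OF u tw] K(3)[OF w] by simp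
    have "l2_inner (K v) v = l2_inner (K u) u + of_real t * l2_inner (K u) w + of_real t * l2_inner (K w) u + of_real (t\<^sup>2) * l2_inner (K w) w"
      unfolding Kv unfolding v_def
      by (simp add: l2_inner_add_left l2_inner_add_right l2_add Vl u w K(1) l2_inner_scale_left l2_inner_scale_right power2_eq_square algebra_simps)
    moreover have "Re (l2_inner (K w) u) = Re (l2_inner (K u) w)"
      using K(4)[OF w u] l2_inner_cnj[of w "K u"] by (metis cnj.sel(1))
    ultimately have Qv: "Q v = Q u + 2 * t * Re (l2_inner (K u) w) + t\<^sup>2 * Q w"
      by (simp add: Q_def)
    have nv: "(l2_norm v)\<^sup>2 = 1 + 2 * t * Re (l2_inner u w) + t\<^sup>2 * (l2_norm w)\<^sup>2"
      unfolding v_def using t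
      by (subst l2_norm_add_sq) (simp_all add: Vl u w tw nu1 l2_inner_scale_right l2_norm_scale power_mult_distrib)
    have "l2_inner w w = l2_inner (K u) w - of_real \<mu> * l2_inner u w"
      by (subst (1) w_def) (simp add: l2_inner_diff_left l2_inner_scale_left Vl u w K(1))
    then have ww: "(l2_norm w)\<^sup>2 = Re (l2_inner (K u) w) - \<mu> * Re (l2_inner u w)"
      unfolding l2_inner_self by (metis Re_complex_of_real minus_complex.sel(1) Re_divide_of_real times_complex.sel(1) Im_complex_of_real mult_zero_left diff_zero)
    have "Q v \<le> \<mu> * (l2_norm v)\<^sup>2" by (rule Q\<mu>[OF v])
    then have "Q u + 2 * t * Re (l2_inner (K u) w) + t\<^sup>2 * Q w \<le> \<mu> + \<mu> * (2 * t * Re (l2_inner u w)) + \<mu> * (t\<^sup>2 * (l2_norm w)\<^sup>2)"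
      unfolding Qv nv by (simp add: distrib_left)
    then have "2 * t * Re (l2_inner (K u) w) - \<mu> * (2 * t * Re (l2_inner u w)) \<le> \<mu> * (t\<^sup>2 * (l2_norm w)\<^sup>2) - t\<^sup>2 * Q w"
      using Qu by linarith
    then show ?thesis unfolding ww b_def by (simp add: algebra_simps)
  qed
  have "(l2_norm w)\<^sup>2 \<le> 0"
  proof (rule ccontr)
    assume "\<not> (l2_norm w)\<^sup>2 \<le> 0"
    then have pos: "(l2_norm w)\<^sup>2 > 0" by simp
    have "b \<noteq> 0" using key[of 1] pos by auto
    moreover have "b \<ge> 0" using Q\<mu>[OF w] by (simp add: b_def)
    ultimately have b: "b > 0" by simp
    define t where "t = (l2_norm w)\<^sup>2 / b"
    have t: "t > 0" using pos b by (simp add: t_def)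
    have "t\<^sup>2 * b = (l2_norm w)\<^sup>2 * t" using b by (simp add: t_def power2_eq_square)
    then have "(l2_norm w)\<^sup>2 * t + (l2_norm w)\<^sup>2 * t \<le> (l2_norm w)\<^sup>2 * t" using key[OF t] by simp
    then show False using mult_pos_pos[OF pos t] by linarith
  qed
  then have "l2_norm w = 0" by simp
  then have "w = (\<lambda>k. 0)" using l2_norm_eq_0[OF Vl[OF w]] by simp
  then have "K u = (\<lambda>k. of_real \<mu> * u k)" by (auto simp: w_def fun_eq_iff)
  then show ?thesis using u \<mu>0 nu1 by blast
qed

section \<open>The self-adjoint operator and its eigenvectors\<close>

lemma wt_l2_finite: "finite {k. u k \<noteq> 0} \<Longrightarrow> wt t u \<in> l2"
  by (rule l2_finite_support) (simp add: wt_def)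

lemma wt_diff: "wt t (\<lambda>k. u k - v k) = (\<lambda>k. wt t u k - wt t v k)"
  by (simp add: wt_def right_diff_distrib)

text \<open>
  The spectral theory of an elliptic operator of order one that is bounded below by \<open>1\<close> rests on these
  properties of its matrix; in \<open>bound\<close> and \<open>reg\<close> the order of the Sobolev space is arbitrary, which
  gives the comparison of all powers.
\<close>

locale elliptic_matrix =
  fixes A :: "int ^ 'n::finite \<Rightarrow> int ^ 'n \<Rightarrow> complex"
  assumes herm: "A k l = cnj (A l k)"
    and row: "u \<in> l2 \<Longrightarrow> (\<lambda>l. cmod (A k l * u l)) summable_on UNIV"
    and bound: "\<exists>C\<ge>0. \<forall>u. wt (Suc t) u \<in> l2 \<longrightarrow>
       wt t (matvec A u) \<in> l2 \<and> l2_norm (wt t (matvec A u)) \<le> C * l2_norm (wt (Suc t) u)"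
    and reg: "\<exists>C\<ge>0. \<forall>u. wt t u \<in> l2 \<longrightarrow> wt t (matvec A u) \<in> l2 \<longrightarrow>
       wt (Suc t) u \<in> l2 \<and> l2_norm (wt (Suc t) u) \<le> C * (l2_norm (wt t (matvec A u)) + l2_norm (wt t u))"
    and pos: "finite {k. u k \<noteq> 0} \<Longrightarrow> Re (l2_inner (matvec A u) u) \<ge> (l2_norm u)\<^sup>2"
begin

definition H1 :: "(int ^ 'n \<Rightarrow> complex) set" where "H1 = {u. wt 1 u \<in> l2}"

lemma H1_l2: "u \<in> H1 \<Longrightarrow> u \<in> l2"
  by (auto simp: H1_def intro: wt_imp_l2)

lemma unit_vec_H1: "unit_vec k \<in> H1"
  unfolding H1_def mem_Collect_eq by (rule wt_l2_finite) (simp add: unit_vec_def)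

lemma finite_H1: "finite {k. u k \<noteq> 0} \<Longrightarrow> u \<in> H1"
  by (simp add: H1_def wt_l2_finite)

lemma A_H1: "u \<in> H1 \<Longrightarrow> matvec A u \<in> l2"
  using bound[of 0] unfolding H1_def wt_0 One_nat_def mem_Collect_eq by blast

text \<open>
  By regularity the operator on \<open>H1\<close> is the maximal one.
\<close>

lemma H1_iff: "u \<in> H1 \<longleftrightarrow> u \<in> l2 \<and> matvec A u \<in> l2"
proof
  assume "u \<in> l2 \<and> matvec A u \<in> l2"
  then have "wt (Suc 0) u \<in> l2" using reg[of 0] unfolding wt_0 by blast
  then show "u \<in> H1" by (simp add: H1_def)
qed (simp add: H1_l2 A_H1)

lemma matvec_unit_vec: "matvec A (unit_vec k) = (\<lambda>l. A l k)"
proof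
  fix l
  have "((\<lambda>m. A l m * unit_vec k m) has_sum A l k) UNIV"
    by (rule has_sum_finite_neutralI[of "{k}"]) (auto simp: unit_vec_def)
  then show "matvec A (unit_vec k) l = A l k" unfolding matvec_def by (rule infsumI)
qed

text \<open>
  Since the matrix is Hermitian, \<open>A u\<close> is given by inner products with its columns, which makes it
  continuous under weak convergence.
\<close>

definition column :: "int ^ 'n \<Rightarrow> int ^ 'n \<Rightarrow> complex" where
  "column k = matvec A (unit_vec k)"

lemma matvec_eq_inner: "matvec A u k = l2_inner u (column k)"
  unfolding column_def matvec_unit_vec unfolding l2_inner_def matvec_def
  by (intro infsum_cong) (subst herm, rule mult.commute)

lemma column_l2: "column k \<in> l2"
  unfolding column_def by (rule A_H1[OF unit_vec_H1])

lemma matvec_add: "u \<in> l2 \<Longrightarrow> v \<in> l2 \<Longrightarrow> matvec A (\<lambda>k. u k + v k) = (\<lambda>k. matvec A u k + matvec A v k)"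
  by (rule ext) (simp add: matvec_eq_inner l2_inner_add_left column_l2)

lemma matvec_diff: "u \<in> l2 \<Longrightarrow> v \<in> l2 \<Longrightarrow> matvec A (\<lambda>k. u k - v k) = (\<lambda>k. matvec A u k - matvec A v k)"
  by (rule ext) (simp add: matvec_eq_inner l2_inner_diff_left column_l2)

lemma matvec_scale: "matvec A (\<lambda>k. z * u k) = (\<lambda>k. z * matvec A u k)"
  by (rule ext) (simp add: matvec_eq_inner l2_inner_scale_left)

lemma H1_add: "u \<in> H1 \<Longrightarrow> v \<in> H1 \<Longrightarrow> (\<lambda>k. u k + v k) \<in> H1"
  by (auto simp: H1_iff matvec_add l2_add)

lemma H1_scale: "u \<in> H1 \<Longrightarrow> (\<lambda>k. z * u k) \<in> H1"
  by (auto simp: H1_iff matvec_scale)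

lemma H1_diff: "u \<in> H1 \<Longrightarrow> v \<in> H1 \<Longrightarrow> (\<lambda>k. u k - v k) \<in> H1"
  by (auto simp: H1_iff matvec_diff l2_diff)

text \<open>Truncations of \<open>u\<close> converge in the norm of \<open>H1\<close>, for which \<open>A\<close> is bounded.\<close>

lemma H1_approx:
  assumes u: "u \<in> H1"
  shows "\<exists>U. (\<forall>m :: nat. finite {k. U m k \<noteq> 0}) \<and> l2_tendsto U u \<and> l2_tendsto (\<lambda>m. matvec A (U m)) (matvec A u)"
proof -
  have w: "wt 1 u \<in> l2" using u by (simp add: H1_def)
  obtain F where F: "\<And>m. finite (F m)" "l2_tendsto (\<lambda>m k. if k \<in> F m then wt 1 u k else 0) (wt 1 u)"
    using l2_tail_sequence[OF w] by blast
  define U where "U = (\<lambda>m k. if k \<in> F m then u k else 0)"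
  have fin: "finite {k. U m k \<noteq> 0}" for m using F(1)[of m] by (rule rev_finite_subset) (auto simp: U_def)
  have wU: "wt 1 (U m) = (\<lambda>k. if k \<in> F m then wt 1 u k else 0)" for m by (auto simp: U_def wt_def)
  have d: "(\<lambda>m. l2_norm (wt 1 (\<lambda>k. U m k - u k))) \<longlonglongrightarrow> 0"
    unfolding wt_diff wU using F(2) by (simp add: l2_tendsto_def)
  have UH: "U m \<in> H1" for m by (rule finite_H1[OF fin])
  have dH: "wt 1 (\<lambda>k. U m k - u k) \<in> l2" for m using H1_diff[OF UH u] by (simp add: H1_def)
  obtain C where C: "C \<ge> 0" "\<And>u. wt 1 u \<in> l2 \<Longrightarrow> l2_norm (matvec A u) \<le> C * l2_norm (wt 1 u)"
    using bound[of 0] by auto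
  have 1: "l2_tendsto U u" unfolding l2_tendsto_def
  proof (intro conjI allI)
    show "(\<lambda>m. l2_norm (\<lambda>k. U m k - u k)) \<longlonglongrightarrow> 0"
      by (rule tendsto_dominated[OF _ d]) (use wt_mono(2)[of 0 1, OF _ dH] in simp)
  qed (use UH u H1_l2 in auto)
  have 2: "l2_tendsto (\<lambda>m. matvec A (U m)) (matvec A u)" unfolding l2_tendsto_def
  proof (intro conjI allI)
    have e: "(\<lambda>k. matvec A (U m) k - matvec A u k) = matvec A (\<lambda>k. U m k - u k)" for m
      by (rule matvec_diff[symmetric]) (intro H1_l2 UH u)+
    show "(\<lambda>m. l2_norm (\<lambda>k. matvec A (U m) k - matvec A u k)) \<longlonglongrightarrow> 0"
    proof (rule tendsto_dominated)
      show "norm (l2_norm (\<lambda>k. matvec A (U m) k - matvec A u k) - 0) \<le> C * l2_norm (wt 1 (\<lambda>k. U m k - u k))" for m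
        unfolding e using C(2)[OF dH[of m]] by simp
      show "(\<lambda>m. C * l2_norm (wt 1 (\<lambda>k. U m k - u k))) \<longlonglongrightarrow> 0"
        using tendsto_mult_left[OF d, of C] by simp
    qed
  qed (use UH u A_H1 in auto)
  show ?thesis using fin 1 2 by blast
qed

lemma A_pos:
  assumes u: "u \<in> H1" shows "Re (l2_inner (matvec A u) u) \<ge> (l2_norm u)\<^sup>2"
proof -
  obtain U where U: "\<And>m :: nat. finite {k. U m k \<noteq> 0}" "l2_tendsto U u" "l2_tendsto (\<lambda>m. matvec A (U m)) (matvec A u)"
    using H1_approx[OF u] by blast
  show ?thesis
  proof (rule LIMSEQ_le)
    show "(\<lambda>m. (l2_norm (U m))\<^sup>2) \<longlonglongrightarrow> (l2_norm u)\<^sup>2" by (intro tendsto_intros l2_tendsto_norm U)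
    show "(\<lambda>m. Re (l2_inner (matvec A (U m)) (U m))) \<longlonglongrightarrow> Re (l2_inner (matvec A u) u)"
      by (intro tendsto_intros l2_tendsto_inner2 U)
  qed (use pos U(1) in auto)
qed

lemma A_norm_ge:
  assumes u: "u \<in> H1" shows "l2_norm u \<le> l2_norm (matvec A u)"
proof -
  have "(l2_norm u)\<^sup>2 \<le> cmod (l2_inner (matvec A u) u)"
    by (rule order_trans[OF A_pos[OF u] complex_Re_le_cmod])
  also have "\<dots> \<le> l2_norm (matvec A u) * l2_norm u" by (intro cauchy_schwarz A_H1 H1_l2 u)
  finally have "l2_norm u * l2_norm u \<le> l2_norm (matvec A u) * l2_norm u" by (simp add: power2_eq_square)
  then show ?thesis
    by (cases "l2_norm u = 0") (simp_all add: mult_le_cancel_right order_less_le)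
qed

text \<open>
  For finitely supported \<open>v\<close> this is the Hermitian symmetry of the matrix; such functions form a core.
\<close>

lemma A_sym:
  assumes u: "u \<in> H1" and v: "v \<in> H1"
  shows "l2_inner (matvec A u) v = l2_inner u (matvec A v)"
proof -
  obtain V where V: "\<And>m :: nat. finite {k. V m k \<noteq> 0}" "l2_tendsto V v" "l2_tendsto (\<lambda>m. matvec A (V m)) (matvec A v)"
    using H1_approx[OF v] by blast
  have "l2_inner (matvec A u) (V m) = l2_inner u (matvec A (V m))" for m
  proof -
    define F where "F = {k. V m k \<noteq> 0}"
    have F: "finite F" using V by (simp add: F_def)
    have Vm: "V m = (\<lambda>k. \<Sum>j\<in>F. V m j * unit_vec j k)"
    proof
      fix k
      have "(\<Sum>j\<in>F. V m j * unit_vec j k) = (\<Sum>j\<in>F. if j = k then V m j else 0)"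
        by (intro sum.cong) (auto simp: unit_vec_def)
      then show "V m k = (\<Sum>j\<in>F. V m j * unit_vec j k)" using F by (simp add: F_def)
    qed
    have AV: "matvec A (\<lambda>k. \<Sum>j\<in>G. V m j * unit_vec j k) = (\<lambda>k. \<Sum>j\<in>G. V m j * matvec A (unit_vec j) k)" if "finite G" for G
      using that
    proof (induction G rule: finite_induct)
      case empty
      then show ?case using matvec_scale[of 0 "\<lambda>k. 0"] by simp
    next
      case (insert j G)
      then show ?case
        by (simp add: matvec_add l2_sum matvec_scale)
    qed
    have "l2_inner (\<lambda>k. \<Sum>j\<in>F. V m j * matvec A (unit_vec j) k) u = (\<Sum>j\<in>F. l2_inner (\<lambda>k. V m j * matvec A (unit_vec j) k) u)"
      by (intro l2_inner_sum_left F l2_scale column_l2[unfolded column_def] H1_l2 u)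
    also have "\<dots> = (\<Sum>j\<in>F. l2_inner (\<lambda>k. V m j * unit_vec j k) (matvec A u))"
    proof (rule sum.cong[OF refl])
      fix j
      have "l2_inner (matvec A (unit_vec j)) u = cnj (matvec A u j)"
        by (simp add: matvec_eq_inner l2_inner_cnj column_def[symmetric])
      also have "\<dots> = l2_inner (unit_vec j) (matvec A u)"
        using l2_inner_unit_vec[of "matvec A u" j] l2_inner_cnj by metis
      finally show "l2_inner (\<lambda>k. V m j * matvec A (unit_vec j) k) u = l2_inner (\<lambda>k. V m j * unit_vec j k) (matvec A u)"
        by (simp add: l2_inner_scale_left)
    qed
    also have "\<dots> = l2_inner (\<lambda>k. \<Sum>j\<in>F. V m j * unit_vec j k) (matvec A u)"
      by (intro l2_inner_sum_left[symmetric] F l2_scale unit_vec_l2 A_H1 u)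
    finally have "l2_inner (matvec A (V m)) u = l2_inner (V m) (matvec A u)"
      using AV[OF F] Vm by simp
    then show ?thesis using l2_inner_cnj by metis
  qed
  moreover have "(\<lambda>m. l2_inner (V m) (matvec A u)) \<longlonglongrightarrow> l2_inner v (matvec A u)"
    by (intro l2_tendsto_inner V A_H1 u)
  then have "(\<lambda>m. cnj (l2_inner (V m) (matvec A u))) \<longlonglongrightarrow> cnj (l2_inner v (matvec A u))" by (rule tendsto_cnj)
  moreover have "(\<lambda>m. l2_inner (matvec A (V m)) u) \<longlonglongrightarrow> l2_inner (matvec A v) u"
    by (intro l2_tendsto_inner V H1_l2 u)
  then have "(\<lambda>m. cnj (l2_inner (matvec A (V m)) u)) \<longlonglongrightarrow> cnj (l2_inner (matvec A v) u)" by (rule tendsto_cnj)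
  ultimately show ?thesis unfolding l2_inner_cnj using LIMSEQ_unique by simp
qed

text \<open>
  The closure of the range of \<open>A\<close> consists of values of \<open>A\<close> because \<open>A\<close> is bounded
  below; a function orthogonal to the range is a weak solution of \<open>A r = 0\<close>, hence lies in the domain
  by elliptic regularity and vanishes.
\<close>

lemma A_surj:
  assumes f: "f \<in> l2" shows "\<exists>u\<in>H1. matvec A u = f"
proof -
  define L where "L = matvec A ` H1"
  have L: "L \<subseteq> l2" "(\<lambda>k. 0) \<in> L" "\<And>x y. x \<in> L \<Longrightarrow> y \<in> L \<Longrightarrow> (\<lambda>k. x k + y k) \<in> L"
    "\<And>c x. x \<in> L \<Longrightarrow> (\<lambda>k. c * x k) \<in> L"
  proof -
    show "L \<subseteq> l2" using A_H1 by (auto simp: L_def)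
    show s: "(\<lambda>k. c * x k) \<in> L" if x: "x \<in> L" for c x
    proof -
      obtain u where "u \<in> H1" "x = matvec A u" using x by (auto simp: L_def)
      then have "(\<lambda>k. c * x k) = matvec A (\<lambda>k. c * u k)" "(\<lambda>k. c * u k) \<in> H1"
        by (simp_all add: matvec_scale H1_scale)
      then show ?thesis unfolding L_def by blast
    qed
    have "matvec A (unit_vec 0) \<in> L" unfolding L_def by (intro imageI unit_vec_H1)
    from s[OF this, of 0] show "(\<lambda>k. 0) \<in> L" by simp
    show "(\<lambda>k. x k + y k) \<in> L" if xy: "x \<in> L" "y \<in> L" for x y
    proof -
      obtain u v where "u \<in> H1" "v \<in> H1" "x = matvec A u" "y = matvec A v" using xy by (auto simp: L_def)
      then have "(\<lambda>k. x k + y k) = matvec A (\<lambda>k. u k + v k)" "(\<lambda>k. u k + v k) \<in> H1"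
        by (simp_all add: matvec_add H1_l2 H1_add)
      then show ?thesis unfolding L_def by blast
    qed
  qed
  obtain V v where V: "\<And>m :: nat. V m \<in> L" "l2_tendsto V v" "\<And>x. x \<in> L \<Longrightarrow> l2_inner (\<lambda>k. f k - v k) x = 0"
    using l2_projection[OF L f] by blast
  have "\<forall>m. \<exists>u. u \<in> H1 \<and> V m = matvec A u" using V(1) by (auto simp: L_def)
  then obtain U where U: "\<And>m. U m \<in> H1" "\<And>m. V m = matvec A (U m)" by metis
  have vl: "v \<in> l2" "V m \<in> l2" for m using V(2) by (auto simp: l2_tendsto_def)
  have "\<exists>M. \<forall>m\<ge>M. \<forall>l\<ge>M. l2_norm (\<lambda>k. U m k - U l k) < e" if e: "e > 0" for e
  proof -
    have "\<forall>\<^sub>F m in sequentially. l2_norm (\<lambda>k. V m k - v k) < e / 2"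
      using V(2) e unfolding l2_tendsto_def by (intro order_tendstoD(2)) auto
    then obtain M where M: "\<And>m. m \<ge> M \<Longrightarrow> l2_norm (\<lambda>k. V m k - v k) < e / 2"
      by (auto simp: eventually_sequentially)
    have "l2_norm (\<lambda>k. U m k - U l k) < e" if "m \<ge> M" "l \<ge> M" for m l
    proof -
      have "l2_norm (\<lambda>k. U m k - U l k) \<le> l2_norm (matvec A (\<lambda>k. U m k - U l k))"
        by (intro A_norm_ge H1_diff U)
      also have "matvec A (\<lambda>k. U m k - U l k) = (\<lambda>k. (V m k - v k) - (V l k - v k))"
        by (simp add: matvec_diff H1_l2 U)
      also have "l2_norm \<dots> \<le> l2_norm (\<lambda>k. V m k - v k) + l2_norm (\<lambda>k. V l k - v k)"
        by (intro l2_diff vl)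
      finally show ?thesis using M[OF that(1)] M[OF that(2)] by linarith
    qed
    then show ?thesis by blast
  qed
  then obtain u where u: "l2_tendsto U u" using l2_complete[of U] U H1_l2 by blast
  have "matvec A u k = v k" for k
  proof -
    have "(\<lambda>m. matvec A (U m) k) \<longlonglongrightarrow> matvec A u k"
      unfolding matvec_eq_inner by (intro l2_tendsto_inner u column_l2)
    then show ?thesis using l2_tendsto_pointwise[OF V(2), of k] unfolding U(2)[symmetric] by (rule LIMSEQ_unique)
  qed
  then have Au: "matvec A u = v" by auto
  have uH: "u \<in> H1" unfolding H1_iff Au using u vl by (simp add: l2_tendsto_def)
  define r where "r = (\<lambda>k. f k - v k)"
  have "matvec A r k = 0" for k
    unfolding matvec_eq_inner r_def by (rule V(3)) (auto simp: L_def unit_vec_H1 column_def)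
  then have Ar: "matvec A r = (\<lambda>k. 0)" by auto
  have "r \<in> H1" unfolding H1_iff Ar by (auto simp: r_def l2_diff f vl)
  from A_norm_ge[OF this] have "l2_norm r = 0" unfolding Ar using l2_norm_nonneg[of r] by simp
  then have "r = (\<lambda>k. 0)" using l2_norm_eq_0[of r] by (simp add: r_def l2_diff f vl)
  then have "f = v" by (auto simp: r_def fun_eq_iff)
  then show ?thesis using Au uH by blast
qed

definition Kop :: "(int ^ 'n \<Rightarrow> complex) \<Rightarrow> int ^ 'n \<Rightarrow> complex" where
  "Kop f = (SOME u. u \<in> H1 \<and> matvec A u = f)"

lemma Kop: "f \<in> l2 \<Longrightarrow> Kop f \<in> H1" "f \<in> l2 \<Longrightarrow> matvec A (Kop f) = f"
  unfolding Kop_def using someI_ex[of "\<lambda>u. u \<in> H1 \<and> matvec A u = f"] A_surj[of f] by auto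

lemma Kop_unique:
  assumes u: "u \<in> H1" shows "Kop (matvec A u) = u"
proof -
  let ?v = "Kop (matvec A u)"
  have v: "?v \<in> H1" "matvec A ?v = matvec A u" using Kop[OF A_H1[OF u]] by auto
  have d: "(\<lambda>k. ?v k - u k) \<in> H1" by (intro H1_diff v u)
  have "matvec A (\<lambda>k. ?v k - u k) = (\<lambda>k. 0)" using v u by (simp add: matvec_diff H1_l2)
  then have "l2_norm (\<lambda>k. ?v k - u k) = 0" using A_norm_ge[OF d] l2_norm_nonneg[of "\<lambda>k. ?v k - u k"] by simp
  then have "(\<lambda>k. ?v k - u k) = (\<lambda>k. 0)" using l2_norm_eq_0[OF H1_l2[OF d]] by simp
  then show ?thesis by (auto simp: fun_eq_iff)
qed

lemma Kop_l2: "f \<in> l2 \<Longrightarrow> Kop f \<in> l2"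
  using Kop H1_l2 by blast

lemma Kop_add: "f \<in> l2 \<Longrightarrow> g \<in> l2 \<Longrightarrow> Kop (\<lambda>k. f k + g k) = (\<lambda>k. Kop f k + Kop g k)"
  using Kop_unique[of "\<lambda>k. Kop f k + Kop g k"] by (simp add: H1_add Kop matvec_add Kop_l2)

lemma Kop_scale: "f \<in> l2 \<Longrightarrow> Kop (\<lambda>k. z * f k) = (\<lambda>k. z * Kop f k)"
  using Kop_unique[of "\<lambda>k. z * Kop f k"] by (simp add: H1_scale Kop matvec_scale)

lemma Kop_sym: "f \<in> l2 \<Longrightarrow> g \<in> l2 \<Longrightarrow> l2_inner (Kop f) g = l2_inner f (Kop g)"
  using A_sym[of "Kop f" "Kop g"] by (simp add: Kop)

lemma Kop_norm: "f \<in> l2 \<Longrightarrow> l2_norm (Kop f) \<le> l2_norm f"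
  using A_norm_ge[of "Kop f"] by (simp add: Kop)

text \<open>Rellich's theorem: a bound in \<open>H1\<close> makes the tails uniformly small.\<close>

lemma H1_bounded_tendsto:
  assumes W: "\<And>m. W m \<in> H1" "\<And>m. l2_norm (wt 1 (W m)) \<le> B" "\<And>k. (\<lambda>m. W m k) \<longlonglongrightarrow> w k"
  shows "l2_tendsto W w"
proof -
  have Wl: "W m \<in> l2" for m using W H1_l2 by blast
  have B: "B \<ge> 0" using W(2)[of 0] l2_norm_nonneg[of "wt 1 (W 0)"] by linarith
  have "(\<lambda>m. wt 1 (W m) k) \<longlonglongrightarrow> wt 1 w k" for k unfolding wt_def by (intro tendsto_intros W)
  then have w: "wt 1 w \<in> l2" "l2_norm (wt 1 w) \<le> B"
    using l2_fatou[of "\<lambda>m. wt 1 (W m)" B "wt 1 w"] W by (auto simp: H1_def)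
  have wl: "w \<in> l2" by (rule wt_imp_l2[OF w(1)])
  have "(\<lambda>m. l2_norm (\<lambda>k. W m k - w k)) \<longlonglongrightarrow> 0"
  proof (rule LIMSEQ_I)
    fix r :: real assume r: "r > 0"
    \<comment> \<open>Outside the finite set \<open>F\<close> the weight is larger than \<open>N\<close>, so the tails of all differences have norm at most \<open>2 B / N\<close>.\<close>
    define N where "N = 4 * (B + 1) / r"
    have N: "N > 0" using r B by (simp add: N_def)
    define F where "F = {k :: int ^ 'n. rho k \<le> N}"
    have fin: "finite F"
    proof (rule finite_subset)
      show "F \<subseteq> vec_lambda ` (PiE UNIV (\<lambda>_. {- \<lceil>N\<rceil>..\<lceil>N\<rceil>}))"
      proof
        fix k assume "k \<in> F"
        then have "\<bar>real_of_int (k $ j)\<bar> \<le> N" for j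
          using coord_le_lat_norm[of k j] by (auto simp: F_def rho_def)
        then have "k $ j \<in> {- \<lceil>N\<rceil>..\<lceil>N\<rceil>}" for j
        proof -
          have "\<bar>real_of_int (k $ j)\<bar> \<le> of_int \<lceil>N\<rceil>" using \<open>\<And>j. \<bar>real_of_int (k $ j)\<bar> \<le> N\<close>[of j] le_of_int_ceiling[of N] by linarith
          then show ?thesis by (auto simp: abs_le_iff)
        qed
        then show "k \<in> vec_lambda ` (PiE UNIV (\<lambda>_. {- \<lceil>N\<rceil>..\<lceil>N\<rceil>}))"
          by (intro image_eqI[of _ _ "vec_nth k"]) auto
      qed
    qed (auto intro!: finite_imageI finite_PiE)
    have "(\<lambda>m. L2_set (\<lambda>k. cmod (W m k - w k)) F) \<longlonglongrightarrow> L2_set (\<lambda>k. 0) F"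
      unfolding L2_set_def
      by (intro tendsto_intros) (use W(3) in \<open>auto simp: LIM_zero_iff tendsto_norm_zero_iff\<close>)
    then have "(\<lambda>m. L2_set (\<lambda>k. cmod (W m k - w k)) F) \<longlonglongrightarrow> 0" by (simp add: L2_set_def)
    then obtain M where M: "\<And>m. m \<ge> M \<Longrightarrow> L2_set (\<lambda>k. cmod (W m k - w k)) F < r / 2"
      using order_tendstoD(2)[of _ 0 sequentially "r/2"] r by (auto simp: eventually_sequentially)
    have "l2_norm (\<lambda>k. W m k - w k) < r" if m: "m \<ge> M" for m
    proof -
      define d where "d = (\<lambda>k. W m k - w k)"
      have dl: "d \<in> l2" unfolding d_def by (intro l2_diff Wl wl)
      have dw: "wt 1 d \<in> l2" "l2_norm (wt 1 d) \<le> 2 * B"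
        unfolding d_def wt_diff using l2_diff[of "wt 1 (W m)" "wt 1 w"] W(1)[of m] W(2)[of m] w by (auto simp: H1_def)
      define d1 where "d1 = (\<lambda>k. if k \<in> F then d k else 0)"
      define d2 where "d2 = (\<lambda>k. if k \<in> F then 0 else d k)"
      have d1: "d1 \<in> l2" "l2_norm d1 \<le> L2_set (\<lambda>k. cmod (d k)) F"
      proof -
        have "(\<Sum>k\<in>G. (cmod (d1 k))\<^sup>2) \<le> (L2_set (\<lambda>k. cmod (d k)) F)\<^sup>2" if "finite G" for G
        proof -
          have "(\<Sum>k\<in>G. (cmod (d1 k))\<^sup>2) = (\<Sum>k\<in>G \<inter> F. (cmod (d k))\<^sup>2)"
            using that by (intro sum.mono_neutral_cong_right) (auto simp: d1_def)
          also have "\<dots> \<le> (\<Sum>k\<in>F. (cmod (d k))\<^sup>2)" by (intro sum_mono2 fin) auto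
          finally show ?thesis by (simp add: L2_set_def sum_nonneg)
        qed
        then show "d1 \<in> l2" "l2_norm d1 \<le> L2_set (\<lambda>k. cmod (d k)) F"
          using l2_boundI[of d1 "L2_set (\<lambda>k. cmod (d k)) F"] by auto
      qed
      have d2: "cmod (d2 k) \<le> (1 / N) * cmod (wt 1 d k)" for k
      proof (cases "k \<in> F")
        case False
        then have "N * cmod (d k) \<le> rho k * cmod (d k)" by (intro mult_right_mono) (auto simp: F_def)
        then show ?thesis using False N by (simp add: d2_def cmod_wt field_simps)
      qed (use N in \<open>simp add: d2_def\<close>)
      note d2l = l2_mono[OF dw(1) d2]
      have "l2_norm d2 \<le> (1 / N) * (2 * B)" using d2l(2) dw(2) N
        by (intro order_trans[OF d2l(2)] mult_left_mono) auto
      also have "\<dots> < r / 2" using r B by (simp add: N_def field_simps)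
      finally have "l2_norm d2 < r / 2" .
      moreover have "l2_norm d1 < r / 2" using d1(2) M[OF m] by (simp add: d_def)
      moreover have "d = (\<lambda>k. d1 k + d2 k)" by (auto simp: d1_def d2_def)
      then have "l2_norm d \<le> l2_norm d1 + l2_norm d2" using l2_add(2)[OF d1(1) d2l(1)] N by simp
      ultimately show ?thesis by (simp add: d_def)
    qed
    then show "\<exists>no. \<forall>n\<ge>no. norm (l2_norm (\<lambda>k. W n k - w k) - 0) < r" by auto
  qed
  then show ?thesis using Wl wl by (simp add: l2_tendsto_def)
qed

text \<open>
  The inverse is bounded from \<open>\<ell>\<^sup>2\<close> to \<open>H1\<close> by elliptic regularity, and weak convergence of the
  arguments gives pointwise convergence of the values by symmetry.
\<close>

lemma Kop_compact:
  assumes U: "\<And>m. U m \<in> l2" "\<And>m. l2_norm (U m) \<le> B" "\<And>k. (\<lambda>m. U m k) \<longlonglongrightarrow> u k"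
  shows "l2_tendsto (\<lambda>m. Kop (U m)) (Kop u)"
proof -
  have u: "u \<in> l2" using l2_fatou[OF U] by blast
  obtain C where C: "C \<ge> 0" "\<And>u. u \<in> l2 \<Longrightarrow> matvec A u \<in> l2 \<Longrightarrow> l2_norm (wt 1 u) \<le> C * (l2_norm (matvec A u) + l2_norm u)"
    using reg[of 0] by auto
  show ?thesis
  proof (rule H1_bounded_tendsto)
    show "Kop (U m) \<in> H1" for m by (rule Kop[OF U(1)])
    show "l2_norm (wt 1 (Kop (U m))) \<le> C * (B + B)" for m
    proof -
      have "l2_norm (wt 1 (Kop (U m))) \<le> C * (l2_norm (U m) + l2_norm (Kop (U m)))"
        using C(2)[of "Kop (U m)"] by (simp add: Kop Kop_l2 U)
      also have "\<dots> \<le> C * (B + B)"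
        using C(1) U(2)[of m] Kop_norm[OF U(1), of m] by (intro mult_left_mono add_mono) auto
      finally show ?thesis .
    qed
    have e: "Kop f k = l2_inner f (Kop (unit_vec k))" if "f \<in> l2" for f k
      using Kop_sym[OF that unit_vec_l2, of k] by (simp add: l2_inner_unit_vec)
    show "(\<lambda>m. Kop (U m) k) \<longlonglongrightarrow> Kop u k" for k
      unfolding e[OF U(1)] e[OF u] by (intro l2_weak_inner[OF U] Kop_l2) simp
  qed
qed

end

context elliptic_matrix
begin

lemma eigen_ge_1:
  fixes \<mu> :: real
  assumes "e \<in> H1" "l2_norm e = 1" "matvec A e = (\<lambda>k. of_real \<mu> * e k)"
  shows "\<mu> \<ge> 1"
  using A_pos[OF assms(1)] assms(2) by (simp add: assms(3) l2_inner_scale_left l2_inner_self)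

text \<open>
  A maximal orthonormal set of eigenvectors is complete, since otherwise the inverse of \<open>A\<close>, a compact
  operator that maps the orthogonal complement to itself, would have another eigenvector there.
\<close>

lemma ex_eigenbasis:
  "\<exists>EE lam. complete_orthonormal EE \<and> (\<forall>e. lam e \<ge> (1::real)) \<and>
     (\<forall>e\<in>EE. e \<in> H1 \<and> matvec A e = (\<lambda>k. of_real (lam e) * e k))"
proof -
  define P where "P = {EE. orthonormal EE \<and> (\<forall>e\<in>EE. e \<in> H1 \<and> (\<exists>\<mu>::real. matvec A e = (\<lambda>k. of_real \<mu> * e k)))}"
  have "\<exists>M\<in>P. \<forall>X\<in>P. M \<subseteq> X \<longrightarrow> X = M"
  proof (rule subset_Zorn')
    fix C assume C: "subset.chain P C"
    then have CP: "X \<in> P" if "X \<in> C" for X using that by (auto simp: subset_chain_def)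
    have common: "\<exists>X\<in>C. e \<in> X \<and> f \<in> X" if ef: "e \<in> \<Union>C" "f \<in> \<Union>C" for e f
    proof -
      obtain X Y where XY: "X \<in> C" "Y \<in> C" "e \<in> X" "f \<in> Y" using ef by blast
      then have "X \<subseteq> Y \<or> Y \<subseteq> X" using C by (auto simp: subset_chain_def)
      then show ?thesis using XY by blast
    qed
    show "\<Union>C \<in> P" unfolding P_def orthonormal_def
    proof (intro CollectI conjI ballI)
      have "X \<subseteq> l2" if "X \<in> C" for X using CP[OF that] by (simp add: P_def orthonormal_def)
      then show "\<Union>C \<subseteq> l2" by blast
      show "l2_inner e f = (if e = f then 1 else 0)" if ef: "e \<in> \<Union>C" "f \<in> \<Union>C" for e f
      proof -
        obtain X where "X \<in> C" "e \<in> X" "f \<in> X" using common[OF ef] by blast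
        then show ?thesis using CP[of X] unfolding P_def orthonormal_def by blast
      qed
      show "e \<in> H1" "\<exists>\<mu>::real. matvec A e = (\<lambda>k. of_real \<mu> * e k)" if e: "e \<in> \<Union>C" for e
      proof -
        obtain X where "X \<in> C" "e \<in> X" using e by blast
        then show "e \<in> H1" "\<exists>\<mu>::real. matvec A e = (\<lambda>k. of_real \<mu> * e k)" using CP[of X] by (simp_all add: P_def)
      qed
    qed
  qed
  then obtain M where M: "M \<in> P" "\<And>X. X \<in> P \<Longrightarrow> M \<subseteq> X \<Longrightarrow> X = M" by blast
  have on: "orthonormal M" using M by (simp add: P_def)
  have Ml: "e \<in> l2" if "e \<in> M" for e using on that by (auto simp: orthonormal_def)
  have nrm: "l2_norm e = 1" if "e \<in> M" for e
  proof -
    have "l2_inner e e = 1" using on that by (auto simp: orthonormal_def)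
    then have "(l2_norm e)\<^sup>2 = 1" unfolding l2_inner_self using of_real_eq_1_iff by blast
    then show ?thesis using l2_norm_nonneg[of e] by (simp add: power2_eq_1_iff)
  qed
  have "\<exists>\<mu>::real. 1 \<le> \<mu> \<and> (e \<in> M \<longrightarrow> matvec A e = (\<lambda>k. of_real \<mu> * e k))" for e
  proof (cases "e \<in> M")
    case True
    then obtain \<mu> :: real where "matvec A e = (\<lambda>k. of_real \<mu> * e k)" "e \<in> H1" using M by (auto simp: P_def)
    then show ?thesis using eigen_ge_1[of e \<mu>] nrm[OF True] by auto
  qed auto
  then obtain lam :: "(int ^ 'n \<Rightarrow> complex) \<Rightarrow> real" where
    lam: "\<And>e. 1 \<le> lam e" "\<And>e. e \<in> M \<Longrightarrow> matvec A e = (\<lambda>k. of_real (lam e) * e k)" by metis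
  have MH: "e \<in> H1" if "e \<in> M" for e using M(1) that by (simp add: P_def)
  have KM: "Kop e = (\<lambda>k. of_real (inverse (lam e)) * e k)" if e: "e \<in> M" for e
  proof -
    have "lam e \<noteq> 0" using lam(1)[of e] by linarith
    then have "matvec A (\<lambda>k. of_real (inverse (lam e)) * e k) = e"
      unfolding matvec_scale lam(2)[OF e] by (simp add: field_simps)
    then show ?thesis using Kop_unique[OF H1_scale[OF MH[OF e]], of "of_real (inverse (lam e))"] by simp
  qed
  define V where "V = {u \<in> l2. \<forall>e\<in>M. l2_inner u e = 0}"
  have "V = {\<lambda>k. 0}"
  proof (rule ccontr)
    assume "V \<noteq> {\<lambda>k. 0}"
    moreover have "(\<lambda>k. 0) \<in> V" by (simp add: V_def)
    ultimately obtain u0 where u0: "u0 \<in> V" "u0 \<noteq> (\<lambda>k. 0)" by blast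
    have Vl: "u \<in> l2" if "u \<in> V" for u using that by (simp add: V_def)
    have "\<exists>e\<in>V. \<exists>\<mu>>0. l2_norm e = 1 \<and> Kop e = (\<lambda>k. of_real \<mu> * e k)"
    proof (rule compact_symmetric_eigenvector[OF _ _ _ _ _ _ _ _ _ _ _ u0])
      show "V \<subseteq> l2" by (auto simp: V_def)
      show "(\<lambda>k. u k + v k) \<in> V" if "u \<in> V" "v \<in> V" for u v
        using that Ml by (simp add: V_def l2_add l2_inner_add_left)
      show "(\<lambda>k. z * u k) \<in> V" if "u \<in> V" for z u
        using that by (simp add: V_def l2_inner_scale_left)
      show "u \<in> V" if U: "\<And>m. U m \<in> V" "\<And>m. l2_norm (U m) \<le> B" "\<And>k. (\<lambda>m. U m k) \<longlonglongrightarrow> u k" for U B u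
      proof -
        have ul: "u \<in> l2" using l2_fatou(1)[OF Vl[OF U(1)] U(2,3)] .
        have "l2_inner u e = 0" if e: "e \<in> M" for e
        proof -
          have "(\<lambda>m. l2_inner (U m) e) \<longlonglongrightarrow> l2_inner u e" by (rule l2_weak_inner[OF Vl[OF U(1)] U(2,3) Ml[OF e]])
          moreover have "l2_inner (U m) e = 0" for m using U(1)[of m] e by (simp add: V_def)
          ultimately have "(\<lambda>m. 0) \<longlonglongrightarrow> l2_inner u e" by simp
          then show ?thesis using LIMSEQ_unique[OF tendsto_const] by metis
        qed
        then show ?thesis using ul by (simp add: V_def)
      qed
      show "Kop u \<in> V" if u: "u \<in> V" for u
      proof -
        have "l2_inner (Kop u) e = 0" if e: "e \<in> M" for e
        proof -
          have "l2_inner (Kop u) e = l2_inner u (Kop e)" by (rule Kop_sym[OF Vl[OF u] Ml[OF e]])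
          also have "\<dots> = 0" unfolding KM[OF e] l2_inner_scale_right using u e by (simp add: V_def)
          finally show ?thesis .
        qed
        then show ?thesis using Kop_l2[OF Vl[OF u]] by (simp add: V_def)
      qed
      show "Kop (\<lambda>k. u k + v k) = (\<lambda>k. Kop u k + Kop v k)" if "u \<in> V" "v \<in> V" for u v
        using that by (intro Kop_add Vl)
      show "Kop (\<lambda>k. z * u k) = (\<lambda>k. z * Kop u k)" if "u \<in> V" for z u
        using that by (intro Kop_scale Vl)
      show "l2_inner (Kop u) v = l2_inner u (Kop v)" if "u \<in> V" "v \<in> V" for u v
        using that by (intro Kop_sym Vl)
      show "l2_norm (Kop u) \<le> l2_norm u" if "u \<in> V" for u using that by (intro Kop_norm Vl)
      show "0 < Re (l2_inner (Kop u) u)" if u: "u \<in> V" "u \<noteq> (\<lambda>k. 0)" for u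
      proof -
        have ul: "u \<in> l2" using Vl u by blast
        have "Kop u \<noteq> (\<lambda>k. 0)"
        proof
          assume "Kop u = (\<lambda>k. 0)"
          then have "u = matvec A (\<lambda>k. 0)" using Kop(2)[OF ul] by simp
          then show False using u(2) matvec_scale[of 0 "\<lambda>k. 0"] by simp
        qed
        then have "0 < (l2_norm (Kop u))\<^sup>2" using l2_norm_eq_0[OF Kop_l2[OF ul]] by simp
        also have "\<dots> \<le> Re (l2_inner (matvec A (Kop u)) (Kop u))" by (rule A_pos[OF Kop(1)[OF ul]])
        also have "\<dots> = Re (l2_inner u (Kop u))" by (simp add: Kop(2)[OF ul])
        also have "\<dots> = Re (l2_inner (Kop u) u)" using Kop_sym[OF ul ul] by simp
        finally show ?thesis .
      qed
      show "l2_tendsto (\<lambda>m. Kop (U m)) (Kop u)"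
        if U: "\<And>m. U m \<in> V" "\<And>m. l2_norm (U m) \<le> B" "\<And>k. (\<lambda>m. U m k) \<longlonglongrightarrow> u k" for U B u
        by (rule Kop_compact[OF Vl[OF U(1)] U(2,3)])
    qed
    then obtain e \<mu> where e: "e \<in> V" "\<mu> > 0" "l2_norm e = 1" "Kop e = (\<lambda>k. of_real \<mu> * e k)" by blast
    have el: "e \<in> l2" by (rule Vl[OF e(1)])
    have "e = (\<lambda>k. of_real (inverse \<mu>) * Kop e k)" using e(2) by (auto simp: e(4))
    then have eH: "e \<in> H1" using H1_scale[OF Kop(1)[OF el]] by metis
    have "(\<lambda>k. of_real \<mu> * matvec A e k) = e" using Kop(2)[OF el] unfolding e(4) matvec_scale .
    then have "of_real \<mu> * matvec A e k = e k" for k by metis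
    then have Ae: "matvec A e = (\<lambda>k. of_real (inverse \<mu>) * e k)" using e(2) by (auto simp: field_simps)
    have orth: "l2_inner e f = 0" "l2_inner f e = 0" if "f \<in> M" for f
    proof -
      show 1: "l2_inner e f = 0" using e(1) that by (simp add: V_def)
      show "l2_inner f e = 0" using l2_inner_cnj[of e f] unfolding 1 by simp
    qed
    have ee: "l2_inner e e = 1" using e(3) by (simp add: l2_inner_self)
    have enM: "e \<notin> M" using orth(1)[of e] ee by auto
    have "orthonormal (insert e M)" unfolding orthonormal_def
    proof (intro conjI ballI)
      show "insert e M \<subseteq> l2" using el Ml by blast
      show "l2_inner f g = (if f = g then 1 else 0)" if fg: "f \<in> insert e M" "g \<in> insert e M" for f g
      proof -
        have "f \<in> M \<Longrightarrow> g \<in> M \<Longrightarrow> ?thesis" using on by (simp add: orthonormal_def)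
        then show ?thesis using fg orth ee enM by (auto split: if_splits)
      qed
    qed
    moreover have "\<exists>\<mu>::real. matvec A e = (\<lambda>k. of_real \<mu> * e k)" by (rule exI, rule Ae)
    ultimately have "insert e M \<in> P" using M(1) eH by (simp add: P_def)
    then have "insert e M = M" using M(2) by blast
    then show False using enM by blast
  qed
  then have "complete_orthonormal M" unfolding complete_orthonormal_def using on by (auto simp: V_def)
  then show ?thesis using lam MH by (intro exI[of _ M] exI[of _ lam]) simp
qed

end

definition evwt :: "('j \<Rightarrow> real) \<Rightarrow> nat \<Rightarrow> ('j \<Rightarrow> complex) \<Rightarrow> 'j \<Rightarrow> complex" where
  "evwt lam p c = (\<lambda>e. of_real (lam e ^ p) * c e)"

lemma evwt_mono:
  assumes "\<And>e. lam e \<ge> 1" "p \<le> q" "evwt lam q c \<in> l2"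
  shows "evwt lam p c \<in> l2" "l2_norm (evwt lam p c) \<le> l2_norm (evwt lam q c)"
proof -
  have l: "0 \<le> lam e" for e using assms(1)[of e] by linarith
  have "cmod (evwt lam p c e) \<le> 1 * cmod (evwt lam q c e)" for e
    unfolding evwt_def norm_mult norm_of_real using assms(1,2) l[of e]
    by (auto intro!: mult_right_mono power_increasing)
  from l2_mono[OF assms(3) this] show "evwt lam p c \<in> l2" "l2_norm (evwt lam p c) \<le> l2_norm (evwt lam q c)"
    by auto
qed

locale elliptic_eigenbasis = elliptic_matrix A
  for A :: "int ^ 'n::finite \<Rightarrow> int ^ 'n \<Rightarrow> complex" +
  fixes EE :: "(int ^ 'n \<Rightarrow> complex) set" and lam :: "(int ^ 'n \<Rightarrow> complex) \<Rightarrow> real"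
  assumes EE: "complete_orthonormal EE" and lam_ge_1: "lam e \<ge> 1"
    and EE_eigen: "e \<in> EE \<Longrightarrow> e \<in> H1" "e \<in> EE \<Longrightarrow> matvec A e = (\<lambda>k. of_real (lam e) * e k)"
begin

lemma EE_on: "orthonormal EE" and EE_l2: "e \<in> EE \<Longrightarrow> e \<in> l2"
  using EE EE_eigen H1_l2 by (auto simp: complete_orthonormal_def)

lemma hcoeff_l2 [simp]: "u \<in> l2 \<Longrightarrow> hcoeff EE u \<in> l2"
  by (rule hcoeff_bessel[OF EE_on])

lemma hcoeff_A:
  assumes u: "u \<in> H1" shows "hcoeff EE (matvec A u) = evwt lam 1 (hcoeff EE u)"
proof
  fix e
  show "hcoeff EE (matvec A u) e = evwt lam 1 (hcoeff EE u) e"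
  proof (cases "e \<in> EE")
    case True
    have "l2_inner (matvec A u) e = l2_inner u (matvec A e)" by (rule A_sym[OF u EE_eigen(1)[OF True]])
    then show ?thesis using True by (simp add: hcoeff_def evwt_def EE_eigen(2) l2_inner_scale_right)
  qed (simp add: hcoeff_def evwt_def)
qed

lemma hcoeff_inj: "u \<in> l2 \<Longrightarrow> v \<in> l2 \<Longrightarrow> hcoeff EE u = hcoeff EE v \<Longrightarrow> u = v"
  using hcoeff_unitary(1)[OF EE] by metis

text \<open>
  The function with the coefficients \<open>lam e * hcoeff EE u e\<close> has a preimage under \<open>A\<close> in \<open>H1\<close>, and
  the preimage has the same coefficients as \<open>u\<close>.
\<close>

lemma H1_of_coeff:
  assumes u: "u \<in> l2" and c: "evwt lam 1 (hcoeff EE u) \<in> l2" shows "u \<in> H1"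
proof -
  define v where "v = synth EE (evwt lam 1 (hcoeff EE u))"
  have s: "\<forall>e. e \<notin> EE \<longrightarrow> evwt lam 1 (hcoeff EE u) e = 0" by (simp add: evwt_def hcoeff_def)
  have v: "v \<in> l2" "hcoeff EE v = evwt lam 1 (hcoeff EE u)"
    unfolding v_def using synth_props[OF EE_on c s] by auto
  have "evwt lam 1 (hcoeff EE (Kop v)) = evwt lam 1 (hcoeff EE u)"
    using hcoeff_A[OF Kop(1)[OF v(1)]] Kop(2)[OF v(1)] v(2) by simp
  then have "of_real (lam e) * hcoeff EE (Kop v) e = of_real (lam e) * hcoeff EE u e" for e
    unfolding evwt_def by (simp add: fun_eq_iff)
  moreover have "lam e \<noteq> 0" for e using lam_ge_1[of e] by linarith
  ultimately have "hcoeff EE (Kop v) = hcoeff EE u" by (intro ext) simp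
  then have "Kop v = u" by (intro hcoeff_inj Kop_l2 v u)
  then show ?thesis using Kop(1)[OF v(1)] by simp
qed

text \<open>
  The powers of \<open>A\<close> and of the weight have the same domains with equivalent norms. In the induction
  the regularity estimate gains one order for the first direction, and the boundedness of \<open>A\<close> loses one
  for the second.
\<close>

theorem sobolev_le_spectral:
  "\<exists>C\<ge>0. \<forall>u\<in>l2. evwt lam N (hcoeff EE u) \<in> l2 \<longrightarrow>
     wt N u \<in> l2 \<and> l2_norm (wt N u) \<le> C * l2_norm (evwt lam N (hcoeff EE u))"
proof (induction N)
  case 0
  show ?case by (intro exI[of _ 1]) (simp add: evwt_def hcoeff_unitary(2)[OF EE])
next
  case (Suc N)
  then obtain C where C: "C \<ge> 0" "\<And>u. u \<in> l2 \<Longrightarrow> evwt lam N (hcoeff EE u) \<in> l2 \<Longrightarrow>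
     wt N u \<in> l2 \<and> l2_norm (wt N u) \<le> C * l2_norm (evwt lam N (hcoeff EE u))" by blast
  obtain D where D: "D \<ge> 0" "\<And>u. wt N u \<in> l2 \<Longrightarrow> wt N (matvec A u) \<in> l2 \<Longrightarrow>
     wt (Suc N) u \<in> l2 \<and> l2_norm (wt (Suc N) u) \<le> D * (l2_norm (wt N (matvec A u)) + l2_norm (wt N u))"
    using reg[of N] by blast
  have "wt (Suc N) u \<in> l2 \<and> l2_norm (wt (Suc N) u) \<le> D * (C + C) * l2_norm (evwt lam (Suc N) (hcoeff EE u))"
    if u: "u \<in> l2" and c: "evwt lam (Suc N) (hcoeff EE u) \<in> l2" for u
  proof -
    have "evwt lam 1 (hcoeff EE u) \<in> l2" by (rule evwt_mono(1)[OF lam_ge_1 _ c]) simp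
    then have uH: "u \<in> H1" by (rule H1_of_coeff[OF u])
    have Ac: "evwt lam N (hcoeff EE (matvec A u)) = evwt lam (Suc N) (hcoeff EE u)"
      unfolding hcoeff_A[OF uH] by (simp add: evwt_def mult_ac)
    have 1: "wt N (matvec A u) \<in> l2" "l2_norm (wt N (matvec A u)) \<le> C * l2_norm (evwt lam (Suc N) (hcoeff EE u))"
      using C(2)[OF A_H1[OF uH]] c unfolding Ac by auto
    have m: "evwt lam N (hcoeff EE u) \<in> l2" "l2_norm (evwt lam N (hcoeff EE u)) \<le> l2_norm (evwt lam (Suc N) (hcoeff EE u))"
      using evwt_mono[OF lam_ge_1 _ c, of N] by auto
    have 2: "wt N u \<in> l2" "l2_norm (wt N u) \<le> C * l2_norm (evwt lam N (hcoeff EE u))" using C(2)[OF u m(1)] by auto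
    have "l2_norm (wt N u) \<le> C * l2_norm (evwt lam (Suc N) (hcoeff EE u))"
      using 2(2) mult_left_mono[OF m(2) C(1)] by linarith
    then have "D * (l2_norm (wt N (matvec A u)) + l2_norm (wt N u))
      \<le> D * (C * l2_norm (evwt lam (Suc N) (hcoeff EE u)) + C * l2_norm (evwt lam (Suc N) (hcoeff EE u)))"
      using 1(2) D(1) by (intro mult_left_mono add_mono) auto
    then show ?thesis using D(2)[OF 2(1) 1(1)] by (simp add: algebra_simps)
  qed
  then show ?case using C(1) D(1) by (intro exI[of _ "D * (C + C)"]) simp
qed

theorem spectral_le_sobolev:
  "\<exists>C\<ge>0. \<forall>u. wt N u \<in> l2 \<longrightarrow>
     evwt lam N (hcoeff EE u) \<in> l2 \<and> l2_norm (evwt lam N (hcoeff EE u)) \<le> C * l2_norm (wt N u)"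
proof (induction N)
  case 0
  show ?case by (intro exI[of _ 1]) (simp add: evwt_def hcoeff_unitary(2)[OF EE])
next
  case (Suc N)
  then obtain C where C: "C \<ge> 0" "\<And>u. wt N u \<in> l2 \<Longrightarrow>
     evwt lam N (hcoeff EE u) \<in> l2 \<and> l2_norm (evwt lam N (hcoeff EE u)) \<le> C * l2_norm (wt N u)" by blast
  obtain D where D: "D \<ge> 0" "\<And>u. wt (Suc N) u \<in> l2 \<Longrightarrow>
     wt N (matvec A u) \<in> l2 \<and> l2_norm (wt N (matvec A u)) \<le> D * l2_norm (wt (Suc N) u)"
    using bound[of N] by blast
  have "evwt lam (Suc N) (hcoeff EE u) \<in> l2 \<and> l2_norm (evwt lam (Suc N) (hcoeff EE u)) \<le> C * D * l2_norm (wt (Suc N) u)"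
    if u: "wt (Suc N) u \<in> l2" for u
  proof -
    have uH: "u \<in> H1" unfolding H1_def using wt_mono(1)[OF _ u, of 1] by simp
    have Ac: "evwt lam N (hcoeff EE (matvec A u)) = evwt lam (Suc N) (hcoeff EE u)"
      unfolding hcoeff_A[OF uH] by (simp add: evwt_def mult_ac)
    have "l2_norm (evwt lam (Suc N) (hcoeff EE u)) \<le> C * l2_norm (wt N (matvec A u))"
      using C(2)[of "matvec A u"] D(2)[OF u] unfolding Ac by blast
    also have "\<dots> \<le> C * (D * l2_norm (wt (Suc N) u))" using C(1) D(2)[OF u] by (intro mult_left_mono) auto
    finally show ?thesis using C(2)[of "matvec A u"] D(2)[OF u] unfolding Ac by (simp add: mult.assoc)
  qed
  then show ?case using C(1) D(1) by (intro exI[of _ "C * D"]) simp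
qed

end

section \<open>Interpolation with a function parameter\<close>

lemma ex_geometric:
  fixes a q :: real
  assumes "a > 1" "q \<ge> 1" shows "\<exists>m. a ^ m \<le> q \<and> q < a ^ Suc m"
proof -
  obtain n where n: "q < a ^ n" using real_arch_pow[OF assms(1)] by blast
  obtain m where "\<forall>i\<le>m. \<not> q < a ^ i" "q < a ^ Suc m"
    using ex_least_nat_less[of "\<lambda>m. q < a ^ m" n] n assms(2) by auto
  then show ?thesis by (intro exI[of _ m]) (simp add: not_less)
qed

text \<open>
  The condition of \<open>RO\<close>-variation, iterated along a geometric progression, gives two-sided
  polynomial growth bounds.
\<close>

lemma RO_growth:
  assumes "\<phi> \<in> RO"
  shows "\<exists>C\<ge>1. \<exists>\<sigma>::nat. \<forall>s\<ge>1. \<forall>t\<ge>1. \<phi> s \<le> C * (max (s / t) (t / s)) ^ \<sigma> * \<phi> t"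
proof -
  obtain a c where ac: "a > 1" "c \<ge> 1" "\<And>t l. t \<ge> 1 \<Longrightarrow> 1 \<le> l \<Longrightarrow> l \<le> a \<Longrightarrow> inverse c \<le> \<phi> (l * t) / \<phi> t \<and> \<phi> (l * t) / \<phi> t \<le> c"
    and pos: "\<And>t. t \<ge> 1 \<Longrightarrow> \<phi> t > 0"
    using assms by (auto simp: RO_def)
  have up: "\<phi> (l * t) \<le> c * \<phi> t" "\<phi> t \<le> c * \<phi> (l * t)" if "t \<ge> 1" "1 \<le> l" "l \<le> a" for l t
  proof -
    show "\<phi> (l * t) \<le> c * \<phi> t" using ac(3)[OF that] pos[OF that(1)] by (simp add: field_simps)
    show "\<phi> t \<le> c * \<phi> (l * t)" using ac(2) ac(3)[OF that] pos[OF that(1)] by (simp add: field_simps)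
  qed
  have pow: "\<phi> (a ^ m * t) \<le> c ^ m * \<phi> t \<and> \<phi> t \<le> c ^ m * \<phi> (a ^ m * t)" if t: "t \<ge> 1" for m t
  proof (induction m)
    case (Suc m)
    have "a ^ m * t \<ge> 1" using ac(1) t mult_mono[of 1 "a ^ m" 1 t] by simp
    then have "\<phi> (a * (a ^ m * t)) \<le> c * \<phi> (a ^ m * t)" "\<phi> (a ^ m * t) \<le> c * \<phi> (a * (a ^ m * t))"
      using up[of "a ^ m * t" a] ac(1) by auto
    moreover have "c * \<phi> (a ^ m * t) \<le> c * (c ^ m * \<phi> t)" using Suc ac(2) by (intro mult_left_mono) auto
    moreover have "c ^ m * \<phi> (a ^ m * t) \<le> c ^ m * (c * \<phi> (a * (a ^ m * t)))"
      using calculation(2) ac(2) by (intro mult_left_mono) auto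
    ultimately show ?case using Suc by (auto simp: mult_ac)
  qed simp
  obtain \<sigma> where \<sigma>: "c < a ^ \<sigma>" using real_arch_pow[OF ac(1)] by blast
  have main: "\<phi> s \<le> c * (s / t) ^ \<sigma> * \<phi> t \<and> \<phi> t \<le> c * (s / t) ^ \<sigma> * \<phi> s" if st: "1 \<le> t" "t \<le> s" for s t
  proof -
    define q where "q = s / t"
    have q: "q \<ge> 1" "s = q * t" using st by (auto simp: q_def)
    obtain m where m2: "a ^ m \<le> q" and m1: "q < a ^ Suc m" using ex_geometric[OF ac(1) q(1)] by blast
    have am: "a ^ m > 0" "a ^ m \<ge> 1" using ac(1) by auto
    define l where "l = q / a ^ m"
    have l: "1 \<le> l" "l \<le> a" using m1 m2 am by (auto simp: l_def field_simps)
    have at: "a ^ m * t \<ge> 1" using am st(1) mult_mono[of 1 "a ^ m" 1 t] by simp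
    have s: "s = l * (a ^ m * t)" using am q ac(1) by (simp add: l_def)
    have cm: "c ^ m \<le> q ^ \<sigma>"
    proof -
      have "c ^ m \<le> (a ^ \<sigma>) ^ m" using \<sigma> ac(2) by (intro power_mono) auto
      also have "\<dots> = (a ^ m) ^ \<sigma>" by (simp add: power_mult[symmetric] mult.commute)
      also have "\<dots> \<le> q ^ \<sigma>" using m2 am by (intro power_mono) auto
      finally show ?thesis .
    qed
    have "\<phi> s \<le> c * \<phi> (a ^ m * t)" unfolding s by (rule up(1)[OF at l])
    also have "\<dots> \<le> c * (c ^ m * \<phi> t)" using pow[OF st(1)] ac(2) by (intro mult_left_mono) auto
    also have "\<dots> \<le> c * (q ^ \<sigma> * \<phi> t)" using cm ac(2) pos[OF st(1)] by (intro mult_left_mono mult_right_mono) auto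
    finally have 1: "\<phi> s \<le> c * (q ^ \<sigma> * \<phi> t)" .
    have s1: "s \<ge> 1" using st by linarith
    have "\<phi> t \<le> c ^ m * \<phi> (a ^ m * t)" using pow[OF st(1)] by blast
    also have "\<dots> \<le> c ^ m * (c * \<phi> s)" unfolding s using up(2)[OF at l] ac(2) by (intro mult_left_mono) auto
    also have "\<dots> \<le> q ^ \<sigma> * (c * \<phi> s)" using cm ac(2) pos[OF s1] by (intro mult_right_mono) auto
    finally show ?thesis using 1 by (simp add: q_def mult_ac)
  qed
  have "\<phi> s \<le> c * (max (s / t) (t / s)) ^ \<sigma> * \<phi> t" if st: "s \<ge> 1" "t \<ge> 1" for s t
  proof (cases "t \<le> s")
    case True
    have "c * (s / t) ^ \<sigma> * \<phi> t \<le> c * (max (s / t) (t / s)) ^ \<sigma> * \<phi> t"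
      using ac(2) st pos[OF st(2)] by (intro mult_right_mono mult_left_mono power_mono) auto
    then show ?thesis using main[OF st(2) True] by linarith
  next
    case False
    have "c * (t / s) ^ \<sigma> * \<phi> t \<le> c * (max (s / t) (t / s)) ^ \<sigma> * \<phi> t"
      using ac(2) st pos[OF st(2)] by (intro mult_right_mono mult_left_mono power_mono) auto
    then show ?thesis using main[of s t] st False by auto
  qed
  then show ?thesis using ac(2) by (intro exI[of _ c] conjI exI[of _ \<sigma>]) auto
qed

text \<open>
  A profile of height \<open>1\<close> at \<open>s = t\<close> that decays like a power on both sides; the two powers are the
  squared weights of the two spaces between which the interpolation takes place.
\<close>

definition bump :: "nat \<Rightarrow> real \<Rightarrow> real \<Rightarrow> real" where
  "bump N t s = (min (s / t) (t / s)) ^ (2 * N)"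

definition rmul :: "('i \<Rightarrow> real) \<Rightarrow> ('i \<Rightarrow> complex) \<Rightarrow> 'i \<Rightarrow> complex" where
  "rmul g u = (\<lambda>k. of_real (g k) * u k)"

lemma cmod_rmul: "cmod (rmul g u k) = \<bar>g k\<bar> * cmod (u k)"
  by (simp add: rmul_def norm_mult)

lemma rmul_bounded:
  assumes "u \<in> l2" "\<And>k. \<bar>g k\<bar> \<le> B" shows "rmul g u \<in> l2"
proof -
  have "B \<ge> 0" using assms(2) abs_ge_zero order_trans by blast
  then show ?thesis
    by (intro l2_mono(1)[OF assms(1), of _ B]) (simp_all add: cmod_rmul mult_right_mono assms(2))
qed

text \<open>
  The two components of a unitary relation \<open>R\<close> carry the weights \<open>w\<close> and \<open>v\<close>, whose \<open>N\<close>-th powers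
  define equivalent norms. The assumptions are symmetric in the two components, so every result
  applies in both directions.
\<close>

locale unitary_relation =
  fixes R :: "('i \<Rightarrow> complex) \<Rightarrow> ('j \<Rightarrow> complex) \<Rightarrow> bool"
    and w :: "'i \<Rightarrow> real" and v :: "'j \<Rightarrow> real" and N :: nat and C :: real
  assumes R_l2: "R u c \<Longrightarrow> u \<in> l2 \<and> c \<in> l2"
    and R_diff: "R u c \<Longrightarrow> R u' c' \<Longrightarrow> R (\<lambda>k. u k - u' k) (\<lambda>k. c k - c' k)"
    and R_inner: "R u c \<Longrightarrow> R u' c' \<Longrightarrow> l2_inner u u' = l2_inner c c'"
    and R_left: "R u c \<Longrightarrow> (\<And>k. \<bar>g k\<bar> \<le> B) \<Longrightarrow> \<exists>c'. R (rmul g u) c'"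
    and R_right: "R u c \<Longrightarrow> (\<And>k. \<bar>h k\<bar> \<le> B) \<Longrightarrow> \<exists>u'. R u' (rmul h c)"
    and w1: "w k \<ge> 1" and v1: "v j \<ge> 1" and C0: "C > 0"
    and up: "R u c \<Longrightarrow> rmul (\<lambda>j. v j ^ N) c \<in> l2 \<Longrightarrow>
       rmul (\<lambda>k. w k ^ N) u \<in> l2 \<and> l2_norm (rmul (\<lambda>k. w k ^ N) u) \<le> C * l2_norm (rmul (\<lambda>j. v j ^ N) c)"
    and down: "R u c \<Longrightarrow> rmul (\<lambda>k. w k ^ N) u \<in> l2 \<Longrightarrow>
       rmul (\<lambda>j. v j ^ N) c \<in> l2 \<and> l2_norm (rmul (\<lambda>j. v j ^ N) c) \<le> C * l2_norm (rmul (\<lambda>k. w k ^ N) u)"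
begin

lemma w0: "w k > 0" and v0: "v j > 0"
  using w1[of k] v1[of j] by linarith+

lemma inv_bound: "\<bar>inverse (w k ^ p)\<bar> \<le> 1" "\<bar>inverse (v j ^ p)\<bar> \<le> 1"
  using w0[of k] v0[of j] one_le_power[OF w1[of k], of p] one_le_power[OF v1[of j], of p]
  by (simp_all add: inverse_le_1_iff)

text \<open>Duality turns the estimate for the weight \<open>w\<^sup>N\<close> into one for \<open>w\<^sup>-\<^sup>N\<close>.\<close>

lemma dual:
  assumes uc: "R u c"
  shows "l2_norm (rmul (\<lambda>k. inverse (w k ^ N)) u) \<le> C * l2_norm (rmul (\<lambda>j. inverse (v j ^ N)) c)"
proof -
  have ul: "u \<in> l2" "c \<in> l2" using R_l2[OF uc] by auto
  define p where "p = rmul (\<lambda>k. inverse (w k ^ N)) u"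
  have pl: "p \<in> l2" unfolding p_def by (rule rmul_bounded[OF ul(1) inv_bound(1)])
  obtain z where z: "R (rmul (\<lambda>k. inverse (w k ^ (2 * N))) u) z"
    using R_left[OF uc, of "\<lambda>k. inverse (w k ^ (2 * N))" 1] inv_bound(1)[of _ "2 * N"] by blast
  have wz: "rmul (\<lambda>k. w k ^ N) (rmul (\<lambda>k. inverse (w k ^ (2 * N))) u) = p"
    unfolding p_def rmul_def
  proof (rule ext)
    fix k
    have "w k ^ N * inverse (w k ^ (2 * N)) = inverse (w k ^ N)"
      using w0[of k] unfolding mult_2 power_add by (simp add: field_simps)
    then show "complex_of_real (w k ^ N) * (complex_of_real (inverse (w k ^ (2 * N))) * u k) = complex_of_real (inverse (w k ^ N)) * u k"
      by (metis mult.assoc of_real_mult)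
  qed
  have vz: "rmul (\<lambda>j. v j ^ N) z \<in> l2" "l2_norm (rmul (\<lambda>j. v j ^ N) z) \<le> C * l2_norm p"
    using down[OF z] pl unfolding wz by auto
  have "of_real ((l2_norm p)\<^sup>2) = l2_inner u (rmul (\<lambda>k. inverse (w k ^ (2 * N))) u)"
    unfolding l2_inner_self[symmetric] unfolding l2_inner_def p_def rmul_def
    by (intro infsum_cong) (simp add: power_mult power2_eq_square power_mult_distrib mult_ac mult_2 power_add)
  also have "\<dots> = l2_inner c z" by (rule R_inner[OF uc z])
  also have "\<dots> = l2_inner (rmul (\<lambda>j. inverse (v j ^ N)) c) (rmul (\<lambda>j. v j ^ N) z)"
    unfolding l2_inner_def rmul_def
  proof (rule infsum_cong)
    fix j
    have "complex_of_real (v j) \<noteq> 0" using v0[of j] by simp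
    then show "c j * cnj (z j) = complex_of_real (inverse (v j ^ N)) * c j * cnj (complex_of_real (v j ^ N) * z j)"
      by (simp add: field_simps)
  qed
  finally have "(l2_norm p)\<^sup>2 = cmod (l2_inner (rmul (\<lambda>j. inverse (v j ^ N)) c) (rmul (\<lambda>j. v j ^ N) z))"
    by (metis abs_of_nonneg norm_of_real zero_le_power2)
  also have "\<dots> \<le> l2_norm (rmul (\<lambda>j. inverse (v j ^ N)) c) * l2_norm (rmul (\<lambda>j. v j ^ N) z)"
    by (rule cauchy_schwarz(2)[OF rmul_bounded[OF ul(2) inv_bound(2)] vz(1)])
  also have "\<dots> \<le> l2_norm (rmul (\<lambda>j. inverse (v j ^ N)) c) * (C * l2_norm p)"
    by (intro mult_left_mono vz) simp
  finally have "l2_norm p * l2_norm p \<le> (C * l2_norm (rmul (\<lambda>j. inverse (v j ^ N)) c)) * l2_norm p"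
    by (simp add: power2_eq_square mult_ac)
  then show ?thesis using C0 by (cases "l2_norm p = 0") (simp_all add: p_def mult_le_cancel_right order_less_le)
qed

lemma bump_le:
  assumes "t > 0" "s > 0" shows "bump N t s \<le> (s / t) ^ (2 * N)" "bump N t s \<le> (t / s) ^ (2 * N)" "bump N t s \<ge> 0"
  using assms by (auto simp: bump_def intro!: power_mono)

text \<open>
  Splitting \<open>u\<close> where \<open>v = t\<close> and estimating the part with large \<open>v\<close> by the weights to the power
  \<open>-N\<close> and the part with small \<open>v\<close> by the weights to the power \<open>N\<close> loses only a constant.
\<close>

lemma bump_estimate:
  assumes uc: "R u c" and t: "t > 0" and F: "finite F"
    and s: "(\<lambda>j. bump N t (v j) * (cmod (c j))\<^sup>2) summable_on UNIV"
  shows "(\<Sum>k\<in>F. bump N t (w k) * (cmod (u k))\<^sup>2) \<le> 4 * C\<^sup>2 * (\<Sum>\<^sub>\<infinity>j. bump N t (v j) * (cmod (c j))\<^sup>2)"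
proof -
  have ul: "u \<in> l2" "c \<in> l2" using R_l2[OF uc] by auto
  define S where "S = (\<Sum>\<^sub>\<infinity>j. bump N t (v j) * (cmod (c j))\<^sup>2)"
  have b0: "0 \<le> bump N t (v j)" for j using bump_le(3)[OF t v0] .
  have S0: "S \<ge> 0" unfolding S_def using b0 by (intro infsum_nonneg) auto
  define h where "h = (\<lambda>j. if v j \<ge> t then 1 else (0::real))"
  have "\<bar>h j\<bar> \<le> 1" for j by (simp add: h_def)
  then obtain u0 where u0: "R u0 (rmul h c)" using R_right[OF uc, of h 1] by blast
  define c0 where "c0 = rmul h c"
  define u1 where "u1 = (\<lambda>k. u k - u0 k)"
  define c1 where "c1 = (\<lambda>j. c j - c0 j)"
  have R0: "R u0 c0" using u0 by (simp add: c0_def)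
  have R1: "R u1 c1" unfolding u1_def c1_def by (rule R_diff[OF uc R0])
  have c1_eq: "c1 j = (if v j \<ge> t then 0 else c j)" and c0_eq: "c0 j = (if v j \<ge> t then c j else 0)" for j
    by (auto simp: c1_def c0_def rmul_def h_def)
  have n0: "(l2_norm (rmul (\<lambda>j. inverse (v j ^ N)) c0))\<^sup>2 \<le> S / t ^ (2 * N)"
  proof -
    have "(l2_norm (rmul (\<lambda>j. inverse (v j ^ N)) c0))\<^sup>2 \<le> (\<Sum>\<^sub>\<infinity>j. (1 / t ^ (2 * N)) * (bump N t (v j) * (cmod (c j))\<^sup>2))"
      unfolding l2_norm_sq
    proof (rule infsum_mono)
      show "(\<lambda>j. (cmod (rmul (\<lambda>j. inverse (v j ^ N)) c0 j))\<^sup>2) summable_on UNIV"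
        using rmul_bounded[OF _ inv_bound(2), of c0] R_l2[OF R0] by (auto simp: l2_def)
      show "(\<lambda>j. (1 / t ^ (2 * N)) * (bump N t (v j) * (cmod (c j))\<^sup>2)) summable_on UNIV"
        by (intro summable_on_cmult_right s)
      fix j
      show "(cmod (rmul (\<lambda>j. inverse (v j ^ N)) c0 j))\<^sup>2 \<le> (1 / t ^ (2 * N)) * (bump N t (v j) * (cmod (c j))\<^sup>2)"
      proof (cases "v j \<ge> t")
        case True
        have "t / v j \<le> v j / t" using True t v0[of j] mult_mono[OF True True] by (simp add: field_simps)
        then have "bump N t (v j) = t ^ (2 * N) / (v j) ^ (2 * N)"
          unfolding bump_def by (simp add: min_absorb2 power_divide)
        moreover have "(cmod (rmul (\<lambda>j. inverse (v j ^ N)) c0 j))\<^sup>2 = (cmod (c j))\<^sup>2 / (v j) ^ (2 * N)"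
          using True v0[of j] by (simp add: cmod_rmul c0_eq power_mult_distrib power_divide field_simps power_mult[symmetric] mult.commute)
        ultimately show ?thesis using t by simp
      qed (use b0 t in \<open>simp add: cmod_rmul c0_eq\<close>)
    qed
    also have "\<dots> = S / t ^ (2 * N)" unfolding S_def infsum_cmult_right' by simp
    finally show ?thesis .
  qed
  have le1: "(cmod (rmul (\<lambda>j. v j ^ N) c1 j))\<^sup>2 \<le> t ^ (2 * N) * (bump N t (v j) * (cmod (c j))\<^sup>2)" for j
  proof (cases "v j \<ge> t")
    case True then show ?thesis using b0 t by (simp add: cmod_rmul c1_eq)
  next
    case False
    then have "v j / t \<le> t / v j" using t v0[of j] mult_mono[of "v j" t "v j" t] by (simp add: field_simps)
    then have "bump N t (v j) = (v j) ^ (2 * N) / t ^ (2 * N)"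
      unfolding bump_def by (simp add: min_absorb1 power_divide)
    moreover have "(cmod (rmul (\<lambda>j. v j ^ N) c1 j))\<^sup>2 = (v j) ^ (2 * N) * (cmod (c j))\<^sup>2"
      using False v0[of j] by (simp add: cmod_rmul c1_eq power_mult_distrib power_mult[symmetric] mult.commute)
    ultimately show ?thesis using t by simp
  qed
  have s1: "(\<lambda>j. t ^ (2 * N) * (bump N t (v j) * (cmod (c j))\<^sup>2)) summable_on UNIV"
    by (intro summable_on_cmult_right s)
  have s1': "(\<lambda>j. (cmod (rmul (\<lambda>j. v j ^ N) c1 j))\<^sup>2) summable_on UNIV"
    by (rule summable_on_comparison_test[OF s1]) (auto simp: le1)
  have n1: "(l2_norm (rmul (\<lambda>j. v j ^ N) c1))\<^sup>2 \<le> t ^ (2 * N) * S"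
    unfolding l2_norm_sq S_def infsum_cmult_right'[symmetric] by (rule infsum_mono[OF s1' s1]) (rule le1)
  have u1: "rmul (\<lambda>k. w k ^ N) u1 \<in> l2" "l2_norm (rmul (\<lambda>k. w k ^ N) u1) \<le> C * l2_norm (rmul (\<lambda>j. v j ^ N) c1)"
    using up[OF R1] s1' by (auto simp: l2_def)
  have u0: "rmul (\<lambda>k. inverse (w k ^ N)) u0 \<in> l2" using rmul_bounded[OF _ inv_bound(1), of u0] R_l2[OF R0] by auto
  have sq1: "(l2_norm (rmul (\<lambda>k. w k ^ N) u1))\<^sup>2 \<le> C\<^sup>2 * (t ^ (2 * N) * S)"
  proof -
    have "(l2_norm (rmul (\<lambda>k. w k ^ N) u1))\<^sup>2 \<le> (C * l2_norm (rmul (\<lambda>j. v j ^ N) c1))\<^sup>2" by (intro power_mono u1) simp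
    also have "\<dots> \<le> C\<^sup>2 * (t ^ (2 * N) * S)" unfolding power_mult_distrib by (intro mult_left_mono n1) simp
    finally show ?thesis .
  qed
  have sq0: "(l2_norm (rmul (\<lambda>k. inverse (w k ^ N)) u0))\<^sup>2 \<le> C\<^sup>2 * (S / t ^ (2 * N))"
  proof -
    have "(l2_norm (rmul (\<lambda>k. inverse (w k ^ N)) u0))\<^sup>2 \<le> (C * l2_norm (rmul (\<lambda>j. inverse (v j ^ N)) c0))\<^sup>2" by (intro power_mono dual[OF R0]) simp
    also have "\<dots> \<le> C\<^sup>2 * (S / t ^ (2 * N))" unfolding power_mult_distrib by (intro mult_left_mono n0) simp
    finally show ?thesis .
  qed
  have "(\<Sum>k\<in>F. bump N t (w k) * (cmod (u k))\<^sup>2)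
     \<le> (\<Sum>k\<in>F. 2 * (t ^ (2 * N) * (cmod (rmul (\<lambda>k. inverse (w k ^ N)) u0 k))\<^sup>2)
          + 2 * ((1 / t ^ (2 * N)) * (cmod (rmul (\<lambda>k. w k ^ N) u1 k))\<^sup>2))"
  proof (rule sum_mono)
    fix k
    have "(cmod (u k))\<^sup>2 \<le> (cmod (u0 k) + cmod (u1 k))\<^sup>2"
      using norm_triangle_ineq[of "u0 k" "u1 k"] by (intro power_mono) (auto simp: u1_def)
    also have "\<dots> \<le> 2 * (cmod (u0 k))\<^sup>2 + 2 * (cmod (u1 k))\<^sup>2"
      using sum_squares_bound[of "cmod (u0 k)" "cmod (u1 k)"] by (simp add: power2_sum)
    finally have "bump N t (w k) * (cmod (u k))\<^sup>2 \<le> bump N t (w k) * (2 * (cmod (u0 k))\<^sup>2 + 2 * (cmod (u1 k))\<^sup>2)"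
      by (intro mult_left_mono bump_le(3) t w0)
    also have "\<dots> = 2 * (bump N t (w k) * (cmod (u0 k))\<^sup>2) + 2 * (bump N t (w k) * (cmod (u1 k))\<^sup>2)" by (simp add: algebra_simps)
    also have "\<dots> \<le> 2 * ((t / w k) ^ (2 * N) * (cmod (u0 k))\<^sup>2) + 2 * ((w k / t) ^ (2 * N) * (cmod (u1 k))\<^sup>2)"
      by (intro add_mono mult_left_mono mult_right_mono bump_le t w0) auto
    also have "(t / w k) ^ (2 * N) * (cmod (u0 k))\<^sup>2 = t ^ (2 * N) * (cmod (rmul (\<lambda>k. inverse (w k ^ N)) u0 k))\<^sup>2"
      using w0[of k] by (simp add: cmod_rmul power_mult_distrib power_divide field_simps power_mult[symmetric] mult.commute)
    also have "(w k / t) ^ (2 * N) * (cmod (u1 k))\<^sup>2 = (1 / t ^ (2 * N)) * (cmod (rmul (\<lambda>k. w k ^ N) u1 k))\<^sup>2"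
      using w0[of k] by (simp add: cmod_rmul power_mult_distrib power_divide power_mult[symmetric] mult.commute)
    finally show "bump N t (w k) * (cmod (u k))\<^sup>2 \<le> 2 * (t ^ (2 * N) * (cmod (rmul (\<lambda>k. inverse (w k ^ N)) u0 k))\<^sup>2)
          + 2 * ((1 / t ^ (2 * N)) * (cmod (rmul (\<lambda>k. w k ^ N) u1 k))\<^sup>2)" .
  qed
  also have "\<dots> = 2 * (t ^ (2 * N) * (\<Sum>k\<in>F. (cmod (rmul (\<lambda>k. inverse (w k ^ N)) u0 k))\<^sup>2))
          + 2 * ((1 / t ^ (2 * N)) * (\<Sum>k\<in>F. (cmod (rmul (\<lambda>k. w k ^ N) u1 k))\<^sup>2))"
    by (simp only: sum.distrib sum_distrib_left)
  also have "\<dots> \<le> 2 * (t ^ (2 * N) * (C\<^sup>2 * (S / t ^ (2 * N)))) + 2 * ((1 / t ^ (2 * N)) * (C\<^sup>2 * (t ^ (2 * N) * S)))"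
    using t by (intro add_mono mult_left_mono order_trans[OF l2_finite_le[OF u0 F] sq0] order_trans[OF l2_finite_le[OF u1(1) F] sq1]) auto
  also have "\<dots> = 4 * C\<^sup>2 * S" using t by simp
  finally show ?thesis by (simp add: S_def)
qed

lemma infsum_finite_sum:
  fixes f :: "nat \<Rightarrow> 'j \<Rightarrow> real"
  assumes "\<And>m. f m summable_on UNIV"
  shows "((\<lambda>j. \<Sum>m<J. f m j) has_sum (\<Sum>m<J. \<Sum>\<^sub>\<infinity>j. f m j)) UNIV"
proof (induction J)
  case (Suc J)
  show ?case using has_sum_add[OF Suc has_sum_infsum[OF assms[of J]]] by simp
qed simp

lemma dyadic_sum_le:
  fixes s :: real
  assumes s: "s \<ge> 1"
  shows "(\<Sum>j<J. min (s / 2 ^ j) (2 ^ j / s)) \<le> 4"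
proof -
  \<comment> \<open>The terms grow geometrically up to \<open>2\<^sup>j = s\<close> and then decrease geometrically; the invariant bounds the partial sums accordingly.\<close>
  have "(2 ^ J \<le> 2 * s \<longrightarrow> (\<Sum>j<J. min (s / 2 ^ j) (2 ^ j / s)) \<le> 2 ^ J / s) \<and>
     (\<not> 2 ^ J \<le> 2 * s \<longrightarrow> (\<Sum>j<J. min (s / 2 ^ j) (2 ^ j / s)) \<le> 4 - 2 * s / 2 ^ J)"
  proof (induction J)
    case 0
    then show ?case using s by simp
  next
    case (Suc J)
    have m: "min (s / 2 ^ J) (2 ^ J / s) \<le> s / 2 ^ J" "min (s / 2 ^ J) (2 ^ J / s) \<le> 2 ^ J / s" by auto
    show ?case
    proof (cases "2 ^ Suc J \<le> 2 * s")
      case True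
      then have "2 ^ J \<le> 2 * s" using s by simp
      then have "(\<Sum>j<J. min (s / 2 ^ j) (2 ^ j / s)) \<le> 2 ^ J / s" using Suc by blast
      then show ?thesis using True m(2) by simp
    next
      case False
      then have sJ: "s / 2 ^ J < 1" by simp
      have "(\<Sum>j<J. min (s / 2 ^ j) (2 ^ j / s)) + s / 2 ^ J \<le> 4 - s / 2 ^ J"
      proof (cases "2 ^ J \<le> 2 * s")
        case True
        then have "(\<Sum>j<J. min (s / 2 ^ j) (2 ^ j / s)) \<le> 2 ^ J / s" using Suc by blast
        moreover have "2 ^ J / s \<le> 2" using True s by (simp add: field_simps)
        ultimately show ?thesis using sJ by linarith
      next
        case F: False
        then have "(\<Sum>j<J. min (s / 2 ^ j) (2 ^ j / s)) \<le> 4 - 2 * s / 2 ^ J" using Suc by blast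
        then show ?thesis by simp
      qed
      then show ?thesis using False m(1) by simp
    qed
  qed
  moreover have "2 ^ J \<le> 2 * s \<Longrightarrow> 2 ^ J / s \<le> 4" using s by (simp add: field_simps)
  moreover have "4 - 2 * s / 2 ^ J \<le> 4" using s by simp
  ultimately show ?thesis by (meson order_trans)
qed

text \<open>
  Bumps at the dyadic points with weights \<open>\<phi>(2\<^sup>j)\<^sup>2\<close> add up to a function that is comparable with
  \<open>\<phi>\<^sup>2\<close>, because \<open>\<phi>\<close> grows and decays more slowly than the bumps do; that is why \<open>N\<close> exceeds the
  growth exponent \<open>\<sigma>\<close>. Summing the estimate for a single bump gives the estimate for \<open>\<phi>\<close>.
\<close>

theorem interpolation:
  assumes pos: "\<And>t. t \<ge> 1 \<Longrightarrow> \<phi> t > 0" and D: "D \<ge> 1" and N: "N = Suc \<sigma>"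
    and growth: "\<And>s t. s \<ge> 1 \<Longrightarrow> t \<ge> 1 \<Longrightarrow> \<phi> s \<le> D * (max (s / t) (t / s)) ^ \<sigma> * \<phi> t"
  shows "\<exists>K>0. \<forall>u c. R u c \<longrightarrow> rmul (\<lambda>j. \<phi> (v j)) c \<in> l2 \<longrightarrow>
     rmul (\<lambda>k. \<phi> (w k)) u \<in> l2 \<and> l2_norm (rmul (\<lambda>k. \<phi> (w k)) u) \<le> K * l2_norm (rmul (\<lambda>j. \<phi> (v j)) c)"
proof -
  define a where "a = (\<lambda>j::nat. (\<phi> (2 ^ j))\<^sup>2)"
  have a0: "a j \<ge> 0" for j by (simp add: a_def)
  have p1: "(2::real) ^ j \<ge> 1" and p0: "(2::real) ^ j > 0" for j :: nat by simp_all
  define L where "L = (D * 2 ^ \<sigma>)\<^sup>2 * 2 ^ (2 * N)"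
  have L0: "L > 0" using D by (simp add: L_def)
  have lower: "\<exists>j. (\<phi> s)\<^sup>2 \<le> L * (a j * bump N (2 ^ j) s)" if s: "s \<ge> 1" for s
  proof -
    obtain j where j: "2 ^ j \<le> s" "s < 2 * 2 ^ j" using ex_geometric[of 2 s] s by auto
    have r: "2 ^ j / s \<le> 1" "1 \<le> s / 2 ^ j" "s / 2 ^ j \<le> 2" using j s by (auto simp: field_simps)
    have mx: "max (s / 2 ^ j) (2 ^ j / s) \<le> 2" "0 \<le> max (s / 2 ^ j) (2 ^ j / s)" using r by linarith+
    have "(max (s / 2 ^ j) (2 ^ j / s)) ^ \<sigma> \<le> 2 ^ \<sigma>" by (rule power_mono[OF mx])
    then have "D * (max (s / 2 ^ j) (2 ^ j / s)) ^ \<sigma> * \<phi> (2 ^ j) \<le> D * 2 ^ \<sigma> * \<phi> (2 ^ j)"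
      using D pos[OF p1[of j]] by (intro mult_right_mono mult_left_mono) auto
    then have "\<phi> s \<le> D * 2 ^ \<sigma> * \<phi> (2 ^ j)" using growth[OF s p1[of j]] by linarith
    then have "(\<phi> s)\<^sup>2 \<le> (D * 2 ^ \<sigma> * \<phi> (2 ^ j))\<^sup>2" using pos[OF s] by (intro power_mono) auto
    also have "\<dots> = (D * 2 ^ \<sigma>)\<^sup>2 * a j * 1" by (simp add: a_def power_mult_distrib)
    also have "\<dots> \<le> (D * 2 ^ \<sigma>)\<^sup>2 * a j * (2 ^ (2 * N) * bump N (2 ^ j) s)"
    proof (rule mult_left_mono)
      have "1 / 2 \<le> min (s / 2 ^ j) (2 ^ j / s)" using j s by (auto simp: field_simps)
      then have "(1 / 2) ^ (2 * N) \<le> bump N (2 ^ j) s" unfolding bump_def by (intro power_mono) auto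
      then show "1 \<le> 2 ^ (2 * N) * bump N (2 ^ j) s" by (simp add: power_divide field_simps)
    qed (simp add: a0)
    finally show ?thesis by (intro exI[of _ j]) (simp add: L_def mult_ac)
  qed
  have upper: "(\<Sum>j<J. a j * bump N (2 ^ j) s) \<le> 4 * D\<^sup>2 * (\<phi> s)\<^sup>2" if s: "s \<ge> 1" for J s
  proof -
    have "a j * bump N (2 ^ j) s \<le> D\<^sup>2 * (\<phi> s)\<^sup>2 * min (s / 2 ^ j) (2 ^ j / s)" for j
    proof -
      define \<mu> where "\<mu> = min (s / 2 ^ j) (2 ^ j / s)"
      have \<mu>: "\<mu> > 0" "\<mu> \<le> 1"
      proof -
        show "\<mu> > 0" using s by (simp add: \<mu>_def)
        show "\<mu> \<le> 1" using s by (cases "s \<le> 2 ^ j") (auto simp: \<mu>_def min_le_iff_disj)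
      qed
      have "max (2 ^ j / s) (s / 2 ^ j) = inverse \<mu>"
        using s by (cases "2 ^ j / s \<le> s / 2 ^ j") (auto simp: \<mu>_def max_def min_def field_simps)
      then have "\<phi> (2 ^ j) \<le> D * inverse \<mu> ^ \<sigma> * \<phi> s" using growth[OF p1[of j] s] by simp
      then have "a j \<le> (D * inverse \<mu> ^ \<sigma> * \<phi> s)\<^sup>2"
        unfolding a_def using pos[OF p1[of j]] by (intro power_mono) auto
      then have "a j * \<mu> ^ (2 * N) \<le> (D * inverse \<mu> ^ \<sigma> * \<phi> s)\<^sup>2 * \<mu> ^ (2 * N)"
        using \<mu> by (intro mult_right_mono) auto
      also have "\<dots> = D\<^sup>2 * (\<phi> s)\<^sup>2 * ((inverse \<mu> * \<mu>) ^ (2 * \<sigma>) * \<mu>\<^sup>2)"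
      proof -
        have e1: "(inverse \<mu> ^ \<sigma>)\<^sup>2 = inverse \<mu> ^ (2 * \<sigma>)" by (subst power_mult[symmetric]) (simp add: mult.commute)
        have e2: "\<mu> ^ (2 * N) = \<mu> ^ (2 * \<sigma>) * \<mu>\<^sup>2" by (simp add: N power2_eq_square mult_ac)
        show ?thesis unfolding power_mult_distrib e1 e2 by (simp only: mult_ac)
      qed
      also have "\<dots> = D\<^sup>2 * (\<phi> s)\<^sup>2 * \<mu>\<^sup>2" using \<mu> by simp
      also have "\<dots> \<le> D\<^sup>2 * (\<phi> s)\<^sup>2 * \<mu>"
        using \<mu> by (intro mult_left_mono) (auto simp: power2_eq_square mult_le_cancel_left1)
      finally show ?thesis by (simp add: bump_def \<mu>_def)
    qed
    then have "(\<Sum>j<J. a j * bump N (2 ^ j) s) \<le> (\<Sum>j<J. D\<^sup>2 * (\<phi> s)\<^sup>2 * min (s / 2 ^ j) (2 ^ j / s))"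
      by (intro sum_mono)
    also have "\<dots> = D\<^sup>2 * (\<phi> s)\<^sup>2 * (\<Sum>j<J. min (s / 2 ^ j) (2 ^ j / s))" by (simp add: sum_distrib_left)
    also have "\<dots> \<le> D\<^sup>2 * (\<phi> s)\<^sup>2 * 4" by (intro mult_left_mono dyadic_sum_le s) simp
    finally show ?thesis by (simp add: mult_ac)
  qed
  define K where "K = sqrt (L * (4 * C\<^sup>2) * (4 * D\<^sup>2))"
  have K2: "K\<^sup>2 = L * (4 * C\<^sup>2) * (4 * D\<^sup>2)" and K0: "K > 0" using L0 C0 D by (simp_all add: K_def)
  have "rmul (\<lambda>k. \<phi> (w k)) u \<in> l2 \<and> l2_norm (rmul (\<lambda>k. \<phi> (w k)) u) \<le> K * l2_norm (rmul (\<lambda>j. \<phi> (v j)) c)"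
    if uc: "R u c" and c: "rmul (\<lambda>j. \<phi> (v j)) c \<in> l2" for u c
  proof -
    have cl: "c \<in> l2" using R_l2[OF uc] by blast
    have c2: "(cmod (rmul (\<lambda>j. \<phi> (v j)) c j))\<^sup>2 = (\<phi> (v j))\<^sup>2 * (cmod (c j))\<^sup>2" for j
      by (simp add: cmod_rmul power_mult_distrib)
    have b0: "0 \<le> bump N (2 ^ m) (v j)" for m j using bump_le(3)[OF p0 v0] .
    have sb: "(\<lambda>j. bump N (2 ^ m) (v j) * (cmod (c j))\<^sup>2) summable_on UNIV" for m
    proof (rule summable_on_comparison_test)
      show "(\<lambda>j. (cmod (c j))\<^sup>2) summable_on UNIV" using cl by (simp add: l2_def)
      have "min (v j / 2 ^ m) (2 ^ m / v j) \<le> 1" for j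
        using v0[of j] by (cases "v j \<le> 2 ^ m") (auto simp: min_le_iff_disj)
      then have "bump N (2 ^ m) (v j) \<le> 1" for j unfolding bump_def using v0[of j] by (intro power_le_one) (auto simp: less_imp_le)
      then show "bump N (2 ^ m) (v j) * (cmod (c j))\<^sup>2 \<le> (cmod (c j))\<^sup>2" for j by (simp add: mult_left_le_one_le b0)
    qed (simp add: b0)
    have "(\<Sum>k\<in>F. (cmod (rmul (\<lambda>k. \<phi> (w k)) u k))\<^sup>2) \<le> (K * l2_norm (rmul (\<lambda>j. \<phi> (v j)) c))\<^sup>2" if F: "finite F" for F
    proof -
      obtain j where j: "\<And>k. (\<phi> (w k))\<^sup>2 \<le> L * (a (j k) * bump N (2 ^ j k) (w k))" using lower[OF w1] by metis
      obtain J where J: "\<And>k. k \<in> F \<Longrightarrow> j k < J"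
        using finite_nat_set_iff_bounded[of "j ` F"] F by auto
      have "(\<Sum>k\<in>F. (cmod (rmul (\<lambda>k. \<phi> (w k)) u k))\<^sup>2) \<le> (\<Sum>k\<in>F. \<Sum>m<J. L * a m * (bump N (2 ^ m) (w k) * (cmod (u k))\<^sup>2))"
      proof (rule sum_mono)
        fix k assume k: "k \<in> F"
        have "a (j k) * bump N (2 ^ j k) (w k) \<le> (\<Sum>m<J. a m * bump N (2 ^ m) (w k))"
          using J[OF k] by (intro member_le_sum) (auto intro!: mult_nonneg_nonneg a0 bump_le(3) w0)
        then have "(\<phi> (w k))\<^sup>2 \<le> L * (\<Sum>m<J. a m * bump N (2 ^ m) (w k))"
          using j[of k] L0 by (meson mult_left_mono less_imp_le order_trans)
        then have "(\<phi> (w k))\<^sup>2 * (cmod (u k))\<^sup>2 \<le> L * (\<Sum>m<J. a m * bump N (2 ^ m) (w k)) * (cmod (u k))\<^sup>2"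
          by (rule mult_right_mono) simp
        then show "(cmod (rmul (\<lambda>k. \<phi> (w k)) u k))\<^sup>2 \<le> (\<Sum>m<J. L * a m * (bump N (2 ^ m) (w k) * (cmod (u k))\<^sup>2))"
          by (simp add: cmod_rmul power_mult_distrib sum_distrib_left sum_distrib_right mult_ac)
      qed
      also have "\<dots> = (\<Sum>m<J. L * a m * (\<Sum>k\<in>F. bump N (2 ^ m) (w k) * (cmod (u k))\<^sup>2))"
        by (subst sum.swap) (simp only: sum_distrib_left)
      also have "\<dots> \<le> (\<Sum>m<J. L * a m * (4 * C\<^sup>2 * (\<Sum>\<^sub>\<infinity>j. bump N (2 ^ m) (v j) * (cmod (c j))\<^sup>2)))"
        using L0 a0 by (intro sum_mono mult_left_mono bump_estimate[OF uc p0 F sb]) simp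
      also have "\<dots> = L * (4 * C\<^sup>2) * (\<Sum>m<J. \<Sum>\<^sub>\<infinity>j. a m * (bump N (2 ^ m) (v j) * (cmod (c j))\<^sup>2))"
        by (simp add: sum_distrib_left infsum_cmult_right' mult_ac)
      also have "(\<Sum>m<J. \<Sum>\<^sub>\<infinity>j. a m * (bump N (2 ^ m) (v j) * (cmod (c j))\<^sup>2)) \<le> 4 * D\<^sup>2 * (l2_norm (rmul (\<lambda>j. \<phi> (v j)) c))\<^sup>2"
      proof -
        have hs: "((\<lambda>j. \<Sum>m<J. a m * (bump N (2 ^ m) (v j) * (cmod (c j))\<^sup>2)) has_sum
           (\<Sum>m<J. \<Sum>\<^sub>\<infinity>j. a m * (bump N (2 ^ m) (v j) * (cmod (c j))\<^sup>2))) UNIV"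
          by (rule infsum_finite_sum) (intro summable_on_cmult_right sb)
        have hc: "((\<lambda>j. 4 * D\<^sup>2 * (cmod (rmul (\<lambda>j. \<phi> (v j)) c j))\<^sup>2) has_sum 4 * D\<^sup>2 * (l2_norm (rmul (\<lambda>j. \<phi> (v j)) c))\<^sup>2) UNIV"
          unfolding l2_norm_sq using c by (intro has_sum_cmult_right has_sum_infsum) (simp add: l2_def)
        show ?thesis
        proof (rule has_sum_mono[OF hs hc])
          fix j
          have "(\<Sum>m<J. a m * bump N (2 ^ m) (v j)) * (cmod (c j))\<^sup>2 \<le> 4 * D\<^sup>2 * (\<phi> (v j))\<^sup>2 * (cmod (c j))\<^sup>2"
            by (intro mult_right_mono upper v1) simp
          then show "(\<Sum>m<J. a m * (bump N (2 ^ m) (v j) * (cmod (c j))\<^sup>2)) \<le> 4 * D\<^sup>2 * (cmod (rmul (\<lambda>j. \<phi> (v j)) c j))\<^sup>2"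
            by (simp only: c2 sum_distrib_right mult.assoc)
        qed
      qed
      finally have "(\<Sum>k\<in>F. (cmod (rmul (\<lambda>k. \<phi> (w k)) u k))\<^sup>2)
          \<le> L * (4 * C\<^sup>2) * (4 * D\<^sup>2 * (l2_norm (rmul (\<lambda>j. \<phi> (v j)) c))\<^sup>2)"
        using L0 by (simp add: mult_left_mono)
      then show ?thesis unfolding power_mult_distrib K2 by (simp add: mult_ac)
    qed
    then show ?thesis using l2_boundI[of "rmul (\<lambda>k. \<phi> (w k)) u" "K * l2_norm (rmul (\<lambda>j. \<phi> (v j)) c)"] K0 by simp
  qed
  then show ?thesis using K0 by blast
qed

end

section \<open>Spectral calculus of a diagonal operator\<close>

text \<open>
  The operator \<open>f(A)\<close> for an operator with the eigenbasis \<open>EE\<close> and the eigenvalues \<open>lam\<close>.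
\<close>

definition diag_graph ::
  "('i \<Rightarrow> complex) set \<Rightarrow> (('i \<Rightarrow> complex) \<Rightarrow> real) \<Rightarrow> (real \<Rightarrow> real) \<Rightarrow> 'i op_graph" where
  "diag_graph EE lam f = {(u, v). u \<in> l2 \<and> v \<in> l2 \<and> hcoeff EE v = rmul (\<lambda>e. f (lam e)) (hcoeff EE u)}"

definition spec_proj ::
  "('i \<Rightarrow> complex) set \<Rightarrow> (('i \<Rightarrow> complex) \<Rightarrow> real) \<Rightarrow> real set \<Rightarrow> ('i \<Rightarrow> complex) \<Rightarrow> 'i \<Rightarrow> complex" where
  "spec_proj EE lam B u = synth EE (\<lambda>e. if lam e \<in> B then hcoeff EE u e else 0)"

definition diagonal_pvm ::
  "('i \<Rightarrow> complex) set \<Rightarrow> (('i \<Rightarrow> complex) \<Rightarrow> real) \<Rightarrow> (real set \<Rightarrow> ('i \<Rightarrow> complex) \<Rightarrow> 'i \<Rightarrow> complex) \<Rightarrow> bool" where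
  "diagonal_pvm EE lam E \<longleftrightarrow> (\<forall>B\<in>sets borel. \<forall>u\<in>l2.
     E B u \<in> l2 \<and> hcoeff EE (E B u) = (\<lambda>e. if lam e \<in> B then hcoeff EE u e else 0))"

subsection \<open>Consequences of the axioms of a projection-valued measure\<close>

context
  fixes E :: "real set \<Rightarrow> ('i \<Rightarrow> complex) \<Rightarrow> 'i \<Rightarrow> complex"
  assumes E: "pvm E"
begin

lemma pvm_l2: "B \<in> sets borel \<Longrightarrow> u \<in> l2 \<Longrightarrow> E B u \<in> l2"
  using E by (simp add: pvm_def orth_projection_def)

lemma pvm_idem: "B \<in> sets borel \<Longrightarrow> u \<in> l2 \<Longrightarrow> E B (E B u) = E B u"
  using E by (simp add: pvm_def orth_projection_def)

lemma pvm_sym: "B \<in> sets borel \<Longrightarrow> u \<in> l2 \<Longrightarrow> v \<in> l2 \<Longrightarrow> l2_inner (E B u) v = l2_inner u (E B v)"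
  using E by (simp add: pvm_def orth_projection_def)

lemma pvm_UNIV: "u \<in> l2 \<Longrightarrow> E UNIV u = u"
  using E by (simp add: pvm_def)

lemma pvm_additive:
  "range B \<subseteq> sets borel \<Longrightarrow> disjoint_family B \<Longrightarrow> u \<in> l2 \<Longrightarrow>
    l2_tendsto (\<lambda>m k. \<Sum>i<m. E (B i) u k) (E (\<Union>i. B i) u)"
  using E by (simp add: pvm_def)

text \<open>
  Countable additivity for a sequence of empty sets makes the multiples of \<open>E {} u\<close> converge.
\<close>

lemma pvm_empty: assumes u: "u \<in> l2" shows "E {} u = (\<lambda>k. 0)"
proof
  fix k
  have "l2_tendsto (\<lambda>m k. \<Sum>i<m. E {} u k) (E {} u)"
    using pvm_additive[of "\<lambda>_. {}" u] u by (simp add: disjoint_family_on_def)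
  then have 1: "(\<lambda>m. real m *\<^sub>R E {} u k) \<longlonglongrightarrow> E {} u k"
    using l2_tendsto_pointwise[of _ "E {} u" k] by (fastforce simp: scaleR_conv_of_real)
  have "(\<lambda>m. real (Suc m) *\<^sub>R E {} u k - real m *\<^sub>R E {} u k) \<longlonglongrightarrow> E {} u k - E {} u k"
    by (rule tendsto_diff[OF LIMSEQ_Suc[OF 1] 1])
  moreover have "(\<lambda>m. real (Suc m) *\<^sub>R E {} u k - real m *\<^sub>R E {} u k) = (\<lambda>m. E {} u k)"
    by (auto simp: algebra_simps)
  ultimately have "(\<lambda>m::nat. E {} u k) \<longlonglongrightarrow> 0" by simp
  then show "E {} u k = 0" by (simp add: LIMSEQ_const_iff)
qed

lemma pvm_Un:
  assumes BC: "B \<in> sets borel" "C \<in> sets borel" "B \<inter> C = {}" and u: "u \<in> l2"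
  shows "E (B \<union> C) u = (\<lambda>k. E B u k + E C u k)"
proof
  fix k
  define S where "S = (\<lambda>i::nat. if i = 0 then B else if i = 1 then C else {})"
  have S: "range S \<subseteq> sets borel" "disjoint_family S" "(\<Union>i. S i) = B \<union> C"
    using BC by (auto simp: S_def disjoint_family_on_def split: if_splits)
  have "(\<lambda>m. \<Sum>i<m. E (S i) u k) \<longlonglongrightarrow> E (B \<union> C) u k"
    using l2_tendsto_pointwise[OF pvm_additive[OF S(1,2) u], of k] S(3) by simp
  then have "(\<lambda>m. \<Sum>i<m + 2. E (S i) u k) \<longlonglongrightarrow> E (B \<union> C) u k" by (rule LIMSEQ_ignore_initial_segment)
  moreover have "(\<Sum>i<m + 2. E (S i) u k) = E B u k + E C u k" for m
  proof -
    have "(\<Sum>i<m + 2. E (S i) u k) = (\<Sum>i\<in>{0, 1}. E (S i) u k)"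
      by (rule sum.mono_neutral_right) (auto simp: S_def pvm_empty u)
    then show ?thesis by (simp add: S_def)
  qed
  ultimately have "(\<lambda>m::nat. E B u k + E C u k) \<longlonglongrightarrow> E (B \<union> C) u k" by simp
  then show "E (B \<union> C) u k = E B u k + E C u k" by (simp add: LIMSEQ_const_iff)
qed

lemma pvm_norm_sq: "B \<in> sets borel \<Longrightarrow> u \<in> l2 \<Longrightarrow> l2_inner (E B u) u = of_real ((l2_norm (E B u))\<^sup>2)"
  using pvm_sym[of B "E B u" u] by (simp add: pvm_idem pvm_l2 l2_inner_self)

text \<open>
  Additivity of \<open>B \<mapsto> \<parallel>E(B)u\<parallel>\<^sup>2\<close> on disjoint sets forces the mixed term to vanish.
\<close>

lemma pvm_orthogonal:
  assumes BC: "B \<in> sets borel" "C \<in> sets borel" "B \<inter> C = {}" and u: "u \<in> l2"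
  shows "Re (l2_inner (E B u) (E C u)) = 0"
proof -
  have l: "E B u \<in> l2" "E C u \<in> l2" using BC u by (auto intro: pvm_l2)
  have "l2_inner (E (B \<union> C) u) u = l2_inner (E B u) u + l2_inner (E C u) u"
    unfolding pvm_Un[OF BC u] by (rule l2_inner_add_left[OF l u])
  then have "complex_of_real ((l2_norm (E (B \<union> C) u))\<^sup>2) = of_real ((l2_norm (E B u))\<^sup>2 + (l2_norm (E C u))\<^sup>2)"
    using BC u by (simp add: pvm_norm_sq del: of_real_power)
  then have "(l2_norm (E (B \<union> C) u))\<^sup>2 = (l2_norm (E B u))\<^sup>2 + (l2_norm (E C u))\<^sup>2"
    using of_real_eq_iff by blast
  then show ?thesis unfolding pvm_Un[OF BC u] l2_norm_add_sq[OF l] by simp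
qed

lemma pvm_finite_sum:
  assumes "finite Y" "\<And>y. y \<in> Y \<Longrightarrow> S y \<in> sets borel" "disjoint_family_on S Y" and u: "u \<in> l2"
  shows "E (\<Union>y\<in>Y. S y) u = (\<lambda>k. \<Sum>y\<in>Y. E (S y) u k)"
    and "(l2_norm (\<lambda>k. \<Sum>y\<in>Y. complex_of_real (c y) * E (S y) u k))\<^sup>2 = (\<Sum>y\<in>Y. (c y)\<^sup>2 * (l2_norm (E (S y) u))\<^sup>2)"
proof -
  have "E (\<Union>y\<in>Y. S y) u = (\<lambda>k. \<Sum>y\<in>Y. E (S y) u k) \<and>
    (l2_norm (\<lambda>k. \<Sum>y\<in>Y. complex_of_real (c y) * E (S y) u k))\<^sup>2 = (\<Sum>y\<in>Y. (c y)\<^sup>2 * (l2_norm (E (S y) u))\<^sup>2)"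
    using assms(1-3)
  proof (induction Y rule: finite_induct)
    case empty
    then show ?case by (simp add: pvm_empty u)
  next
    case (insert x Y)
    have dj: "S x \<inter> (\<Union>y\<in>Y. S y) = {}" "\<And>y. y \<in> Y \<Longrightarrow> S x \<inter> S y = {}" "disjoint_family_on S Y"
      using insert.prems(2) insert.hyps(2) by (auto simp: disjoint_family_on_def)
    have sb: "S x \<in> sets borel" "(\<Union>y\<in>Y. S y) \<in> sets borel" "\<And>y. y \<in> Y \<Longrightarrow> S y \<in> sets borel"
      using insert by auto
    note IH = insert.IH[OF sb(3) dj(3)]
    have 1: "E (\<Union>y\<in>insert x Y. S y) u = (\<lambda>k. \<Sum>y\<in>insert x Y. E (S y) u k)"
      using pvm_Un[OF sb(1,2) dj(1) u] IH insert.hyps by simp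
    define s where "s = (\<lambda>k. \<Sum>y\<in>Y. complex_of_real (c y) * E (S y) u k)"
    define z where "z = (\<lambda>k. complex_of_real (c x) * E (S x) u k)"
    have sl: "s \<in> l2" "z \<in> l2" unfolding s_def z_def by (auto intro!: l2_sum l2_scale pvm_l2 sb u)
    have "l2_inner s z = (\<Sum>y\<in>Y. l2_inner (\<lambda>k. complex_of_real (c y) * E (S y) u k) z)"
      unfolding s_def by (intro l2_inner_sum_left insert.hyps l2_scale pvm_l2 sb u sl)
    also have "\<dots> = (\<Sum>y\<in>Y. of_real (c y * c x) * l2_inner (E (S y) u) (E (S x) u))"
      by (simp add: z_def l2_inner_scale_left l2_inner_scale_right mult_ac)
    finally have "Re (l2_inner s z) = (\<Sum>y\<in>Y. c y * c x * Re (l2_inner (E (S y) u) (E (S x) u)))" by simp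
    also have "\<dots> = 0"
    proof (intro sum.neutral ballI)
      fix y assume y: "y \<in> Y"
      have "S y \<inter> S x = {}" using dj(2)[OF y] by blast
      then show "c y * c x * Re (l2_inner (E (S y) u) (E (S x) u)) = 0"
        using pvm_orthogonal[OF sb(3)[OF y] sb(1) _ u] by simp
    qed
    finally have o: "Re (l2_inner s z) = 0" .
    have "(\<lambda>k. \<Sum>y\<in>insert x Y. complex_of_real (c y) * E (S y) u k) = (\<lambda>k. s k + z k)"
      using insert.hyps by (auto simp: s_def z_def)
    then have "(l2_norm (\<lambda>k. \<Sum>y\<in>insert x Y. complex_of_real (c y) * E (S y) u k))\<^sup>2 = (l2_norm s)\<^sup>2 + (l2_norm z)\<^sup>2"
      using l2_norm_add_sq[OF sl] o by simp
    also have "\<dots> = (\<Sum>y\<in>insert x Y. (c y)\<^sup>2 * (l2_norm (E (S y) u))\<^sup>2)"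
      using IH insert.hyps by (simp add: s_def[symmetric] z_def l2_norm_scale power_mult_distrib)
    finally show ?case using 1 by blast
  qed
  then show "E (\<Union>y\<in>Y. S y) u = (\<lambda>k. \<Sum>y\<in>Y. E (S y) u k)"
    and "(l2_norm (\<lambda>k. \<Sum>y\<in>Y. complex_of_real (c y) * E (S y) u k))\<^sup>2 = (\<Sum>y\<in>Y. (c y)\<^sup>2 * (l2_norm (E (S y) u))\<^sup>2)"
    by auto
qed

lemma pvm_scalar_emeasure:
  assumes u: "u \<in> l2"
  shows "space (pvm_scalar E u) = UNIV" "sets (pvm_scalar E u) = sets borel"
    and "B \<in> sets borel \<Longrightarrow> emeasure (pvm_scalar E u) B = ennreal ((l2_norm (E B u))\<^sup>2)"
proof -
  show "space (pvm_scalar E u) = UNIV" "sets (pvm_scalar E u) = sets borel"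
    unfolding pvm_scalar_def by (auto simp: space_measure_of_conv sets.sigma_sets_eq[of borel, simplified])
  show "emeasure (pvm_scalar E u) B = ennreal ((l2_norm (E B u))\<^sup>2)" if B: "B \<in> sets borel"
  proof (rule emeasure_measure_of[OF pvm_scalar_def])
    show "sets borel \<subseteq> Pow (UNIV :: real set)" by simp
    show "B \<in> sets (pvm_scalar E u)" using B \<open>sets (pvm_scalar E u) = sets borel\<close> by simp
    show "positive (sets (pvm_scalar E u)) (\<lambda>B. ennreal ((l2_norm (E B u))\<^sup>2))"
      by (simp add: positive_def pvm_empty u)
    show "countably_additive (sets (pvm_scalar E u)) (\<lambda>B. ennreal ((l2_norm (E B u))\<^sup>2))"
      unfolding countably_additive_def \<open>sets (pvm_scalar E u) = sets borel\<close>
    proof (intro allI impI)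
      fix S :: "nat \<Rightarrow> real set"
      assume S: "range S \<subseteq> sets borel" "disjoint_family S" "(\<Union>i. S i) \<in> sets borel"
      have Sb: "S i \<in> sets borel" for i using S by auto
      have t: "(\<lambda>m. l2_inner (\<lambda>k. \<Sum>i<m. E (S i) u k) u) \<longlonglongrightarrow> l2_inner (E (\<Union>i. S i) u) u"
        by (intro l2_tendsto_inner pvm_additive S u)
      have "l2_inner (\<lambda>k. \<Sum>i<m. E (S i) u k) u = of_real (\<Sum>i<m. (l2_norm (E (S i) u))\<^sup>2)" for m
        by (subst l2_inner_sum_left) (auto simp: pvm_l2 Sb u pvm_norm_sq)
      then have "(\<lambda>m. complex_of_real (\<Sum>i<m. (l2_norm (E (S i) u))\<^sup>2)) \<longlonglongrightarrow> of_real ((l2_norm (E (\<Union>i. S i) u))\<^sup>2)"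
        using t pvm_norm_sq[OF S(3) u] by simp
      then have "(\<lambda>m. \<Sum>i<m. (l2_norm (E (S i) u))\<^sup>2) \<longlonglongrightarrow> (l2_norm (E (\<Union>i. S i) u))\<^sup>2"
        by (simp only: tendsto_of_real_iff)
      then have "(\<lambda>i. (l2_norm (E (S i) u))\<^sup>2) sums ((l2_norm (E (\<Union>i. S i) u))\<^sup>2)" by (simp add: sums_def)
      then show "(\<Sum>i. ennreal ((l2_norm (E (S i) u))\<^sup>2)) = ennreal ((l2_norm (E (\<Union>i. S i) u))\<^sup>2)"
        by (intro suminf_ennreal_eq) auto
    qed
  qed
qed

lemma pvm_scalar_finite: "u \<in> l2 \<Longrightarrow> finite_measure (pvm_scalar E u)"
  by (intro finite_measureI) (simp add: pvm_scalar_emeasure)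

lemma pvm_scalar_measure: "u \<in> l2 \<Longrightarrow> B \<in> sets borel \<Longrightarrow> measure (pvm_scalar E u) B = (l2_norm (E B u))\<^sup>2"
  by (simp add: measure_def pvm_scalar_emeasure)

text \<open>
  An eigenvector of \<open>\<integral> t dE\<close> is concentrated on its eigenvalue \<open>\<mu>\<close>. The integrals of the simple
  functions \<open>s\<close> that approximate \<open>t\<close> converge to \<open>\<mu> e\<close>, so \<open>s\<close> converges both to \<open>t\<close> and to \<open>\<mu>\<close> in
  the \<open>L\<^sup>2\<close> space of the scalar measure, which is therefore carried by the point \<open>\<mu>\<close>.
\<close>

lemma pvm_eigenvector:
  assumes e: "e \<in> l2" and ev: "(e, \<lambda>k. of_real \<mu> * e k) \<in> pvm_integral E (\<lambda>t. t)" and B: "B \<in> sets borel"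
  shows "E B e = (if \<mu> \<in> B then e else (\<lambda>k. 0))"
proof -
  define M where "M = pvm_scalar E e"
  have MM: "space M = UNIV" "sets M = sets borel" unfolding M_def by (rule pvm_scalar_emeasure[OF e])+
  interpret M: finite_measure M unfolding M_def by (rule pvm_scalar_finite[OF e])
  have bm: "g \<in> borel_measurable M \<longleftrightarrow> g \<in> borel_measurable borel" for g :: "real \<Rightarrow> real"
    using measurable_cong_sets[OF MM(2)] by blast
  have int2: "integrable M (\<lambda>t. t\<^sup>2)" using ev by (simp add: pvm_integral_def M_def)
  obtain s where s: "\<And>m. simple_function borel (s m :: real \<Rightarrow> real)"
    "(\<lambda>m. LINT t|M. (s m t - t)\<^sup>2) \<longlonglongrightarrow> 0"
    "l2_tendsto (\<lambda>m. simple_pvm_integral E (s m) e) (\<lambda>k. of_real \<mu> * e k)"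
    using ev by (auto simp: pvm_integral_def M_def)
  have sbm: "s m \<in> borel_measurable borel" for m using s(1) by (rule borel_measurable_simple_function)
  have fin: "finite (range (s m))" for m using s(1)[of m] by (simp add: simple_function_def)
  have sb: "s m -` {y} \<in> sets borel" for m y using sbm[of m] by (metis borel_singleton measurable_sets_borel sets.empty_sets sets.insert_in_sets)
  have id: "(LINT t|M. (s m t - \<mu>)\<^sup>2) = (l2_norm (\<lambda>k. simple_pvm_integral E (s m) e k - of_real \<mu> * e k))\<^sup>2"
    and ints: "integrable M (\<lambda>t. (s m t - \<mu>)\<^sup>2)" for m
  proof -
    have sum: "(s m t - \<mu>)\<^sup>2 = (\<Sum>y\<in>range (s m). (y - \<mu>)\<^sup>2 * indicator (s m -` {y}) t)" for t
    proof -
      have "(\<Sum>y\<in>range (s m). (y - \<mu>)\<^sup>2 * indicator (s m -` {y}) t) = (\<Sum>y\<in>range (s m). if y = s m t then (y - \<mu>)\<^sup>2 else 0)"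
        by (intro sum.cong) (auto simp: indicator_def)
      then show ?thesis using fin[of m] by simp
    qed
    have ii: "integrable M (\<lambda>t. (y - \<mu>)\<^sup>2 * indicator (s m -` {y}) t)" for y
      using sb[of m y] MM by (intro integrable_mult_right integrable_real_indicator) (auto simp: M.emeasure_finite less_top[symmetric])
    show "integrable M (\<lambda>t. (s m t - \<mu>)\<^sup>2)" unfolding sum by (intro Bochner_Integration.integrable_sum ii)
    have "(LINT t|M. (s m t - \<mu>)\<^sup>2) = (\<Sum>y\<in>range (s m). (y - \<mu>)\<^sup>2 * measure M (s m -` {y}))"
      unfolding sum using sb[of m] MM by (subst Bochner_Integration.integral_sum[OF ii]) simp
    also have "\<dots> = (\<Sum>y\<in>range (s m). (y - \<mu>)\<^sup>2 * (l2_norm (E (s m -` {y}) e))\<^sup>2)"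
      unfolding M_def by (simp add: pvm_scalar_measure e sb)
    also have "\<dots> = (l2_norm (\<lambda>k. \<Sum>y\<in>range (s m). complex_of_real (y - \<mu>) * E (s m -` {y}) e k))\<^sup>2"
      by (rule pvm_finite_sum(2)[symmetric, OF fin sb _ e]) (auto simp: disjoint_family_on_def)
    also have "(\<lambda>k. \<Sum>y\<in>range (s m). complex_of_real (y - \<mu>) * E (s m -` {y}) e k)
       = (\<lambda>k. simple_pvm_integral E (s m) e k - of_real \<mu> * e k)"
    proof
      fix k
      have "disjoint_family_on (\<lambda>y. s m -` {y}) (range (s m))" unfolding disjoint_family_on_def by blast
      then have "E (\<Union>y\<in>range (s m). s m -` {y}) e = (\<lambda>k. \<Sum>y\<in>range (s m). E (s m -` {y}) e k)"
        by (intro pvm_finite_sum(1) fin sb e)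
      moreover have "(\<Union>y\<in>range (s m). s m -` {y}) = UNIV" by auto
      ultimately have "e = (\<lambda>k. \<Sum>y\<in>range (s m). E (s m -` {y}) e k)"
        using pvm_UNIV[OF e] by (simp only:)
      then have ek: "e k = (\<Sum>y\<in>range (s m). E (s m -` {y}) e k)" by metis
      have "of_real \<mu> * e k = (\<Sum>y\<in>range (s m). of_real \<mu> * E (s m -` {y}) e k)"
        by (subst ek) (rule sum_distrib_left)
      then show "(\<Sum>y\<in>range (s m). complex_of_real (y - \<mu>) * E (s m -` {y}) e k)
          = simple_pvm_integral E (s m) e k - of_real \<mu> * e k"
        by (simp add: simple_pvm_integral_def left_diff_distrib sum_subtractf)
    qed
    finally show "(LINT t|M. (s m t - \<mu>)\<^sup>2) = (l2_norm (\<lambda>k. simple_pvm_integral E (s m) e k - of_real \<mu> * e k))\<^sup>2" .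
  qed
  have const: "integrable M (\<lambda>t. c)" for c :: real by simp
  have sq: "(x + y)\<^sup>2 \<le> 2 * x\<^sup>2 + 2 * y\<^sup>2" for x y :: real
    using sum_squares_bound[of x y] by (simp add: power2_sum)
  have iq: "integrable M (\<lambda>t. (t - \<mu>)\<^sup>2)"
  proof (rule Bochner_Integration.integrable_bound)
    show "integrable M (\<lambda>t. 2 * t\<^sup>2 + 2 * \<mu>\<^sup>2)" by (intro Bochner_Integration.integrable_add integrable_mult_right int2 const)
    show "(\<lambda>t. (t - \<mu>)\<^sup>2) \<in> borel_measurable M" unfolding bm by measurable
    show "AE t in M. norm ((t - \<mu>)\<^sup>2) \<le> norm (2 * t\<^sup>2 + 2 * \<mu>\<^sup>2)"
    proof (rule AE_I2)
      fix t
      show "norm ((t - \<mu>)\<^sup>2) \<le> norm (2 * t\<^sup>2 + 2 * \<mu>\<^sup>2)" using sq[of t "- \<mu>"] by simp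
    qed
  qed
  have its: "integrable M (\<lambda>t. (s m t - t)\<^sup>2)" for m
  proof (rule Bochner_Integration.integrable_bound)
    show "integrable M (\<lambda>t. 2 * (s m t - \<mu>)\<^sup>2 + 2 * (t - \<mu>)\<^sup>2)"
      by (intro Bochner_Integration.integrable_add integrable_mult_right ints iq)
    show "(\<lambda>t. (s m t - t)\<^sup>2) \<in> borel_measurable M" unfolding bm using sbm[of m] by measurable
    show "AE t in M. norm ((s m t - t)\<^sup>2) \<le> norm (2 * (s m t - \<mu>)\<^sup>2 + 2 * (t - \<mu>)\<^sup>2)"
    proof (rule AE_I2)
      fix t
      show "norm ((s m t - t)\<^sup>2) \<le> norm (2 * (s m t - \<mu>)\<^sup>2 + 2 * (t - \<mu>)\<^sup>2)"
        using sq[of "s m t - \<mu>" "\<mu> - t"] by (simp add: power2_commute[of \<mu>])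
    qed
  qed
  have "(LINT t|M. (t - \<mu>)\<^sup>2) \<le> 0"
  proof (rule LIMSEQ_le_const)
    have "(\<lambda>m. l2_norm (\<lambda>k. simple_pvm_integral E (s m) e k - of_real \<mu> * e k)) \<longlonglongrightarrow> 0"
      using s(3) by (simp add: l2_tendsto_def)
    then have "(\<lambda>m. LINT t|M. (s m t - \<mu>)\<^sup>2) \<longlonglongrightarrow> 0\<^sup>2" unfolding id by (intro tendsto_intros)
    then have "(\<lambda>m. 2 * (LINT t|M. (s m t - t)\<^sup>2) + 2 * (LINT t|M. (s m t - \<mu>)\<^sup>2)) \<longlonglongrightarrow> 2 * 0 + 2 * 0"
      using s(2) by (intro tendsto_intros) simp_all
    then show "(\<lambda>m. 2 * (LINT t|M. (s m t - t)\<^sup>2) + 2 * (LINT t|M. (s m t - \<mu>)\<^sup>2)) \<longlonglongrightarrow> 0" by simp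
    show "\<exists>N. \<forall>m\<ge>N. (LINT t|M. (t - \<mu>)\<^sup>2) \<le> 2 * (LINT t|M. (s m t - t)\<^sup>2) + 2 * (LINT t|M. (s m t - \<mu>)\<^sup>2)"
    proof (intro exI allI impI)
      fix m
      have "(LINT t|M. (t - \<mu>)\<^sup>2) \<le> (LINT t|M. 2 * (s m t - t)\<^sup>2 + 2 * (s m t - \<mu>)\<^sup>2)"
      proof (rule integral_mono)
        show "(t - \<mu>)\<^sup>2 \<le> 2 * (s m t - t)\<^sup>2 + 2 * (s m t - \<mu>)\<^sup>2" for t
          using sq[of "t - s m t" "s m t - \<mu>"] by (simp add: power2_commute[of t])
      qed (intro iq Bochner_Integration.integrable_add integrable_mult_right ints its)+
      also have "\<dots> = 2 * (LINT t|M. (s m t - t)\<^sup>2) + 2 * (LINT t|M. (s m t - \<mu>)\<^sup>2)"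
        by (simp add: Bochner_Integration.integral_add ints its)
      finally show "(LINT t|M. (t - \<mu>)\<^sup>2) \<le> 2 * (LINT t|M. (s m t - t)\<^sup>2) + 2 * (LINT t|M. (s m t - \<mu>)\<^sup>2)" .
    qed
  qed
  moreover have "0 \<le> (LINT t|M. (t - \<mu>)\<^sup>2)" by simp
  ultimately have "(LINT t|M. (t - \<mu>)\<^sup>2) = 0" by linarith
  then have "AE t in M. (t - \<mu>)\<^sup>2 = 0"
    using integral_nonneg_eq_0_iff_AE[OF iq] by simp
  then have "AE t in M. t \<in> {\<mu>}" by simp
  moreover have "{t \<in> space M. t \<notin> {\<mu>}} = - {\<mu>}" using MM by auto
  moreover have "- {\<mu>} \<in> sets M" using MM by auto
  ultimately have "emeasure M (- {\<mu>}) = 0" using AE_iff_measurable[of "- {\<mu>}" M "\<lambda>t. t \<in> {\<mu>}"] by metis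
  then have "measure M (- {\<mu>}) = 0" by (simp add: measure_def)
  moreover have "measure M C \<le> measure M (- {\<mu>})" if "C \<in> sets borel" "\<mu> \<notin> C" for C
    using that MM by (intro M.finite_measure_mono) auto
  ultimately have z: "measure M C = 0" if "C \<in> sets borel" "\<mu> \<notin> C" for C
    using that measure_nonneg[of M C] by (metis antisym)
  have zero: "E C e = (\<lambda>k. 0)" if C: "C \<in> sets borel" "\<mu> \<notin> C" for C
  proof -
    have "(l2_norm (E C e))\<^sup>2 = 0" using z[OF C] pvm_scalar_measure[OF e C(1)] by (simp add: M_def)
    then show ?thesis using l2_norm_eq_0[OF pvm_l2[OF C(1) e]] by simp
  qed
  show ?thesis
  proof (cases "\<mu> \<in> B")
    case True
    have "E (B \<union> - B) e = (\<lambda>k. E B e k + E (- B) e k)" using B by (intro pvm_Un e) auto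
    then show ?thesis using zero[of "- B"] B True pvm_UNIV[OF e] by (auto simp: fun_eq_iff)
  qed (simp add: zero B)
qed

end

subsection \<open>Projection-valued measures that are diagonal in an orthonormal basis\<close>

context
  fixes EE :: "('i \<Rightarrow> complex) set" and lam :: "('i \<Rightarrow> complex) \<Rightarrow> real"
  assumes EE: "complete_orthonormal EE"
begin

lemma EE_orthonormal: "orthonormal EE" and EE_sub_l2: "EE \<subseteq> l2"
  using EE by (auto simp: complete_orthonormal_def orthonormal_def)

lemma hcoeff_in_l2: "u \<in> l2 \<Longrightarrow> hcoeff EE u \<in> l2"
  by (rule hcoeff_bessel(1)[OF EE_orthonormal])

lemma hcoeff_eqD: "u \<in> l2 \<Longrightarrow> v \<in> l2 \<Longrightarrow> hcoeff EE u = hcoeff EE v \<Longrightarrow> u = v"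
  using hcoeff_unitary(1)[OF EE] by metis

lemma ex_hcoeff:
  assumes "c \<in> l2" "\<And>e. e \<notin> EE \<Longrightarrow> c e = 0" shows "\<exists>v\<in>l2. hcoeff EE v = c"
  using synth_props(1,3)[OF EE_orthonormal assms(1)] assms(2) by blast

lemma hcoeff_outside: "e \<notin> EE \<Longrightarrow> hcoeff EE u e = 0"
  by (simp add: hcoeff_def)

lemma hcoeff_norm: "u \<in> l2 \<Longrightarrow> l2_norm (hcoeff EE u) = l2_norm u"
  by (rule hcoeff_unitary(2)[OF EE])

lemma hcoeff_sum:
  assumes "finite A" "\<And>i. i \<in> A \<Longrightarrow> f i \<in> l2"
  shows "hcoeff EE (\<lambda>k. \<Sum>i\<in>A. f i k) = (\<lambda>e. \<Sum>i\<in>A. hcoeff EE (f i) e)"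
  using assms
proof (induction A rule: finite_induct)
  case empty
  then show ?case by (auto simp: hcoeff_def)
next
  case (insert i A)
  then show ?case by (simp add: hcoeff_lin(1) l2_sum EE_sub_l2)
qed

lemma spec_proj_props:
  assumes u: "u \<in> l2"
  shows "spec_proj EE lam B u \<in> l2"
    and "hcoeff EE (spec_proj EE lam B u) = (\<lambda>e. if lam e \<in> B then hcoeff EE u e else 0)"
proof -
  have c: "(\<lambda>e. if lam e \<in> B then hcoeff EE u e else 0) \<in> l2"
    by (rule l2_restrict(1)[OF hcoeff_in_l2[OF u]])
  have z: "\<forall>e. e \<notin> EE \<longrightarrow> (if lam e \<in> B then hcoeff EE u e else 0) = 0" by (simp add: hcoeff_outside)
  show "spec_proj EE lam B u \<in> l2"
    "hcoeff EE (spec_proj EE lam B u) = (\<lambda>e. if lam e \<in> B then hcoeff EE u e else 0)"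
    unfolding spec_proj_def using synth_props[OF EE_orthonormal c z] by auto
qed

lemma spec_proj_diagonal: "diagonal_pvm EE lam (spec_proj EE lam)"
  by (simp add: diagonal_pvm_def spec_proj_props)

text \<open>
  Countable additivity: up to a small norm the coefficients of \<open>u\<close> live on a finite set, and the
  eigenvalues of its members are exhausted by finitely many of the sets.
\<close>

lemma pvm_spec_proj: "pvm (spec_proj EE lam)"
  unfolding pvm_def
proof (intro conjI ballI allI impI)
  let ?P = "spec_proj EE lam"
  fix B :: "real set"
  show "orth_projection (?P B)" unfolding orth_projection_def
  proof (intro conjI ballI allI)
    fix u v :: "'i \<Rightarrow> complex" and c :: complex
    assume u: "u \<in> l2"
    show "?P B u \<in> l2" by (rule spec_proj_props(1)[OF u])
    show "?P B (?P B u) = ?P B u"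
      by (rule hcoeff_eqD) (auto simp: spec_proj_props u)
    show "?P B (\<lambda>k. c * u k) = (\<lambda>k. c * ?P B u k)"
      by (rule hcoeff_eqD) (auto simp: spec_proj_props u hcoeff_lin(3)[OF _ u EE_sub_l2] hcoeff_lin(3)[OF _ _ EE_sub_l2])
    assume v: "v \<in> l2"
    show "?P B (\<lambda>k. u k + v k) = (\<lambda>k. ?P B u k + ?P B v k)"
      by (rule hcoeff_eqD) (auto simp: spec_proj_props u v l2_add hcoeff_lin(1) EE_sub_l2)
    have "l2_inner (?P B u) v = l2_inner (hcoeff EE (?P B u)) (hcoeff EE v)"
      by (rule hcoeff_unitary(3)[OF EE _ v, symmetric]) (rule spec_proj_props(1)[OF u])
    also have "\<dots> = l2_inner (hcoeff EE u) (hcoeff EE (?P B v))"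
      unfolding l2_inner_def by (intro infsum_cong) (simp add: spec_proj_props u v)
    also have "\<dots> = l2_inner u (?P B v)"
      by (rule hcoeff_unitary(3)[OF EE u]) (rule spec_proj_props(1)[OF v])
    finally show "l2_inner (?P B u) v = l2_inner u (?P B v)" .
  qed
next
  fix u :: "'i \<Rightarrow> complex" assume "u \<in> l2"
  then show "spec_proj EE lam UNIV u = u" by (intro hcoeff_eqD) (auto simp: spec_proj_props)
next
  let ?P = "spec_proj EE lam"
  fix B :: "nat \<Rightarrow> real set" and u :: "'i \<Rightarrow> complex"
  assume dj: "disjoint_family B" and u: "u \<in> l2"
  define S where "S = (\<lambda>m k. \<Sum>i<m. ?P (B i) u k)"
  have Sl: "S m \<in> l2" for m unfolding S_def by (intro l2_sum spec_proj_props u)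
  have Ul: "?P (\<Union>i. B i) u \<in> l2" by (rule spec_proj_props(1)[OF u])
  have hS: "hcoeff EE (S m) = (\<lambda>e. if lam e \<in> (\<Union>i<m. B i) then hcoeff EE u e else 0)" for m
  proof
    fix e
    have "hcoeff EE (S m) e = (\<Sum>i<m. if lam e \<in> B i then hcoeff EE u e else 0)"
      unfolding S_def by (subst hcoeff_sum) (auto simp: spec_proj_props u)
    also have "\<dots> = (if lam e \<in> (\<Union>i<m. B i) then hcoeff EE u e else 0)"
    proof (cases "\<exists>i<m. lam e \<in> B i")
      case True
      then obtain i where i: "i < m" "lam e \<in> B i" by blast
      have "lam e \<in> B j \<longleftrightarrow> j = i" for j using dj i(2) by (auto simp: disjoint_family_on_def)
      then have "(\<Sum>j<m. if lam e \<in> B j then hcoeff EE u e else 0) = (\<Sum>j<m. if j = i then hcoeff EE u e else 0)"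
        by simp
      also have "\<dots> = hcoeff EE u e" using i(1) by simp
      finally show ?thesis using i by auto
    qed auto
    finally show "hcoeff EE (S m) e = (if lam e \<in> (\<Union>i<m. B i) then hcoeff EE u e else 0)" .
  qed
  have "(\<lambda>m. l2_norm (\<lambda>k. S m k - ?P (\<Union>i. B i) u k)) \<longlonglongrightarrow> 0"
  proof (rule LIMSEQ_I)
    fix r :: real assume r: "r > 0"
    obtain F where F: "finite F" "l2_norm (\<lambda>e. if e \<in> F then 0 else hcoeff EE u e) < r"
      using l2_tail[OF hcoeff_in_l2[OF u] r] by blast
    have "\<forall>e. \<exists>i. lam e \<in> (\<Union>i. B i) \<longrightarrow> lam e \<in> B i" by blast
    then obtain i where i: "\<And>e. lam e \<in> (\<Union>i. B i) \<Longrightarrow> lam e \<in> B (i e)" by metis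
    obtain m0 where m0: "\<And>e. e \<in> F \<Longrightarrow> i e < m0"
      using finite_nat_set_iff_bounded[of "i ` F"] F(1) by auto
    have "l2_norm (\<lambda>k. S m k - ?P (\<Union>i. B i) u k) < r" if m: "m \<ge> m0" for m
    proof -
      have "l2_norm (\<lambda>k. S m k - ?P (\<Union>i. B i) u k) = l2_norm (\<lambda>e. hcoeff EE (S m) e - hcoeff EE (?P (\<Union>i. B i) u) e)"
        using hcoeff_norm[OF l2_diff(1)[OF Sl[of m] Ul]] hcoeff_lin(2)[OF Sl[of m] Ul EE_sub_l2] by simp
      also have "\<dots> \<le> 1 * l2_norm (\<lambda>e. if e \<in> F then 0 else hcoeff EE u e)"
      proof (rule l2_mono(2))
        show "(\<lambda>e. if e \<in> F then 0 else hcoeff EE u e) \<in> l2"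
          by (rule l2_mono(1)[OF hcoeff_in_l2[OF u], of _ 1]) auto
        fix e
        have "e \<in> F \<Longrightarrow> lam e \<in> (\<Union>i. B i) \<Longrightarrow> lam e \<in> (\<Union>i<m. B i)"
          using i[of e] m0[of e] m by force
        then show "cmod (hcoeff EE (S m) e - hcoeff EE (?P (\<Union>i. B i) u) e) \<le> 1 * cmod (if e \<in> F then 0 else hcoeff EE u e)"
          unfolding hS spec_proj_props(2)[OF u] by auto
      qed simp
      finally show ?thesis using F(2) by simp
    qed
    then show "\<exists>no. \<forall>n\<ge>no. norm (l2_norm (\<lambda>k. S n k - ?P (\<Union>i. B i) u k) - 0) < r" by auto
  qed
  then show "l2_tendsto (\<lambda>m k. \<Sum>i<m. ?P (B i) u k) (?P (\<Union>i. B i) u)"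
    using Sl Ul by (simp add: l2_tendsto_def S_def)
qed

text \<open>
  The coefficient of \<open>E(B) u\<close> at \<open>e\<close> is \<open>(u, E(B) e)\<close>, and \<open>E(B) e\<close> is \<open>e\<close> or \<open>0\<close> according to whether
  the eigenvalue of \<open>e\<close> lies in \<open>B\<close>.
\<close>

lemma diagonal_of_eigenvectors:
  assumes E: "pvm E" and ev: "\<And>e. e \<in> EE \<Longrightarrow> (e, \<lambda>k. of_real (lam e) * e k) \<in> pvm_integral E (\<lambda>t. t)"
  shows "diagonal_pvm EE lam E"
  unfolding diagonal_pvm_def
proof (intro ballI conjI)
  fix B :: "real set" and u :: "'i \<Rightarrow> complex" assume B: "B \<in> sets borel" and u: "u \<in> l2"
  show "E B u \<in> l2" by (rule pvm_l2[OF E B u])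
  show "hcoeff EE (E B u) = (\<lambda>e. if lam e \<in> B then hcoeff EE u e else 0)"
  proof
    fix e
    show "hcoeff EE (E B u) e = (if lam e \<in> B then hcoeff EE u e else 0)"
    proof (cases "e \<in> EE")
      case True
      then have e: "e \<in> l2" using EE_sub_l2 by blast
      have "l2_inner (E B u) e = l2_inner u (E B e)" by (rule pvm_sym[OF E B u e])
      then show ?thesis using True pvm_eigenvector[OF E e ev[OF True] B] by (simp add: hcoeff_def)
    qed (simp add: hcoeff_outside)
  qed
qed

subsection \<open>Integrals with respect to a diagonal projection-valued measure\<close>

context
  fixes E :: "real set \<Rightarrow> ('i \<Rightarrow> complex) \<Rightarrow> 'i \<Rightarrow> complex"
  assumes E: "diagonal_pvm EE lam E"
begin

lemma diag_l2: "B \<in> sets borel \<Longrightarrow> u \<in> l2 \<Longrightarrow> E B u \<in> l2"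
  and diag_hcoeff: "B \<in> sets borel \<Longrightarrow> u \<in> l2 \<Longrightarrow> hcoeff EE (E B u) = (\<lambda>e. if lam e \<in> B then hcoeff EE u e else 0)"
  using E by (auto simp: diagonal_pvm_def)

text \<open>The scalar measure of \<open>u\<close> is discrete, with mass \<open>|(u,e)|\<^sup>2\<close> at the eigenvalue of \<open>e\<close>.\<close>

lemma diag_scalar:
  assumes u: "u \<in> l2"
  shows "pvm_scalar E u = distr (density (count_space UNIV) (\<lambda>e. ennreal ((cmod (hcoeff EE u e))\<^sup>2))) borel lam"
    (is "_ = ?M")
proof -
  have em: "emeasure ?M B = ennreal ((l2_norm (E B u))\<^sup>2)" if B: "B \<in> sets borel" for B
  proof -
    have "emeasure ?M B = emeasure (density (count_space UNIV) (\<lambda>e. ennreal ((cmod (hcoeff EE u e))\<^sup>2))) (lam -` B)"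
      using B by (subst emeasure_distr) auto
    also have "\<dots> = (\<integral>\<^sup>+ e. ennreal ((cmod (hcoeff EE u e))\<^sup>2) * indicator (lam -` B) e \<partial>count_space UNIV)"
      by (rule emeasure_density) auto
    also have "\<dots> = (\<integral>\<^sup>+ e. ennreal ((cmod (hcoeff EE (E B u) e))\<^sup>2) \<partial>count_space UNIV)"
      by (intro nn_integral_cong) (auto simp: diag_hcoeff[OF B u] indicator_def)
    also have "\<dots> = ennreal (infsetsum (\<lambda>e. (cmod (hcoeff EE (E B u) e))\<^sup>2) UNIV)"
    proof (rule nn_integral_conv_infsetsum)
      show "Infinite_Set_Sum.abs_summable_on (\<lambda>e. (cmod (hcoeff EE (E B u) e))\<^sup>2) UNIV"
        unfolding abs_summable_equivalent[symmetric]
        using hcoeff_in_l2[OF diag_l2[OF B u]] by (simp add: l2_def)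
    qed simp
    also have "infsetsum (\<lambda>e. (cmod (hcoeff EE (E B u) e))\<^sup>2) UNIV = infsum (\<lambda>e. (cmod (hcoeff EE (E B u) e))\<^sup>2) UNIV"
    proof (rule infsetsum_infsum)
      show "Infinite_Set_Sum.abs_summable_on (\<lambda>e. (cmod (hcoeff EE (E B u) e))\<^sup>2) UNIV"
        unfolding abs_summable_equivalent[symmetric]
        using hcoeff_in_l2[OF diag_l2[OF B u]] by (simp add: l2_def)
    qed
    also have "\<dots> = (l2_norm (E B u))\<^sup>2"
      unfolding l2_norm_sq[symmetric] by (simp add: hcoeff_norm diag_l2 B u)
    finally show ?thesis .
  qed
  have "pvm_scalar E u = measure_of UNIV (sets borel) (emeasure ?M)"
    unfolding pvm_scalar_def
  proof (rule measure_of_eq)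
    fix B :: "real set" assume "B \<in> sigma_sets UNIV (sets borel)"
    then have "B \<in> sets borel" using sets.sigma_sets_eq[of "borel :: real measure"] by simp
    then show "ennreal ((l2_norm (E B u))\<^sup>2) = emeasure ?M B" by (simp add: em)
  qed simp
  also have "\<dots> = ?M" using measure_of_of_measure[of ?M] by simp
  finally show ?thesis .
qed

lemma diag_integrable:
  fixes g :: "real \<Rightarrow> real"
  assumes u: "u \<in> l2" and g: "g \<in> borel_measurable borel" "\<And>t. g t \<ge> 0"
  shows "integrable (pvm_scalar E u) g \<longleftrightarrow> (\<lambda>e. (cmod (hcoeff EE u e))\<^sup>2 * g (lam e)) summable_on UNIV"
    and "(\<lambda>e. (cmod (hcoeff EE u e))\<^sup>2 * g (lam e)) summable_on UNIV \<Longrightarrow>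
      integral\<^sup>L (pvm_scalar E u) g = (\<Sum>\<^sub>\<infinity>e. (cmod (hcoeff EE u e))\<^sup>2 * g (lam e))"
proof -
  have abs: "Infinite_Set_Sum.abs_summable_on (\<lambda>e. (cmod (hcoeff EE u e))\<^sup>2 * g (lam e)) UNIV \<longleftrightarrow>
      (\<lambda>e. (cmod (hcoeff EE u e))\<^sup>2 * g (lam e)) summable_on UNIV"
    unfolding abs_summable_equivalent[symmetric] using g(2) by (simp add: abs_mult)
  have m: "lam \<in> measurable (density (count_space UNIV) (\<lambda>e. ennreal ((cmod (hcoeff EE u e))\<^sup>2))) borel" by simp
  have "integrable (pvm_scalar E u) g \<longleftrightarrow> integrable (count_space UNIV) (\<lambda>e. (cmod (hcoeff EE u e))\<^sup>2 *\<^sub>R g (lam e))"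
    unfolding diag_scalar[OF u] by (subst integrable_distr_eq[OF m g(1)], subst integrable_density) auto
  then show "integrable (pvm_scalar E u) g \<longleftrightarrow> (\<lambda>e. (cmod (hcoeff EE u e))\<^sup>2 * g (lam e)) summable_on UNIV"
    unfolding abs[symmetric] Infinite_Set_Sum.abs_summable_on_def by simp
  assume s: "(\<lambda>e. (cmod (hcoeff EE u e))\<^sup>2 * g (lam e)) summable_on UNIV"
  have "integral\<^sup>L (pvm_scalar E u) g = integral\<^sup>L (count_space UNIV) (\<lambda>e. (cmod (hcoeff EE u e))\<^sup>2 *\<^sub>R g (lam e))"
    unfolding diag_scalar[OF u] by (subst integral_distr[OF m g(1)], subst integral_density) auto
  also have "\<dots> = infsetsum (\<lambda>e. (cmod (hcoeff EE u e))\<^sup>2 * g (lam e)) UNIV" by (simp add: infsetsum_def)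
  also have "\<dots> = (\<Sum>\<^sub>\<infinity>e. (cmod (hcoeff EE u e))\<^sup>2 * g (lam e))" by (rule infsetsum_infsum) (use s abs in blast)
  finally show "integral\<^sup>L (pvm_scalar E u) g = (\<Sum>\<^sub>\<infinity>e. (cmod (hcoeff EE u e))\<^sup>2 * g (lam e))" .
qed

lemma rmul_l2_iff: "rmul g c \<in> l2 \<longleftrightarrow> (\<lambda>e. (cmod (c e))\<^sup>2 * (g e)\<^sup>2) summable_on UNIV"
  by (simp add: l2_def cmod_rmul power_mult_distrib mult.commute)

lemma diag_simple:
  assumes u: "u \<in> l2" and s: "simple_function borel s"
  shows "simple_pvm_integral E s u \<in> l2"
    and "hcoeff EE (simple_pvm_integral E s u) = rmul (\<lambda>e. s (lam e)) (hcoeff EE u)"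
proof -
  have fin: "finite (range s)" using s by (simp add: simple_function_def)
  have sb: "s -` {y} \<in> sets borel" for y
    using borel_measurable_simple_function[OF s] by (metis borel_singleton measurable_sets_borel sets.empty_sets)
  show "simple_pvm_integral E s u \<in> l2"
    unfolding simple_pvm_integral_def by (intro l2_sum l2_scale diag_l2 sb u)
  show "hcoeff EE (simple_pvm_integral E s u) = rmul (\<lambda>e. s (lam e)) (hcoeff EE u)"
  proof
    fix e
    have "hcoeff EE (simple_pvm_integral E s u) e = (\<Sum>y\<in>range s. hcoeff EE (\<lambda>k. of_real y * E (s -` {y}) u k) e)"
      unfolding simple_pvm_integral_def by (subst hcoeff_sum) (auto intro!: fin l2_scale diag_l2 sb u)
    also have "\<dots> = (\<Sum>y\<in>range s. if y = s (lam e) then of_real (s (lam e)) * hcoeff EE u e else 0)"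
      by (intro sum.cong refl) (auto simp: hcoeff_lin(3)[OF diag_l2[OF sb u] _ EE_sub_l2] hcoeff_lin(3)[OF diag_l2[OF sb u] diag_l2[OF sb u] EE_sub_l2] diag_hcoeff sb u)
    also have "\<dots> = rmul (\<lambda>e. s (lam e)) (hcoeff EE u) e" using fin by (simp add: rmul_def)
    finally show "hcoeff EE (simple_pvm_integral E s u) e = rmul (\<lambda>e. s (lam e)) (hcoeff EE u) e" .
  qed
qed

lemma diag_simple_tendsto:
  assumes u: "u \<in> l2" and v: "v \<in> l2" and hv: "hcoeff EE v = rmul (\<lambda>e. f (lam e)) (hcoeff EE u)"
    and f: "f \<in> borel_measurable borel" and s: "\<And>m. simple_function borel (s m)"
    and lim: "(\<lambda>m. LINT t | pvm_scalar E u. (s m t - f t)\<^sup>2) \<longlonglongrightarrow> 0"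
  shows "l2_tendsto (\<lambda>m. simple_pvm_integral E (s m) u) v"
proof -
  have eq: "(LINT t | pvm_scalar E u. (s m t - f t)\<^sup>2) = (l2_norm (\<lambda>k. simple_pvm_integral E (s m) u k - v k))\<^sup>2" for m
  proof -
    note sm = diag_simple[OF u s[of m]]
    have d: "(\<lambda>k. simple_pvm_integral E (s m) u k - v k) \<in> l2" by (intro l2_diff sm v)
    have hd: "hcoeff EE (\<lambda>k. simple_pvm_integral E (s m) u k - v k) = rmul (\<lambda>e. s m (lam e) - f (lam e)) (hcoeff EE u)"
      unfolding hcoeff_lin(2)[OF sm(1) v EE_sub_l2] sm(2) hv by (auto simp: rmul_def left_diff_distrib)
    have g: "(\<lambda>t. (s m t - f t)\<^sup>2) \<in> borel_measurable borel"
      using f borel_measurable_simple_function[OF s[of m]] by measurable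
    have sum: "(\<lambda>e. (cmod (hcoeff EE u e))\<^sup>2 * (s m (lam e) - f (lam e))\<^sup>2) summable_on UNIV"
      using hcoeff_in_l2[OF d] unfolding hd rmul_l2_iff .
    have "(LINT t | pvm_scalar E u. (s m t - f t)\<^sup>2) = (\<Sum>\<^sub>\<infinity>e. (cmod (hcoeff EE u e))\<^sup>2 * (s m (lam e) - f (lam e))\<^sup>2)"
      by (rule diag_integrable(2)[OF u g _ sum]) simp
    also have "\<dots> = (l2_norm (hcoeff EE (\<lambda>k. simple_pvm_integral E (s m) u k - v k)))\<^sup>2"
      unfolding hd l2_norm_sq by (simp add: cmod_rmul power_mult_distrib mult.commute)
    finally show ?thesis using hcoeff_norm[OF d] by simp
  qed
  have "(\<lambda>m. sqrt ((l2_norm (\<lambda>k. simple_pvm_integral E (s m) u k - v k))\<^sup>2)) \<longlonglongrightarrow> sqrt 0"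
    using lim unfolding eq by (intro tendsto_intros)
  then show ?thesis using diag_simple(1)[OF u s] v by (simp add: l2_tendsto_def)
qed

text \<open>
  In coordinates the integral of a simple function \<open>s\<close> multiplies the coefficients by \<open>s(lam e)\<close>, and
  the \<open>L\<^sup>2\<close> distance for the scalar measure is the distance of the resulting functions in \<open>\<ell>\<^sup>2\<close>.
\<close>

theorem diag_pvm_integral:
  assumes f: "f \<in> borel_measurable borel"
  shows "pvm_integral E f = diag_graph EE lam f"
proof (intro set_eqI iffI; safe)
  fix u v assume "(u, v) \<in> pvm_integral E f"
  then obtain s where u: "u \<in> l2" and i: "integrable (pvm_scalar E u) (\<lambda>t. (f t)\<^sup>2)"
    and s: "\<And>m. simple_function borel (s m :: real \<Rightarrow> real)"
      "(\<lambda>m. LINT t | pvm_scalar E u. (s m t - f t)\<^sup>2) \<longlonglongrightarrow> 0"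
      "l2_tendsto (\<lambda>m. simple_pvm_integral E (s m) u) v"
    by (auto simp: pvm_integral_def)
  have "(\<lambda>t. (f t)\<^sup>2) \<in> borel_measurable borel" using f by measurable
  then have "rmul (\<lambda>e. f (lam e)) (hcoeff EE u) \<in> l2"
    unfolding rmul_l2_iff using i diag_integrable(1)[OF u, of "\<lambda>t. (f t)\<^sup>2"] by simp
  then obtain v' where v': "v' \<in> l2" "hcoeff EE v' = rmul (\<lambda>e. f (lam e)) (hcoeff EE u)"
    using ex_hcoeff[of "rmul (\<lambda>e. f (lam e)) (hcoeff EE u)"] by (auto simp: rmul_def hcoeff_outside)
  have "l2_tendsto (\<lambda>m. simple_pvm_integral E (s m) u) v'"
    by (rule diag_simple_tendsto[OF u v' f s(1,2)])
  then have "v' = v" using s(3) by (rule l2_tendsto_unique)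
  then show "(u, v) \<in> diag_graph EE lam f" using u v' by (simp add: diag_graph_def)
next
  fix u v assume "(u, v) \<in> diag_graph EE lam f"
  then have u: "u \<in> l2" and v: "v \<in> l2" and hv: "hcoeff EE v = rmul (\<lambda>e. f (lam e)) (hcoeff EE u)"
    by (auto simp: diag_graph_def)
  have f2: "(\<lambda>t. (f t)\<^sup>2) \<in> borel_measurable borel" using f by measurable
  have "rmul (\<lambda>e. f (lam e)) (hcoeff EE u) \<in> l2" using hcoeff_in_l2[OF v] hv by simp
  then have i: "integrable (pvm_scalar E u) (\<lambda>t. (f t)\<^sup>2)"
    unfolding rmul_l2_iff using diag_integrable(1)[OF u f2] by simp
  obtain s where s: "\<And>m. simple_function borel (s m)" "\<And>t. (\<lambda>m. s m t) \<longlonglongrightarrow> f t"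
      "\<And>m t. dist (s m t) 0 \<le> 2 * dist (f t) 0"
    using borel_measurable_implies_sequence_metric[OF f, of 0] by auto
  have bm: "borel_measurable (pvm_scalar E u) = (borel_measurable borel :: (real \<Rightarrow> real) set)"
    by (rule measurable_cong_sets) (simp_all add: diag_scalar[OF u])
  have "(\<lambda>m. LINT t | pvm_scalar E u. (s m t - f t)\<^sup>2) \<longlonglongrightarrow> (LINT t | pvm_scalar E u. 0)"
  proof (rule integral_dominated_convergence)
    show "(\<lambda>t. 0) \<in> borel_measurable (pvm_scalar E u)" by simp
    show "(\<lambda>t. (s m t - f t)\<^sup>2) \<in> borel_measurable (pvm_scalar E u)" for m
      unfolding bm using f borel_measurable_simple_function[OF s(1)[of m]] by measurable
    show "integrable (pvm_scalar E u) (\<lambda>t. 9 * (f t)\<^sup>2)" by (intro integrable_mult_right i)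
    have "(\<lambda>m. (s m t - f t)\<^sup>2) \<longlonglongrightarrow> (f t - f t)\<^sup>2" for t by (intro tendsto_intros s(2))
    then show "AE t in pvm_scalar E u. (\<lambda>m. (s m t - f t)\<^sup>2) \<longlonglongrightarrow> 0" by simp
    have "norm ((s m t - f t)\<^sup>2) \<le> 9 * (f t)\<^sup>2" for m t
    proof -
      have "\<bar>s m t\<bar> \<le> 2 * \<bar>f t\<bar>" using s(3)[of m t] by (simp add: dist_real_def)
      then have "\<bar>s m t - f t\<bar> \<le> 3 * \<bar>f t\<bar>" by linarith
      then have "\<bar>s m t - f t\<bar>\<^sup>2 \<le> (3 * \<bar>f t\<bar>)\<^sup>2" by (intro power_mono) auto
      then show ?thesis by (simp add: power_mult_distrib)
    qed
    then show "AE t in pvm_scalar E u. norm ((s m t - f t)\<^sup>2) \<le> 9 * (f t)\<^sup>2" for m by simp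
  qed
  then have lim: "(\<lambda>m. LINT t | pvm_scalar E u. (s m t - f t)\<^sup>2) \<longlonglongrightarrow> 0" by simp
  have "l2_tendsto (\<lambda>m. simple_pvm_integral E (s m) u) v"
    by (rule diag_simple_tendsto[OF u v hv f s(1) lim])
  then show "(u, v) \<in> pvm_integral E f" using u i s(1) lim unfolding pvm_integral_def by blast
qed

end

text \<open>
  Whichever spectral measure is chosen, it integrates the identity to the operator, so the basis
  vectors are eigenvectors for it and it is diagonal on square summable functions.
\<close>

theorem fun_calc_diag:
  assumes \<phi>: "\<phi> \<in> borel_measurable (restrict_space borel {1..})" and lam: "\<And>e. lam e \<ge> 1"
  shows "fun_calc \<phi> (diag_graph EE lam (\<lambda>t. t)) = diag_graph EE lam \<phi>"
proof -
  let ?T = "diag_graph EE lam (\<lambda>t. t)"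
  have idm: "(\<lambda>t::real. t) \<in> borel_measurable borel" by simp
  have "\<exists>E. pvm E \<and> pvm_integral E (\<lambda>t. t) = ?T"
    using pvm_spec_proj diag_pvm_integral[OF spec_proj_diagonal idm] by blast
  then have S: "pvm (spectral_measure ?T)" "pvm_integral (spectral_measure ?T) (\<lambda>t. t) = ?T"
    unfolding spectral_measure_def using someI_ex[of "\<lambda>E. pvm E \<and> pvm_integral E (\<lambda>t. t) = ?T"] by blast+
  have "diagonal_pvm EE lam (spectral_measure ?T)"
  proof (rule diagonal_of_eigenvectors[OF S(1)])
    fix e assume e: "e \<in> EE"
    have el: "e \<in> l2" using e EE_sub_l2 by blast
    have "hcoeff EE (\<lambda>k. of_real (lam e) * e k) = rmul lam (hcoeff EE e)"
    proof
      fix f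
      have "hcoeff EE e f = 0" if "f \<noteq> e" using that e EE_orthonormal by (auto simp: hcoeff_def orthonormal_def)
      then show "hcoeff EE (\<lambda>k. of_real (lam e) * e k) f = rmul lam (hcoeff EE e) f"
        unfolding hcoeff_lin(3)[OF el el EE_sub_l2] by (cases "f = e") (simp_all add: rmul_def)
    qed
    then show "(e, \<lambda>k. of_real (lam e) * e k) \<in> pvm_integral (spectral_measure ?T) (\<lambda>t. t)"
      unfolding S(2) using el by (simp add: diag_graph_def)
  qed
  moreover have "(\<lambda>t. if 1 \<le> t then \<phi> t else 0) \<in> borel_measurable borel"
  proof -
    have "(\<lambda>t. indicator {1..} t *\<^sub>R \<phi> t) \<in> borel_measurable borel"
      using \<phi> borel_measurable_restrict_space_iff[of "{1..}" borel \<phi>] by (simp add: mult.commute)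
    moreover have "(\<lambda>t. if 1 \<le> t then \<phi> t else 0) = (\<lambda>t. indicator {1..} t *\<^sub>R \<phi> t)" by (auto simp: indicator_def)
    ultimately show ?thesis by simp
  qed
  ultimately have "fun_calc \<phi> ?T = diag_graph EE lam (\<lambda>t. if 1 \<le> t then \<phi> t else 0)"
    unfolding fun_calc_def by (rule diag_pvm_integral)
  then show ?thesis by (simp add: diag_graph_def lam)
qed

end

section \<open>Completion of a dense subspace of a weighted space\<close>

lemma rmul_add: "rmul h (\<lambda>k. u k + v k) = (\<lambda>k. rmul h u k + rmul h v k)"
  and rmul_diff: "rmul h (\<lambda>k. u k - v k) = (\<lambda>k. rmul h u k - rmul h v k)"
  and rmul_scale: "rmul h (\<lambda>k. z * u k) = (\<lambda>k. z * rmul h u k)"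
  by (auto simp: rmul_def algebra_simps)

lemma rmul_inj: "(\<And>k. h k > 0) \<Longrightarrow> rmul h u = rmul h v \<Longrightarrow> u = v"
proof
  fix k assume h: "\<And>k. h k > 0" and eq: "rmul h u = rmul h v"
  have "of_real (h k) * u k = of_real (h k) * v k" using fun_cong[OF eq, of k] by (simp add: rmul_def)
  then show "u k = v k" using h[of k] by simp
qed

lemma rmul_cancel: "(\<And>k. h k > 0) \<Longrightarrow> rmul h (\<lambda>k. w k / of_real (h k)) = w"
proof
  fix k assume h: "\<And>k. h k > 0"
  show "rmul h (\<lambda>k. w k / of_real (h k)) k = w k" using h[of k] by (simp add: rmul_def)
qed

text \<open>
  A space \<open>V\<close> of functions, dense in the weighted space with weight \<open>h\<close>, whose inner product gives a
  seminorm that is equivalent to the weighted norm on \<open>V\<close>. The identification of its completion with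
  the weighted space sends a class of Cauchy sequences to their common limit.
\<close>

locale dense_in_weighted =
  fixes V :: "('i \<Rightarrow> complex) set" and ip :: "('i \<Rightarrow> complex) \<Rightarrow> ('i \<Rightarrow> complex) \<Rightarrow> complex"
    and h :: "'i \<Rightarrow> real" and K L :: real
  assumes h: "h k > 0" and K: "K > 0" and L: "L > 0"
    and V_weighted: "u \<in> V \<Longrightarrow> rmul h u \<in> l2"
    and V_finite: "finite {k. u k \<noteq> 0} \<Longrightarrow> u \<in> V"
    and V_add: "u \<in> V \<Longrightarrow> v \<in> V \<Longrightarrow> (\<lambda>k. u k + v k) \<in> V"
    and V_scale: "u \<in> V \<Longrightarrow> (\<lambda>k. z * u k) \<in> V"
    and upper: "u \<in> V \<Longrightarrow> ip_norm ip u \<le> K * l2_norm (rmul h u)"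
    and lower: "u \<in> V \<Longrightarrow> l2_norm (rmul h u) \<le> L * ip_norm ip u"
    and triangle: "u \<in> V \<Longrightarrow> v \<in> V \<Longrightarrow> \<bar>ip_norm ip u - ip_norm ip v\<bar> \<le> ip_norm ip (\<lambda>k. u k - v k)"
begin

abbreviation "CS \<equiv> cauchy_seqs V ip"

definition has_limit :: "(nat \<Rightarrow> 'i \<Rightarrow> complex) \<Rightarrow> ('i \<Rightarrow> complex) \<Rightarrow> bool" where
  "has_limit X u \<longleftrightarrow> range X \<subseteq> V \<and> l2_tendsto (\<lambda>m. rmul h (X m)) (rmul h u)"

lemma V_diff: "u \<in> V \<Longrightarrow> v \<in> V \<Longrightarrow> (\<lambda>k. u k - v k) \<in> V"
proof -
  assume u: "u \<in> V" and v: "v \<in> V"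
  show ?thesis using V_add[OF u V_scale[OF v, of "- 1"]] by simp
qed

lemma ip_norm_nonneg: "u \<in> V \<Longrightarrow> ip_norm ip u \<ge> 0"
proof -
  assume "u \<in> V"
  then have "0 \<le> L * ip_norm ip u" using lower l2_norm_nonneg order_trans by blast
  then show ?thesis using L by (simp add: zero_le_mult_iff)
qed

lemma has_limit_unique: "has_limit X u \<Longrightarrow> has_limit X v \<Longrightarrow> u = v"
  unfolding has_limit_def by (elim conjE) (rule rmul_inj[OF h l2_tendsto_unique])

lemma has_limit_weighted: "has_limit X u \<Longrightarrow> rmul h u \<in> l2"
  by (simp add: has_limit_def l2_tendsto_def)

lemma cauchy_has_limit:
  assumes X: "X \<in> CS" shows "\<exists>u. has_limit X u"
proof -
  have V: "X m \<in> V" for m using X by (auto simp: cauchy_seqs_def)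
  have "\<exists>w. l2_tendsto (\<lambda>m. rmul h (X m)) w"
  proof (rule l2_complete)
    show "rmul h (X m) \<in> l2" for m by (rule V_weighted[OF V])
    fix e :: real assume "e > 0"
    then have eL: "e / L > 0" using L by simp
    have "\<forall>e>0. \<exists>M. \<forall>m\<ge>M. \<forall>l\<ge>M. ip_norm ip (\<lambda>k. X m k - X l k) < e" using X by (simp add: cauchy_seqs_def)
    from this[rule_format, OF eL] obtain M
      where M: "\<forall>m\<ge>M. \<forall>l\<ge>M. ip_norm ip (\<lambda>k. X m k - X l k) < e / L" ..
    have "l2_norm (\<lambda>k. rmul h (X m) k - rmul h (X l) k) < e" if "m \<ge> M" "l \<ge> M" for m l
    proof -
      have "l2_norm (rmul h (\<lambda>k. X m k - X l k)) \<le> L * ip_norm ip (\<lambda>k. X m k - X l k)"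
        by (rule lower[OF V_diff[OF V V]])
      also have "\<dots> < e" using M[rule_format, OF that] L by (simp add: field_simps)
      finally show ?thesis by (simp add: rmul_diff)
    qed
    then show "\<exists>M. \<forall>m\<ge>M. \<forall>l\<ge>M. l2_norm (\<lambda>k. rmul h (X m) k - rmul h (X l) k) < e" by blast
  qed
  then obtain w where w: "l2_tendsto (\<lambda>m. rmul h (X m)) w" by blast
  then have "has_limit X (\<lambda>k. w k / of_real (h k))"
    using V by (auto simp: has_limit_def rmul_cancel[OF h])
  then show ?thesis by blast
qed

lemma has_limit_diff_tendsto:
  assumes X: "has_limit X u" and Y: "has_limit Y u"
  shows "\<And>e. e > 0 \<Longrightarrow> \<exists>M. \<forall>m\<ge>M. \<forall>l\<ge>M. ip_norm ip (\<lambda>k. X m k - Y l k) < e"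
proof -
  fix e :: real assume e: "e > 0"
  have V: "X m \<in> V" "Y m \<in> V" for m using X Y by (auto simp: has_limit_def)
  let ?x = "\<lambda>m. l2_norm (\<lambda>k. rmul h (X m) k - rmul h u k)"
  let ?y = "\<lambda>m. l2_norm (\<lambda>k. rmul h (Y m) k - rmul h u k)"
  have "?x \<longlonglongrightarrow> 0" "?y \<longlonglongrightarrow> 0" using X Y by (auto simp: has_limit_def l2_tendsto_def)
  moreover have e2: "e / (2 * K) > 0" using e K by simp
  ultimately obtain M1 M2 where M: "\<And>m. m \<ge> M1 \<Longrightarrow> ?x m < e / (2 * K)" "\<And>m. m \<ge> M2 \<Longrightarrow> ?y m < e / (2 * K)"
    using LIMSEQ_D[OF _ e2, of ?x 0] LIMSEQ_D[OF _ e2, of ?y 0] by auto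
  have "ip_norm ip (\<lambda>k. X m k - Y l k) < e" if "m \<ge> max M1 M2" "l \<ge> max M1 M2" for m l
  proof -
    have l2: "(\<lambda>k. rmul h (X m) k - rmul h u k) \<in> l2" "(\<lambda>k. rmul h (Y l) k - rmul h u k) \<in> l2"
      using V_weighted[OF V(1)] V_weighted[OF V(2)] has_limit_weighted[OF X] by (auto intro: l2_diff)
    have "ip_norm ip (\<lambda>k. X m k - Y l k) \<le> K * l2_norm (rmul h (\<lambda>k. X m k - Y l k))"
      by (rule upper[OF V_diff[OF V]])
    also have "l2_norm (rmul h (\<lambda>k. X m k - Y l k)) \<le> ?x m + ?y l"
      using l2_diff(2)[OF l2] by (simp add: rmul_diff)
    also have "?x m + ?y l < e / (2 * K) + e / (2 * K)" using M that by (intro add_strict_mono) auto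
    finally have "ip_norm ip (\<lambda>k. X m k - Y l k) < K * (e / (2 * K) + e / (2 * K))" using K by simp
    also have "\<dots> = e" using K by (simp add: field_simps)
    finally show ?thesis .
  qed
  then show "\<exists>M. \<forall>m\<ge>M. \<forall>l\<ge>M. ip_norm ip (\<lambda>k. X m k - Y l k) < e" by blast
qed

lemma has_limit_cauchy: "has_limit X u \<Longrightarrow> X \<in> CS"
  using has_limit_diff_tendsto[of X u X] by (auto simp: cauchy_seqs_def has_limit_def)

text \<open>
  The two norms of the differences \<open>X m - Y m\<close> tend to \<open>0\<close> together because they are equivalent on \<open>V\<close>.
\<close>

lemma rel_iff: "(X, Y) \<in> cauchy_rel V ip \<longleftrightarrow> (\<exists>u. has_limit X u \<and> has_limit Y u)"
proof
  assume R: "(X, Y) \<in> cauchy_rel V ip"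
  then have C: "X \<in> CS" "Y \<in> CS" and d: "(\<lambda>m. ip_norm ip (\<lambda>k. X m k - Y m k)) \<longlonglongrightarrow> 0"
    by (auto simp: cauchy_rel_def)
  obtain u v where uv: "has_limit X u" "has_limit Y v" using cauchy_has_limit C by blast
  have V: "X m \<in> V" "Y m \<in> V" for m using C by (auto simp: cauchy_seqs_def)
  have "u k = v k" for k
  proof -
    have "(\<lambda>m. rmul h (X m) k - rmul h (Y m) k) \<longlonglongrightarrow> 0"
    proof (rule tendsto_dominated)
      fix m
      have "norm (rmul h (X m) k - rmul h (Y m) k) \<le> l2_norm (\<lambda>k. rmul h (X m) k - rmul h (Y m) k)"
        by (rule cmod_le_l2_norm[OF l2_diff(1)[OF V_weighted[OF V(1)] V_weighted[OF V(2)]]])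
      also have "\<dots> \<le> L * ip_norm ip (\<lambda>k. X m k - Y m k)"
        using lower[OF V_diff[OF V]] by (simp add: rmul_diff)
      finally show "norm (rmul h (X m) k - rmul h (Y m) k - 0) \<le> L * ip_norm ip (\<lambda>k. X m k - Y m k)" by simp
      show "(\<lambda>m. L * ip_norm ip (\<lambda>k. X m k - Y m k)) \<longlonglongrightarrow> 0" using tendsto_mult_left[OF d, of L] by simp
    qed
    moreover have "(\<lambda>m. rmul h (X m) k - rmul h (Y m) k) \<longlonglongrightarrow> rmul h u k - rmul h v k"
      using uv by (intro tendsto_diff l2_tendsto_pointwise) (auto simp: has_limit_def)
    ultimately have "rmul h u k - rmul h v k = 0" using LIMSEQ_unique by blast
    then show "u k = v k" using h[of k] by (simp add: rmul_def)
  qed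
  then have "u = v" by blast
  then show "\<exists>u. has_limit X u \<and> has_limit Y u" using uv by blast
next
  assume "\<exists>u. has_limit X u \<and> has_limit Y u"
  then obtain u where u: "has_limit X u" "has_limit Y u" by blast
  have "(\<lambda>m. ip_norm ip (\<lambda>k. X m k - Y m k)) \<longlonglongrightarrow> 0"
  proof (rule LIMSEQ_I)
    fix e :: real assume "e > 0"
    then obtain M where M: "\<And>m. m \<ge> M \<Longrightarrow> ip_norm ip (\<lambda>k. X m k - Y m k) < e"
      using has_limit_diff_tendsto[OF u] by blast
    have V: "X m \<in> V" "Y m \<in> V" for m using u by (auto simp: has_limit_def)
    show "\<exists>no. \<forall>n\<ge>no. norm (ip_norm ip (\<lambda>k. X n k - Y n k) - 0) < e"
      using M ip_norm_nonneg[OF V_diff[OF V]] by (intro exI[of _ M]) auto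
  qed
  then show "(X, Y) \<in> cauchy_rel V ip" using u has_limit_cauchy by (auto simp: cauchy_rel_def)
qed

text \<open>The elements of the completion, indexed by the limits of their members.\<close>

definition limit_class :: "('i \<Rightarrow> complex) \<Rightarrow> (nat \<Rightarrow> 'i \<Rightarrow> complex) set" where
  "limit_class u = {X. has_limit X u}"

lemma completion_class_eq: "has_limit X u \<Longrightarrow> completion_class V ip X = limit_class u"
proof -
  assume X: "has_limit X u"
  have "(\<exists>v. has_limit X v \<and> has_limit Y v) \<longleftrightarrow> has_limit Y u" for Y
    using X has_limit_unique[OF X] by blast
  then show ?thesis by (auto simp: completion_class_def limit_class_def rel_iff)
qed

lemma ex_has_limit:
  assumes u: "rmul h u \<in> l2" shows "\<exists>X. has_limit X u"
proof -
  obtain F :: "nat \<Rightarrow> 'i set" where F: "\<And>m. finite (F m)" "l2_tendsto (\<lambda>m k. if k \<in> F m then rmul h u k else 0) (rmul h u)"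
    using l2_tail_sequence[OF u] by blast
  define X where "X = (\<lambda>m k. if k \<in> F m then u k else 0)"
  have "finite {k. X m k \<noteq> 0}" for m using F(1)[of m] by (rule rev_finite_subset) (auto simp: X_def)
  then have "X m \<in> V" for m by (rule V_finite)
  moreover have "(\<lambda>m. rmul h (X m)) = (\<lambda>m k. if k \<in> F m then rmul h u k else 0)"
    by (intro ext) (simp add: X_def rmul_def)
  ultimately have "has_limit X u" using F(2) by (auto simp: has_limit_def)
  then show ?thesis by blast
qed

lemma completion_eq: "completion V ip = limit_class ` {u. rmul h u \<in> l2}"
proof (intro set_eqI iffI)
  fix \<xi> assume "\<xi> \<in> completion V ip"
  then obtain X where X: "X \<in> CS" "\<xi> = completion_class V ip X"
    unfolding completion_def completion_class_def by (elim quotientE)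
  obtain u where u: "has_limit X u" using cauchy_has_limit[OF X(1)] by blast
  show "\<xi> \<in> limit_class ` {u. rmul h u \<in> l2}"
    unfolding X(2) completion_class_eq[OF u] using has_limit_weighted[OF u] by simp
next
  fix \<xi> assume "\<xi> \<in> limit_class ` {u. rmul h u \<in> l2}"
  then obtain u X where "\<xi> = limit_class u" "has_limit X u" using ex_has_limit by blast
  then show "\<xi> \<in> completion V ip"
    using completion_class_eq[of X u] quotientI[OF has_limit_cauchy[of X u], of "cauchy_rel V ip"]
    by (simp add: completion_def completion_class_def)
qed

lemma limit_class_inj: "inj_on limit_class {u. rmul h u \<in> l2}"
proof (rule inj_onI, unfold mem_Collect_eq)
  fix u v assume "rmul h u \<in> l2" and eq: "limit_class u = limit_class v"
  then obtain X where "has_limit X u" using ex_has_limit by blast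
  moreover from this have "has_limit X v" using eq by (auto simp: limit_class_def)
  ultimately show "u = v" by (rule has_limit_unique)
qed

lemma has_limit_add:
  assumes X: "has_limit X u" and Y: "has_limit Y v"
  shows "has_limit (\<lambda>m k. X m k + Y m k) (\<lambda>k. u k + v k)"
proof -
  have V: "X m \<in> V" "Y m \<in> V" for m using X Y by (auto simp: has_limit_def)
  note w = V_weighted[OF V(1)] V_weighted[OF V(2)] has_limit_weighted[OF X] has_limit_weighted[OF Y]
  have "(\<lambda>m. l2_norm (\<lambda>k. rmul h (X m) k + rmul h (Y m) k - (rmul h u k + rmul h v k))) \<longlonglongrightarrow> 0"
  proof (rule tendsto_dominated)
    fix m
    have "l2_norm (\<lambda>k. (rmul h (X m) k - rmul h u k) + (rmul h (Y m) k - rmul h v k))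
        \<le> l2_norm (\<lambda>k. rmul h (X m) k - rmul h u k) + l2_norm (\<lambda>k. rmul h (Y m) k - rmul h v k)"
      by (intro l2_add(2) l2_diff(1) w)
    then show "norm (l2_norm (\<lambda>k. rmul h (X m) k + rmul h (Y m) k - (rmul h u k + rmul h v k)) - 0)
        \<le> l2_norm (\<lambda>k. rmul h (X m) k - rmul h u k) + l2_norm (\<lambda>k. rmul h (Y m) k - rmul h v k)"
      by (simp add: add_diff_add)
    show "(\<lambda>m. l2_norm (\<lambda>k. rmul h (X m) k - rmul h u k) + l2_norm (\<lambda>k. rmul h (Y m) k - rmul h v k)) \<longlonglongrightarrow> 0"
      using X Y by (intro tendsto_add_zero) (auto simp: has_limit_def l2_tendsto_def)
  qed
  then show ?thesis using V_add[OF V] w by (auto simp: has_limit_def l2_tendsto_def rmul_add l2_add)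
qed

lemma has_limit_scale:
  assumes X: "has_limit X u" shows "has_limit (\<lambda>m k. z * X m k) (\<lambda>k. z * u k)"
proof -
  have V: "X m \<in> V" for m using X by (auto simp: has_limit_def)
  have "(\<lambda>m. cmod z * l2_norm (\<lambda>k. rmul h (X m) k - rmul h u k)) \<longlonglongrightarrow> cmod z * 0"
    using X by (intro tendsto_mult_left) (auto simp: has_limit_def l2_tendsto_def)
  then have "(\<lambda>m. l2_norm (\<lambda>k. z * rmul h (X m) k - z * rmul h u k)) \<longlonglongrightarrow> 0"
    by (simp add: l2_norm_scale right_diff_distrib[symmetric])
  then show ?thesis
    using V_scale[OF V] V_weighted[OF V] has_limit_weighted[OF X]
    by (auto simp: has_limit_def l2_tendsto_def rmul_scale)
qed

lemma limit_class_add: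
  assumes "rmul h u \<in> l2" "rmul h v \<in> l2"
  shows "completion_add V ip (limit_class u) (limit_class v) = limit_class (\<lambda>k. u k + v k)"
proof -
  have "completion_class V ip (\<lambda>m k. X m k + Y m k) = limit_class (\<lambda>k. u k + v k)"
    if "X \<in> limit_class u" "Y \<in> limit_class v" for X Y
    using that by (intro completion_class_eq has_limit_add) (auto simp: limit_class_def)
  moreover have "limit_class u \<noteq> {}" "limit_class v \<noteq> {}"
    using ex_has_limit assms by (auto simp: limit_class_def)
  ultimately show ?thesis by (simp add: completion_add_def)
qed

lemma limit_class_scale:
  assumes "rmul h u \<in> l2"
  shows "completion_scale V ip z (limit_class u) = limit_class (\<lambda>k. z * u k)"
proof -
  have "completion_class V ip (\<lambda>m k. z * X m k) = limit_class (\<lambda>k. z * u k)"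
    if "X \<in> limit_class u" for X
    using that by (intro completion_class_eq has_limit_scale) (auto simp: limit_class_def)
  moreover have "limit_class u \<noteq> {}" using ex_has_limit assms by (auto simp: limit_class_def)
  ultimately show ?thesis by (simp add: completion_scale_def)
qed

lemma limit_class_norm:
  assumes u: "rmul h u \<in> l2"
  shows "completion_norm ip (limit_class u) \<le> K * l2_norm (rmul h u)"
    and "l2_norm (rmul h u) \<le> L * completion_norm ip (limit_class u)"
proof -
  obtain X where X: "has_limit X u" using ex_has_limit[OF u] by blast
  have V: "Y m \<in> V" if "has_limit Y u" for Y m using that by (auto simp: has_limit_def)
  have "Cauchy (\<lambda>m. ip_norm ip (X m))"
  proof (rule metric_CauchyI)
    fix e :: real assume "e > 0"
    then obtain M where M: "\<And>m l. m \<ge> M \<Longrightarrow> l \<ge> M \<Longrightarrow> ip_norm ip (\<lambda>k. X m k - X l k) < e"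
      using has_limit_diff_tendsto[OF X X] by blast
    show "\<exists>M. \<forall>m\<ge>M. \<forall>n\<ge>M. dist (ip_norm ip (X m)) (ip_norm ip (X n)) < e"
      unfolding dist_real_def by (intro exI[of _ M] allI impI order_le_less_trans[OF triangle[OF V[OF X] V[OF X]]] M)
  qed
  then obtain r where r: "(\<lambda>m. ip_norm ip (X m)) \<longlonglongrightarrow> r"
    using real_Cauchy_convergent convergent_def by blast
  have rY: "(\<lambda>m. ip_norm ip (Y m)) \<longlonglongrightarrow> r" if Y: "has_limit Y u" for Y
  proof -
    have "(X, Y) \<in> cauchy_rel V ip" using X Y rel_iff by blast
    then have d: "(\<lambda>m. ip_norm ip (\<lambda>k. X m k - Y m k)) \<longlonglongrightarrow> 0" by (simp add: cauchy_rel_def)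
    have "(\<lambda>m. ip_norm ip (X m) - ip_norm ip (Y m)) \<longlonglongrightarrow> 0"
      by (rule tendsto_dominated[OF _ d]) (use triangle[OF V[OF X] V[OF Y]] in simp)
    from tendsto_diff[OF r this] show ?thesis by simp
  qed
  have "completion_norm ip (limit_class u) = r"
    unfolding completion_norm_def limit_class_def
  proof (rule the_equality)
    show "\<forall>Y\<in>{X. has_limit X u}. (\<lambda>m. ip_norm ip (Y m)) \<longlonglongrightarrow> r" using rY by blast
    fix s assume "\<forall>Y\<in>{X. has_limit X u}. (\<lambda>m. ip_norm ip (Y m)) \<longlonglongrightarrow> s"
    then show "s = r" using X r LIMSEQ_unique by blast
  qed
  moreover have n: "(\<lambda>m. l2_norm (rmul h (X m))) \<longlonglongrightarrow> l2_norm (rmul h u)"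
    using X by (intro l2_tendsto_norm) (simp add: has_limit_def)
  have "r \<le> K * l2_norm (rmul h u)"
    by (rule LIMSEQ_le[OF r tendsto_mult_left[OF n]]) (use upper[OF V[OF X]] in blast)
  moreover have "l2_norm (rmul h u) \<le> L * r"
    by (rule LIMSEQ_le[OF n tendsto_mult_left[OF r]]) (use lower[OF V[OF X]] in blast)
  ultimately show "completion_norm ip (limit_class u) \<le> K * l2_norm (rmul h u)"
    "l2_norm (rmul h u) \<le> L * completion_norm ip (limit_class u)" by simp_all
qed

lemma has_limit_const: "u \<in> V \<Longrightarrow> has_limit (\<lambda>m. u) u"
  using V_weighted[of u] by (auto simp: has_limit_def l2_tendsto_def)

theorem completion_eq_weighted:
  assumes W: "W = {u. rmul h u \<in> l2}" and iq: "\<And>u. u \<in> W \<Longrightarrow> ip_norm iq u = l2_norm (rmul h u)"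
  shows "completion_eq_upto_norm_equiv V ip W iq"
  unfolding completion_eq_upto_norm_equiv_def
proof (intro exI conjI ballI allI)
  let ?J = "the_inv_into W limit_class"
  have inj: "inj_on limit_class W" and comp: "completion V ip = limit_class ` W"
    using limit_class_inj completion_eq by (simp_all add: W)
  have J: "?J (limit_class u) = u" if "rmul h u \<in> l2" for u
    by (rule the_inv_into_f_f[OF inj]) (simp add: W that)
  show "bij_betw ?J (completion V ip) W"
    unfolding comp by (rule bij_betw_the_inv_into[OF inj_on_imp_bij_betw[OF inj]])
  show "?J (completion_class V ip (\<lambda>m. u)) = u" if "u \<in> V" for u
    unfolding completion_class_eq[OF has_limit_const[OF that]] by (rule J[OF V_weighted[OF that]])
  show "?J (completion_add V ip \<xi> \<eta>) = (\<lambda>k. ?J \<xi> k + ?J \<eta> k)"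
    if mem: "\<xi> \<in> completion V ip" "\<eta> \<in> completion V ip" for \<xi> \<eta>
  proof -
    obtain u v where u: "rmul h u \<in> l2" "\<xi> = limit_class u" and v: "rmul h v \<in> l2" "\<eta> = limit_class v"
      using mem unfolding comp W by blast
    have "rmul h (\<lambda>k. u k + v k) \<in> l2" using u v by (simp add: rmul_add l2_add)
    then show ?thesis unfolding u(2) v(2) limit_class_add[OF u(1) v(1)] by (simp add: J u(1) v(1))
  qed
  show "?J (completion_scale V ip z \<xi>) = (\<lambda>k. z * ?J \<xi> k)" if mem: "\<xi> \<in> completion V ip" for z \<xi>
  proof -
    obtain u where u: "rmul h u \<in> l2" "\<xi> = limit_class u" using mem unfolding comp W by blast
    have "rmul h (\<lambda>k. z * u k) \<in> l2" using u by (simp add: rmul_scale)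
    then show ?thesis unfolding u(2) limit_class_scale[OF u(1)] by (simp add: J u(1))
  qed
  show "inverse K > 0" "L > 0" using K L by simp_all
  fix \<xi> assume "\<xi> \<in> completion V ip"
  then obtain u where u: "rmul h u \<in> l2" "\<xi> = limit_class u" by (auto simp: comp W)
  have n: "ip_norm iq (?J (limit_class u)) = l2_norm (rmul h u)" unfolding J[OF u(1)] by (rule iq) (simp add: W u)
  show "inverse K * completion_norm ip \<xi> \<le> ip_norm iq (?J \<xi>)"
    unfolding u(2) n using limit_class_norm(1)[OF u(1)] K by (simp add: field_simps)
  show "ip_norm iq (?J \<xi>) \<le> L * completion_norm ip \<xi>"
    unfolding u(2) n by (rule limit_class_norm(2)[OF u(1)])
qed

end

section \<open>The operator on the Schwartz space\<close>

subsection \<open>Rapidly decreasing functions\<close>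

lemma diff1_finite: "finite {k. u k \<noteq> 0} \<Longrightarrow> finite {k. diff1 j u k \<noteq> 0}"
proof -
  assume fin: "finite {k. u k \<noteq> 0}"
  have "{k. diff1 j u k \<noteq> 0} \<subseteq> {k. u k \<noteq> 0} \<union> (\<lambda>k. k - axis j 1) ` {k. u k \<noteq> 0}"
  proof
    fix k assume "k \<in> {k. diff1 j u k \<noteq> 0}"
    then have "u k \<noteq> 0 \<or> u (k + axis j 1) \<noteq> 0" by (auto simp: diff1_def)
    moreover have "k = (k + axis j 1) - axis j 1" by simp
    ultimately show "k \<in> {k. u k \<noteq> 0} \<union> (\<lambda>k. k - axis j 1) ` {k. u k \<noteq> 0}" by blast
  qed
  then show ?thesis by (rule finite_subset) (use fin in simp)
qed

lemma diff_op_finite: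
  fixes u :: "int ^ 'n::{finite,linorder} \<Rightarrow> complex"
  assumes "finite {k. u k \<noteq> 0}" shows "finite {k. diff_op \<beta> u k \<noteq> 0}"
proof -
  have p: "finite {k. (diff1 j ^^ p) v k \<noteq> 0}" if "finite {k. v k \<noteq> 0}" for j p and v :: "int ^ 'n::{finite,linorder} \<Rightarrow> complex"
    using that by (induction p) (auto intro: diff1_finite)
  have "finite {k. foldr (\<lambda>j v. (diff1 j ^^ (\<beta> $ j)) v) xs u k \<noteq> 0}" for xs
    using assms by (induction xs) (auto intro: p)
  then show ?thesis by (simp add: diff_op_def)
qed

lemma finite_support_schwartz:
  fixes u :: "int ^ 'n::{finite,linorder} \<Rightarrow> complex"
  assumes "finite {k. u k \<noteq> 0}" shows "u \<in> schwartz"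
  unfolding schwartz_def mem_Collect_eq
proof (intro allI)
  fix \<alpha> \<beta> :: "nat ^ 'n::{finite,linorder}"
  let ?f = "\<lambda>k. cmod ((\<Prod>j\<in>UNIV. of_int (k $ j) ^ (\<alpha> $ j)) * diff_op \<beta> u k)"
  have "range ?f \<subseteq> insert 0 (?f ` {k. diff_op \<beta> u k \<noteq> 0})" by auto
  then have "finite (range ?f)" by (rule finite_subset) (use diff_op_finite[OF assms] in simp)
  then show "bdd_above (range ?f)" by (rule bdd_above_finite)
qed

lemma schwartz_decay:
  fixes u :: "int ^ 'n::{finite,linorder} \<Rightarrow> complex"
  assumes u: "u \<in> schwartz"
  shows "\<exists>C\<ge>0. \<forall>k. rho k ^ N * cmod (u k) \<le> C"
proof -
  have b: "\<exists>B. \<forall>k. cmod ((\<Prod>j\<in>UNIV. of_int (k $ j) ^ (\<alpha> $ j)) * u k) \<le> B" for \<alpha> :: "nat ^ 'n::{finite,linorder}"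
  proof -
    have "bdd_above (range (\<lambda>k. cmod ((\<Prod>j\<in>UNIV. of_int (k $ j) ^ (\<alpha> $ j)) * diff_op 0 u k)))"
      using u unfolding schwartz_def mem_Collect_eq by (elim allE)
    then show ?thesis by (auto simp: bdd_above_def diff_op_0)
  qed
  obtain B0 where B0: "\<And>k. cmod (u k) \<le> B0" using b[of 0] by auto
  have "\<exists>B. \<forall>k. \<bar>real_of_int (k $ i)\<bar> ^ N * cmod (u k) \<le> B" for i :: "'n::{finite,linorder}"
  proof -
    have "(\<Prod>j\<in>UNIV. of_int (k $ j) ^ (axis i N $ j)) = (of_int (k $ i) ^ N :: complex)" for k :: "int ^ 'n::{finite,linorder}"
    proof -
      have "(\<Prod>j\<in>UNIV. of_int (k $ j) ^ (axis i N $ j)) = (\<Prod>j\<in>UNIV. if j = i then of_int (k $ i) ^ N else (1 :: complex))"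
        by (intro prod.cong refl) (auto simp: axis_def)
      then show ?thesis by simp
    qed
    then show ?thesis using b[of "axis i N"] by (simp add: norm_mult norm_power)
  qed
  then obtain B where B: "\<And>i k. \<bar>real_of_int (k $ i)\<bar> ^ N * cmod (u k) \<le> B i" by metis
  let ?C = "(1 + real CARD('n)) ^ N * (B0 + (\<Sum>i\<in>UNIV. B i))"
  have le: "rho k ^ N * cmod (u k) \<le> ?C" for k by (rule rho_power_mult_le[OF B0 B])
  moreover have "0 \<le> ?C" using order_trans[OF _ le[of 0]] by simp
  ultimately show ?thesis by blast
qed

lemma schwartz_summable:
  fixes u :: "int ^ 'n::{finite,linorder} \<Rightarrow> complex"
  assumes u: "u \<in> schwartz" shows "(\<lambda>k. cmod (u k)) summable_on UNIV"
proof -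
  obtain C where C: "\<And>k. rho k ^ (2 * CARD('n)) * cmod (u k) \<le> C" using schwartz_decay[OF u] by blast
  have "cmod (u k) \<le> C / rho k ^ (2 * CARD('n))" for k using C[of k] by (simp add: field_simps)
  then show ?thesis by (rule summable_decay)
qed

lemma schwartz_wt:
  fixes u :: "int ^ 'n::{finite,linorder} \<Rightarrow> complex"
  assumes u: "u \<in> schwartz" shows "wt p u \<in> l2"
proof -
  obtain C where C: "C \<ge> 0" "\<And>k. rho k ^ (CARD('n) + p) * cmod (u k) \<le> C" using schwartz_decay[OF u] by blast
  have "cmod ((cmod (wt p u k))\<^sup>2) \<le> C\<^sup>2 / rho k ^ (2 * CARD('n))" for k
  proof -
    have "rho k ^ CARD('n) * cmod (wt p u k) \<le> C" using C(2)[of k] by (simp add: cmod_wt power_add mult.assoc)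
    then have "(rho k ^ CARD('n) * cmod (wt p u k))\<^sup>2 \<le> C\<^sup>2" by (intro power_mono) auto
    then have "rho k ^ (2 * CARD('n)) * (cmod (wt p u k))\<^sup>2 \<le> C\<^sup>2"
      by (simp add: power_mult_distrib power_mult[symmetric] mult.commute)
    then show ?thesis by (simp add: field_simps norm_power)
  qed
  then show ?thesis using summable_decay[of "\<lambda>k. of_real ((cmod (wt p u k))\<^sup>2)" "C\<^sup>2"] by (simp add: l2_def norm_power)
qed

lemma Op_schwartz:
  fixes a :: "int ^ 'n::{finite,linorder} \<Rightarrow> real ^ 'n::{finite,linorder} \<Rightarrow> complex"
  assumes "a \<in> symbols 1" "u \<in> schwartz"
  shows "Op a u = matvec (symbol_matrix a) u"
proof
  fix k
  have "continuous_on UNIV (a k)" using assms(1) by (intro smooth_torusD(1)) (simp add: symbols_def)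
  from Op_matrix[of u a k, OF schwartz_summable[OF assms(2)] this]
  show "Op a u k = matvec (symbol_matrix a) u k" by (simp add: matvec_def symbol_matrix_def)
qed

subsection \<open>Symmetry\<close>

lemma matvec_finite:
  assumes "finite F" "\<And>l. l \<notin> F \<Longrightarrow> u l = 0"
  shows "matvec A u k = (\<Sum>l\<in>F. A k l * u l)"
  unfolding matvec_def by (rule infsumI, rule has_sum_finite_neutralI) (use assms in auto)

lemma l2_inner_finite:
  assumes "finite F" "\<And>l. l \<notin> F \<Longrightarrow> v l = 0"
  shows "l2_inner u v = (\<Sum>l\<in>F. u l * cnj (v l))"
  unfolding l2_inner_def by (rule infsumI, rule has_sum_finite_neutralI) (use assms in auto)

text \<open>
  A complex quadratic form with real values is Hermitian: polarize with vectors supported in two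
  points.
\<close>

lemma real_form_hermitian:
  assumes real: "\<And>u. finite {k. u k \<noteq> 0} \<Longrightarrow> l2_inner (matvec A u) u \<in> \<real>"
  shows "A k l = cnj (A l k)"
proof -
  have form: "l2_inner (matvec A u) u = (\<Sum>i\<in>F. \<Sum>j\<in>F. A i j * u j * cnj (u i))"
    if "finite F" "\<And>i. i \<notin> F \<Longrightarrow> u i = 0" for F u
    using l2_inner_finite[of F u "matvec A u"] matvec_finite[of F u A] that by (simp add: sum_distrib_right)
  have diag: "A i i \<in> \<real>" for i
  proof -
    define u where "u = (\<lambda>j. if j = i then 1 else (0 :: complex))"
    have "l2_inner (matvec A u) u = A i i" by (subst form[of "{i}"]) (auto simp: u_def)
    moreover have "finite {j. u j \<noteq> 0}" by (rule finite_subset[of _ "{i}"]) (auto simp: u_def)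
    ultimately show ?thesis using real[of u] by simp
  qed
  show ?thesis
  proof (cases "k = l")
    case True
    then show ?thesis using diag[of k] by (simp add: Reals_cnj_iff)
  next
    case False
    have *: "A k l * c + A l k * cnj c \<in> \<real>" if c: "cmod c = 1" for c
    proof -
      define u where "u = (\<lambda>j. if j = l then c else if j = k then 1 else (0 :: complex))"
      have "l2_inner (matvec A u) u = A k k + A k l * c + (A l k * cnj c + A l l * (c * cnj c))"
        using False by (subst form[of "{k, l}"]) (auto simp: u_def algebra_simps)
      moreover have "c * cnj c = 1" using c by (simp add: complex_norm_square[symmetric])
      moreover have "finite {j. u j \<noteq> 0}" by (rule finite_subset[of _ "{k, l}"]) (auto simp: u_def)
      ultimately have r: "A k k + A k l * c + (A l k * cnj c + A l l) \<in> \<real>" using real[of u] by simp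
      have "A k k + A k l * c + (A l k * cnj c + A l l) - (A k k + A l l) \<in> \<real>"
        by (rule Reals_diff[OF r Reals_add[OF diag diag]])
      then show ?thesis by (simp add: algebra_simps)
    qed
    from *[of 1] *[of \<i>] show ?thesis by (simp add: complex_is_Real_iff complex_eq_iff)
  qed
qed

section \<open>The closure of the operator\<close>

text \<open>
  Limits in the graph are values of the matrix, because its rows are square summable, and their first
  components lie in \<open>H1\<close> by elliptic regularity. Conversely finitely supported functions form a core.
\<close>

theorem (in elliptic_matrix) op_closure_matvec:
  assumes G: "G = {(u, matvec A u) |u. u \<in> S}" and S: "S \<subseteq> H1" "\<And>u. finite {k. u k \<noteq> 0} \<Longrightarrow> u \<in> S"
  shows "op_closure G = {(u, matvec A u) |u. u \<in> H1}"
proof (intro set_eqI iffI; clarify)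
  fix u v assume "(u, v) \<in> op_closure G"
  then obtain U V where UV: "\<And>m :: nat. (U m, V m) \<in> G" and lim: "l2_tendsto U u" "l2_tendsto V v"
    unfolding op_closure_def by blast
  have V: "V m = matvec A (U m)" for m using UV[of m] by (auto simp: G)
  have "v k = matvec A u k" for k
  proof (rule LIMSEQ_unique)
    show "(\<lambda>m. V m k) \<longlonglongrightarrow> v k" by (rule l2_tendsto_pointwise[OF lim(2)])
    show "(\<lambda>m. V m k) \<longlonglongrightarrow> matvec A u k"
      unfolding V matvec_eq_inner by (rule l2_tendsto_inner[OF lim(1) column_l2])
  qed
  then have v: "v = matvec A u" by blast
  have "u \<in> H1" using lim v by (simp add: H1_iff l2_tendsto_def)
  then show "\<exists>w. (u, v) = (w, matvec A w) \<and> w \<in> H1" using v by blast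
next
  fix u assume "u \<in> H1"
  then obtain U where U: "\<And>m :: nat. finite {k. U m k \<noteq> 0}" "l2_tendsto U u" "l2_tendsto (\<lambda>m. matvec A (U m)) (matvec A u)"
    using H1_approx by blast
  have "\<forall>m. (U m, matvec A (U m)) \<in> G" using S(2)[OF U(1)] G by blast
  then show "(u, matvec A u) \<in> op_closure G"
    unfolding op_closure_def mem_Collect_eq case_prod_conv
    by (intro exI[of _ U] exI[of _ "\<lambda>m. matvec A (U m)"] conjI U)
qed

context elliptic_eigenbasis begin

theorem graph_eq_diag: "{(u, matvec A u) |u. u \<in> H1} = diag_graph EE lam (\<lambda>t. t)"
proof (intro set_eqI iffI; clarify)
  fix u assume u: "u \<in> H1"
  then show "(u, matvec A u) \<in> diag_graph EE lam (\<lambda>t. t)"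
    using hcoeff_A[OF u] by (simp add: diag_graph_def H1_l2 A_H1 rmul_def evwt_def)
next
  fix u v assume "(u, v) \<in> diag_graph EE lam (\<lambda>t. t)"
  then have uv: "u \<in> l2" "v \<in> l2" "hcoeff EE v = evwt lam 1 (hcoeff EE u)"
    by (simp_all add: diag_graph_def rmul_def evwt_def)
  then have u: "u \<in> H1" using hcoeff_l2[OF uv(2)] by (intro H1_of_coeff) simp_all
  have "v = matvec A u" using hcoeff_A[OF u] uv by (intro hcoeff_inj A_H1 u) simp_all
  then show "\<exists>w. (u, v) = (w, matvec A w) \<and> w \<in> H1" using u by blast
qed

end

lemma diag_graph_apply:
  assumes EE: "complete_orthonormal EE" and uv: "(u, v) \<in> diag_graph EE lam f"
  shows "op_apply (diag_graph EE lam f) u = v"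
  unfolding op_apply_def
proof (rule the_equality[of "\<lambda>v. (u, v) \<in> diag_graph EE lam f", OF uv])
  fix w assume "(u, w) \<in> diag_graph EE lam f"
  then show "w = v" using uv by (intro hcoeff_eqD[OF EE]) (simp_all add: diag_graph_def)
qed

lemma diag_graph_Domain:
  assumes EE: "complete_orthonormal EE"
  shows "Domain (diag_graph EE lam f) = {u \<in> l2. rmul (\<lambda>e. f (lam e)) (hcoeff EE u) \<in> l2}"
proof (intro set_eqI iffI)
  fix u assume "u \<in> Domain (diag_graph EE lam f)"
  then obtain v where "u \<in> l2" "v \<in> l2" "hcoeff EE v = rmul (\<lambda>e. f (lam e)) (hcoeff EE u)"
    by (auto simp: diag_graph_def)
  then show "u \<in> {u \<in> l2. rmul (\<lambda>e. f (lam e)) (hcoeff EE u) \<in> l2}"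
    using hcoeff_in_l2[OF EE, of v] by simp
next
  fix u assume u: "u \<in> {u \<in> l2. rmul (\<lambda>e. f (lam e)) (hcoeff EE u) \<in> l2}"
  have "\<exists>v\<in>l2. hcoeff EE v = rmul (\<lambda>e. f (lam e)) (hcoeff EE u)"
    using u by (intro ex_hcoeff[OF EE]) (simp_all add: rmul_def hcoeff_outside[OF EE])
  then show "u \<in> Domain (diag_graph EE lam f)" using u by (auto simp: diag_graph_def)
qed

lemma diag_graph_norm:
  assumes EE: "complete_orthonormal EE" and u: "u \<in> Domain (diag_graph EE lam f)"
  shows "ip_norm (\<lambda>u v. l2_inner (op_apply (diag_graph EE lam f) u) (op_apply (diag_graph EE lam f) v)) u
    = l2_norm (rmul (\<lambda>e. f (lam e)) (hcoeff EE u))"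
proof -
  obtain v where uv: "(u, v) \<in> diag_graph EE lam f" using u by blast
  then have v: "v \<in> l2" "hcoeff EE v = rmul (\<lambda>e. f (lam e)) (hcoeff EE u)" by (simp_all add: diag_graph_def)
  show ?thesis
    unfolding ip_norm_def diag_graph_apply[OF EE uv] v(2)[symmetric]
    using hcoeff_norm[OF EE v(1)] by (simp add: l2_inner_self)
qed

section \<open>Comparison of the spectral and the lattice weights\<close>

lemma bracket_ge_1: "bracket k \<ge> 1" and bracket_le_rho: "bracket k \<le> rho k" and rho_le_bracket: "rho k \<le> 2 * bracket k"
proof -
  have "sqrt 1 \<le> bracket k" unfolding bracket_def by (rule real_sqrt_le_mono) simp
  then show 1: "bracket k \<ge> 1" by simp
  show "bracket k \<le> rho k"
    unfolding bracket_def by (rule real_le_lsqrt) (simp_all add: rho_def power2_sum)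
  have "lat_norm k \<le> bracket k" unfolding bracket_def by (rule real_le_rsqrt) simp
  then show "rho k \<le> 2 * bracket k" using 1 by (simp add: rho_def)
qed

lemma bracket_power_weight:
  "wt N u \<in> l2 \<Longrightarrow> rmul (\<lambda>k. bracket k ^ N) u \<in> l2 \<and> l2_norm (rmul (\<lambda>k. bracket k ^ N) u) \<le> l2_norm (wt N u)"
  "rmul (\<lambda>k. bracket k ^ N) u \<in> l2 \<Longrightarrow> wt N u \<in> l2 \<and> l2_norm (wt N u) \<le> 2 ^ N * l2_norm (rmul (\<lambda>k. bracket k ^ N) u)"
proof -
  have b: "0 \<le> bracket k" for k :: "int ^ 'n" using bracket_ge_1[of k] by linarith
  have 1: "cmod (rmul (\<lambda>k. bracket k ^ N) u k) \<le> 1 * cmod (wt N u k)" for k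
    using power_mono[OF bracket_le_rho[of k] b, of N] b[of k] by (simp add: cmod_rmul cmod_wt mult_right_mono)
  have 2: "cmod (wt N u k) \<le> 2 ^ N * cmod (rmul (\<lambda>k. bracket k ^ N) u k)" for k
  proof -
    have "rho k ^ N \<le> 2 ^ N * bracket k ^ N"
      using power_mono[OF rho_le_bracket[of k], of N] by (simp add: power_mult_distrib)
    then have "rho k ^ N * cmod (u k) \<le> 2 ^ N * bracket k ^ N * cmod (u k)" by (rule mult_right_mono) simp
    then show ?thesis using b[of k] by (simp add: cmod_rmul cmod_wt mult.assoc)
  qed
  show "wt N u \<in> l2 \<Longrightarrow> rmul (\<lambda>k. bracket k ^ N) u \<in> l2 \<and> l2_norm (rmul (\<lambda>k. bracket k ^ N) u) \<le> l2_norm (wt N u)"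
    using l2_mono[of "wt N u" "rmul (\<lambda>k. bracket k ^ N) u", OF _ 1] by simp
  show "rmul (\<lambda>k. bracket k ^ N) u \<in> l2 \<Longrightarrow> wt N u \<in> l2 \<and> l2_norm (wt N u) \<le> 2 ^ N * l2_norm (rmul (\<lambda>k. bracket k ^ N) u)"
    using l2_mono[of "rmul (\<lambda>k. bracket k ^ N) u" "wt N u", OF _ 2] by simp
qed

context elliptic_eigenbasis begin

lemma evwt_rmul: "evwt lam N c = rmul (\<lambda>e. lam e ^ N) c"
  by (simp add: evwt_def rmul_def)

lemma power_weights:
  "\<exists>C>0. \<forall>u\<in>l2. (rmul (\<lambda>e. lam e ^ N) (hcoeff EE u) \<in> l2 \<longrightarrow>
      rmul (\<lambda>k. bracket k ^ N) u \<in> l2 \<and> l2_norm (rmul (\<lambda>k. bracket k ^ N) u) \<le> C * l2_norm (rmul (\<lambda>e. lam e ^ N) (hcoeff EE u))) \<and>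
    (rmul (\<lambda>k. bracket k ^ N) u \<in> l2 \<longrightarrow>
      rmul (\<lambda>e. lam e ^ N) (hcoeff EE u) \<in> l2 \<and> l2_norm (rmul (\<lambda>e. lam e ^ N) (hcoeff EE u)) \<le> C * l2_norm (rmul (\<lambda>k. bracket k ^ N) u))"
proof -
  obtain C1 where C1: "C1 \<ge> 0" "\<And>u. u \<in> l2 \<Longrightarrow> evwt lam N (hcoeff EE u) \<in> l2 \<Longrightarrow>
      wt N u \<in> l2 \<and> l2_norm (wt N u) \<le> C1 * l2_norm (evwt lam N (hcoeff EE u))"
    using sobolev_le_spectral[of N] by blast
  obtain C2 where C2: "C2 \<ge> 0" "\<And>u. wt N u \<in> l2 \<Longrightarrow>
      evwt lam N (hcoeff EE u) \<in> l2 \<and> l2_norm (evwt lam N (hcoeff EE u)) \<le> C2 * l2_norm (wt N u)"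
    using spectral_le_sobolev[of N] by blast
  define C where "C = C1 + C2 * 2 ^ N + 1"
  have C: "C > 0" "C1 \<le> C" "C2 * 2 ^ N \<le> C" using C1(1) C2(1) by (simp_all add: C_def add_nonneg_pos)
  show ?thesis
  proof (intro exI[of _ C] conjI ballI impI C)
    fix u :: "int ^ 'n \<Rightarrow> complex" assume u: "u \<in> l2"
    {
      assume "rmul (\<lambda>e. lam e ^ N) (hcoeff EE u) \<in> l2"
      then have 1: "wt N u \<in> l2" "l2_norm (wt N u) \<le> C1 * l2_norm (rmul (\<lambda>e. lam e ^ N) (hcoeff EE u))"
        using C1(2)[OF u] by (simp_all add: evwt_rmul)
      show "rmul (\<lambda>k. bracket k ^ N) u \<in> l2" using bracket_power_weight(1)[OF 1(1)] by simp
      have "l2_norm (rmul (\<lambda>k. bracket k ^ N) u) \<le> l2_norm (wt N u)" using bracket_power_weight(1)[OF 1(1)] by simp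
      also note 1(2)
      also have "C1 * l2_norm (rmul (\<lambda>e. lam e ^ N) (hcoeff EE u)) \<le> C * l2_norm (rmul (\<lambda>e. lam e ^ N) (hcoeff EE u))"
        by (intro mult_right_mono C) simp
      finally show "l2_norm (rmul (\<lambda>k. bracket k ^ N) u) \<le> C * l2_norm (rmul (\<lambda>e. lam e ^ N) (hcoeff EE u))" .
    next
      assume r: "rmul (\<lambda>k. bracket k ^ N) u \<in> l2"
      have 1: "wt N u \<in> l2" "l2_norm (wt N u) \<le> 2 ^ N * l2_norm (rmul (\<lambda>k. bracket k ^ N) u)"
        using bracket_power_weight(2)[OF r] by simp_all
      show "rmul (\<lambda>e. lam e ^ N) (hcoeff EE u) \<in> l2" using C2(2)[OF 1(1)] by (simp add: evwt_rmul)
      have "l2_norm (rmul (\<lambda>e. lam e ^ N) (hcoeff EE u)) \<le> C2 * l2_norm (wt N u)"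
        using C2(2)[OF 1(1)] by (simp add: evwt_rmul)
      also have "\<dots> \<le> C2 * (2 ^ N * l2_norm (rmul (\<lambda>k. bracket k ^ N) u))" by (intro mult_left_mono 1 C2)
      also have "\<dots> \<le> C * l2_norm (rmul (\<lambda>k. bracket k ^ N) u)"
        unfolding mult.assoc[symmetric] by (intro mult_right_mono C) simp
      finally show "l2_norm (rmul (\<lambda>e. lam e ^ N) (hcoeff EE u)) \<le> C * l2_norm (rmul (\<lambda>k. bracket k ^ N) u)" .
    }
  qed
qed

text \<open>
  The coefficient map is a unitary relation between functions of \<open>k\<close> and functions on the eigenbasis,
  and integer powers of the weights are comparable, so interpolation applies in both directions.
\<close>

theorem RO_weights:
  assumes RO: "\<phi> \<in> RO"
  shows "\<exists>K>0. \<exists>L>0. \<forall>u\<in>l2.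
    (rmul (\<lambda>e. \<phi> (lam e)) (hcoeff EE u) \<in> l2 \<longrightarrow>
      rmul (\<lambda>k. \<phi> (bracket k)) u \<in> l2 \<and> l2_norm (rmul (\<lambda>k. \<phi> (bracket k)) u) \<le> L * l2_norm (rmul (\<lambda>e. \<phi> (lam e)) (hcoeff EE u))) \<and>
    (rmul (\<lambda>k. \<phi> (bracket k)) u \<in> l2 \<longrightarrow>
      rmul (\<lambda>e. \<phi> (lam e)) (hcoeff EE u) \<in> l2 \<and> l2_norm (rmul (\<lambda>e. \<phi> (lam e)) (hcoeff EE u)) \<le> K * l2_norm (rmul (\<lambda>k. \<phi> (bracket k)) u))"
proof -
  obtain D \<sigma> where D: "D \<ge> 1" and growth: "\<And>s t. s \<ge> 1 \<Longrightarrow> t \<ge> 1 \<Longrightarrow> \<phi> s \<le> D * (max (s / t) (t / s)) ^ \<sigma> * \<phi> t"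
    using RO_growth[OF RO] by blast
  have pos: "\<phi> t > 0" if "t \<ge> 1" for t using RO that by (simp add: RO_def)
  obtain C where C: "C > 0" and pw: "\<forall>u\<in>l2. (rmul (\<lambda>e. lam e ^ Suc \<sigma>) (hcoeff EE u) \<in> l2 \<longrightarrow>
      rmul (\<lambda>k. bracket k ^ Suc \<sigma>) u \<in> l2 \<and> l2_norm (rmul (\<lambda>k. bracket k ^ Suc \<sigma>) u) \<le> C * l2_norm (rmul (\<lambda>e. lam e ^ Suc \<sigma>) (hcoeff EE u))) \<and>
    (rmul (\<lambda>k. bracket k ^ Suc \<sigma>) u \<in> l2 \<longrightarrow>
      rmul (\<lambda>e. lam e ^ Suc \<sigma>) (hcoeff EE u) \<in> l2 \<and> l2_norm (rmul (\<lambda>e. lam e ^ Suc \<sigma>) (hcoeff EE u)) \<le> C * l2_norm (rmul (\<lambda>k. bracket k ^ Suc \<sigma>) u))"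
    using power_weights[of "Suc \<sigma>"] by blast
  define R where "R = (\<lambda>u c. u \<in> l2 \<and> c = hcoeff EE u)"
  have sub: "EE \<subseteq> l2" using EE_l2 by blast
  have R_l2: "u \<in> l2 \<and> c \<in> l2" if "R u c" for u c using that hcoeff_l2 by (simp add: R_def)
  have R_diff: "R (\<lambda>k. u k - u' k) (\<lambda>k. c k - c' k)" if "R u c" "R u' c'" for u c u' c'
    using that by (simp add: R_def l2_diff(1) hcoeff_lin(2)[OF _ _ sub])
  have R_inner: "l2_inner u u' = l2_inner c c'" if "R u c" "R u' c'" for u c u' c'
    using that by (simp add: R_def hcoeff_unitary(3)[OF EE])
  have R_left: "\<exists>c'. R (rmul g u) c'" if "R u c" "\<And>k. \<bar>g k\<bar> \<le> B" for u c g B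
    using that rmul_bounded[of u g B] by (simp add: R_def)
  have R_right: "\<exists>u'. R u' (rmul g c)" if r: "R u c" "\<And>k. \<bar>g k\<bar> \<le> B" for u c g B
  proof -
    have "rmul g c \<in> l2" by (rule rmul_bounded[of c g B]) (use r R_l2[OF r(1)] in auto)
    then have "\<exists>v\<in>l2. hcoeff EE v = rmul g c"
      using r(1) by (intro ex_hcoeff[OF EE]) (simp_all add: rmul_def R_def hcoeff_outside[OF EE])
    then obtain v where "v \<in> l2" "hcoeff EE v = rmul g c" by blast
    then have "R v (rmul g c)" by (simp add: R_def)
    then show ?thesis by blast
  qed
  have up: "rmul (\<lambda>k. bracket k ^ Suc \<sigma>) u \<in> l2 \<and> l2_norm (rmul (\<lambda>k. bracket k ^ Suc \<sigma>) u) \<le> C * l2_norm (rmul (\<lambda>e. lam e ^ Suc \<sigma>) c)"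
    if "R u c" "rmul (\<lambda>e. lam e ^ Suc \<sigma>) c \<in> l2" for u c using pw that unfolding R_def by blast
  have down: "rmul (\<lambda>e. lam e ^ Suc \<sigma>) c \<in> l2 \<and> l2_norm (rmul (\<lambda>e. lam e ^ Suc \<sigma>) c) \<le> C * l2_norm (rmul (\<lambda>k. bracket k ^ Suc \<sigma>) u)"
    if "R u c" "rmul (\<lambda>k. bracket k ^ Suc \<sigma>) u \<in> l2" for u c using pw that unfolding R_def by blast
  interpret to_lattice: unitary_relation R bracket lam "Suc \<sigma>" C
    by unfold_locales (fact R_l2 R_diff R_inner R_left R_right bracket_ge_1 lam_ge_1 C up down)+
  interpret to_spectrum: unitary_relation "\<lambda>c u. R u c" lam bracket "Suc \<sigma>" C
  proof unfold_locales
    show "c \<in> l2 \<and> u \<in> l2" if "R u c" for u c using R_l2[OF that] by simp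
    show "l2_inner c c' = l2_inner u u'" if "R u c" "R u' c'" for u c u' c' using R_inner[OF that] by simp
  qed (fact R_diff R_left R_right bracket_ge_1 lam_ge_1 C up down)+
  obtain L where L: "L > 0" "\<And>u c. R u c \<Longrightarrow> rmul (\<lambda>e. \<phi> (lam e)) c \<in> l2 \<Longrightarrow>
     rmul (\<lambda>k. \<phi> (bracket k)) u \<in> l2 \<and> l2_norm (rmul (\<lambda>k. \<phi> (bracket k)) u) \<le> L * l2_norm (rmul (\<lambda>e. \<phi> (lam e)) c)"
    using to_lattice.interpolation[OF pos D refl growth] by blast
  obtain K where K: "K > 0" "\<And>u c. R u c \<Longrightarrow> rmul (\<lambda>k. \<phi> (bracket k)) u \<in> l2 \<Longrightarrow>
     rmul (\<lambda>e. \<phi> (lam e)) c \<in> l2 \<and> l2_norm (rmul (\<lambda>e. \<phi> (lam e)) c) \<le> K * l2_norm (rmul (\<lambda>k. \<phi> (bracket k)) u)"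
    using to_spectrum.interpolation[OF pos D refl growth] by blast
  show ?thesis
    by (intro exI[of _ K] exI[of _ L] conjI ballI impI K(1) L(1)) (use K(2) L(2) in \<open>auto simp: R_def\<close>)
qed

end

text \<open>
  Since \<open>\<phi>\<close> decays at most polynomially, a bound for the values of \<open>\<phi>(\<langle>k\<rangle>) u\<close> bounds \<open>u\<close> by a power of
  \<open>1 + |k|\<close>.
\<close>

lemma H_space_eq:
  assumes RO: "\<phi> \<in> RO" shows "H_space \<phi> = {u. rmul (\<lambda>k. \<phi> (bracket k)) u \<in> l2}"
proof -
  obtain D \<sigma> where D: "D \<ge> 1" and growth: "\<And>s t. s \<ge> 1 \<Longrightarrow> t \<ge> 1 \<Longrightarrow> \<phi> s \<le> D * (max (s / t) (t / s)) ^ \<sigma> * \<phi> t"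
    using RO_growth[OF RO] by blast
  have p1: "\<phi> 1 > 0" using RO by (simp add: RO_def)
  have "u \<in> tempered" if u: "rmul (\<lambda>k. \<phi> (bracket k)) u \<in> l2" for u :: "int ^ 'n \<Rightarrow> complex"
  proof -
    let ?B = "l2_norm (rmul (\<lambda>k. \<phi> (bracket k)) u)"
    have "cmod (u k) \<le> D * ?B / \<phi> 1 * (1 + lat_norm k) ^ \<sigma>" for k
    proof -
      have b: "bracket k \<ge> 1" by (rule bracket_ge_1)
      have pk: "\<phi> (bracket k) > 0" using RO b by (simp add: RO_def)
      have "1 / bracket k \<le> bracket k" using b by (simp add: divide_le_eq mult_ge1_I)
      then have "\<phi> 1 \<le> D * bracket k ^ \<sigma> * \<phi> (bracket k)" using growth[of 1 "bracket k"] b by (simp add: max_def)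
      also have "\<dots> \<le> D * (1 + lat_norm k) ^ \<sigma> * \<phi> (bracket k)"
        using power_mono[OF bracket_le_rho[of k], of \<sigma>] b D pk
        by (intro mult_right_mono mult_left_mono) (auto simp: rho_def)
      finally have "\<phi> 1 * cmod (u k) \<le> D * (1 + lat_norm k) ^ \<sigma> * \<phi> (bracket k) * cmod (u k)"
        by (rule mult_right_mono) simp
      also have "\<dots> = D * (1 + lat_norm k) ^ \<sigma> * cmod (rmul (\<lambda>k. \<phi> (bracket k)) u k)" using pk by (simp add: cmod_rmul)
      also have "\<dots> \<le> D * (1 + lat_norm k) ^ \<sigma> * ?B"
        using D by (intro mult_left_mono cmod_le_l2_norm[OF u]) auto
      finally show ?thesis using p1 by (simp add: field_simps)
    qed
    then show ?thesis unfolding tempered_def by blast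
  qed
  then show ?thesis by (auto simp: H_space_def rmul_def)
qed

lemma H_inner_norm: "ip_norm (H_inner \<phi>) u = l2_norm (rmul (\<lambda>k. \<phi> (bracket k)) u)"
proof -
  have "H_inner \<phi> u u = l2_inner (rmul (\<lambda>k. \<phi> (bracket k)) u) (rmul (\<lambda>k. \<phi> (bracket k)) u)"
    unfolding H_inner_def l2_inner_def by (intro infsum_cong) (simp add: rmul_def power2_eq_square)
  then show ?thesis by (simp add: ip_norm_def l2_inner_self)
qed

section \<open>The completion of the domain of \<open>\<phi>(A)\<close>\<close>

lemma elliptic_matrix_symbol:
  fixes a :: "int ^ 'n::{finite,linorder} \<Rightarrow> real ^ 'n::{finite,linorder} \<Rightarrow> complex"
  assumes ell: "a \<in> elliptic_symbols 1"
    and form: "\<And>u. u \<in> schwartz \<Longrightarrow> l2_inner (Op a u) u \<in> \<real> \<and> Re (l2_inner (Op a u) u) \<ge> (l2_norm u)\<^sup>2"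
  shows "elliptic_matrix (symbol_matrix a)"
proof
  have a: "a \<in> symbols 1" using ell by (simp add: elliptic_symbols_def)
  have fin: "l2_inner (matvec (symbol_matrix a) u) u \<in> \<real> \<and> Re (l2_inner (matvec (symbol_matrix a) u) u) \<ge> (l2_norm u)\<^sup>2"
    if "finite {k. u k \<noteq> 0}" for u
    using form[OF finite_support_schwartz[OF that]] Op_schwartz[OF a finite_support_schwartz[OF that]] by simp
  show "symbol_matrix a k l = cnj (symbol_matrix a l k)" for k l
    by (rule real_form_hermitian) (use fin in blast)
  show "(\<lambda>l. cmod (symbol_matrix a k l * u l)) summable_on UNIV" if "u \<in> l2" for u k
  proof -
    obtain C where "\<forall>u k. u \<in> l2 \<longrightarrow> (\<lambda>l. cmod (symbol_matrix a k l * u l)) summable_on UNIV \<and>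
        (\<Sum>\<^sub>\<infinity>l. cmod (symbol_matrix a k l * u l)) \<le> C * rho k * l2_norm u"
      using symbol_matrix_row_bound[OF a] by (elim exE conjE)
    then show ?thesis using that by simp
  qed
  show "\<exists>C\<ge>0. \<forall>u. wt (Suc t) u \<in> l2 \<longrightarrow> wt t (matvec (symbol_matrix a) u) \<in> l2 \<and>
      l2_norm (wt t (matvec (symbol_matrix a) u)) \<le> C * l2_norm (wt (Suc t) u)" for t
    using order_plus_bound[of "symbol_matrix a" t, OF symbol_matrix_bound[OF a]] by (elim exE conjE) (rule exI, auto)
  show "\<exists>C\<ge>0. \<forall>u. wt t u \<in> l2 \<longrightarrow> wt t (matvec (symbol_matrix a) u) \<in> l2 \<longrightarrow>
       wt (Suc t) u \<in> l2 \<and>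
       l2_norm (wt (Suc t) u) \<le> C * (l2_norm (wt t (matvec (symbol_matrix a) u)) + l2_norm (wt t u))" for t
    by (rule elliptic_regularity[OF ell])
  show "Re (l2_inner (matvec (symbol_matrix a) u) u) \<ge> (l2_norm u)\<^sup>2" if "finite {k. u k \<noteq> 0}" for u
    using fin[OF that] by blast
qed

theorem theorem2p7:
  fixes \<phi> :: "real \<Rightarrow> real"
    and a :: "int ^ 'n::{finite,linorder} \<Rightarrow> real ^ 'n::{finite,linorder} \<Rightarrow> complex"
  assumes "\<phi> \<in> RO"
    and "a \<in> elliptic_symbols 1"
    and "\<And>u. u \<in> schwartz \<Longrightarrow>
           l2_inner (Op a u) u \<in> \<real> \<and> Re (l2_inner (Op a u) u) \<ge> (l2_norm u)\<^sup>2"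
  shows "completion_eq_upto_norm_equiv
           (Domain (fun_calc \<phi> (Op_closure a))) (fun_calc_inner \<phi> (Op_closure a))
           (H_space \<phi>) (H_inner \<phi>)"
proof -
  let ?A = "symbol_matrix a"
  have a: "a \<in> symbols 1" using assms(2) by (simp add: elliptic_symbols_def)
  interpret elliptic_matrix ?A by (rule elliptic_matrix_symbol[OF assms(2,3)])
  obtain EE lam where E: "complete_orthonormal EE" "\<And>e. lam e \<ge> 1" "\<And>e. e \<in> EE \<Longrightarrow> e \<in> H1"
      "\<And>e. e \<in> EE \<Longrightarrow> matvec ?A e = (\<lambda>k. of_real (lam e) * e k)"
    using ex_eigenbasis by blast
  interpret elliptic_eigenbasis ?A EE lam by unfold_locales (fact E)+
  have G: "{(u, Op a u) |u. u \<in> schwartz} = {(u, matvec ?A u) |u. u \<in> schwartz}"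
    using Op_schwartz[OF a] by (auto intro!: exI)
  have "schwartz \<subseteq> H1" using schwartz_wt by (auto simp: H1_def)
  then have "Op_closure a = diag_graph EE lam (\<lambda>t. t)"
    unfolding Op_closure_def graph_eq_diag[symmetric]
    by (intro op_closure_matvec[OF G] finite_support_schwartz)
  moreover have "\<phi> \<in> borel_measurable (restrict_space borel {1..})" using assms(1) by (simp add: RO_def)
  ultimately have calc: "fun_calc \<phi> (Op_closure a) = diag_graph EE lam \<phi>"
    using fun_calc_diag[OF E(1) _ E(2)] by simp
  let ?V = "Domain (diag_graph EE lam \<phi>)" and ?ip = "fun_calc_inner \<phi> (Op_closure a)"
  let ?h = "\<lambda>k. \<phi> (bracket k)" and ?s = "\<lambda>u. rmul (\<lambda>e. \<phi> (lam e)) (hcoeff EE u)"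
  have ip: "ip_norm ?ip u = l2_norm (?s u)" if "u \<in> ?V" for u
    using diag_graph_norm[OF E(1) that] by (simp add: fun_calc_inner_def[abs_def] calc)
  obtain K L where K: "K > 0" and L: "L > 0"
    and KL: "\<forall>u\<in>l2. (?s u \<in> l2 \<longrightarrow> rmul ?h u \<in> l2 \<and> l2_norm (rmul ?h u) \<le> L * l2_norm (?s u)) \<and>
      (rmul ?h u \<in> l2 \<longrightarrow> ?s u \<in> l2 \<and> l2_norm (?s u) \<le> K * l2_norm (rmul ?h u))"
    using RO_weights[OF assms(1)] by (elim exE conjE)
  have V: "u \<in> ?V \<longleftrightarrow> u \<in> l2 \<and> ?s u \<in> l2" "u \<in> ?V \<longleftrightarrow> u \<in> l2 \<and> rmul ?h u \<in> l2" for u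
    using KL unfolding diag_graph_Domain[OF E(1)] by auto
  interpret dense_in_weighted ?V ?ip ?h K L
  proof
    fix u v :: "int ^ 'n::{finite,linorder} \<Rightarrow> complex" and k z
    show "\<phi> (bracket k) > 0" using assms(1) bracket_ge_1[of k] by (simp add: RO_def)
    show "K > 0" "L > 0" by (fact K L)+
    show "rmul ?h u \<in> l2" if "u \<in> ?V" using that V(2) by blast
    show "u \<in> ?V" if "finite {k. u k \<noteq> 0}"
      unfolding V(2) using that by (auto intro!: l2_finite_support simp: rmul_def elim!: rev_finite_subset)
    show "(\<lambda>k. z * u k) \<in> ?V" if "u \<in> ?V"
      using that unfolding V(2) rmul_scale by simp
    assume u: "u \<in> ?V"
    show "ip_norm ?ip u \<le> K * l2_norm (rmul ?h u)"
      unfolding ip[OF u] using KL u V(2) by blast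
    show "l2_norm (rmul ?h u) \<le> L * ip_norm ?ip u"
      unfolding ip[OF u] using KL u V(1) by blast
    assume v: "v \<in> ?V"
    show "(\<lambda>k. u k + v k) \<in> ?V"
      using u v unfolding V(2) rmul_add by (simp add: l2_add)
    have d: "(\<lambda>k. u k - v k) \<in> ?V"
      using u v unfolding V(2) rmul_diff by (simp add: l2_diff)
    have "?s (\<lambda>k. u k - v k) = (\<lambda>e. ?s u e - ?s v e)"
      using u v V(1) hcoeff_lin(2)[of u v EE] EE_l2 by (simp add: rmul_diff subset_iff)
    then show "\<bar>ip_norm ?ip u - ip_norm ?ip v\<bar> \<le> ip_norm ?ip (\<lambda>k. u k - v k)"
      unfolding ip[OF u] ip[OF v] ip[OF d] using l2_norm_triangle_sub[of "?s u" "?s v"] u v V(1) by simp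
  qed
  show ?thesis
    unfolding calc
    by (rule completion_eq_weighted[OF H_space_eq[OF assms(1)] H_inner_norm])
qed

end
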